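(* Let $\{u_j\}$ be a sequence of $C^2$ plurisubharmonic functions converging to $u$ uniformly on compact subsets of a domain $\Omega$ in $\mathscr{H}$. Then $u$ is a continuous plurisubharmonic function on $\Omega$. Moreover, $\det\left(\overline{Q_l}Q_m u_j + 8\delta_{lm}\mathbf{i}\partial_t u_j\right)$ is a family of uniformly bounded measures on each compact subset $K$ of $\Omega$ and weakly converges to a non-negative measure on $\Omega$. This measure depends only on $u$ and not on the choice of an approximating sequence $\{u_j\}$.
   Context: $\mathscr{H}$ is the $(4n+1)$-dimensional Heisenberg group $\mathbb{R}^{4n+1}$ with multiplication $(x,t)\cdot(y,s)=(x+y,\,t+s+2\sum_{l=1}^{2n}(x_{2l-1}y_{2l}-x_{2l}y_{2l-1}))$, and $\mathbb{R}^{4n}$ is identified with $\mathbb{H}^n$. The left invariant horizontal vector fields are $X_{2l-1}=\partial_{x_{2l-1}}-2x_{2l}\partial_t$, $X_{2l}=\partial_{x_{2l}}+2x_{2l-1}\partial_t$, $l=1,\dots,2n$. Set $\overline{Q_l}=X_{4l+1}+\mathbf{i}X_{4l+2}+\mathbf{j}X_{4l+3}+\mathbf{k}X_{4l+4}$ and $Q_l=X_{4l+1}-\mathbf{i}X_{4l+2}-\mathbf{j}X_{4l+3}-\mathbf{k}X_{4l+4}$, $l=0,\dots,n-1$; $\det$ is the Moore determinant of the (hyperhermitian) quaternionic $n\times n$ matrix. For $q\in\mathbb{H}^n$, $\mathscr{H}_q=\{(q\lambda,t):\lambda\in\mathbb{H},t\in\mathbb{R}\}$ is a subgroup, and for $\eta\in\mathscr{H}$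 the quaternionic Heisenberg line is $\mathscr{H}_{\eta,q}=\eta\mathscr{H}_q$. Writing $q_l=x_{4l+1}+\mathbf{i}x_{4l+2}+\mathbf{j}x_{4l+3}+\mathbf{k}x_{4l+4}$, let $\Lambda_q=|\sum_l\overline{q_l}\,\mathbf{i}\,q_l|$ and $\mathfrak{D}=\{q:\Lambda_q=0\}$. The map $\iota_{\eta,q}:(\lambda,t)\mapsto\eta(q\lambda,t)$ identifies $\mathbb{R}^5$ (with the induced group law) with $\mathscr{H}_{\eta,q}$; a function is subharmonic on $\mathscr{H}_{\eta,q}$ if its pullback by $\iota_{\eta,q}$ is subharmonic for the SubLaplacian $\sum_{j=1}^4\widetilde{X_j}^2$ of this 5-dimensional group (with $\widetilde{X_j}$ the left invariant fields in the directions $\lambda_j$). A $[-\infty,\infty)$-valued upper semicontinuous function $u$ on $\Omega$ is plurisubharmonic if $u\in L^1_{\rm loc}(\Omega)$ and it is subharmonic on each $\mathscr{H}_{\eta,q}$ for all $\eta\in\mathscr{H}$, $q\in\mathbb{H}^n\setminus\mathfrak{D}$. *)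

theory Defs
  imports "HOL-Analysis.Analysis"
begin

type_synonym quat = "real^4"

definition qone :: quat where "qone = axis 1 1"
definition qi :: quat where "qi = axis 2 1"
definition qj :: quat where "qj = axis 3 1"
definition qk :: quat where "qk = axis 4 1"

definition qmult :: "quat \<Rightarrow> quat \<Rightarrow> quat" where
  "qmult p q = vector
     [p$1*q$1 - p$2*q$2 - p$3*q$3 - p$4*q$4,
      p$1*q$2 + p$2*q$1 + p$3*q$4 - p$4*q$3,
      p$1*q$3 - p$2*q$4 + p$3*q$1 + p$4*q$2,
      p$1*q$4 + p$2*q$3 - p$3*q$2 + p$4*q$1]"

definition qconj :: "quat \<Rightarrow> quat" where
  "qconj p = vector [p$1, - p$2, - p$3, - p$4]"

definition qprod_list :: "quat list \<Rightarrow> quat" where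
  "qprod_list xs = foldr qmult xs qone"

definition cyc_len :: "('n \<Rightarrow> 'n) \<Rightarrow> 'n \<Rightarrow> nat" where
  "cyc_len \<sigma> m = (LEAST k. 0 < k \<and> (\<sigma> ^^ k) m = m)"

definition cycle_word :: "('n \<Rightarrow> 'n \<Rightarrow> quat) \<Rightarrow> ('n \<Rightarrow> 'n) \<Rightarrow> 'n \<Rightarrow> quat" where
  "cycle_word A \<sigma> m =
     qprod_list (map (\<lambda>k. A ((\<sigma> ^^ k) m) ((\<sigma> ^^ Suc k) m)) [0..<cyc_len \<sigma> m])"

definition cycle_leaders :: "('n::linorder \<Rightarrow> 'n) \<Rightarrow> 'n set" where
  "cycle_leaders \<sigma> = {m. \<forall>k. m \<le> (\<sigma> ^^ k) m}"

text \<open>Moore's normal form: each cycle starts with its smallest element and the cycles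
  are ordered by decreasing leading element.\<close>
definition moore_term :: "('n::{finite,linorder} \<Rightarrow> 'n \<Rightarrow> quat) \<Rightarrow> ('n \<Rightarrow> 'n) \<Rightarrow> quat" where
  "moore_term A \<sigma> =
     qprod_list (map (cycle_word A \<sigma>) (rev (sorted_list_of_set (cycle_leaders \<sigma>))))"

definition Mdet :: "('n::{finite,linorder} \<Rightarrow> 'n \<Rightarrow> quat) \<Rightarrow> quat" where
  "Mdet A = (\<Sum>\<sigma> | \<sigma> permutes (UNIV :: 'n set). of_int (sign \<sigma>) *\<^sub>R moore_term A \<sigma>)"

text \<open>A point (x,t): x $ l $ a is the coordinate x_{4l+a}, i.e. the a-th real component of q_l.\<close>
type_synonym ('n) hpt = "(real^4^'n) \<times> real"

definition symp :: "real^4^('n::finite) \<Rightarrow> real^4^'n \<Rightarrow> real" where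
  "symp x y = (\<Sum>l\<in>UNIV. x$l$1 * y$l$2 - x$l$2 * y$l$1 + x$l$3 * y$l$4 - x$l$4 * y$l$3)"

definition hmul :: "('n::finite) hpt \<Rightarrow> 'n hpt \<Rightarrow> 'n hpt" where
  "hmul p p' = (fst p + fst p', snd p + snd p' + 2 * symp (fst p) (fst p'))"

definition HX :: "('n::finite) \<Rightarrow> 4 \<Rightarrow> ('n hpt \<Rightarrow> 'b::real_normed_vector) \<Rightarrow> 'n hpt \<Rightarrow> 'b" where
  "HX l a f p = vector_derivative (\<lambda>s. f (hmul p (axis l (axis a s), 0))) (at 0)"

definition Ht :: "(('n::finite) hpt \<Rightarrow> 'b::real_normed_vector) \<Rightarrow> 'n hpt \<Rightarrow> 'b" where
  "Ht f p = vector_derivative (\<lambda>s. f (hmul p (0, s))) (at 0)"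

definition Qop :: "('n::finite) \<Rightarrow> ('n hpt \<Rightarrow> real) \<Rightarrow> 'n hpt \<Rightarrow> quat" where
  "Qop m f p = HX m 1 f p *\<^sub>R qone - HX m 2 f p *\<^sub>R qi - HX m 3 f p *\<^sub>R qj - HX m 4 f p *\<^sub>R qk"

definition Qbar :: "('n::finite) \<Rightarrow> ('n hpt \<Rightarrow> quat) \<Rightarrow> 'n hpt \<Rightarrow> quat" where
  "Qbar l F p = HX l 1 F p + qmult qi (HX l 2 F p) + qmult qj (HX l 3 F p) + qmult qk (HX l 4 F p)"

definition qhess :: "(('n::finite) hpt \<Rightarrow> real) \<Rightarrow> 'n hpt \<Rightarrow> 'n \<Rightarrow> 'n \<Rightarrow> quat" where
  "qhess u p l m = Qbar l (Qop m u) p + (if l = m then (8 * Ht u p) *\<^sub>R qi else 0)"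

text \<open>Density of det(Qbar_l Q_m u + 8 delta_lm i d_t u); the matrix is hyperhermitian,
  so its Moore determinant is real and we take the real component.\<close>
definition MA_density :: "('n::{finite,linorder} hpt \<Rightarrow> real) \<Rightarrow> 'n hpt \<Rightarrow> real" where
  "MA_density u p = Mdet (qhess u p) $ 1"

definition qline :: "real^4^('n::finite) \<Rightarrow> quat \<Rightarrow> real^4^'n" where
  "qline q c = (\<chi> l. qmult (q$l) c)"

definition Lambda :: "real^4^('n::finite) \<Rightarrow> real" where
  "Lambda q = norm (\<Sum>l\<in>UNIV. qmult (qconj (q$l)) (qmult qi (q$l)))"

definition degenerate_set :: "(real^4^('n::finite)) set" where
  "degenerate_set = {q. Lambda q = 0}"

definition iota :: "('n::finite) hpt \<Rightarrow> real^4^'n \<Rightarrow> quat \<times> real \<Rightarrow> 'n hpt" where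
  "iota \<eta> q z = hmul \<eta> (qline q (fst z), snd z)"

definition lmul :: "real^4^('n::finite) \<Rightarrow> quat \<times> real \<Rightarrow> quat \<times> real \<Rightarrow> quat \<times> real" where
  "lmul q z z' = (fst z + fst z', snd z + snd z' + 2 * symp (qline q (fst z)) (qline q (fst z')))"

definition LX :: "real^4^('n::finite) \<Rightarrow> 4 \<Rightarrow> (quat \<times> real \<Rightarrow> real) \<Rightarrow> quat \<times> real \<Rightarrow> real" where
  "LX q a f z = vector_derivative (\<lambda>s. f (lmul q z (axis a s, 0))) (at 0)"

definition subLap :: "real^4^('n::finite) \<Rightarrow> (quat \<times> real \<Rightarrow> real) \<Rightarrow> quat \<times> real \<Rightarrow> real" where
  "subLap q f z = (\<Sum>a\<in>UNIV. LX q a (LX q a f) z)"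

definition usc_on :: "'a::topological_space set \<Rightarrow> ('a \<Rightarrow> ereal) \<Rightarrow> bool" where
  "usc_on U f \<longleftrightarrow> (\<forall>x\<in>U. \<forall>c. f x < c \<longrightarrow> eventually (\<lambda>y. f y < c) (at x within U))"

definition C1_on :: "'a::euclidean_space set \<Rightarrow> ('a \<Rightarrow> real) \<Rightarrow> bool" where
  "C1_on S f \<longleftrightarrow> (\<forall>x\<in>S. f differentiable (at x)) \<and>
     (\<forall>b\<in>Basis. continuous_on S (\<lambda>x. frechet_derivative f (at x) b))"

definition C2_on :: "'a::euclidean_space set \<Rightarrow> ('a \<Rightarrow> real) \<Rightarrow> bool" where
  "C2_on S f \<longleftrightarrow> C1_on S f \<and> (\<forall>b\<in>Basis. C1_on S (\<lambda>x. frechet_derivative f (at x) b))"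

definition loc_integrable :: "'a::euclidean_space set \<Rightarrow> ('a \<Rightarrow> ereal) \<Rightarrow> bool" where
  "loc_integrable \<Omega> f \<longleftrightarrow> (\<forall>K. compact K \<and> K \<subseteq> \<Omega> \<longrightarrow>
     f \<in> borel_measurable (restrict_space lborel K) \<and>
     (\<integral>\<^sup>+x\<in>K. e2ennreal \<bar>f x\<bar> \<partial>lborel) < \<infinity>)"

definition subharmonic_on :: "real^4^('n::finite) \<Rightarrow> (quat \<times> real) set \<Rightarrow> (quat \<times> real \<Rightarrow> ereal) \<Rightarrow> bool" where
  "subharmonic_on q U w \<longleftrightarrow> usc_on U w \<and>
     (\<forall>V h. open V \<and> bounded V \<and> closure V \<subseteq> U \<and> C2_on V h \<and> continuous_on (closure V) h \<and>
        (\<forall>z\<in>V. subLap q h z = 0) \<and> (\<forall>z\<in>frontier V. w z \<le> ereal (h z))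
        \<longrightarrow> (\<forall>z\<in>V. w z \<le> ereal (h z)))"

definition psh_on :: "('n::finite) hpt set \<Rightarrow> ('n hpt \<Rightarrow> ereal) \<Rightarrow> bool" where
  "psh_on \<Omega> u \<longleftrightarrow> usc_on \<Omega> u \<and> loc_integrable \<Omega> u \<and>
     (\<forall>\<eta> q. q \<notin> degenerate_set \<longrightarrow> subharmonic_on q (iota \<eta> q -` \<Omega>) (u \<circ> iota \<eta> q))"

definition loc_unif_conv :: "'a::metric_space set \<Rightarrow> (nat \<Rightarrow> 'a \<Rightarrow> real) \<Rightarrow> ('a \<Rightarrow> real) \<Rightarrow> bool" where
  "loc_unif_conv \<Omega> f g \<longleftrightarrow> (\<forall>K. compact K \<and> K \<subseteq> \<Omega> \<longrightarrow> uniform_limit K f g sequentially)"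

definition weak_conv_on :: "'a::euclidean_space set \<Rightarrow> (nat \<Rightarrow> 'a \<Rightarrow> real) \<Rightarrow> 'a measure \<Rightarrow> bool" where
  "weak_conv_on \<Omega> d \<mu> \<longleftrightarrow> (\<forall>\<phi>::'a \<Rightarrow> real. continuous_on UNIV \<phi> \<and>
      (\<exists>K. compact K \<and> K \<subseteq> \<Omega> \<and> (\<forall>x. x \<notin> K \<longrightarrow> \<phi> x = 0)) \<longrightarrow>
      (\<lambda>j. \<integral>x. \<phi> x * d j x \<partial>lborel) \<longlonglongrightarrow> (\<integral>x. \<phi> x \<partial>\<mu>))"

definition radon_on :: "'a::euclidean_space set \<Rightarrow> 'a measure \<Rightarrow> bool" where
  "radon_on \<Omega> \<mu> \<longleftrightarrow> sets \<mu> = sets borel \<and> emeasure \<mu> (UNIV - \<Omega>) = 0 \<and>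
     (\<forall>K. compact K \<and> K \<subseteq> \<Omega> \<longrightarrow> emeasure \<mu> K < \<infinity>)"

end

theory Submission
  imports Defs "HOL-Combinatorics.Cycles" "HOL-Library.Nonpos_Ints"
begin

text \<open>The Moore determinant of a hyperhermitian matrix is, up to the factor \<open>2\<^sup>n n!\<close>, the Pfaffian of
  the associated skew-symmetric complex matrix. Its polarisation gives a mixed Monge-Ampere density of
  \<open>n\<close> functions which is nonnegative when all their Hessians are positive semidefinite, as is the case
  for plurisubharmonic functions: otherwise a harmonic quadratic comparison function on some
  quaternionic Heisenberg line contradicts subharmonicity. The two columns of complex horizontal fields
  out of which the Hessian is built commute within each column, and their mixed commutators are
  symmetric in the two indices; hence a test function may be exchanged with any
  of the \<open>n\<close> functions under the integral sign. Exchanging with cut-off functions and comparing with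
  \<open>|x|\<^sup>2\<close>, whose Hessian is \<open>8 I\<close>, bounds the masses on compact sets; exchanging one slot at a time
  shows that the integrals against a test function depend on the functions in a Lipschitz way for the
  uniform norm. The limit functional is positive and thus given by a Radon measure.\<close>

text \<open>The Moore determinant is a signed sum of noncommutative words, and its handle is the
  normal form itself: leaders are minimal and ordered decreasingly, so the largest index is either a
  fixed point standing first or sits in the interior of a word. Removing it gives a recursion which,
  on positive definite matrices, becomes multiplication by a pivot and passage to the Schur
  complement. The identification with the Pfaffian is made on semidefinite matrices only, by
  evaluating both sides on a Cholesky sum of rank-one matrices; nonnegativity of the polarised form
  comes from the same sums. The exchange under the integral differentiates Hessian entries once more
  and so needs third derivatives, while the given functions are only C^2 and only local: hence C^3
  mollification and cut-offs. A comparison function must be exactly harmonic for a SubLaplacian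
  whose fields have linear coefficients; the constant in its quartic term comes from the
  multiplicativity of the quaternion norm. Degenerate directions are excluded in the definition of
  plurisubharmonicity and are recovered by density.\<close>

lemma vector_4_nth [simp]:
  "(vector [a, b, c, d] :: 'a::zero^4) $ 1 = a"
  "(vector [a, b, c, d] :: 'a::zero^4) $ 2 = b"
  "(vector [a, b, c, d] :: 'a::zero^4) $ 3 = c"
  "(vector [a, b, c, d] :: 'a::zero^4) $ 4 = d"
  by (simp_all add: vector_def)

section \<open>Quaternion algebra\<close>

lemma quat_eq_iff: "p = q \<longleftrightarrow> p$1 = q$1 \<and> p$2 = q$2 \<and> p$3 = q$3 \<and> p$4 = q$4" for p q :: quat
  by (simp add: vec_eq_iff forall_4)

lemma quat_norm_sq: "(norm p)\<^sup>2 = (p$1)\<^sup>2 + (p$2)\<^sup>2 + (p$3)\<^sup>2 + (p$4)\<^sup>2" for p :: quat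
  by (simp add: norm_vec_def L2_set_def sum_4)

lemma quat_unit_nth [simp]:
  "qone $ 1 = 1" "qone $ 2 = 0" "qone $ 3 = 0" "qone $ 4 = 0"
  "qi $ 1 = 0" "qi $ 2 = 1" "qi $ 3 = 0" "qi $ 4 = 0"
  "qj $ 1 = 0" "qj $ 2 = 0" "qj $ 3 = 1" "qj $ 4 = 0"
  "qk $ 1 = 0" "qk $ 2 = 0" "qk $ 3 = 0" "qk $ 4 = 1"
  by (simp_all add: qone_def qi_def qj_def qk_def axis_def)

lemma qmult_nth [simp]:
  "qmult p q $ 1 = p$1*q$1 - p$2*q$2 - p$3*q$3 - p$4*q$4"
  "qmult p q $ 2 = p$1*q$2 + p$2*q$1 + p$3*q$4 - p$4*q$3"
  "qmult p q $ 3 = p$1*q$3 - p$2*q$4 + p$3*q$1 + p$4*q$2"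
  "qmult p q $ 4 = p$1*q$4 + p$2*q$3 - p$3*q$2 + p$4*q$1"
  by (simp_all add: qmult_def)

lemma qconj_nth [simp]:
  "qconj p $ 1 = p$1" "qconj p $ 2 = - p$2" "qconj p $ 3 = - p$3" "qconj p $ 4 = - p$4"
  by (simp_all add: qconj_def)

lemma qmult_assoc: "qmult (qmult p q) r = qmult p (qmult q r)"
  by (simp add: quat_eq_iff algebra_simps)

lemma qmult_one [simp]: "qmult qone p = p" "qmult p qone = p"
  by (simp_all add: quat_eq_iff)

lemma qmult_add_left: "qmult (p + q) r = qmult p r + qmult q r"
  and qmult_add_right: "qmult r (p + q) = qmult r p + qmult r q"
  by (simp_all add: quat_eq_iff algebra_simps)

lemma qmult_scaleR_left [simp]: "qmult (c *\<^sub>R p) r = c *\<^sub>R qmult p r"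
  and qmult_scaleR_right [simp]: "qmult r (c *\<^sub>R p) = c *\<^sub>R qmult r p"
  by (simp_all add: quat_eq_iff algebra_simps)

lemma norm_qmult: "norm (qmult p q) = norm p * norm q"
proof -
  have "(norm (qmult p q))\<^sup>2 = (norm p * norm q)\<^sup>2"
    unfolding power_mult_distrib quat_norm_sq qmult_nth by algebra
  then show ?thesis by simp
qed

interpretation qmult: bounded_bilinear qmult
proof
  show "\<exists>K. \<forall>a b. norm (qmult a b) \<le> norm a * norm b * K"
    by (rule exI[of _ 1]) (simp add: norm_qmult)
qed (simp_all add: qmult_add_left qmult_add_right)

lemma qconj_qconj [simp]: "qconj (qconj p) = p"
  by (simp add: quat_eq_iff)

lemma qconj_mult: "qconj (qmult p q) = qmult (qconj q) (qconj p)"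
  by (simp add: quat_eq_iff algebra_simps)

lemma qconj_add: "qconj (p + q) = qconj p + qconj q"
  and qconj_diff: "qconj (p - q) = qconj p - qconj q"
  and qconj_scaleR: "qconj (c *\<^sub>R p) = c *\<^sub>R qconj p"
  and qconj_0 [simp]: "qconj 0 = 0"
  by (simp_all add: quat_eq_iff)

lemma qconj_sum: "qconj (sum f S) = (\<Sum>x\<in>S. qconj (f x))"
  by (induct S rule: infinite_finite_induct) (simp_all add: qconj_add)

lemma norm_qconj [simp]: "norm (qconj p) = norm p"
proof -
  have "(norm (qconj p))\<^sup>2 = (norm p)\<^sup>2" unfolding quat_norm_sq by simp
  then show ?thesis by simp
qed

lemma qmult_conj_self: "qmult (qconj p) p = (norm p)\<^sup>2 *\<^sub>R qone" "qmult p (qconj p) = (norm p)\<^sup>2 *\<^sub>R qone"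
  by (simp_all add: quat_eq_iff quat_norm_sq, simp_all add: power2_eq_square algebra_simps)

lemma qprod_list_simps [simp]:
  "qprod_list [] = qone"
  "qprod_list (x # xs) = qmult x (qprod_list xs)"
  "qprod_list (xs @ ys) = qmult (qprod_list xs) (qprod_list ys)"
proof -
  show "qprod_list [] = qone" "qprod_list (x # xs) = qmult x (qprod_list xs)" for x xs
    by (simp_all add: qprod_list_def)
  then show "qprod_list (xs @ ys) = qmult (qprod_list xs) (qprod_list ys)"
    by (induct xs) (simp_all add: qmult_assoc)
qed

subsection \<open>Removing the largest index from a Moore determinant\<close>

text \<open>Relative versions for a subset \<open>S\<close> of the index type, so that an induction
  can remove the largest element of \<open>S\<close> while the matrix keeps its type.\<close>

definition moore_term_on :: "'n::{finite,linorder} set \<Rightarrow> ('n \<Rightarrow> 'n \<Rightarrow> quat) \<Rightarrow> ('n \<Rightarrow> 'n) \<Rightarrow> quat" where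
  "moore_term_on S A \<sigma> =
     qprod_list (map (cycle_word A \<sigma>) (rev (sorted_list_of_set (cycle_leaders \<sigma> \<inter> S))))"

definition Mdet_on :: "'n::{finite,linorder} set \<Rightarrow> ('n \<Rightarrow> 'n \<Rightarrow> quat) \<Rightarrow> quat" where
  "Mdet_on S A = (\<Sum>\<sigma> | \<sigma> permutes S. of_int (sign \<sigma>) *\<^sub>R moore_term_on S A \<sigma>)"

lemma Mdet_on_UNIV: "Mdet_on UNIV = Mdet"
  by (simp add: fun_eq_iff Mdet_on_def Mdet_def moore_term_on_def moore_term_def)

lemma cyc_len_eqI:
  assumes "0 < L" "(p ^^ L) m = m" "\<And>k. 0 < k \<Longrightarrow> k < L \<Longrightarrow> (p ^^ k) m \<noteq> m"
  shows "cyc_len p m = L"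
  unfolding cyc_len_def
  by (rule Least_equality) (use assms in \<open>auto simp: not_less[symmetric]\<close>)

lemma cyc_len_eq_least_power: "cyc_len p m = least_power p m"
  by (simp add: cyc_len_def least_power_def conj_commute)

context
  fixes q :: "'n::{finite,linorder} \<Rightarrow> 'n" and S :: "'n set"
  assumes q: "q permutes S"
begin

lemma perm_q: "permutation q"
  using q permutation_permutes finite by blast

lemma cyc_len_pos: "0 < cyc_len q m"
  and cyc_len_pow: "(q ^^ cyc_len q m) m = m"
  unfolding cyc_len_eq_least_power
  using least_power_of_permutation[OF perm_q] by auto

lemma cyc_len_min: "0 < k \<Longrightarrow> k < cyc_len q m \<Longrightarrow> (q ^^ k) m \<noteq> m"
  unfolding cyc_len_eq_least_power
  using least_power_le[where f=q and x=m and n=k] by auto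

lemma cyc_inj:
  assumes "i < cyc_len q m" "j < cyc_len q m" "(q ^^ i) m = (q ^^ j) m"
  shows "i = j"
proof -
  have "False" if ij: "i < j" "j < cyc_len q m" "(q ^^ i) m = (q ^^ j) m" for i j
  proof -
    have "(q ^^ (j - i)) m = m"
      using funpow_diff[OF permutes_inj[OF q], of i j m] ij by auto
    then show False using cyc_len_min[of "j - i" m] ij by auto
  qed
  from this[of i j] this[of j i] assms show ?thesis by (metis linorder_neqE_nat)
qed

lemma pow_in_S: "m \<in> S \<Longrightarrow> (q ^^ k) m \<in> S"
  by (induct k) (use permutes_in_image[OF q] in auto)

text \<open>\<open>ins\<close> inserts \<open>r\<close> into a cycle of \<open>q\<close>, between \<open>l\<close> and \<open>b = q l\<close>.\<close>

context
  fixes r b l :: 'n and ins :: "'n \<Rightarrow> 'n"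
  assumes ins_def: "ins = Transposition.transpose r b \<circ> q" and r: "\<forall>x\<in>S. x < r" and b: "b \<in> S" and ql: "q l = b"
begin

lemma rnS: "r \<notin> S"
  using r by blast

lemma ins_l: "ins l = r" by (simp add: ql ins_def)
lemma ins_r: "ins r = b" using permutes_not_in[OF q rnS] by (simp add: ins_def)
lemma ins_other: "x \<noteq> l \<Longrightarrow> x \<noteq> r \<Longrightarrow> ins x = q x"
proof -
  assume x: "x \<noteq> l" "x \<noteq> r"
  have "q x \<noteq> b" using x ql permutes_inj[OF q] by (auto dest: injD)
  moreover have "q x \<noteq> r" using x permutes_inj[OF q] permutes_not_in[OF q rnS] by (metis injD)
  ultimately show ?thesis by (simp add: Transposition.transpose_def ins_def)
qed

lemma pow_ne_r: "m \<in> S \<Longrightarrow> (q ^^ k) m \<noteq> r"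
  using pow_in_S rnS by metis

text \<open>The detour from \<open>l\<close> through \<open>r\<close> to \<open>b\<close> replaces
  the factor \<open>A l b\<close> by \<open>A l r\<close> times \<open>A r b\<close>, which amounts
  to changing row \<open>l\<close>. The word starts at \<open>m\<close> in \<open>S\<close>, so
  \<open>r\<close> is never its first letter and the two new factors are always adjacent; without
  commutativity this is essential.\<close>

lemma cycle_word_ins:
  assumes m: "m \<in> S"
  shows "cycle_word A ins m = cycle_word (A(l := \<lambda>k. qmult (A l r) (A r k))) q m"
proof (cases "\<exists>j. (q ^^ j) m = l")
  case False
  then have nl: "(q ^^ k) m \<noteq> l" for k by blast
  have pw: "(ins ^^ k) m = (q ^^ k) m" for k
  proof (induct k)
    case (Suc k)
    then show ?case using ins_other[OF nl[of k] pow_ne_r[OF m, of k]] by simp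
  qed simp
  have "cyc_len ins m = cyc_len q m"
    unfolding cyc_len_def pw ..
  then show ?thesis
    unfolding cycle_word_def pw using nl by simp
next
  case True
  define L where "L = cyc_len q m"
  have Lpos: "0 < L" and Lp: "(q ^^ L) m = m"
    unfolding L_def by (rule cyc_len_pos, rule cyc_len_pow)
  obtain j0 where "(q ^^ j0) m = l" using True by blast
  moreover have "(q ^^ (j0 mod L)) m = (q ^^ j0) m"
    using funpow_mod_eq[OF Lp] by simp
  ultimately obtain j where j: "j < L" "(q ^^ j) m = l"
    using Lpos by (metis mod_less_divisor)
  have jne: "(q ^^ k) m \<noteq> l" if "k < L" "k \<noteq> j" for k
    using cyc_inj[of k m j] that j unfolding L_def by metis
  have p1: "(ins ^^ k) m = (q ^^ k) m" if "k \<le> j" for k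
    using that
  proof (induct k)
    case (Suc k)
    then have "k < L" "k \<noteq> j" using j by auto
    then show ?case using Suc ins_other[OF jne pow_ne_r[OF m]] by simp
  qed simp
  have p2: "(ins ^^ Suc j) m = r"
    using p1[of j] j ins_l by simp
  \<comment> \<open>Once \<open>r\<close> has been passed, the orbit under \<open>ins\<close> lags
    exactly one step behind the orbit under \<open>q\<close>.\<close>
  have p3: "(ins ^^ (Suc (Suc j + i))) m = (q ^^ (Suc j + i)) m" if "Suc j + i \<le> L" for i
    using that
  proof (induct i)
    case 0
    show ?case using p2 ins_r j ql by simp
  next
    case (Suc i)
    then have *: "Suc j + i < L" "Suc j + i \<noteq> j" by auto
    have "(ins ^^ (Suc (Suc j + Suc i))) m = ins ((ins ^^ (Suc (Suc j + i))) m)" by simp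
    also have "\<dots> = ins ((q ^^ (Suc j + i)) m)" using Suc by simp
    also have "\<dots> = q ((q ^^ (Suc j + i)) m)"
      by (rule ins_other[OF jne[OF *] pow_ne_r[OF m]])
    finally show ?case by simp
  qed
  have p3': "(ins ^^ (Suc k)) m = (q ^^ k) m" if "j < k" "k \<le> L" for k
    using p3[of "k - Suc j"] that by simp
  have len: "cyc_len ins m = Suc L"
  proof (rule cyc_len_eqI)
    show "(ins ^^ Suc L) m = m" using p3'[of L] j Lp by simp
    fix k assume k: "0 < k" "k < Suc L"
    consider "k \<le> j" | "k = Suc j" | k' where "k = Suc k'" "j < k'" "k' \<le> L"
      using k by (cases k) force+
    then show "(ins ^^ k) m \<noteq> m"
    proof cases
      case 1 then show ?thesis using p1[of k] k j cyc_len_min[of k m] unfolding L_def by auto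
    next
      case 2 then show ?thesis using p2 m rnS by metis
    next
      case 3 then show ?thesis using p3'[of k'] k j cyc_len_min[of k' m] unfolding L_def by auto
    qed
  qed simp
  define B where "B = A(l := \<lambda>k. qmult (A l r) (A r k))"
  \<comment> \<open>Position \<open>j\<close> of the old word becomes the two positions
    \<open>j\<close> and \<open>Suc j\<close>; all later positions shift by one.\<close>
  have s1: "[0..<Suc L] = [0..<j] @ [j, Suc j] @ map Suc [Suc j..<L]"
  proof -
    have "[0..<Suc L] = [0..<j] @ [j..<Suc L]"
      using j by (metis less_imp_le_nat less_SucI upt_add_eq_append le_add_diff_inverse zero_le)
    also have "[j..<Suc L] = j # Suc j # [Suc (Suc j)..<Suc L]"
      using j by (simp add: upt_conv_Cons del: upt_Suc)
    finally show ?thesis by (simp add: map_Suc_upt del: upt_Suc)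
  qed
  have s2: "[0..<L] = [0..<j] @ [j] @ [Suc j..<L]"
  proof -
    have "[0..<L] = [0..<j] @ [j..<L]"
      using j by (metis less_imp_le_nat upt_add_eq_append le_add_diff_inverse zero_le)
    also have "[j..<L] = j # [Suc j..<L]" using j by (simp add: upt_conv_Cons)
    finally show ?thesis by simp
  qed
  have e1: "map (\<lambda>k. A ((ins ^^ k) m) ((ins ^^ Suc k) m)) [0..<j]
    = map (\<lambda>k. B ((q ^^ k) m) ((q ^^ Suc k) m)) [0..<j]"
  proof (rule map_cong[OF refl])
    fix k assume "k \<in> set [0..<j]"
    then have k: "k < j" by simp
    then have "(q ^^ k) m \<noteq> l" using jne[of k] j by simp
    then show "A ((ins ^^ k) m) ((ins ^^ Suc k) m) = B ((q ^^ k) m) ((q ^^ Suc k) m)"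
      using p1[of k] p1[of "Suc k"] k unfolding B_def by simp
  qed
  have e2: "map (\<lambda>k. A ((ins ^^ Suc k) m) ((ins ^^ Suc (Suc k)) m)) [Suc j..<L]
    = map (\<lambda>k. B ((q ^^ k) m) ((q ^^ Suc k) m)) [Suc j..<L]"
  proof (rule map_cong[OF refl])
    fix k assume "k \<in> set [Suc j..<L]"
    then have k: "j < k" "k < L" by auto
    then have "(q ^^ k) m \<noteq> l" using jne[of k] by simp
    then show "A ((ins ^^ Suc k) m) ((ins ^^ Suc (Suc k)) m) = B ((q ^^ k) m) ((q ^^ Suc k) m)"
      using p3'[of k] p3'[of "Suc k"] k unfolding B_def by simp
  qed
  have a: "(ins ^^ j) m = l" "(ins ^^ Suc j) m = r" "(ins ^^ Suc (Suc j)) m = b"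
    using p1[of j] p2 p3'[of "Suc j"] j ql by (simp_all del: funpow.simps, simp)
  have a': "(q ^^ j) m = l" "(q ^^ Suc j) m = b" using j ql by auto
  have "cycle_word A ins m = qmult (qprod_list (map (\<lambda>k. B ((q ^^ k) m) ((q ^^ Suc k) m)) [0..<j]))
     (qmult (A l r) (qmult (A r b) (qprod_list (map (\<lambda>k. B ((q ^^ k) m) ((q ^^ Suc k) m)) [Suc j..<L]))))"
    unfolding cycle_word_def len s1 map_append map_map o_def list.map qprod_list_simps e1[unfolded o_def] e2[unfolded o_def] a[unfolded o_def]
    by (simp add: qmult_assoc)
  also have "\<dots> = cycle_word B q m"
    unfolding cycle_word_def L_def[symmetric] s2 map_append list.map qprod_list_simps a'
    by (simp add: B_def qmult_assoc del: funpow.simps)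
  finally show ?thesis unfolding B_def .
qed

text \<open>Adding the largest index to a cycle does not change its minimum, and \<open>r\<close>
  itself cannot lead because its cycle contains the smaller element \<open>b\<close>.\<close>

lemma leaders_ins: "cycle_leaders ins \<inter> insert r S = cycle_leaders q \<inter> S"
proof -
  have sub1: "\<exists>i. (q ^^ k) m = (ins ^^ i) m" if "m \<in> S" for m k
  proof (induct k)
    case 0 show ?case by (rule exI[of _ 0]) simp
  next
    case (Suc k)
    then obtain i where i: "(q ^^ k) m = (ins ^^ i) m" by blast
    show ?case
    proof (cases "(q ^^ k) m = l")
      case True
      then have "(q ^^ Suc k) m = (ins ^^ Suc (Suc i)) m" using i ins_l ins_r ql by simp
      then show ?thesis by blast
    next
      case False
      then have "(q ^^ Suc k) m = (ins ^^ Suc i) m"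
        using i ins_other[OF False pow_ne_r[OF that]] by simp
      then show ?thesis by blast
    qed
  qed
  have sub2: "(\<exists>i. (ins ^^ k) m = (q ^^ i) m) \<or> (ins ^^ k) m = r \<and> (\<exists>i. (q ^^ i) m = l)" if "m \<in> S" for m k
  proof (induct k)
    case 0
    have "(ins ^^ 0) m = (q ^^ 0) m" by simp
    then show ?case by blast
  next
    case (Suc k)
    then show ?case
    proof (elim disjE exE conjE)
      fix i assume i: "(ins ^^ k) m = (q ^^ i) m"
      show ?thesis
      proof (cases "(q ^^ i) m = l")
        case True then have "(ins ^^ Suc k) m = r" using i ins_l by simp
        with True show ?thesis by blast
      next
        case False
        then have "(ins ^^ Suc k) m = (q ^^ Suc i) m"
          using i ins_other[OF False pow_ne_r[OF that]] by simp
        then show ?thesis by blast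
      qed
    next
      fix i assume "(ins ^^ k) m = r" "(q ^^ i) m = l"
      then have "(ins ^^ Suc k) m = (q ^^ Suc i) m" using ins_r ql by simp
      then show ?thesis by blast
    qed
  qed
  have "m \<in> cycle_leaders ins \<longleftrightarrow> m \<in> cycle_leaders q" if m: "m \<in> S" for m
  proof
    assume *: "m \<in> cycle_leaders ins"
    have "m \<le> (q ^^ k) m" for k
      using sub1[OF m, of k] * unfolding cycle_leaders_def by auto
    then show "m \<in> cycle_leaders q" unfolding cycle_leaders_def by simp
  next
    assume *: "m \<in> cycle_leaders q"
    have "m \<le> (ins ^^ k) m" for k
      using sub2[OF m, of k] * bspec[OF r m] unfolding cycle_leaders_def by auto
    then show "m \<in> cycle_leaders ins" unfolding cycle_leaders_def by simp
  qed
  moreover have "r \<notin> cycle_leaders ins"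
  proof
    assume "r \<in> cycle_leaders ins"
    then have "\<forall>k. r \<le> (ins ^^ k) r" unfolding cycle_leaders_def by simp
    then have "r \<le> (ins ^^ 1) r" by (rule spec)
    then have "r \<le> b" using ins_r by simp
    then show False using bspec[OF r b] by simp
  qed
  ultimately show ?thesis by blast
qed

lemma moore_term_on_ins:
  "moore_term_on (insert r S) A ins = moore_term_on S (A(l := \<lambda>k. qmult (A l r) (A r k))) q"
proof -
  have "map (cycle_word A ins) xs = map (cycle_word (A(l := \<lambda>k. qmult (A l r) (A r k))) q) xs"
    if "set xs \<subseteq> S" for xs
    using that cycle_word_ins by (intro map_cong refl) blast
  from this[of "rev (sorted_list_of_set (cycle_leaders q \<inter> S))"]
  have "map (cycle_word A ins) (rev (sorted_list_of_set (cycle_leaders q \<inter> S)))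
    = map (cycle_word (A(l := \<lambda>k. qmult (A l r) (A r k))) q) (rev (sorted_list_of_set (cycle_leaders q \<inter> S)))"
    by simp
  then show ?thesis unfolding moore_term_on_def leaders_ins by (rule arg_cong)
qed

lemma sign_ins: "sign ins = - sign q"
  using sign_compose[OF permutation_swap_id perm_q, of r b] b rnS by (auto simp: sign_swap_id ins_def)

end

text \<open>A fixed \<open>r\<close> is a cycle of length one with the largest leader, so Moore's
  decreasing order puts its factor \<open>A r r\<close> in front of the whole product.\<close>

lemma moore_term_on_fixed:
  assumes r: "\<forall>x\<in>S. x < r"
  shows "moore_term_on (insert r S) A q = qmult (A r r) (moore_term_on S A q)"
proof -
  have rn: "r \<notin> S" using r by blast
  have qr: "q r = r" by (rule permutes_not_in[OF q rn])
  then have pw: "(q ^^ k) r = r" for k by (induct k) auto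
  have len: "cyc_len q r = 1" by (rule cyc_len_eqI) (auto simp: qr)
  have w: "cycle_word A q r = A r r"
    unfolding cycle_word_def len by (simp add: qr)
  have "cycle_leaders q \<inter> insert r S = insert r (cycle_leaders q \<inter> S)"
    unfolding cycle_leaders_def using pw by auto
  moreover have "sorted_list_of_set (insert r (cycle_leaders q \<inter> S)) = sorted_list_of_set (cycle_leaders q \<inter> S) @ [r]"
  proof -
    let ?xs = "sorted_list_of_set (cycle_leaders q \<inter> S) @ [r]"
    have "sorted ?xs" "distinct ?xs" using r rn by (auto simp: sorted_append less_imp_le)
    then have "sorted_list_of_set (set ?xs) = ?xs" by (rule sorted_list_of_set.idem_if_sorted_distinct)
    then show ?thesis by simp
  qed
  ultimately show ?thesis unfolding moore_term_on_def by (simp only: rev_append rev.simps append.simps list.map qprod_list_simps w)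
qed

end

text \<open>Every permutation of \<open>insert r S\<close> is a transposition of \<open>r\<close>
  with some \<open>b\<close>, composed with a permutation \<open>q\<close> of \<open>S\<close>. The
  choice \<open>b = r\<close> leaves \<open>r\<close> fixed and gives the first term; any other
  \<open>b\<close> inserts \<open>r\<close> into a cycle of \<open>q\<close> just before
  \<open>b\<close> and reverses the sign.\<close>

theorem Mdet_on_insert:
  assumes r: "\<forall>x\<in>S. x < r"
  shows "Mdet_on (insert r S) A = qmult (A r r) (Mdet_on S A)
     - (\<Sum>l\<in>S. Mdet_on S (A(l := \<lambda>k. qmult (A l r) (A r k))))"
proof -
  let ?P = "{q. q permutes S}"
  have rn: "r \<notin> S" using r by blast
  have fin: "finite ?P" using finite_permutations[of S] by simp
  have A: "(\<Sum>q\<in>?P. of_int (sign (Transposition.transpose r r \<circ> q)) *\<^sub>R moore_term_on (insert r S) A (Transposition.transpose r r \<circ> q))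
     = qmult (A r r) (Mdet_on S A)"
    unfolding Mdet_on_def qmult.sum_right
    by (rule sum.cong) (use moore_term_on_fixed[OF _ r] in auto)
  have "(\<Sum>b\<in>S. \<Sum>q\<in>?P. of_int (sign (Transposition.transpose r b \<circ> q)) *\<^sub>R moore_term_on (insert r S) A (Transposition.transpose r b \<circ> q))
    = (\<Sum>b\<in>S. \<Sum>q\<in>?P. - (of_int (sign q) *\<^sub>R moore_term_on S (A(inv q b := \<lambda>k. qmult (A (inv q b) r) (A r k))) q))"
  proof (intro sum.cong refl)
    fix b q assume b: "b \<in> S" and q: "q \<in> ?P"
    then have q': "q permutes S" by simp
    have ql: "q (inv q b) = b" using permutes_inverses(1)[OF q'] .
    show "of_int (sign (Transposition.transpose r b \<circ> q)) *\<^sub>R moore_term_on (insert r S) A (Transposition.transpose r b \<circ> q)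
      = - (of_int (sign q) *\<^sub>R moore_term_on S (A(inv q b := \<lambda>k. qmult (A (inv q b) r) (A r k))) q)"
      unfolding sign_ins[OF q' refl r b ql] moore_term_on_ins[OF q' refl r b ql] by simp
  qed
  also have "\<dots> = (\<Sum>q\<in>?P. \<Sum>b\<in>S. - (of_int (sign q) *\<^sub>R moore_term_on S (A(inv q b := \<lambda>k. qmult (A (inv q b) r) (A r k))) q))"
    by (rule sum.swap)
  \<comment> \<open>For fixed \<open>q\<close> the sum over \<open>b\<close> is reindexed by the
    predecessor \<open>l = inv q b\<close>, which makes the row update independent of
    \<open>q\<close>.\<close>
  also have "\<dots> = (\<Sum>q\<in>?P. \<Sum>l\<in>S. - (of_int (sign q) *\<^sub>R moore_term_on S (A(l := \<lambda>k. qmult (A l r) (A r k))) q))"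
  proof (rule sum.cong[OF refl])
    fix q assume "q \<in> ?P"
    then have q': "q permutes S" by simp
    show "(\<Sum>b\<in>S. - (of_int (sign q) *\<^sub>R moore_term_on S (A(inv q b := \<lambda>k. qmult (A (inv q b) r) (A r k))) q))
      = (\<Sum>l\<in>S. - (of_int (sign q) *\<^sub>R moore_term_on S (A(l := \<lambda>k. qmult (A l r) (A r k))) q))"
      by (subst sum.permute[OF q']) (simp add: permutes_inverses(2)[OF q'])
  qed
  also have "\<dots> = (\<Sum>l\<in>S. \<Sum>q\<in>?P. - (of_int (sign q) *\<^sub>R moore_term_on S (A(l := \<lambda>k. qmult (A l r) (A r k))) q))"
    by (rule sum.swap)
  also have "\<dots> = - (\<Sum>l\<in>S. Mdet_on S (A(l := \<lambda>k. qmult (A l r) (A r k))))"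
    unfolding Mdet_on_def by (simp add: sum_negf)
  finally have B: "(\<Sum>b\<in>S. \<Sum>q\<in>?P. of_int (sign (Transposition.transpose r b \<circ> q)) *\<^sub>R moore_term_on (insert r S) A (Transposition.transpose r b \<circ> q))
    = - (\<Sum>l\<in>S. Mdet_on S (A(l := \<lambda>k. qmult (A l r) (A r k))))" .
  have "Mdet_on (insert r S) A = (\<Sum>b\<in>insert r S. \<Sum>q\<in>?P. of_int (sign (Transposition.transpose r b \<circ> q)) *\<^sub>R moore_term_on (insert r S) A (Transposition.transpose r b \<circ> q))"
    unfolding Mdet_on_def by (rule sum_over_permutations_insert) (use rn in auto)
  also have "\<dots> = qmult (A r r) (Mdet_on S A) - (\<Sum>l\<in>S. Mdet_on S (A(l := \<lambda>k. qmult (A l r) (A r k))))"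
    using rn A B by (subst sum.insert) auto
  finally show ?thesis .
qed

lemma Mdet_on_empty: "Mdet_on {} A = qone"
  by (simp add: Mdet_on_def moore_term_on_def)

subsection \<open>Schur complements and Cholesky decomposition\<close>

lemma Mdet_on_cong:
  assumes "finite S" "\<And>l m. l \<in> S \<Longrightarrow> m \<in> S \<Longrightarrow> A l m = B l m"
  shows "Mdet_on S A = Mdet_on S B"
  using assms
proof (induct S arbitrary: A B rule: finite_linorder_max_induct)
  case empty
  then show ?case by (simp add: Mdet_on_empty)
next
  case (insert r S)
  have "Mdet_on S A = Mdet_on S B" by (rule insert.hyps(3)) (use insert.prems in auto)
  moreover have "Mdet_on S (A(l := \<lambda>k. qmult (A l r) (A r k))) = Mdet_on S (B(l := \<lambda>k. qmult (B l r) (B r k)))"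
    if "l \<in> S" for l
    by (rule insert.hyps(3)) (use insert.prems that in auto)
  moreover have "A r r = B r r" using insert.prems by auto
  ultimately show ?case by (simp add: Mdet_on_insert[OF insert.hyps(2)])
qed

lemma Mdet_on_upd_out: "finite S \<Longrightarrow> r \<notin> S \<Longrightarrow> Mdet_on S (A(r := X)) = Mdet_on S A"
  "finite S \<Longrightarrow> r \<notin> S \<Longrightarrow> Mdet_on S (A(r := X, k := Y)) = Mdet_on S (A(k := Y))"
  by (auto intro!: Mdet_on_cong)

text \<open>Only additivity in a row is claimed: a quaternionic factor could not be pulled out of
  the middle of a word. In the recursion, row \<open>l\<close> also enters through its entry at
  \<open>r\<close>, which multiplies row \<open>r\<close>; this is the case
  \<open>k = l\<close>.\<close>

lemma Mdet_on_row_add: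
  assumes "finite S" "l \<in> S"
  shows "Mdet_on S (A(l := \<lambda>m. X m + Y m)) = Mdet_on S (A(l := X)) + Mdet_on S (A(l := Y))"
  using assms
proof (induct S arbitrary: A l X Y rule: finite_linorder_max_induct)
  case empty
  then show ?case by simp
next
  case (insert r S)
  have ih: "Mdet_on S (A(l := \<lambda>m. X m + Y m)) = Mdet_on S (A(l := X)) + Mdet_on S (A(l := Y))"
    if "l \<in> S" for A l X Y by (rule insert.hyps(3)[OF that])
  have rn: "r \<notin> S" using insert.hyps(2) by blast
  note out = Mdet_on_upd_out[OF insert.hyps(1) rn]
  note ex = Mdet_on_insert[OF insert.hyps(2)]
  have "Mdet_on (insert r S) (A(l := \<lambda>m. X m + Y m)) = Mdet_on (insert r S) (A(l := X)) + Mdet_on (insert r S) (A(l := Y))"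
  proof (cases "l = r")
    case True
    have "Mdet_on S (A(k := \<lambda>m. qmult (A k r) (X m + Y m)))
      = Mdet_on S (A(k := \<lambda>m. qmult (A k r) (X m))) + Mdet_on S (A(k := \<lambda>m. qmult (A k r) (Y m)))"
      if "k \<in> S" for k
      using ih[OF that, of A "\<lambda>m. qmult (A k r) (X m)" "\<lambda>m. qmult (A k r) (Y m)"] by (simp add: qmult_add_right)
    moreover have "k \<noteq> r" if "k \<in> S" for k using that rn by blast
    ultimately show ?thesis
      unfolding True ex by (simp add: out qmult_add_left sum.distrib)
  next
    case False
    then have l: "l \<in> S" using insert.prems by simp
    have e: "Mdet_on S ((A(l := Z))(k := \<lambda>m. qmult ((A(l := Z)) k r) (A r m)))
       = (if k = l then Mdet_on S (A(l := \<lambda>m. qmult (Z r) (A r m)))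
          else Mdet_on S ((A(k := \<lambda>m. qmult (A k r) (A r m)))(l := Z)))" for k Z
      by (simp add: fun_upd_twist)
    have s: "Mdet_on S (A(l := \<lambda>m. qmult (X r + Y r) (A r m)))
        = Mdet_on S (A(l := \<lambda>m. qmult (X r) (A r m))) + Mdet_on S (A(l := \<lambda>m. qmult (Y r) (A r m)))"
      using ih[OF l, of A "\<lambda>m. qmult (X r) (A r m)" "\<lambda>m. qmult (Y r) (A r m)"] by (simp add: qmult_add_left)
    have r: "(A(l := Z)) r = A r" for Z using False by simp
    have "(\<Sum>k\<in>S. Mdet_on S ((A(l := \<lambda>m. X m + Y m))(k := \<lambda>m. qmult ((A(l := \<lambda>m. X m + Y m)) k r) (A r m))))
      = (\<Sum>k\<in>S. Mdet_on S ((A(l := X))(k := \<lambda>m. qmult ((A(l := X)) k r) (A r m))))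
      + (\<Sum>k\<in>S. Mdet_on S ((A(l := Y))(k := \<lambda>m. qmult ((A(l := Y)) k r) (A r m))))"
      unfolding sum.distrib[symmetric] e
      by (rule sum.cong) (auto simp: s ih[OF l])
    then show ?thesis
      unfolding ex r ih[OF l] by (simp add: qmult_add_right)
  qed
  then show ?case .
qed

text \<open>The subtracted sum in \<open>Mdet_on_insert\<close> is a derivative of this kind, in the
  direction with entries \<open>qmult (A l r) (A r k)\<close>. This turns the recursion into a
  statement about the determinant along a line of matrices. Continuity of the determinant is
  obtained from it as well.\<close>

lemma Mdet_on_has_vector_derivative:
  fixes A :: "real \<Rightarrow> 'n::{finite,linorder} \<Rightarrow> 'n \<Rightarrow> quat"
  assumes "finite S"
    and "\<And>l m. l \<in> S \<Longrightarrow> m \<in> S \<Longrightarrow> ((\<lambda>t. A t l m) has_vector_derivative A' l m) (at t0)"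
  shows "((\<lambda>t. Mdet_on S (A t)) has_vector_derivative (\<Sum>k\<in>S. Mdet_on S ((A t0)(k := A' k)))) (at t0)"
  using assms
proof (induct S arbitrary: A A' rule: finite_linorder_max_induct)
  case empty
  then show ?case by (simp add: Mdet_on_empty)
next
  case (insert r S)
  have ih: "((\<lambda>t. Mdet_on S (A t)) has_vector_derivative (\<Sum>k\<in>S. Mdet_on S ((A t0)(k := A' k)))) (at t0)"
    if "\<And>l m. l \<in> S \<Longrightarrow> m \<in> S \<Longrightarrow> ((\<lambda>t. A t l m) has_vector_derivative A' l m) (at t0)" for A A'
    by (rule insert.hyps(3)[OF that])
  have rn: "r \<notin> S" using insert.hyps(2) by blast
  note out = Mdet_on_upd_out[OF insert.hyps(1) rn]
  note ex = Mdet_on_insert[OF insert.hyps(2)]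
  let ?A = "A t0"
  define B where "B l t = (A t)(l := \<lambda>k. qmult (A t l r) (A t r k))" for l t
  define B' where "B' l = A'(l := \<lambda>k. qmult (?A l r) (A' r k) + qmult (A' l r) (?A r k))" for l
  have dB: "((\<lambda>t. Mdet_on S (B l t)) has_vector_derivative (\<Sum>k\<in>S. Mdet_on S ((B l t0)(k := B' l k)))) (at t0)"
    if l: "l \<in> S" for l
  proof (rule ih)
    fix i m assume im: "i \<in> S" "m \<in> S"
    show "((\<lambda>t. B l t i m) has_vector_derivative B' l i m) (at t0)"
    proof (cases "i = l")
      case True
      then show ?thesis unfolding B_def B'_def
        using qmult.has_vector_derivative[OF insert.prems[of l r] insert.prems[of r m]] l im by simp
    next
      case False
      then show ?thesis unfolding B_def B'_def using insert.prems im by simp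
    qed
  qed
  have d0: "((\<lambda>t. Mdet_on S (A t)) has_vector_derivative (\<Sum>k\<in>S. Mdet_on S (?A(k := A' k)))) (at t0)"
    by (rule ih) (use insert.prems in auto)
  have drr: "((\<lambda>t. A t r r) has_vector_derivative A' r r) (at t0)" using insert.prems by auto
  \<comment> \<open>In row \<open>l\<close> of the recursion the product rule has two halves.
    Differentiating \<open>A l r\<close> is counted in \<open>E l l\<close>; differentiating row
    \<open>r\<close> is split off in \<open>L\<close> below, since it belongs to the summand in
    which row \<open>r\<close> is replaced.\<close>
  define E where "E l k = (if k = l then Mdet_on S (?A(l := \<lambda>m. qmult (A' l r) (?A r m)))
      else Mdet_on S ((?A(l := \<lambda>m. qmult (?A l r) (?A r m)))(k := A' k)))" for l k
  have L: "(\<Sum>k\<in>S. Mdet_on S ((B l t0)(k := B' l k))) = Mdet_on S (?A(l := \<lambda>m. qmult (?A l r) (A' r m))) + (\<Sum>k\<in>S. E l k)"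
    if l: "l \<in> S" for l
  proof -
    have "Mdet_on S ((B l t0)(k := B' l k)) = (if k = l then Mdet_on S (?A(l := \<lambda>m. qmult (?A l r) (A' r m))) else 0) + E l k" for k
      unfolding B_def B'_def E_def using Mdet_on_row_add[OF insert.hyps(1) l] by simp
    then show ?thesis using l insert.hyps(1) by (simp add: sum.distrib)
  qed
  have Rr: "Mdet_on (insert r S) (?A(r := A' r)) = qmult (A' r r) (Mdet_on S ?A)
       - (\<Sum>l\<in>S. Mdet_on S (?A(l := \<lambda>m. qmult (?A l r) (A' r m))))"
  proof -
    have "Mdet_on S ((?A(r := A' r))(l := \<lambda>m. qmult ((?A(r := A' r)) l r) (A' r m))) = Mdet_on S (?A(l := \<lambda>m. qmult (?A l r) (A' r m)))"
      if "l \<in> S" for l using that rn out(2) by (cases "l = r") auto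
    then show ?thesis unfolding ex by (simp add: out)
  qed
  have Rk: "Mdet_on (insert r S) (?A(k := A' k)) = qmult (?A r r) (Mdet_on S (?A(k := A' k))) - (\<Sum>l\<in>S. E l k)"
    if k: "k \<in> S" for k
  proof -
    have kr: "k \<noteq> r" using k rn by blast
    have "Mdet_on S ((?A(k := A' k))(l := \<lambda>m. qmult ((?A(k := A' k)) l r) (?A r m))) = E l k" for l
      unfolding E_def by (simp add: fun_upd_twist)
    then show ?thesis unfolding ex using kr by simp
  qed
  have "((\<lambda>t. Mdet_on (insert r S) (A t)) has_vector_derivative
      (qmult (?A r r) (\<Sum>k\<in>S. Mdet_on S (?A(k := A' k))) + qmult (A' r r) (Mdet_on S ?A)
       - (\<Sum>l\<in>S. \<Sum>k\<in>S. Mdet_on S ((B l t0)(k := B' l k))))) (at t0)"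
    unfolding ex B_def[symmetric]
    by (intro has_vector_derivative_diff has_vector_derivative_sum qmult.has_vector_derivative drr d0 dB)
  moreover have "qmult (?A r r) (\<Sum>k\<in>S. Mdet_on S (?A(k := A' k))) + qmult (A' r r) (Mdet_on S ?A)
       - (\<Sum>l\<in>S. \<Sum>k\<in>S. Mdet_on S ((B l t0)(k := B' l k)))
      = (\<Sum>k\<in>insert r S. Mdet_on (insert r S) (?A(k := A' k)))"
    using insert.hyps(1) rn
    by (simp add: L Rr Rk sum.distrib sum_subtractf qmult.sum_right sum.swap[of E S S] cong: sum.cong)
  ultimately have "((\<lambda>t. Mdet_on (insert r S) (A t)) has_vector_derivative
      (\<Sum>k\<in>insert r S. Mdet_on (insert r S) (?A(k := A' k)))) (at t0)"
    by (simp only:)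
  then show ?case .
qed

lemma qmult_sum_sum: "qmult (sum f S) (sum g T) = (\<Sum>l\<in>S. \<Sum>m\<in>T. qmult (f l) (g m))"
  by (subst qmult.sum_left) (simp add: qmult.sum_right)

definition qform :: "'n set \<Rightarrow> ('n \<Rightarrow> 'n \<Rightarrow> quat) \<Rightarrow> ('n \<Rightarrow> quat) \<Rightarrow> quat" where
  "qform S A v = (\<Sum>l\<in>S. \<Sum>m\<in>S. qmult (qconj (v l)) (qmult (A l m) (v m)))"

definition qherm :: "'n set \<Rightarrow> ('n \<Rightarrow> 'n \<Rightarrow> quat) \<Rightarrow> bool" where
  "qherm S A \<longleftrightarrow> (\<forall>l\<in>S. \<forall>m\<in>S. A m l = qconj (A l m))"

definition qposdef :: "'n set \<Rightarrow> ('n \<Rightarrow> 'n \<Rightarrow> quat) \<Rightarrow> bool" where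
  "qposdef S A \<longleftrightarrow> qherm S A \<and> (\<forall>v. (\<exists>l\<in>S. v l \<noteq> 0) \<longrightarrow> 0 < qform S A v $ 1)"

abbreviation qouter :: "('n \<Rightarrow> quat) \<Rightarrow> 'n \<Rightarrow> 'n \<Rightarrow> quat" where
  "qouter v l m \<equiv> qmult (v l) (qconj (v m))"

lemma qherm_diag: "qherm S A \<Longrightarrow> r \<in> S \<Longrightarrow> A r r = (A r r $ 1) *\<^sub>R qone"
proof -
  assume "qherm S A" "r \<in> S"
  then have "A r r = qconj (A r r)" unfolding qherm_def by blast
  then show ?thesis by (simp add: quat_eq_iff)
qed

lemma qform_rank1: "qform S (qouter v) x = (norm (\<Sum>m\<in>S. qmult (qconj (v m)) (x m)))\<^sup>2 *\<^sub>R qone"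
proof -
  have "qform S (qouter v) x = qmult (\<Sum>l\<in>S. qmult (qconj (x l)) (v l)) (\<Sum>m\<in>S. qmult (qconj (v m)) (x m))"
    unfolding qform_def qmult_sum_sum by (simp add: qmult_assoc)
  also have "(\<Sum>l\<in>S. qmult (qconj (x l)) (v l)) = qconj (\<Sum>m\<in>S. qmult (qconj (v m)) (x m))"
    by (simp add: qconj_sum qconj_mult)
  finally show ?thesis by (simp add: qmult_conj_self)
qed

lemma qform_add: "qform S (\<lambda>l m. A l m + B l m) x = qform S A x + qform S B x"
  by (simp add: qform_def qmult_add_left qmult_add_right sum.distrib)

lemma qform_scaleR: "qform S (\<lambda>l m. c *\<^sub>R A l m) x = c *\<^sub>R qform S A x"
  by (simp add: qform_def scaleR_sum_right)

lemma qposdef_add_rank1: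
  assumes "qposdef S A" "0 \<le> t"
  shows "qposdef S (\<lambda>l m. A l m + t *\<^sub>R qouter v l m)"
proof -
  have "qherm S (\<lambda>l m. A l m + t *\<^sub>R qouter v l m)"
    unfolding qherm_def
  proof (intro ballI)
    fix l m assume "l \<in> S" "m \<in> S"
    then have "qconj (A l m) = A m l" using assms unfolding qposdef_def qherm_def by metis
    then show "A m l + t *\<^sub>R qouter v m l = qconj (A l m + t *\<^sub>R qouter v l m)"
      by (simp add: qconj_add qconj_scaleR qconj_mult)
  qed
  moreover have "0 < qform S (\<lambda>l m. A l m + t *\<^sub>R qouter v l m) x $ 1" if "\<exists>l\<in>S. x l \<noteq> 0" for x
    using assms that unfolding qposdef_def qform_add qform_scaleR qform_rank1
    by (simp add: add_pos_nonneg)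
  ultimately show ?thesis unfolding qposdef_def by blast
qed

text \<open>The Schur complement of the pivot \<open>r\<close>. A diagonal entry of a hyperhermitian
  matrix is real, hence the division by its first component.\<close>

definition schur :: "'n \<Rightarrow> ('n \<Rightarrow> 'n \<Rightarrow> quat) \<Rightarrow> 'n \<Rightarrow> 'n \<Rightarrow> quat" where
  "schur r A l m = A l m - (1 / (A r r $ 1)) *\<^sub>R qmult (A l r) (A r m)"

lemma qposdef_diag_pos:
  assumes "finite S" "qposdef S A" "r \<in> S"
  shows "0 < A r r $ 1"
proof -
  define e where "e l = (if l = r then qone else 0)" for l
  have e: "e r = qone" "\<And>l. l \<noteq> r \<Longrightarrow> e l = 0" by (simp_all add: e_def)
  have q1: "qconj qone = qone" "qone \<noteq> 0" by (simp_all add: quat_eq_iff)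
  have "\<exists>l\<in>S. e l \<noteq> 0" using assms(3) e(1) q1(2) by metis
  then have "0 < qform S A e $ 1" using assms(2) unfolding qposdef_def by blast
  also have "qform S A e = (\<Sum>l\<in>S. \<Sum>m\<in>S. if m = r then (if l = r then A r r else 0) else 0)"
    unfolding qform_def
  proof (intro sum.cong refl)
    fix l m
    show "qmult (qconj (e l)) (qmult (A l m) (e m)) = (if m = r then (if l = r then A r r else 0) else 0)"
      by (cases "l = r"; cases "m = r") (simp_all add: e q1 qmult.zero_left qmult.zero_right)
  qed
  also have "\<dots> = A r r" using assms(1,3) by simp
  finally show ?thesis .
qed

text \<open>Completing the square: the form of the Schur complement at \<open>v\<close> is the form
  of \<open>A\<close> at the extension of \<open>v\<close> whose \<open>r\<close>-component
  minimises it.\<close>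

lemma qposdef_schur:
  assumes "finite S" "r \<notin> S" "qposdef (insert r S) A"
  shows "qposdef S (schur r A)"
proof -
  define a where "a = A r r $ 1"
  have a: "a > 0" using qposdef_diag_pos[OF _ assms(3)] assms(1) unfolding a_def by simp
  have h: "A m l = qconj (A l m)" if "l \<in> insert r S" "m \<in> insert r S" for l m
    using assms(3) that unfolding qposdef_def qherm_def by blast
  have arr: "A r r = a *\<^sub>R qone" unfolding a_def
    by (rule qherm_diag[of "insert r S"]) (use assms(3) in \<open>auto simp: qposdef_def\<close>)
  have hs: "qherm S (schur r A)"
    unfolding qherm_def
  proof (intro ballI)
    fix l m assume "l \<in> S" "m \<in> S"
    then have "qconj (A l m) = A m l" "qconj (A l r) = A r l" "qconj (A r m) = A m r"
      by (metis h insertI1 insertI2)+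
    then show "schur r A m l = qconj (schur r A l m)"
      by (simp add: schur_def qconj_diff qconj_scaleR qconj_mult)
  qed
  have "0 < qform S (schur r A) v $ 1" if v: "\<exists>l\<in>S. v l \<noteq> 0" for v
  proof -
    define y where "y = (\<Sum>m\<in>S. qmult (A r m) (v m))"
    \<comment> \<open>The minimiser in the \<open>r\<close>-th variable, from setting
      \<open>a z + y = 0\<close>.\<close>
    define z where "z = (- (1/a)) *\<^sub>R y"
    have y': "(\<Sum>l\<in>S. qmult (qconj (v l)) (A l r)) = qconj y"
      unfolding y_def qconj_sum qconj_mult by (rule sum.cong) (auto simp: h[symmetric])
    have ne: "l \<noteq> r" if "l \<in> S" for l using that assms(2) by blast
    have "qform (insert r S) A (v(r := z)) = qform S A v + qmult (\<Sum>l\<in>S. qmult (qconj (v l)) (A l r)) z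
       + qmult (qconj z) y + qmult (qconj z) (qmult (A r r) z)"
      unfolding qform_def y_def qmult.sum_left qmult.sum_right
      using assms(1,2) ne by (simp add: sum.distrib qmult_assoc cong: sum.cong)
    also have "\<dots> = qform S A v - (1/a) *\<^sub>R qmult (qconj y) y"
    proof -
      define Y where "Y = qmult (qconj y) y"
      have zz: "qmult (qconj y) z = (- (1/a)) *\<^sub>R Y" "qmult (qconj z) y = (- (1/a)) *\<^sub>R Y"
        "qmult (qconj z) (qmult (A r r) z) = (1/a) *\<^sub>R Y"
        unfolding arr z_def Y_def qconj_scaleR qmult_scaleR_left qmult_scaleR_right using a by simp_all
      show ?thesis unfolding y' zz Y_def[symmetric] by (simp add: algebra_simps)
    qed
    also have "\<dots> = qform S (schur r A) v"
    proof -
      have "qmult (qconj y) y = qform S (\<lambda>l m. qmult (A l r) (A r m)) v"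
        unfolding y'[symmetric] unfolding y_def qform_def qmult_sum_sum by (simp add: qmult_assoc)
      moreover have "qform S (schur r A) v = qform S A v + (- (1/a)) *\<^sub>R qform S (\<lambda>l m. qmult (A l r) (A r m)) v"
        unfolding qform_scaleR[symmetric] qform_add[symmetric] by (simp add: schur_def[abs_def] a_def)
      ultimately show ?thesis by simp
    qed
    finally have e: "qform (insert r S) A (v(r := z)) = qform S (schur r A) v" .
    have "\<exists>l\<in>insert r S. (v(r := z)) l \<noteq> 0" using v ne by auto
    then show ?thesis using assms(3) e unfolding qposdef_def by metis
  qed
  with hs show ?thesis unfolding qposdef_def by blast
qed

text \<open>The companion statement of the Schur formula in a joint induction: affinity on
  \<open>S\<close> gives the Schur formula on \<open>insert r S\<close>, which in turn gives
  affinity there. The slope \<open>g\<close> is needed only as something that exists.\<close>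

definition rank1_affine :: "'n::{finite,linorder} set \<Rightarrow> bool" where
  "rank1_affine S \<longleftrightarrow> (\<forall>A v. qposdef S A \<longrightarrow>
     (\<exists>g. \<forall>t\<ge>0. Mdet_on S (\<lambda>l m. A l m + t *\<^sub>R qouter v l m) = Mdet_on S A + t *\<^sub>R g))"

text \<open>\<open>A\<close> is its Schur complement plus \<open>1/a\<close> times the rank-one
  matrix \<open>C\<close>. Along this line the determinant on \<open>S\<close> is affine with slope
  \<open>g\<close>, and \<open>g\<close> is also its derivative at \<open>1/a\<close>, namely the
  subtracted sum in \<open>Mdet_on_insert\<close>. The recursion then reads
  \<open>a (D + g/a) - g = a D\<close>, with \<open>D\<close> the determinant of the Schur
  complement.\<close>

lemma Mdet_on_schur:
  assumes aff: "rank1_affine S" and r: "\<forall>x\<in>S. x < r" and pd: "qposdef (insert r S) A"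
  shows "Mdet_on (insert r S) A = (A r r $ 1) *\<^sub>R Mdet_on S (schur r A)"
proof -
  define a where "a = A r r $ 1"
  have fin: "finite S" by simp
  have rn: "r \<notin> S" using r by blast
  have a: "a > 0" using qposdef_diag_pos[OF _ pd] unfolding a_def by simp
  have arr: "A r r = a *\<^sub>R qone" unfolding a_def
    by (rule qherm_diag[of "insert r S"]) (use pd in \<open>auto simp: qposdef_def\<close>)
  define C where "C l m = qmult (A l r) (A r m)" for l m
  define w where "w l = A l r" for l
  have Cw: "C l m = qouter w l m" if "l \<in> S" "m \<in> S" for l m
    using pd that unfolding qposdef_def qherm_def C_def w_def by (metis insertI1 insertI2)
  obtain g where g: "\<And>t. t \<ge> 0 \<Longrightarrow> Mdet_on S (\<lambda>l m. schur r A l m + t *\<^sub>R qouter w l m) = Mdet_on S (schur r A) + t *\<^sub>R g"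
    using aff qposdef_schur[OF fin rn pd] unfolding rank1_affine_def by blast
  define F where "F t = Mdet_on S (\<lambda>l m. schur r A l m + t *\<^sub>R C l m)" for t
  have F: "F t = Mdet_on S (schur r A) + t *\<^sub>R g" if "t \<ge> 0" for t
    unfolding F_def g[OF that, symmetric] by (rule Mdet_on_cong[OF fin]) (simp add: Cw)
  have e: "(\<lambda>l m. schur r A l m + (1/a) *\<^sub>R C l m) = A"
    by (simp add: fun_eq_iff schur_def C_def a_def)
  have d1: "(F has_vector_derivative (\<Sum>k\<in>S. Mdet_on S (A(k := C k)))) (at (1/a))"
  proof -
    have "((\<lambda>t. schur r A l m + t *\<^sub>R C l m) has_vector_derivative C l m) (at (1/a))" for l m
      by (auto intro!: derivative_eq_intros)
    from Mdet_on_has_vector_derivative[OF fin, of "\<lambda>t l m. schur r A l m + t *\<^sub>R C l m" C "1/a", OF this]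
    show ?thesis unfolding F_def[abs_def] e .
  qed
  \<comment> \<open>Affinity is known for \<open>t \<ge> 0\<close> only; since \<open>1/a\<close> is
    positive, it lies inside the open half-line and the two-sided derivative is available.\<close>
  have d2: "(F has_vector_derivative g) (at (1/a))"
  proof (rule has_vector_derivative_transform_within_open)
    show "((\<lambda>t. Mdet_on S (schur r A) + t *\<^sub>R g) has_vector_derivative g) (at (1/a))"
      by (auto intro!: derivative_eq_intros)
    show "open {0::real<..}" "1/a \<in> {0<..}" using a by auto
    show "Mdet_on S (schur r A) + t *\<^sub>R g = F t" if "t \<in> {0<..}" for t using F[of t] that by simp
  qed
  have "(\<Sum>k\<in>S. Mdet_on S (A(k := C k))) = g"
    using vector_derivative_unique_at[OF d1 d2] .
  moreover have "Mdet_on S A = Mdet_on S (schur r A) + (1/a) *\<^sub>R g"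
    using F[of "1/a"] a unfolding F_def e by simp
  ultimately show ?thesis
    unfolding Mdet_on_insert[OF r] arr C_def[abs_def] using a
    by (simp add: scaleR_add_right)
qed

text \<open>A rank-one change by \<open>v\<close> changes the pivot to
  \<open>a' = a + t \<rho>\<close> and the Schur complement by \<open>s\<close> times the rank-one
  matrix of \<open>w\<close>, with \<open>s = t a / a'\<close>. The determinant
  \<open>a' (D + s g)\<close> is affine in \<open>t\<close> because the denominator of
  \<open>s\<close> cancels against the new pivot.\<close>

lemma rank1_affine:
  fixes S :: "'n::{finite,linorder} set"
  shows "rank1_affine S"
  using finite[of S]
proof (induct S rule: finite_linorder_max_induct)
  case empty
  have "Mdet_on {} A = qone" for A :: "'n \<Rightarrow> 'n \<Rightarrow> quat" by (rule Mdet_on_empty)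
  then show ?case unfolding rank1_affine_def by (auto intro!: exI[of _ 0])
next
  case (insert r S)
  have rn: "r \<notin> S" using insert.hyps(2) by blast
  show ?case unfolding rank1_affine_def
  proof (intro allI impI)
    fix A :: "'n \<Rightarrow> 'n \<Rightarrow> quat" and v :: "'n \<Rightarrow> quat" assume pd: "qposdef (insert r S) A"
    define a where "a = A r r $ 1"
    define \<rho> where "\<rho> = (norm (v r))\<^sup>2"
    have a: "a > 0" using qposdef_diag_pos[OF _ pd] unfolding a_def by simp
    have \<rho>: "\<rho> \<ge> 0" by (simp add: \<rho>_def)
    define w where "w l = v l - (1/a) *\<^sub>R qmult (A l r) (v r)" for l
    obtain g where g: "\<And>t. t \<ge> 0 \<Longrightarrow> Mdet_on S (\<lambda>l m. schur r A l m + t *\<^sub>R qouter w l m) = Mdet_on S (schur r A) + t *\<^sub>R g"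
      using insert.hyps(3) qposdef_schur[OF insert.hyps(1) rn pd] unfolding rank1_affine_def by blast
    have main: "Mdet_on (insert r S) (\<lambda>l m. A l m + t *\<^sub>R qouter v l m)
        = Mdet_on (insert r S) A + t *\<^sub>R (\<rho> *\<^sub>R Mdet_on S (schur r A) + a *\<^sub>R g)" if t: "t \<ge> 0" for t
    proof -
      let ?At = "\<lambda>l m. A l m + t *\<^sub>R qouter v l m"
      define a' where "a' = a + t * \<rho>"
      have a': "a' > 0" unfolding a'_def using a \<rho> t by (simp add: add_pos_nonneg)
      define s where "s = t * a / a'"
      have s: "s \<ge> 0" unfolding s_def using a a' t by simp
      have rr: "?At r r $ 1 = a'" unfolding a'_def a_def \<rho>_def by (simp add: qmult_conj_self del: qmult_nth)
      have sch: "schur r ?At l m = schur r A l m + s *\<^sub>R qouter w l m" if lm: "l \<in> S" "m \<in> S" for l m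
      proof -
        have h: "qconj (A m r) = A r m" using pd lm unfolding qposdef_def qherm_def by (metis insertI1 insertI2)
        define P where "P = qmult (A l r) (A r m)"
        define Q where "Q = qmult (A l r) (qmult (v r) (qconj (v m)))"
        define R where "R = qmult (v l) (qmult (qconj (v r)) (A r m))"
        define T where "T = qmult (v l) (qconj (v m))"
        have vv: "qmult (v r) (qmult (qconj (v r)) X) = \<rho> *\<^sub>R X" "qmult (qconj (v r)) (qmult (v r) X) = \<rho> *\<^sub>R X" for X
          unfolding qmult_assoc[symmetric] qmult_conj_self \<rho>_def by simp_all
        have w: "qouter w l m = T - (1/a) *\<^sub>R R - (1/a) *\<^sub>R Q + (\<rho> / a\<^sup>2) *\<^sub>R P"
          unfolding w_def qconj_diff qconj_scaleR qconj_mult h P_def Q_def R_def T_def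
          by (simp add: qmult.diff_left qmult.diff_right qmult_assoc vv power2_eq_square scaleR_diff_right)
        have p: "qmult (?At l r) (?At r m) = P + t *\<^sub>R Q + t *\<^sub>R R + (t * t * \<rho>) *\<^sub>R T"
          unfolding P_def Q_def R_def T_def
          by (simp add: qmult_add_left qmult_add_right qmult_assoc vv scaleR_add_right)
        have c1: "t - (1/a') * (t * t * \<rho>) = s" "- (1/a') * t = - s * (1/a)" "- (1/a') = - (1/a) + s * (\<rho>/a\<^sup>2)"
        proof -
          show "t - (1/a') * (t * t * \<rho>) = s" "- (1/a') * t = - s * (1/a)"
            using a a' unfolding s_def a'_def by (simp_all add: field_simps)
          have "s * (\<rho>/a\<^sup>2) = (t * \<rho>) / (a * a')"
            unfolding s_def using a a' by (simp add: power2_eq_square)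
          also have "t * \<rho> = a' - a" unfolding a'_def by simp
          also have "(a' - a) / (a * a') = 1/a - 1/a'" using a a' by (simp add: diff_divide_distrib)
          finally show "- (1/a') = - (1/a) + s * (\<rho>/a\<^sup>2)" by simp
        qed
        have "schur r ?At l m = A l m + t *\<^sub>R T - (1/a') *\<^sub>R (P + t *\<^sub>R Q + t *\<^sub>R R + (t * t * \<rho>) *\<^sub>R T)"
          unfolding schur_def rr p T_def ..
        also have "\<dots> = A l m + (- (1/a')) *\<^sub>R P + (- (1/a') * t) *\<^sub>R Q + (- (1/a') * t) *\<^sub>R R + (t - (1/a') * (t * t * \<rho>)) *\<^sub>R T"
          by (simp add: algebra_simps)
        also have "\<dots> = A l m + (- (1/a) + s * (\<rho>/a\<^sup>2)) *\<^sub>R P + (- s * (1/a)) *\<^sub>R Q + (- s * (1/a)) *\<^sub>R R + s *\<^sub>R T"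
          unfolding c1(1,2) unfolding c1(3) ..
        also have "\<dots> = A l m - (1/a) *\<^sub>R P + s *\<^sub>R (T - (1/a) *\<^sub>R R - (1/a) *\<^sub>R Q + (\<rho> / a\<^sup>2) *\<^sub>R P)"
          by (simp add: algebra_simps)
        finally show ?thesis unfolding w schur_def P_def a_def .
      qed
      have "Mdet_on (insert r S) ?At = a' *\<^sub>R Mdet_on S (schur r ?At)"
        using Mdet_on_schur[OF insert.hyps(3) insert.hyps(2) qposdef_add_rank1[OF pd t, of v]] unfolding rr .
      also have "Mdet_on S (schur r ?At) = Mdet_on S (\<lambda>l m. schur r A l m + s *\<^sub>R qouter w l m)"
        by (rule Mdet_on_cong[OF insert.hyps(1) sch])
      also have "\<dots> = Mdet_on S (schur r A) + s *\<^sub>R g" by (rule g[OF s])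
      also have "a' *\<^sub>R \<dots> = a *\<^sub>R Mdet_on S (schur r A) + t *\<^sub>R (\<rho> *\<^sub>R Mdet_on S (schur r A) + a *\<^sub>R g)"
        using a' unfolding s_def by (simp add: scaleR_add_right scaleR_add_left a'_def)
      also have "a *\<^sub>R Mdet_on S (schur r A) = Mdet_on (insert r S) A"
        using Mdet_on_schur[OF insert.hyps(3) insert.hyps(2) pd] unfolding a_def ..
      finally show ?thesis .
    qed
    then show "\<exists>g. \<forall>t\<ge>0. Mdet_on (insert r S) (\<lambda>l m. A l m + t *\<^sub>R qouter v l m) = Mdet_on (insert r S) A + t *\<^sub>R g"
      by blast
  qed
qed

text \<open>The last column divided by its pivot gives the vector of \<open>r\<close>; the remainder
  is the Schur complement, to which the induction applies. On this unit triangular form both the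
  Moore determinant and the Pfaffian polarisation can be evaluated.\<close>

theorem qposdef_cholesky:
  assumes "qposdef S (A :: 'n::{finite,linorder} \<Rightarrow> 'n \<Rightarrow> quat)"
  shows "\<exists>d v. (\<forall>r\<in>S. 0 < d r \<and> v r r = qone \<and> (\<forall>l. l \<notin> S \<or> r < l \<longrightarrow> v r l = 0)) \<and>
     (\<forall>l\<in>S. \<forall>m\<in>S. A l m = (\<Sum>r\<in>S. d r *\<^sub>R qouter (v r) l m)) \<and>
     Mdet_on S A = (\<Prod>r\<in>S. d r) *\<^sub>R qone"
  using finite[of S] assms
proof (induct S arbitrary: A rule: finite_linorder_max_induct)
  case empty
  then show ?case by (simp add: Mdet_on_empty)
next
  case (insert r S)
  have rn: "r \<notin> S" using insert.hyps(2) by blast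
  define a where "a = A r r $ 1"
  have a: "a > 0" using qposdef_diag_pos[OF _ insert.prems] unfolding a_def by simp
  have arr: "A r r = a *\<^sub>R qone" unfolding a_def
    by (rule qherm_diag[of "insert r S"]) (use insert.prems in \<open>auto simp: qposdef_def\<close>)
  have h: "qconj (A m r) = A r m" if "m \<in> insert r S" for m
    using insert.prems that unfolding qposdef_def qherm_def by (metis insertI1)
  obtain d v where dv: "\<forall>r\<in>S. 0 < d r \<and> v r r = qone \<and> (\<forall>l. l \<notin> S \<or> r < l \<longrightarrow> v r l = 0)"
    and A: "\<forall>l\<in>S. \<forall>m\<in>S. schur r A l m = (\<Sum>r\<in>S. d r *\<^sub>R qouter (v r) l m)"
    and M: "Mdet_on S (schur r A) = (\<Prod>r\<in>S. d r) *\<^sub>R qone"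
    using insert.hyps(3)[OF qposdef_schur[OF insert.hyps(1) rn insert.prems]] by blast
  define d' where "d' = d(r := a)"
  define v' where "v' = v(r := \<lambda>l. if l \<in> insert r S then (1/a) *\<^sub>R A l r else 0)"
  have old: "d' k = d k" "v' k = v k" if "k \<in> S" for k
    using that rn unfolding d'_def v'_def by auto
  have vr: "v' r l = (1/a) *\<^sub>R A l r" if "l \<in> insert r S" for l
    using that unfolding v'_def by simp
  have 1: "0 < d' k \<and> v' k k = qone \<and> (\<forall>l. l \<notin> insert r S \<or> k < l \<longrightarrow> v' k l = 0)" if "k \<in> insert r S" for k
  proof (cases "k = r")
    case True
    have "l \<notin> insert r S" if "r < l" for l using that insert.hyps(2) by auto
    then show ?thesis unfolding True using a arr vr[of r] by (auto simp: d'_def v'_def)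
  next
    case False
    then show ?thesis using that dv old by auto
  qed
  have trm: "d' r *\<^sub>R qouter (v' r) l m = (1/a) *\<^sub>R qmult (A l r) (A r m)"
    if "l \<in> insert r S" "m \<in> insert r S" for l m
    unfolding vr[OF that(1)] vr[OF that(2)] qconj_scaleR h[OF that(2)] using a by (simp add: d'_def)
  have 2: "A l m = (\<Sum>k\<in>insert r S. d' k *\<^sub>R qouter (v' k) l m)" if lm: "l \<in> insert r S" "m \<in> insert r S" for l m
  proof -
    \<comment> \<open>The vectors of the Schur complement vanish outside \<open>S\<close>, so they
      contribute nothing to row and column \<open>r\<close>, which come from the new vector
      alone.\<close>
    have "(\<Sum>k\<in>S. d' k *\<^sub>R qouter (v' k) l m) = (if l \<in> S \<and> m \<in> S then schur r A l m else 0)"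
    proof (cases "l \<in> S \<and> m \<in> S")
      case True
      then show ?thesis using A old by (auto intro: sum.cong)
    next
      case False
      have "d' k *\<^sub>R qouter (v' k) l m = 0" if k: "k \<in> S" for k
        using False dv k old[OF k] by (auto simp: qmult.zero_left qmult.zero_right)
      then have "(\<Sum>k\<in>S. d' k *\<^sub>R qouter (v' k) l m) = 0" by (intro sum.neutral ballI)
      then show ?thesis using False by (simp only: if_False)
    qed
    then have "(\<Sum>k\<in>insert r S. d' k *\<^sub>R qouter (v' k) l m) = (1/a) *\<^sub>R qmult (A l r) (A r m) + (if l \<in> S \<and> m \<in> S then schur r A l m else 0)"
      using rn insert.hyps(1) trm[OF lm] by simp
    also have "\<dots> = A l m"
      using lm a arr by (auto simp: schur_def a_def[symmetric])
    finally show ?thesis ..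
  qed
  have 3: "Mdet_on (insert r S) A = (\<Prod>k\<in>insert r S. d' k) *\<^sub>R qone"
  proof -
    have "(\<Prod>k\<in>S. d' k) = (\<Prod>k\<in>S. d k)" by (rule prod.cong) (auto simp: old)
    then show ?thesis
      unfolding Mdet_on_schur[OF rank1_affine insert.hyps(2) insert.prems] M a_def[symmetric]
      using rn insert.hyps(1) by (simp add: d'_def)
  qed
  show ?case by (intro exI[of _ d'] exI[of _ v'] conjI ballI 1 2 3)
qed

subsection \<open>The mixed Moore determinant\<close>

text \<open>With \<open>a = x1 + i x2\<close> and \<open>b = x3 + i x4\<close>, \<open>qcA\<close>
  and \<open>qcB\<close> are the two columns of the usual complex 2 by 2 matrix of a quaternion,
  with rows \<open>(a, b)\<close> and \<open>(-conj b, conj a)\<close>. The boolean is the row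
  index.\<close>

definition qcA :: "quat \<Rightarrow> bool \<Rightarrow> complex" where
  "qcA x s = (if s then Complex (- x$3) (x$4) else Complex (x$1) (x$2))"

definition qcB :: "quat \<Rightarrow> bool \<Rightarrow> complex" where
  "qcB x s = (if s then Complex (x$1) (- x$2) else Complex (x$3) (x$4))"

text \<open>The 2 by 2 matrix of \<open>p\<close> multiplied on the right by the standard symplectic
  matrix; this makes the blocks of a hyperhermitian matrix fit together to a skew-symmetric
  one.\<close>

definition pfB :: "quat \<Rightarrow> bool \<Rightarrow> bool \<Rightarrow> complex" where
  "pfB p s t = (if t then qcA p s else - qcB p s)"

text \<open>A quaternionic rank-one matrix becomes the wedge product of the two complex columns of
  its vector.\<close>

lemma pfB_outer: "pfB (qmult x (qconj y)) s t = qcA x s * qcB y t - qcB x s * qcA y t"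
  by (cases s; cases t) (simp_all add: pfB_def qcA_def qcB_def complex_eq_iff)

lemma pfB_linear:
  "pfB (p + q) s t = pfB p s t + pfB q s t"
  "pfB (c *\<^sub>R p) s t = of_real c * pfB p s t"
  "pfB 0 s t = 0"
  by (simp_all add: pfB_def qcA_def qcB_def complex_eq_iff)

lemma pfB_sum: "pfB (sum f K) s t = (\<Sum>k\<in>K. pfB (f k) s t)"
  by (induct K rule: infinite_finite_induct) (simp_all add: pfB_linear)

type_synonym 'n sidx = "'n \<times> bool"

definition pfE :: "('n \<Rightarrow> 'n \<Rightarrow> quat) \<Rightarrow> 'n sidx \<Rightarrow> 'n sidx \<Rightarrow> complex" where
  "pfE A x y = pfB (A (fst x) (fst y)) (snd x) (snd y)"

text \<open>The polarised Moore determinant, written as the polarisation of the Pfaffian of the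
  skew-symmetric \<open>2n \<times> 2n\<close> complex matrix attached to a hyperhermitian matrix.\<close>

definition mixD :: "('n::finite \<Rightarrow> 'n \<Rightarrow> 'n \<Rightarrow> quat) \<Rightarrow> complex" where
  "mixD H = (\<Sum>\<pi> | \<pi> permutes (UNIV :: 'n sidx set).
     of_int (sign \<pi>) * (\<Prod>i\<in>UNIV. pfE (H i) (\<pi> (i, False)) (\<pi> (i, True))))"

text \<open>The ordinary determinant of the \<open>2n\<close> by \<open>2n\<close> complex matrix
  whose columns are the two complex columns of each \<open>v i\<close>, that is, the Study
  determinant of the quaternionic matrix with columns \<open>v i\<close>.\<close>

definition rdet :: "('n::finite \<Rightarrow> 'n \<Rightarrow> quat) \<Rightarrow> complex" where
  "rdet v = (\<Sum>\<pi> | \<pi> permutes (UNIV :: 'n sidx set). of_int (sign \<pi>) *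
     (\<Prod>i\<in>UNIV. (case \<pi> (i, False) of (l, s) \<Rightarrow> qcA (v i l) s) * (case \<pi> (i, True) of (l, s) \<Rightarrow> qcB (v i l) s)))"

lemma sum_sign_transpose:
  fixes f :: "('a::finite \<Rightarrow> 'a) \<Rightarrow> complex"
  assumes "a \<noteq> b"
  shows "(\<Sum>\<pi> | \<pi> permutes UNIV. of_int (sign \<pi>) * f (\<pi> \<circ> Transposition.transpose a b))
       = - (\<Sum>\<pi> | \<pi> permutes UNIV. of_int (sign \<pi>) * f \<pi>)"
proof -
  let ?t = "Transposition.transpose a b"
  have t: "?t permutes UNIV" by (simp add: permutes_swap_id)
  have "(\<Sum>\<pi> | \<pi> permutes UNIV. of_int (sign \<pi>) * f \<pi>)
    = (\<Sum>\<pi> | \<pi> permutes UNIV. of_int (sign (\<pi> \<circ> ?t)) * f (\<pi> \<circ> ?t))"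
    by (rule sum_permutations_compose_right[OF t])
  also have "\<dots> = (\<Sum>\<pi> | \<pi> permutes UNIV. - (of_int (sign \<pi>) * f (\<pi> \<circ> ?t)))"
  proof (rule sum.cong[OF refl])
    fix \<pi> :: "'a \<Rightarrow> 'a" assume "\<pi> \<in> {\<pi>. \<pi> permutes UNIV}"
    then have "permutation \<pi>" unfolding permutation_permutes by (intro exI[of _ UNIV]) auto
    then have "sign (\<pi> \<circ> ?t) = - sign \<pi>"
      using sign_compose[OF _ permutation_swap_id, of \<pi> a b] assms by (simp add: sign_swap_id)
    then show "of_int (sign (\<pi> \<circ> ?t)) * f (\<pi> \<circ> ?t) = - (of_int (sign \<pi>) * f (\<pi> \<circ> ?t))" by simp
  qed
  finally show ?thesis by (simp add: sum_negf)
qed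

lemma sum_sign_symmetric_zero:
  fixes f :: "('a::finite \<Rightarrow> 'a) \<Rightarrow> complex"
  assumes "a \<noteq> b" "\<And>\<pi>. f (\<pi> \<circ> Transposition.transpose a b) = f \<pi>"
  shows "(\<Sum>\<pi> | \<pi> permutes UNIV. of_int (sign \<pi>) * f \<pi>) = 0"
  using sum_sign_transpose[OF assms(1), of f] unfolding assms(2) by simp

text \<open>Swapping the two arguments of slot \<open>i\<close> reverses the sign of the permutation
  and exchanges the two halves of the entry, so both halves contribute equally; this gives a factor
  2 per slot. It serves for rank-one matrices and again for Hessians, where \<open>W\<close> is a
  product of two complex fields.\<close>

lemma mixD_skew:
  fixes H :: "'n::finite \<Rightarrow> 'n \<Rightarrow> 'n \<Rightarrow> quat"
  assumes "\<And>i x y. pfE (H i) x y = W i x y - W i y x"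
  shows "mixD H = 2 ^ CARD('n) * (\<Sum>\<pi> | \<pi> permutes UNIV.
    of_int (sign \<pi>) * (\<Prod>i\<in>UNIV. W i (\<pi> (i, False)) (\<pi> (i, True))))"
proof -
  define X where "X i \<pi> = W i (\<pi> (i, False)) (\<pi> (i, True))" for i and \<pi> :: "'n sidx \<Rightarrow> 'n sidx"
  define \<tau> where "\<tau> i = Transposition.transpose (i, False) (i, True)" for i :: 'n
  have ent: "pfE (H i) (\<pi> (i, False)) (\<pi> (i, True)) = X i \<pi> - X i (\<pi> \<circ> \<tau> i)" for i \<pi>
    unfolding assms X_def \<tau>_def by simp
  \<comment> \<open>In \<open>Y T\<close> the slots in \<open>T\<close> have already been
    symmetrised; the induction adds one slot at a time.\<close>
  define Y where "Y T i \<pi> = (if i \<in> T then 2 * X i \<pi> else X i \<pi> - X i (\<pi> \<circ> \<tau> i))" for T i \<pi>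
  have inv: "X i (\<pi> \<circ> \<tau> j) = X i \<pi>" "X i (\<pi> \<circ> \<tau> j \<circ> \<tau> i) = X i (\<pi> \<circ> \<tau> i)" if "i \<noteq> j" for i j \<pi>
    using that by (simp_all add: X_def \<tau>_def Transposition.transpose_def)
  have "(\<Sum>\<pi> | \<pi> permutes UNIV. of_int (sign \<pi>) * (\<Prod>i\<in>UNIV. Y T i \<pi>)) = mixD H" if "finite T" for T
    using that
  proof (induct T)
    case empty
    then show ?case unfolding mixD_def Y_def ent by simp
  next
    case (insert j T)
    define R where "R \<pi> = (\<Prod>i\<in>UNIV - {j}. Y T i \<pi>)" for \<pi>
    have R: "R (\<pi> \<circ> \<tau> j) = R \<pi>" for \<pi>
      unfolding R_def by (rule prod.cong) (auto simp: Y_def inv)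
    have R': "(\<Prod>i\<in>UNIV - {j}. Y (insert j T) i \<pi>) = R \<pi>" for \<pi>
      unfolding R_def by (rule prod.cong) (auto simp: Y_def)
    have s1: "(\<Prod>i\<in>UNIV. Y T i \<pi>) = X j \<pi> * R \<pi> - X j (\<pi> \<circ> \<tau> j) * R (\<pi> \<circ> \<tau> j)" for \<pi>
      unfolding R using insert.hyps by (subst prod.remove[of UNIV j]) (auto simp: R_def Y_def algebra_simps)
    have s2: "(\<Prod>i\<in>UNIV. Y (insert j T) i \<pi>) = 2 * (X j \<pi> * R \<pi>)" for \<pi>
    proof -
      have "(\<Prod>i\<in>UNIV. Y (insert j T) i \<pi>) = Y (insert j T) j \<pi> * (\<Prod>i\<in>UNIV - {j}. Y (insert j T) i \<pi>)"
        by (rule prod.remove) simp_all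
      moreover have "Y (insert j T) j \<pi> = 2 * X j \<pi>" by (simp add: Y_def)
      ultimately show ?thesis unfolding R' by simp
    qed
    have "(\<Sum>\<pi> | \<pi> permutes UNIV. of_int (sign \<pi>) * (X j (\<pi> \<circ> \<tau> j) * R (\<pi> \<circ> \<tau> j)))
      = - (\<Sum>\<pi> | \<pi> permutes UNIV. of_int (sign \<pi>) * (X j \<pi> * R \<pi>))"
      unfolding \<tau>_def by (rule sum_sign_transpose[where f="\<lambda>\<pi>. X j \<pi> * R \<pi>"]) simp
    then have "(\<Sum>\<pi> | \<pi> permutes UNIV. of_int (sign \<pi>) * (\<Prod>i\<in>UNIV. Y T i \<pi>))
      = (\<Sum>\<pi> | \<pi> permutes UNIV. of_int (sign \<pi>) * (\<Prod>i\<in>UNIV. Y (insert j T) i \<pi>))"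
      unfolding s1 s2 right_diff_distrib sum_subtractf
      by (simp add: sum_distrib_left algebra_simps)
    then show ?case using insert.hyps by simp
  qed
  from this[OF finite[of UNIV]] have "mixD H = (\<Sum>\<pi> | \<pi> permutes UNIV. of_int (sign \<pi>) * (\<Prod>i\<in>UNIV. 2 * X i \<pi>))"
    by (simp add: Y_def)
  also have "\<dots> = 2 ^ CARD('n) * (\<Sum>\<pi> | \<pi> permutes UNIV. of_int (sign \<pi>) * (\<Prod>i\<in>UNIV. X i \<pi>))"
    unfolding prod.distrib by (simp add: sum_distrib_left algebra_simps)
  finally show ?thesis unfolding X_def .
qed

lemma mixD_outer: "mixD (\<lambda>i. qouter (v i)) = 2 ^ CARD('n) * rdet (v :: 'n::finite \<Rightarrow> 'n \<Rightarrow> quat)"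
  unfolding rdet_def split_beta
  by (rule mixD_skew[where W="\<lambda>i x y. qcA (v i (fst x)) (snd x) * qcB (v i (fst y)) (snd y)"])
    (simp add: pfE_def pfB_outer)

text \<open>Exchanging two quaternionic columns exchanges two pairs of complex columns, so the two
  signs cancel.\<close>

lemma rdet_transpose: "rdet (v \<circ> Transposition.transpose a b) = rdet (v :: 'n::finite \<Rightarrow> 'n \<Rightarrow> quat)"
proof (cases "a = b")
  case False
  let ?t = "Transposition.transpose a b"
  let ?F = "Transposition.transpose (a, False) (b, False)"
  let ?T = "Transposition.transpose (a, True) (b, True)"
  define Y where "Y i x y = (case x of (l, s) \<Rightarrow> qcA (v i l) s) * (case y of (l, s) \<Rightarrow> qcB (v i l) s)"
    for i and x y :: "'n sidx"
  define f where "f \<pi> = (\<Prod>i\<in>UNIV. Y i (\<pi> (i, False)) (\<pi> (i, True)))" for \<pi>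
  have e: "(\<Prod>i\<in>UNIV. Y (?t i) (\<pi> (i, False)) (\<pi> (i, True))) = f (\<pi> \<circ> ?F \<circ> ?T)" for \<pi>
  proof -
    have "f (\<pi> \<circ> ?F \<circ> ?T) = (\<Prod>i\<in>UNIV. Y i (\<pi> (?t i, False)) (\<pi> (?t i, True)))"
      unfolding f_def by (rule prod.cong) (auto simp: Transposition.transpose_def)
    also have "\<dots> = (\<Prod>i\<in>UNIV. Y (?t i) (\<pi> (i, False)) (\<pi> (i, True)))"
      by (rule prod.reindex_bij_witness[of _ ?t ?t]) auto
    finally show ?thesis ..
  qed
  have "rdet (v \<circ> ?t) = (\<Sum>\<pi> | \<pi> permutes UNIV. of_int (sign \<pi>) * f (\<pi> \<circ> ?F \<circ> ?T))"
    unfolding rdet_def e[symmetric] by (simp add: Y_def)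
  also have "\<dots> = - (\<Sum>\<pi> | \<pi> permutes UNIV. of_int (sign \<pi>) * f (\<pi> \<circ> ?T))"
    using sum_sign_transpose[of "(a, False)" "(b, False)" "\<lambda>\<pi>. f (\<pi> \<circ> ?T)"] False by simp
  also have "\<dots> = (\<Sum>\<pi> | \<pi> permutes UNIV. of_int (sign \<pi>) * f \<pi>)"
    using sum_sign_transpose[of "(a, True)" "(b, True)" f] False by simp
  also have "\<dots> = rdet v" unfolding rdet_def f_def by (simp add: Y_def)
  finally show ?thesis .
qed simp

lemma rdet_permute:
  assumes "\<rho> permutes (UNIV :: 'n::finite set)"
  shows "rdet (v \<circ> \<rho>) = rdet (v :: 'n \<Rightarrow> 'n \<Rightarrow> quat)"
  using assms finite[of UNIV]
proof (induct arbitrary: v rule: permutes_induct)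
  case id
  then show ?case by simp
next
  case (swap a b p)
  have "rdet (v \<circ> (Transposition.transpose a b \<circ> p)) = rdet ((v \<circ> Transposition.transpose a b) \<circ> p)"
    by (simp add: comp_assoc)
  also have "\<dots> = rdet v" using swap rdet_transpose by metis
  finally show ?case .
qed

lemma rdet_repeated:
  assumes "i \<noteq> j" "v i = v j"
  shows "rdet v = 0"
proof -
  define Y where "Y i x y = (case x of (l, s) \<Rightarrow> qcA (v i l) s) * (case y of (l, s) \<Rightarrow> qcB (v i l) s)" for i x y
  define f where "f \<pi> = (\<Prod>i\<in>UNIV. Y i (\<pi> (i, False)) (\<pi> (i, True)))" for \<pi>
  let ?t = "Transposition.transpose i j"
  let ?F = "Transposition.transpose (i, False) (j, False)"
  have vt: "v (?t k) = v k" for k using assms by (auto simp: Transposition.transpose_def)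
  have "f (\<pi> \<circ> ?F) = f \<pi>" for \<pi>
  proof -
    have "f (\<pi> \<circ> ?F) = (\<Prod>k\<in>UNIV. (case \<pi> (?t k, False) of (l, s) \<Rightarrow> qcA (v k l) s)) * (\<Prod>k\<in>UNIV. (case \<pi> (k, True) of (l, s) \<Rightarrow> qcB (v k l) s))"
      unfolding f_def Y_def prod.distrib
      by (intro arg_cong2[where f=times] prod.cong) (auto simp: Transposition.transpose_def)
    also have "(\<Prod>k\<in>UNIV. (case \<pi> (?t k, False) of (l, s) \<Rightarrow> qcA (v k l) s)) = (\<Prod>k\<in>UNIV. (case \<pi> (k, False) of (l, s) \<Rightarrow> qcA (v k l) s))"
      by (rule prod.reindex_bij_witness[of _ ?t ?t]) (auto simp: vt)
    finally show ?thesis unfolding f_def Y_def prod.distrib .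
  qed
  then have "(\<Sum>\<pi> | \<pi> permutes UNIV. of_int (sign \<pi>) * f \<pi>) = 0"
    using assms(1) by (intro sum_sign_symmetric_zero) auto
  then show ?thesis unfolding rdet_def f_def Y_def .
qed

text \<open>Strong induction on the index: a point that is moved goes to a smaller index, where
  everything is already fixed, and this contradicts injectivity.\<close>

lemma permutes_triangular_id:
  fixes \<pi> :: "'n::{finite,linorder} sidx \<Rightarrow> 'n sidx"
  assumes "\<pi> permutes UNIV" "\<And>x. \<pi> x = x \<or> fst (\<pi> x) < fst x"
  shows "\<pi> = id"
proof -
  have "\<forall>x. fst x = l \<longrightarrow> \<pi> x = x" for l
  proof (induct "card {k. k < l}" arbitrary: l rule: less_induct)
    case less
    show ?case
    proof (intro allI impI)
      fix x :: "'n sidx" assume l: "fst x = l"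
      show "\<pi> x = x"
      proof (rule ccontr)
        assume n: "\<pi> x \<noteq> x"
        then have lt: "fst (\<pi> x) < l" using assms(2)[of x] l by auto
        then have "card {k. k < fst (\<pi> x)} < card {k. k < l}"
          by (intro psubset_card_mono) auto
        from less[OF this] have "\<pi> (\<pi> x) = \<pi> x" by blast
        then show False using n permutes_inj[OF assms(1)] by (auto dest: injD)
      qed
    qed
  qed
  then show ?thesis by auto
qed

lemma rdet_triangular:
  fixes v :: "'n::{finite,linorder} \<Rightarrow> 'n \<Rightarrow> quat"
  assumes "\<And>r. v r r = qone" "\<And>r l. r < l \<Longrightarrow> v r l = 0"
  shows "rdet v = 1"
proof -
  let ?g = "\<lambda>\<pi>::'n sidx \<Rightarrow> 'n sidx. of_int (sign \<pi>) *
     (\<Prod>i\<in>UNIV. (case \<pi> (i, False) of (l, s) \<Rightarrow> qcA (v i l) s) * (case \<pi> (i, True) of (l, s) \<Rightarrow> qcB (v i l) s))"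
  have q0: "qcA 0 s = 0" "qcB 0 s = 0" "qcA qone s = (if s then 0 else 1)" "qcB qone s = (if s then 1 else 0)" for s
    by (simp_all add: qcA_def qcB_def complex_eq_iff)
  have z: "?g \<pi> = 0" if p: "\<pi> permutes UNIV" and n: "\<pi> \<noteq> id" for \<pi>
  proof -
    obtain x where x: "\<not> (\<pi> x = x \<or> fst (\<pi> x) < fst x)"
      using permutes_triangular_id[OF p] n by blast
    obtain i b where ib: "x = (i, b)" by force
    obtain l s where ls: "\<pi> (i, b) = (l, s)" by force
    have "i < l \<or> (l = i \<and> s \<noteq> b)" using x unfolding ib ls by auto
    then have "(case \<pi> (i, False) of (l, s) \<Rightarrow> qcA (v i l) s) * (case \<pi> (i, True) of (l, s) \<Rightarrow> qcB (v i l) s) = 0"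
      using ls by (cases b) (auto simp: assms q0)
    then show ?thesis by (auto intro!: prod_zero)
  qed
  have "rdet v = (\<Sum>\<pi>\<in>{id}. ?g \<pi>)"
    unfolding rdet_def by (rule sum.mono_neutral_right) (use z permutes_id in \<open>auto simp: finite_permutations\<close>)
  also have "\<dots> = 1" by (simp add: assms q0)
  finally show ?thesis .
qed

lemma mixD_cong: "(\<And>i l m. H i l m = H' i l m) \<Longrightarrow> mixD H = mixD H'"
  by (rule arg_cong[where f=mixD]) (simp add: fun_eq_iff)

lemma mixD_expand:
  fixes v :: "'n::finite \<Rightarrow> 'k::finite \<Rightarrow> 'n \<Rightarrow> quat"
  shows "mixD (\<lambda>i l m. \<Sum>k\<in>UNIV. c i k *\<^sub>R qouter (v i k) l m)
    = 2 ^ CARD('n) * (\<Sum>g\<in>UNIV. of_real (\<Prod>i\<in>UNIV. c i (g i)) * rdet (\<lambda>i. v i (g i)))"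
proof -
  have "mixD (\<lambda>i l m. \<Sum>k\<in>UNIV. c i k *\<^sub>R qouter (v i k) l m)
    = (\<Sum>\<pi> | \<pi> permutes (UNIV :: 'n sidx set). of_int (sign \<pi>) *
       (\<Prod>i\<in>UNIV. \<Sum>k\<in>UNIV. of_real (c i k) * pfE (qouter (v i k)) (\<pi> (i, False)) (\<pi> (i, True))))"
    unfolding mixD_def pfE_def pfB_sum pfB_linear ..
  also have "\<dots> = (\<Sum>\<pi> | \<pi> permutes (UNIV :: 'n sidx set). \<Sum>g\<in>UNIV. of_int (sign \<pi>) *
       (\<Prod>i\<in>UNIV. of_real (c i (g i)) * pfE (qouter (v i (g i))) (\<pi> (i, False)) (\<pi> (i, True))))"
    by (subst prod_sum_PiE) (simp_all add: sum_distrib_left PiE_UNIV_domain)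
  also have "\<dots> = (\<Sum>g\<in>UNIV. \<Sum>\<pi> | \<pi> permutes (UNIV :: 'n sidx set). of_int (sign \<pi>) *
       (\<Prod>i\<in>UNIV. of_real (c i (g i)) * pfE (qouter (v i (g i))) (\<pi> (i, False)) (\<pi> (i, True))))"
    by (rule sum.swap)
  also have "\<dots> = (\<Sum>g\<in>UNIV. of_real (\<Prod>i\<in>UNIV. c i (g i)) * mixD (\<lambda>i. qouter (v i (g i))))"
    unfolding mixD_def by (simp add: prod.distrib sum_distrib_left algebra_simps)
  also have "\<dots> = 2 ^ CARD('n) * (\<Sum>g\<in>UNIV. of_real (\<Prod>i\<in>UNIV. c i (g i)) * rdet (\<lambda>i. v i (g i)))"
    unfolding mixD_outer by (simp add: sum_distrib_left algebra_simps)
  finally show ?thesis .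
qed

text \<open>In the multilinear expansion a choice that repeats a vector vanishes. The remaining
  choices are the \<open>n!\<close> permutations, and each of them gives the same term since
  \<open>rdet\<close> is symmetric in its columns.\<close>

lemma mixD_expand_same:
  fixes v :: "'n::finite \<Rightarrow> 'n \<Rightarrow> quat"
  shows "mixD (\<lambda>i::'n. \<lambda>l m. \<Sum>k\<in>UNIV. d k *\<^sub>R qouter (v k) l m)
    = 2 ^ CARD('n) * fact CARD('n) * of_real (\<Prod>k\<in>UNIV. d k) * rdet v"
proof -
  have z: "of_real (\<Prod>i\<in>UNIV. d (g i)) * rdet (\<lambda>i. v (g i)) = 0" if "\<not> g permutes UNIV" for g :: "'n \<Rightarrow> 'n"
  proof -
    have "\<not> inj g"
    proof
      assume g: "inj g"
      then have "bij g" using finite_UNIV_inj_surj[OF finite g] by (simp add: bij_def)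
      then show False using that bij_imp_permutes[of g UNIV] by auto
    qed
    then obtain i j where "i \<noteq> j" "g i = g j" by (auto simp: inj_def)
    then show ?thesis using rdet_repeated[of i j "\<lambda>i. v (g i)"] by simp
  qed
  have p: "of_real (\<Prod>i\<in>UNIV. d (g i)) * rdet (\<lambda>i. v (g i)) = of_real (\<Prod>k\<in>UNIV. d k) * rdet v"
    if "g permutes UNIV" for g :: "'n \<Rightarrow> 'n"
  proof -
    have "(\<Prod>i\<in>UNIV. d (g i)) = (\<Prod>k\<in>UNIV. d k)" using prod.permute[OF that, of d] by (simp add: comp_def)
    moreover have "rdet (\<lambda>i. v (g i)) = rdet v" using rdet_permute[OF that, of v] by (simp add: comp_def)
    ultimately show ?thesis by simp
  qed
  have "(\<Sum>g\<in>UNIV. of_real (\<Prod>i\<in>UNIV. d (g i)) * rdet (\<lambda>i. v (g i)))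
      = (\<Sum>g | g permutes (UNIV::'n set). of_real (\<Prod>i\<in>UNIV. d (g i)) * rdet (\<lambda>i. v (g i)))"
    by (rule sum.mono_neutral_right) (use z in auto)
  also have "\<dots> = (\<Sum>g | g permutes (UNIV::'n set). of_real (\<Prod>k\<in>UNIV. d k) * rdet v)"
    by (rule sum.cong) (use p in auto)
  also have "\<dots> = fact CARD('n) * (of_real (\<Prod>k\<in>UNIV. d k) * rdet v)"
    by (simp add: card_permutations)
  finally show ?thesis using mixD_expand[of "\<lambda>_. d" "\<lambda>_. v"] by simp
qed

definition qpossemidef :: "('n::finite \<Rightarrow> 'n \<Rightarrow> quat) \<Rightarrow> bool" where
  "qpossemidef A \<longleftrightarrow> qherm UNIV A \<and> (\<forall>v. 0 \<le> qform UNIV A v $ 1)"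

definition qidm :: "'n \<Rightarrow> 'n \<Rightarrow> quat" where
  "qidm l m = (if l = m then qone else 0)"

lemma qform_qidm: "qform UNIV qidm v $ 1 = (\<Sum>l\<in>UNIV. (norm (v l))\<^sup>2)" for v :: "'n::finite \<Rightarrow> quat"
proof -
  have "(\<Sum>m\<in>UNIV. qmult (qconj (v l)) (qmult (qidm l m) (v m))) = (norm (v l))\<^sup>2 *\<^sub>R qone" for l
  proof -
    have "(\<Sum>m\<in>UNIV. qmult (qconj (v l)) (qmult (qidm l m) (v m))) = (\<Sum>m\<in>UNIV. if l = m then qmult (qconj (v l)) (v l) else 0)"
      by (rule sum.cong) (auto simp: qidm_def qmult.zero_left qmult.zero_right)
    then show ?thesis by (simp add: qmult_conj_self)
  qed
  then show ?thesis unfolding qform_def by (simp add: scaleR_sum_left[symmetric])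
qed

lemma qherm_qidm: "qherm UNIV qidm"
  by (auto simp: qherm_def qidm_def quat_eq_iff)

lemma qherm_add: "qherm S A \<Longrightarrow> qherm S B \<Longrightarrow> qherm S (\<lambda>l m. A l m + B l m)"
  and qherm_scaleR: "qherm S A \<Longrightarrow> qherm S (\<lambda>l m. c *\<^sub>R A l m)"
proof -
  show "qherm S (\<lambda>l m. A l m + B l m)" if "qherm S A" "qherm S B"
    unfolding qherm_def qconj_add using that[unfolded qherm_def] by metis
  show "qherm S (\<lambda>l m. c *\<^sub>R A l m)" if "qherm S A"
    unfolding qherm_def qconj_scaleR using that[unfolded qherm_def] by metis
qed

lemma qpossemidef_perturb:
  assumes "qpossemidef (A :: 'n::finite \<Rightarrow> 'n \<Rightarrow> quat)" "0 < t"
  shows "qposdef UNIV (\<lambda>l m. A l m + t *\<^sub>R qidm l m)"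
proof -
  have "0 < qform UNIV (\<lambda>l m. A l m + t *\<^sub>R qidm l m) v $ 1" if v: "\<exists>l\<in>UNIV. v l \<noteq> 0" for v
  proof -
    obtain l where "v l \<noteq> 0" using v by blast
    then have "0 < (\<Sum>l\<in>UNIV. (norm (v l))\<^sup>2)"
      by (intro sum_pos2[where i=l]) auto
    then show ?thesis using assms unfolding qform_add qform_scaleR qpossemidef_def by (simp add: qform_qidm add_nonneg_pos)
  qed
  then show ?thesis
    using assms(1) qherm_qidm unfolding qposdef_def qpossemidef_def by (auto intro: qherm_add qherm_scaleR)
qed

text \<open>On the Cholesky form both sides are the product of the pivots, up to
  \<open>2^n n!\<close>, because the unit triangular factor has \<open>rdet\<close> equal to
  1.\<close>

lemma qposdef_mixD:
  assumes "qposdef UNIV (A :: 'n::{finite,linorder} \<Rightarrow> 'n \<Rightarrow> quat)"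
  shows "mixD (\<lambda>i::'n. A) = of_real (2 ^ CARD('n) * fact CARD('n) * Mdet A $ 1)" "0 < Mdet A $ 1"
proof -
  obtain d v where dv: "\<And>r. 0 < d r" "\<And>r. v r r = qone" "\<And>r l. r < l \<Longrightarrow> v r l = 0"
    and A: "\<And>l m. A l m = (\<Sum>r\<in>UNIV. d r *\<^sub>R qouter (v r) l m)"
    and M: "Mdet_on UNIV A = (\<Prod>r\<in>UNIV. d r) *\<^sub>R qone"
    using qposdef_cholesky[OF assms] by auto
  have M1: "Mdet A $ 1 = (\<Prod>r\<in>UNIV. d r)" using M unfolding Mdet_on_UNIV by simp
  show "0 < Mdet A $ 1" unfolding M1 using dv(1) by (intro prod_pos) auto
  have "mixD (\<lambda>i::'n. A) = mixD (\<lambda>i::'n. \<lambda>l m. \<Sum>r\<in>UNIV. d r *\<^sub>R qouter (v r) l m)"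
    by (rule mixD_cong) (rule A)
  also have "\<dots> = 2 ^ CARD('n) * fact CARD('n) * of_real (\<Prod>k\<in>UNIV. d k)"
    unfolding mixD_expand_same using rdet_triangular[of v] dv by simp
  finally show "mixD (\<lambda>i::'n. A) = of_real (2 ^ CARD('n) * fact CARD('n) * Mdet A $ 1)"
    unfolding M1 by simp
qed

lemma mixD_perturb_tendsto:
  "((\<lambda>t. mixD (\<lambda>i l m. H i l m + t *\<^sub>R B i l m)) \<longlongrightarrow> mixD H) (at_right (0::real))"
proof -
  have "((\<lambda>t. mixD (\<lambda>i l m. H i l m + t *\<^sub>R B i l m)) \<longlongrightarrow> mixD (\<lambda>i l m. H i l m + 0 *\<^sub>R B i l m)) (at_right 0)"
    unfolding mixD_def pfE_def pfB_linear by (intro tendsto_intros)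
  then show ?thesis by simp
qed

lemma Mdet_perturb_tendsto:
  fixes A :: "'n::{finite,linorder} \<Rightarrow> 'n \<Rightarrow> quat"
  shows "((\<lambda>t. Mdet (\<lambda>l m. A l m + t *\<^sub>R B l m) $ 1) \<longlongrightarrow> Mdet A $ 1) (at_right (0::real))"
proof -
  have "((\<lambda>t. A l m + t *\<^sub>R B l m) has_vector_derivative B l m) (at 0)" for l m
    by (auto intro!: derivative_eq_intros)
  from Mdet_on_has_vector_derivative[of UNIV "\<lambda>t l m. A l m + t *\<^sub>R B l m" B 0, OF finite this]
  have "isCont (\<lambda>t. Mdet (\<lambda>l m. A l m + t *\<^sub>R B l m)) 0"
    unfolding Mdet_on_UNIV by (rule has_vector_derivative_continuous)
  then have "((\<lambda>t. Mdet (\<lambda>l m. A l m + t *\<^sub>R B l m)) \<longlongrightarrow> Mdet A) (at 0)"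
    by (simp add: isCont_def)
  then have "((\<lambda>t. Mdet (\<lambda>l m. A l m + t *\<^sub>R B l m)) \<longlongrightarrow> Mdet A) (at_right 0)"
    by (rule tendsto_within_subset) simp
  then show ?thesis by (rule tendsto_vec_nth)
qed

theorem qpossemidef_mixD:
  assumes "qpossemidef (A :: 'n::{finite,linorder} \<Rightarrow> 'n \<Rightarrow> quat)"
  shows "mixD (\<lambda>i::'n. A) = of_real (2 ^ CARD('n) * fact CARD('n) * Mdet A $ 1)" "0 \<le> Mdet A $ 1"
proof -
  let ?A = "\<lambda>t l m. A l m + t *\<^sub>R qidm l m"
  have ev: "eventually (\<lambda>t::real. 0 < t) (at_right 0)" by (rule eventually_at_right_less)
  have "((\<lambda>t. complex_of_real (2 ^ CARD('n) * fact CARD('n) * Mdet (?A t) $ 1))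
     \<longlongrightarrow> of_real (2 ^ CARD('n) * fact CARD('n) * Mdet A $ 1)) (at_right 0)"
    by (intro tendsto_intros Mdet_perturb_tendsto)
  moreover have "eventually (\<lambda>t. complex_of_real (2 ^ CARD('n) * fact CARD('n) * Mdet (?A t) $ 1) = mixD (\<lambda>i::'n. ?A t)) (at_right 0)"
    using ev by (rule eventually_mono) (simp only: qposdef_mixD(1)[OF qpossemidef_perturb[OF assms]])
  ultimately have "((\<lambda>t. mixD (\<lambda>i::'n. ?A t)) \<longlongrightarrow> of_real (2 ^ CARD('n) * fact CARD('n) * Mdet A $ 1)) (at_right 0)"
    by (rule Lim_transform_eventually)
  from tendsto_unique[OF _ mixD_perturb_tendsto this]
  show "mixD (\<lambda>i::'n. A) = of_real (2 ^ CARD('n) * fact CARD('n) * Mdet A $ 1)" by simp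
  show "0 \<le> Mdet A $ 1"
  proof (rule tendsto_lowerbound[OF Mdet_perturb_tendsto])
    show "eventually (\<lambda>t. 0 \<le> Mdet (?A t) $ 1) (at_right 0)"
      using ev by (rule eventually_mono) (simp only: less_imp_le qposdef_mixD(2)[OF qpossemidef_perturb[OF assms]])
  qed simp
qed

lemma qpossemidef_sum_outer:
  "qpossemidef (\<lambda>l m. \<Sum>k\<in>UNIV. qouter (v k) l m)" for v :: "'n::finite \<Rightarrow> 'n \<Rightarrow> quat"
proof -
  have "qform UNIV (\<lambda>l m. \<Sum>k\<in>K. qouter (v k) l m) x $ 1 \<ge> 0" if "finite K" for K x
    using that
  proof (induct K)
    case empty
    then show ?case by (simp add: qform_def qmult.zero_left qmult.zero_right)
  next
    case (insert k K)
    then show ?case using qform_rank1[of UNIV "v k" x] by (simp add: qform_add)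
  qed
  then show ?thesis unfolding qpossemidef_def qherm_def by (simp add: qconj_sum qconj_mult)
qed

text \<open>Read backwards, the semidefinite formula for the sum of the rank-one matrices of the
  \<open>v k\<close> says that \<open>rdet v\<close> is the Moore determinant of that sum, which is
  nonnegative.\<close>

lemma rdet_nonneg: "rdet (v :: 'n::{finite,linorder} \<Rightarrow> 'n \<Rightarrow> quat) \<in> \<real>\<^sub>\<ge>\<^sub>0"
proof -
  let ?A = "\<lambda>l m. \<Sum>k\<in>UNIV. qouter (v k) l m"
  let ?c = "2 ^ CARD('n) * fact CARD('n) :: real"
  have c: "?c > 0" by simp
  have "of_real ?c * rdet v = of_real (?c * Mdet ?A $ 1)"
    using qpossemidef_mixD(1)[OF qpossemidef_sum_outer[of v]] mixD_expand_same[of "\<lambda>_. 1" v] by simp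
  then have "rdet v = of_real (Mdet ?A $ 1)" by (simp add: mult.assoc)
  then show ?thesis using qpossemidef_mixD(2)[OF qpossemidef_sum_outer[of v]] by simp
qed

lemma nonneg_Reals_sum:
  fixes f :: "'a \<Rightarrow> complex"
  shows "(\<And>x. x \<in> S \<Longrightarrow> f x \<in> \<real>\<^sub>\<ge>\<^sub>0) \<Longrightarrow> sum f S \<in> \<real>\<^sub>\<ge>\<^sub>0"
  by (induct S rule: infinite_finite_induct) auto

text \<open>Each slot is a positive combination of rank-one matrices, so the multilinear expansion
  is a nonnegative combination of values of \<open>rdet\<close>. The decompositions of different
  slots need not be related.\<close>

theorem mixD_nonneg:
  assumes "\<And>i. qpossemidef (H i :: 'n::{finite,linorder} \<Rightarrow> 'n \<Rightarrow> quat)"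
  shows "mixD H \<in> \<real>\<^sub>\<ge>\<^sub>0"
proof -
  have pd: "mixD H \<in> \<real>\<^sub>\<ge>\<^sub>0" if pdH: "\<And>i. qposdef UNIV (H i)" for H :: "'n \<Rightarrow> 'n \<Rightarrow> 'n \<Rightarrow> quat"
  proof -
    define P where "P i p \<longleftrightarrow> (\<forall>r. 0 < fst p r) \<and> (\<forall>l m. H i l m = (\<Sum>r\<in>UNIV. fst p r *\<^sub>R qouter (snd p r) l m))"
      for i and p :: "('n \<Rightarrow> real) \<times> ('n \<Rightarrow> 'n \<Rightarrow> quat)"
    have "\<exists>p. P i p" for i
    proof -
      obtain d v where dv: "\<forall>r\<in>UNIV. 0 < d r \<and> v r r = qone \<and> (\<forall>l. l \<notin> UNIV \<or> r < l \<longrightarrow> v r l = 0)"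
        "\<forall>l\<in>UNIV. \<forall>m\<in>UNIV. H i l m = (\<Sum>r\<in>UNIV. d r *\<^sub>R qouter (v r) l m)"
        using qposdef_cholesky[OF pdH[of i]] by (elim exE conjE)
      have "P i (d, v)" unfolding P_def fst_conv snd_conv using dv by blast
      then show ?thesis ..
    qed
    then have "\<exists>p. \<forall>i. P i (p i)" by (intro choice allI)
    then obtain p where p: "\<And>i. P i (p i)" by blast
    define d where "d i = fst (p i)" for i
    define v where "v i = snd (p i)" for i
    have dv: "\<And>i r. 0 < d i r" "\<And>i l m. H i l m = (\<Sum>r\<in>UNIV. d i r *\<^sub>R qouter (v i r) l m)"
      using p unfolding P_def d_def v_def by blast+
    have "mixD H = mixD (\<lambda>i l m. \<Sum>r\<in>UNIV. d i r *\<^sub>R qouter (v i r) l m)"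
      by (rule mixD_cong) (rule dv(2))
    also have "\<dots> \<in> \<real>\<^sub>\<ge>\<^sub>0"
    proof -
      have "complex_of_real (\<Prod>i\<in>UNIV. d i (g i)) \<in> \<real>\<^sub>\<ge>\<^sub>0" for g
        using dv(1) by (simp add: prod_nonneg less_imp_le del: of_real_prod)
      then show ?thesis
        unfolding mixD_expand by (intro nonneg_Reals_mult_I nonneg_Reals_sum rdet_nonneg) auto
    qed
    finally show ?thesis .
  qed
  \<comment> \<open>Semidefinite entries are reached from definite ones by adding \<open>t\<close>
    times the identity; the nonnegative reals are closed in the complex plane.\<close>
  have "mixD (\<lambda>i l m. H i l m + t *\<^sub>R qidm l m) \<in> \<real>\<^sub>\<ge>\<^sub>0" if t: "0 < t" for t :: real
    by (rule pd[of "\<lambda>i l m. H i l m + t *\<^sub>R qidm l m"]) (rule qpossemidef_perturb[OF assms t])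
  then have "eventually (\<lambda>t. mixD (\<lambda>i l m. H i l m + t *\<^sub>R qidm l m) \<in> \<real>\<^sub>\<ge>\<^sub>0) (at_right (0::real))"
    using eventually_at_right_less[of "0::real"] by (simp add: eventually_mono)
  then show ?thesis
    using Lim_in_closed_set[OF closed_nonneg_Reals_complex _ _ mixD_perturb_tendsto[of H "\<lambda>i. qidm"]] by simp
qed

subsection \<open>Functions of class \<open>C\<^sup>k\<close>\<close>

definition dd :: "'a::real_normed_vector \<Rightarrow> ('a \<Rightarrow> 'b::real_normed_vector) \<Rightarrow> 'a \<Rightarrow> 'b" where
  "dd v f x = frechet_derivative f (at x) v"

text \<open>Regularity on the whole space, phrased with all directional derivatives so that no basis
  intervenes. Global functions suffice because local ones are first multiplied by cut-offs.\<close>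

fun Ck :: "nat \<Rightarrow> ('a::euclidean_space \<Rightarrow> 'b::real_normed_vector) \<Rightarrow> bool" where
  "Ck 0 f \<longleftrightarrow> continuous_on UNIV f"
| "Ck (Suc k) f \<longleftrightarrow> (\<forall>x. f differentiable (at x)) \<and> (\<forall>v. Ck k (dd v f))"

lemmas Ck_Suc_iff = Ck.simps(2)
declare Ck.simps(2) [simp del]

lemma Ck_dd: "Ck (Suc k) f \<Longrightarrow> Ck k (dd v f)"
  by (simp add: Ck_Suc_iff)

lemma dd_eqI: "(f has_derivative f') (at x) \<Longrightarrow> dd v f x = f' v"
  unfolding dd_def by (simp add: frechet_derivative_at[symmetric])

lemma Ck_has_derivative:
  assumes "Ck (Suc k) f"
  shows "(f has_derivative (\<lambda>v. dd v f x)) (at x)"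
  using assms unfolding dd_def by (simp add: frechet_derivative_works[symmetric] Ck_Suc_iff)

lemma Ck_SucI:
  assumes "\<And>x. (f has_derivative f' x) (at x)" "\<And>v. Ck k (\<lambda>x. f' x v)"
  shows "Ck (Suc k) f"
proof -
  have "dd v f = (\<lambda>x. f' x v)" for v using dd_eqI[OF assms(1)] by blast
  moreover have "f differentiable (at x)" for x using assms(1) unfolding differentiable_def by blast
  ultimately show ?thesis using assms(2) by (simp add: Ck_Suc_iff)
qed

lemma Ck_Suc_D: "Ck (Suc k) f \<Longrightarrow> Ck k f"
proof (induct k arbitrary: f)
  case 0
  then show ?case by (auto simp: Ck_Suc_iff intro!: continuous_at_imp_continuous_on differentiable_imp_continuous_within)
next
  case (Suc k)
  then show ?case by (metis Ck_Suc_iff)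
qed

lemma Ck_mono: "Ck k f \<Longrightarrow> j \<le> k \<Longrightarrow> Ck j f"
proof (induct k)
  case (Suc k)
  then show ?case using Ck_Suc_D by (cases "j = Suc k") auto
qed simp

lemma Ck_continuous: "Ck k f \<Longrightarrow> continuous_on UNIV f"
  using Ck_mono[of k f 0] by simp

lemma Ck_const [simp]: "Ck k (\<lambda>x. c)"
proof (induct k arbitrary: c)
  case (Suc k)
  show ?case by (rule Ck_SucI[where f'="\<lambda>x v. 0"]) (use Suc in auto)
qed simp

lemma Ck_add: "Ck k f \<Longrightarrow> Ck k g \<Longrightarrow> Ck k (\<lambda>x. f x + g x)"
proof (induct k arbitrary: f g)
  case 0 then show ?case by (auto intro: continuous_intros)
next
  case (Suc k)
  show ?case
    by (rule Ck_SucI[where f'="\<lambda>x v. dd v f x + dd v g x"])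
      (intro has_derivative_add Ck_has_derivative[OF Suc(2)] Ck_has_derivative[OF Suc(3)],
        intro Suc(1) Ck_dd[OF Suc(2)] Ck_dd[OF Suc(3)])
qed

lemma Ck_bounded_linear_comp: "bounded_linear L \<Longrightarrow> Ck k f \<Longrightarrow> Ck k (\<lambda>x. L (f x))"
proof (induct k arbitrary: f)
  case 0 then show ?case by (auto intro: bounded_linear.continuous_on)
next
  case (Suc k)
  show ?case
    by (rule Ck_SucI[where f'="\<lambda>x v. L (dd v f x)"])
      (rule bounded_linear.has_derivative[OF Suc(2) Ck_has_derivative[OF Suc(3)]],
        rule Suc(1)[OF Suc(2) Ck_dd[OF Suc(3)]])
qed

lemma dd_bounded_linear_comp:
  "Ck (Suc k) f \<Longrightarrow> bounded_linear L \<Longrightarrow> dd v (\<lambda>x. L (f x)) x = L (dd v f x)"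
  by (rule dd_eqI) (auto intro: bounded_linear.has_derivative Ck_has_derivative)

lemma Ck_bounded_linear: "bounded_linear f \<Longrightarrow> Ck k f"
proof (induct k)
  case 0 then show ?case by (auto intro: linear_continuous_on)
next
  case (Suc k)
  show ?case
    by (rule Ck_SucI[where f'="\<lambda>x v. f v"]) (use Suc in \<open>auto intro: bounded_linear_imp_has_derivative\<close>)
qed

lemma Ck_minus: "Ck k f \<Longrightarrow> Ck k (\<lambda>x. - f x)"
  by (rule Ck_bounded_linear_comp[OF bounded_linear_minus[OF bounded_linear_ident]])

lemma Ck_diff: "Ck k f \<Longrightarrow> Ck k g \<Longrightarrow> Ck k (\<lambda>x. f x - g x)"
  using Ck_add[OF _ Ck_minus] by (metis (no_types, lifting) ext diff_conv_add_uminus)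

lemma Ck_mult:
  fixes f g :: "'a::euclidean_space \<Rightarrow> 'b::real_normed_algebra"
  shows "Ck k f \<Longrightarrow> Ck k g \<Longrightarrow> Ck k (\<lambda>x. f x * g x)"
proof (induct k arbitrary: f g)
  case 0 then show ?case by (auto intro: continuous_intros)
next
  case (Suc k)
  show ?case
  proof (rule Ck_SucI[where f'="\<lambda>x v. f x * dd v g x + dd v f x * g x"])
    show "((\<lambda>x. f x * g x) has_derivative (\<lambda>v. f x * dd v g x + dd v f x * g x)) (at x)" for x
      using has_derivative_mult[OF Ck_has_derivative[OF Suc(2)] Ck_has_derivative[OF Suc(3)]] .
    show "Ck k (\<lambda>x. f x * dd v g x + dd v f x * g x)" for v
      by (intro Ck_add Suc(1) Ck_dd[OF Suc(2)] Ck_dd[OF Suc(3)] Ck_Suc_D[OF Suc(2)] Ck_Suc_D[OF Suc(3)])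
  qed
qed

lemma dd_mult:
  fixes f g :: "'a::euclidean_space \<Rightarrow> 'b::real_normed_algebra"
  assumes "Ck (Suc k) f" "Ck (Suc j) g"
  shows "dd v (\<lambda>x. f x * g x) x = f x * dd v g x + dd v f x * g x"
  using dd_eqI[OF has_derivative_mult[OF Ck_has_derivative[OF assms(1)] Ck_has_derivative[OF assms(2)]]] .

lemma dd_add:
  assumes "Ck (Suc k) f" "Ck (Suc j) g"
  shows "dd v (\<lambda>x. f x + g x) x = dd v f x + dd v g x"
  using dd_eqI[OF has_derivative_add[OF Ck_has_derivative[OF assms(1)] Ck_has_derivative[OF assms(2)]]] .

lemma Ck_sum: "(\<And>i. i \<in> I \<Longrightarrow> Ck k (f i)) \<Longrightarrow> Ck k (\<lambda>x. \<Sum>i\<in>I. f i x)"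
  by (induct I rule: infinite_finite_induct) (auto intro: Ck_add)

lemma Ck_prod:
  fixes f :: "'i \<Rightarrow> 'a::euclidean_space \<Rightarrow> 'b::{real_normed_algebra,comm_monoid_mult}"
  shows "(\<And>i. i \<in> I \<Longrightarrow> Ck k (f i)) \<Longrightarrow> Ck k (\<lambda>x. \<Prod>i\<in>I. f i x)"
  by (induct I rule: infinite_finite_induct) (auto intro: Ck_mult)

lemma Ck_compose_affine:
  assumes "bounded_linear L"
  shows "Ck k f \<Longrightarrow> Ck k (\<lambda>x. f (L x + c))"
proof (induct k arbitrary: f)
  case 0
  have "continuous_on UNIV (\<lambda>x. L x + c)"
    by (intro continuous_intros linear_continuous_on assms)
  then show ?case using 0 by (auto intro: continuous_on_compose2[of UNIV f])
next
  case (Suc k)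
  show ?case
  proof (rule Ck_SucI[where f'="\<lambda>x v. dd (L v) f (L x + c)"])
    show "((\<lambda>x. f (L x + c)) has_derivative (\<lambda>v. dd (L v) f (L x + c))) (at x)" for x
      by (rule has_derivative_compose[OF _ Ck_has_derivative[OF Suc(2)]])
        (auto intro!: derivative_eq_intros bounded_linear_imp_has_derivative assms)
    show "Ck k (\<lambda>x. dd (L v) f (L x + c))" for v by (rule Suc(1)[OF Ck_dd[OF Suc(2)]])
  qed
qed

lemma dd_compose_affine:
  assumes "bounded_linear L" "Ck (Suc k) f"
  shows "dd v (\<lambda>x. f (L x + c)) x = dd (L v) f (L x + c)"
  by (rule dd_eqI, rule has_derivative_compose[OF _ Ck_has_derivative[OF assms(2)]])
    (auto intro!: derivative_eq_intros bounded_linear_imp_has_derivative assms)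

lemma dd_cong_open:
  assumes "open U" "x \<in> U" "\<And>y. y \<in> U \<Longrightarrow> f y = g y"
  shows "dd v f x = dd v g x"
proof -
  have "(f has_derivative f') (at x) = (g has_derivative f') (at x)" for f'
    using assms by (metis has_derivative_transform_within_open)
  then show ?thesis unfolding dd_def frechet_derivative_def by simp
qed

lemma dd_zero_off:
  assumes "closed K" "\<And>x. x \<notin> K \<Longrightarrow> f x = 0" "x \<notin> K"
  shows "dd v f x = 0"
proof -
  have "dd v f x = dd v (\<lambda>_. 0) x"
    by (rule dd_cong_open[of "- K"]) (use assms in auto)
  also have "\<dots> = 0" by (rule dd_eqI[where f'="\<lambda>v. 0"]) simp
  finally show ?thesis .
qed

text \<open>Each differentiation lowers the power of the positive part by one, and the last
  remaining power is still continuous. With \<open>m = 3\<close> this yields the C^3 kernel used for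
  mollification.\<close>

lemma Ck_max_power:
  fixes g :: "'a::euclidean_space \<Rightarrow> real"
  assumes "\<And>k. Ck k g"
  shows "Ck m (\<lambda>x. (max 0 (g x)) ^ Suc m)"
proof (induct m)
  case 0
  show ?case using Ck_continuous[OF assms] by (auto intro!: continuous_intros)
next
  case (Suc m)
  have d: "((\<lambda>s::real. (max 0 s) ^ Suc (Suc m)) has_real_derivative (real (Suc (Suc m)) * (max 0 s) ^ Suc m)) (at s)" for s
  proof (cases "s = 0")
    case False
    show ?thesis
    proof (cases "s > 0")
      case True
      have "((\<lambda>s::real. s ^ Suc (Suc m)) has_real_derivative (real (Suc (Suc m)) * s ^ Suc m)) (at s)"
        using DERIV_pow[of "Suc (Suc m)" s] by simp
      then show ?thesis
        using True has_field_derivative_transform_within_open[of "\<lambda>s. s ^ Suc (Suc m)" _ s "{0<..}" "\<lambda>s. (max 0 s) ^ Suc (Suc m)"]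
        by (simp add: max_def)
    next
      case n: False
      then have "s < 0" using False by simp
      have "((\<lambda>s::real. 0) has_real_derivative 0) (at s)" by simp
      from has_field_derivative_transform_within_open[OF this, of "{..<0}" "\<lambda>s. (max 0 s) ^ Suc (Suc m)"]
      show ?thesis using \<open>s < 0\<close> by simp
    qed
  next
    case True
    have "((\<lambda>h::real. ((max 0 h) ^ Suc (Suc m)) / h) \<longlongrightarrow> 0) (at 0)"
    proof (rule Lim_null_comparison)
      show "eventually (\<lambda>h::real. norm ((max 0 h) ^ Suc (Suc m) / h) \<le> \<bar>h\<bar> ^ Suc m) (at 0)"
      proof (rule eventually_mono[OF eventually_neq_at_within[of 0]])
        fix h :: real assume "h \<noteq> 0"
        then show "norm ((max 0 h) ^ Suc (Suc m) / h) \<le> \<bar>h\<bar> ^ Suc m"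
        proof (cases "h > 0")
          case True
          then show ?thesis by (simp add: max_def)
        next
          case False
          then have "norm ((max 0 h) ^ Suc (Suc m) / h) = 0" by simp
          then show ?thesis by (metis abs_ge_zero zero_le_power)
        qed
      qed
      show "((\<lambda>h::real. \<bar>h\<bar> ^ Suc m) \<longlongrightarrow> 0) (at 0)"
        by (auto intro!: tendsto_eq_intros)
    qed
    then show ?thesis unfolding True has_field_derivative_iff by simp
  qed
  show ?case
  proof (rule Ck_SucI[where f'="\<lambda>x v. (real (Suc (Suc m)) * (max 0 (g x)) ^ Suc m) * dd v g x"])
    fix x
    have "((\<lambda>s::real. (max 0 s) ^ Suc (Suc m)) has_derivative (\<lambda>h. (real (Suc (Suc m)) * (max 0 (g x)) ^ Suc m) * h)) (at (g x))"
      using d[of "g x"] unfolding has_field_derivative_def by simp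
    from has_derivative_compose[OF Ck_has_derivative[OF assms] this]
    show "((\<lambda>x. (max 0 (g x)) ^ Suc (Suc m)) has_derivative (\<lambda>v. (real (Suc (Suc m)) * (max 0 (g x)) ^ Suc m) * dd v g x)) (at x)" .
  next
    fix v
    show "Ck m (\<lambda>x. (real (Suc (Suc m)) * (max 0 (g x)) ^ Suc m) * dd v g x)"
      by (intro Ck_mult Ck_const Suc Ck_dd assms)
  qed
qed

section \<open>Integrals of compactly supported functions and of their derivatives\<close>

lemma Cc_integrable:
  fixes f :: "'a::euclidean_space \<Rightarrow> 'b::{banach,second_countable_topology}"
  assumes "continuous_on UNIV f" "compact K" "\<And>x. x \<notin> K \<Longrightarrow> f x = 0"
  shows "integrable lborel f"
proof -
  have "integrable lborel (\<lambda>x. indicator K x *\<^sub>R f x)"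
    by (rule borel_integrable_compact[OF assms(2)]) (rule continuous_on_subset[OF assms(1) subset_UNIV])
  moreover have "(\<lambda>x. indicator K x *\<^sub>R f x) = f" using assms(3) by (auto simp: indicator_def)
  ultimately show ?thesis by simp
qed

lemma Cc_integral_cbox:
  fixes f :: "'a::euclidean_space \<Rightarrow> 'b::euclidean_space"
  assumes "continuous_on UNIV f" "\<And>x. x \<notin> cbox a b \<Longrightarrow> f x = 0"
  shows "integral (cbox a b) f = (\<integral>x. f x \<partial>lborel)"
proof -
  have e: "(\<lambda>x. indicator (cbox a b) x *\<^sub>R f x) = f" using assms(2) by (auto simp: indicator_def)
  have "set_integrable lborel (cbox a b) f"
    unfolding set_integrable_def e by (rule Cc_integrable[OF assms(1) compact_cbox assms(2)])
  from set_borel_integral_eq_integral(2)[OF this] show ?thesis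
    unfolding set_lebesgue_integral_def e by simp
qed

lemma lborel_integral_translate:
  fixes f :: "'a::euclidean_space \<Rightarrow> 'b::{banach,second_countable_topology}"
  assumes "f \<in> borel_measurable borel"
  shows "(\<integral>x. f (x + c) \<partial>lborel) = (\<integral>x. f x \<partial>lborel)"
proof -
  have "(\<integral>x. f x \<partial>lborel) = (\<integral>x. f x \<partial>distr lborel borel ((+) c))" by (simp add: lborel_distr_plus)
  also have "\<dots> = (\<integral>x. f (c + x) \<partial>lborel)" by (rule integral_distr) (use assms in auto)
  finally show ?thesis by (simp add: add.commute)
qed

lemma compact_in_cbox:
  fixes K :: "'a::euclidean_space set"
  assumes "compact K"
  obtains a b where "K \<subseteq> cbox a b"
  using bounded_subset_cbox_symmetric[OF compact_imp_bounded[OF assms]] by blast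

text \<open>By translation invariance the integral of \<open>F (x + s v)\<close> does not depend on
  \<open>s\<close>; differentiating under the integral at \<open>s = 0\<close> gives the
  claim.\<close>

theorem integral_dd_zero:
  fixes F :: "'a::euclidean_space \<Rightarrow> 'b::euclidean_space"
  assumes F: "Ck (Suc 0) F" and K: "compact K" and z: "\<And>x. x \<notin> K \<Longrightarrow> F x = 0"
  shows "(\<integral>x. dd v F x \<partial>lborel) = 0"
proof -
  \<comment> \<open>One box must contain the supports of all translates with
    \<open>|s| \<le> 1\<close>, so that the parameter integral runs over a fixed box.\<close>
  let ?K' = "(\<lambda>(x, s). x - s *\<^sub>R v) ` (K \<times> {-1..1::real})"
  have "compact ?K'"
    by (intro compact_continuous_image compact_Times K compact_Icc) (auto simp: split_beta intro!: continuous_intros)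
  then obtain a b where ab: "?K' \<subseteq> cbox a b" by (rule compact_in_cbox)
  have out: "F (x + s *\<^sub>R v) = 0" if "x \<notin> cbox a b" "s \<in> {-1..1}" for x s
  proof (rule z)
    show "x + s *\<^sub>R v \<notin> K"
    proof
      assume "x + s *\<^sub>R v \<in> K"
      then have "(x + s *\<^sub>R v, s) \<in> K \<times> {-1..1}" using that by auto
      then have "x \<in> ?K'" by (rule rev_image_eqI) simp
      then show False using ab that by blast
    qed
  qed
  have cF: "continuous_on UNIV F" and cd: "continuous_on UNIV (dd v F)"
    using Ck_continuous[OF F] Ck_dd[OF F, of v] by auto
  have cFs: "continuous_on UNIV (\<lambda>x. F (x + s *\<^sub>R v))" for s
    by (intro continuous_on_compose2[OF cF] continuous_intros) auto
  let ?U = "{-1<..<1::real}"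
  have "((\<lambda>s. integral (cbox a b) (\<lambda>x. F (x + s *\<^sub>R v))) has_vector_derivative
      integral (cbox a b) (\<lambda>x. dd v F (x + 0 *\<^sub>R v))) (at 0 within ?U)"
  proof (rule leibniz_rule_vector_derivative[where fx="\<lambda>s x. dd v F (x + s *\<^sub>R v)" and U="?U"])
    fix s x
    have "((\<lambda>s. F (x + s *\<^sub>R v)) has_derivative (\<lambda>h. dd (h *\<^sub>R v) F (x + s *\<^sub>R v))) (at s)"
      by (rule has_derivative_compose[OF _ Ck_has_derivative[OF F]]) (auto intro!: derivative_eq_intros)
    moreover have "dd (h *\<^sub>R v) F (x + s *\<^sub>R v) = h *\<^sub>R dd v F (x + s *\<^sub>R v)" for h
      using has_derivative_linear[OF Ck_has_derivative[OF F]] by (rule linear_scale)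
    ultimately show "((\<lambda>s. F (x + s *\<^sub>R v)) has_vector_derivative dd v F (x + s *\<^sub>R v)) (at s within ?U)"
      unfolding has_vector_derivative_def by (simp add: has_derivative_at_withinI)
  next
    show "(\<lambda>x. F (x + s *\<^sub>R v)) integrable_on cbox a b" for s
      by (intro integrable_continuous continuous_on_subset[OF cFs]) auto
    show "continuous_on (?U \<times> cbox a b) (\<lambda>(s, x). dd v F (x + s *\<^sub>R v))"
      by (auto simp: split_beta intro!: continuous_on_compose2[OF cd] continuous_intros)
  qed auto
  then have d1: "((\<lambda>s. integral (cbox a b) (\<lambda>x. F (x + s *\<^sub>R v))) has_vector_derivative
      integral (cbox a b) (dd v F)) (at 0)"
    by (simp add: at_within_open[of 0 ?U])
  have mF: "F \<in> borel_measurable borel" using cF by (rule borel_measurable_continuous_onI)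
  have eq: "integral (cbox a b) (\<lambda>x. F (x + s *\<^sub>R v)) = (\<integral>x. F x \<partial>lborel)" if "s \<in> ?U" for s
  proof -
    have "integral (cbox a b) (\<lambda>x. F (x + s *\<^sub>R v)) = (\<integral>x. F (x + s *\<^sub>R v) \<partial>lborel)"
      by (rule Cc_integral_cbox[OF cFs]) (use out that in auto)
    then show ?thesis using lborel_integral_translate[OF mF] by simp
  qed
  have d2: "((\<lambda>s. integral (cbox a b) (\<lambda>x. F (x + s *\<^sub>R v))) has_vector_derivative 0) (at 0)"
    by (rule has_vector_derivative_transform_within_open[of "\<lambda>s. \<integral>x. F x \<partial>lborel" _ _ ?U]) (auto simp: eq)
  have "integral (cbox a b) (dd v F) = 0" by (rule vector_derivative_unique_at[OF d1 d2])
  moreover have "integral (cbox a b) (dd v F) = (\<integral>x. dd v F x \<partial>lborel)"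
    by (rule Cc_integral_cbox[OF cd], rule dd_zero_off[OF closed_cbox]) (use out[of _ 0] in auto)
  ultimately show ?thesis by simp
qed

text \<open>The second difference of \<open>f\<close> over a parallelogram of size \<open>h\<close>
  is symmetric in the two directions. Two applications of the mean value theorem express it by
  either mixed derivative at a nearby point, and continuity finishes the argument.\<close>

lemma dd_symmetric_real:
  fixes f :: "'a::euclidean_space \<Rightarrow> real"
  assumes f: "Ck (Suc (Suc 0)) f"
  shows "dd w (dd v f) p = dd v (dd w f) p"
proof -
  have f1: "Ck (Suc 0) f" "\<And>v. Ck (Suc 0) (dd v f)" using f Ck_Suc_D Ck_dd by auto
  have line: "((\<lambda>s. g (x + s *\<^sub>R v)) has_real_derivative dd v g (x + s *\<^sub>R v)) (at s)"
    if "Ck (Suc 0) g" for g :: "'a \<Rightarrow> real" and x s v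
  proof -
    have "((\<lambda>s. g (x + s *\<^sub>R v)) has_derivative (\<lambda>h. dd (h *\<^sub>R v) g (x + s *\<^sub>R v))) (at s)"
      by (rule has_derivative_compose[OF _ Ck_has_derivative[OF that]]) (auto intro!: derivative_eq_intros)
    moreover have "dd (h *\<^sub>R v) g (x + s *\<^sub>R v) = h * dd v g (x + s *\<^sub>R v)" for h
      using linear_scale[OF has_derivative_linear[OF Ck_has_derivative[OF that]]] by simp
    moreover have "times (dd v g (x + s *\<^sub>R v)) = (\<lambda>h. h * dd v g (x + s *\<^sub>R v))" by (simp add: fun_eq_iff)
    ultimately show ?thesis unfolding has_field_derivative_def by simp
  qed
  have key: "\<exists>\<xi> \<eta>. 0 < \<xi> \<and> \<xi> < h \<and> 0 < \<eta> \<and> \<eta> < h \<and>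
      f (p + h *\<^sub>R v + h *\<^sub>R w) - f (p + h *\<^sub>R v) - f (p + h *\<^sub>R w) + f p = h * h * dd w (dd v f) (p + \<xi> *\<^sub>R v + \<eta> *\<^sub>R w)"
    if h: "h > 0" for h v w
  proof -
    have "\<exists>\<xi>. 0 < \<xi> \<and> \<xi> < h \<and> (f ((p + h *\<^sub>R w) + h *\<^sub>R v) - f (p + h *\<^sub>R v)) - (f ((p + h *\<^sub>R w) + 0 *\<^sub>R v) - f (p + 0 *\<^sub>R v))
       = (h - 0) * (dd v f ((p + h *\<^sub>R w) + \<xi> *\<^sub>R v) - dd v f (p + \<xi> *\<^sub>R v))"
      by (rule MVT2[OF h]) (intro DERIV_diff line[OF f1(1)])
    then obtain \<xi> where xi: "0 < \<xi>" "\<xi> < h" and e1: "f ((p + h *\<^sub>R w) + h *\<^sub>R v) - f (p + h *\<^sub>R v) - f (p + h *\<^sub>R w) + f p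
       = h * (dd v f ((p + h *\<^sub>R w) + \<xi> *\<^sub>R v) - dd v f (p + \<xi> *\<^sub>R v))" by auto
    have "\<exists>\<eta>. 0 < \<eta> \<and> \<eta> < h \<and> dd v f ((p + \<xi> *\<^sub>R v) + h *\<^sub>R w) - dd v f ((p + \<xi> *\<^sub>R v) + 0 *\<^sub>R w)
       = (h - 0) * dd w (dd v f) ((p + \<xi> *\<^sub>R v) + \<eta> *\<^sub>R w)"
      by (rule MVT2[OF h]) (rule line[OF f1(2)])
    then obtain \<eta> where eta: "0 < \<eta>" "\<eta> < h" and e2: "dd v f ((p + \<xi> *\<^sub>R v) + h *\<^sub>R w) - dd v f (p + \<xi> *\<^sub>R v)
       = h * dd w (dd v f) ((p + \<xi> *\<^sub>R v) + \<eta> *\<^sub>R w)" by auto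
    have "f (p + h *\<^sub>R v + h *\<^sub>R w) - f (p + h *\<^sub>R v) - f (p + h *\<^sub>R w) + f p = h * (h * dd w (dd v f) ((p + \<xi> *\<^sub>R v) + \<eta> *\<^sub>R w))"
      using e1 e2 by (simp add: algebra_simps)
    then show ?thesis using xi eta by (intro exI[of _ \<xi>] exI[of _ \<eta>]) (simp add: algebra_simps)
  qed
  have near: "\<exists>d>0. \<forall>\<xi> \<eta>. \<bar>\<xi>\<bar> < d \<and> \<bar>\<eta>\<bar> < d \<longrightarrow> \<bar>dd w (dd v f) (p + \<xi> *\<^sub>R v + \<eta> *\<^sub>R w) - dd w (dd v f) p\<bar> < e"
    if e: "e > 0" for v w e
  proof -
    have "isCont (dd w (dd v f)) p" using Ck_dd[OF f1(2), of w v] by (simp add: continuous_on_eq_continuous_at)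
    then obtain d where d: "d > 0" "\<And>y. dist y p < d \<Longrightarrow> dist (dd w (dd v f) y) (dd w (dd v f) p) < e"
      using e unfolding continuous_at_eps_delta by blast
    define d' where "d' = d / (norm v + norm w + 1)"
    have pos: "norm v + norm w + 1 > 0" by (simp add: add_nonneg_pos)
    have d': "d' > 0" unfolding d'_def using d(1) pos by simp
    have "dist (p + \<xi> *\<^sub>R v + \<eta> *\<^sub>R w) p < d" if "\<bar>\<xi>\<bar> < d'" "\<bar>\<eta>\<bar> < d'" for \<xi> \<eta>
    proof -
      have "dist (p + \<xi> *\<^sub>R v + \<eta> *\<^sub>R w) p \<le> \<bar>\<xi>\<bar> * norm v + \<bar>\<eta>\<bar> * norm w"
        unfolding dist_norm using norm_triangle_ineq[of "\<xi> *\<^sub>R v" "\<eta> *\<^sub>R w"] by (simp add: algebra_simps)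
      also have "\<dots> \<le> d' * norm v + d' * norm w"
        using that by (intro add_mono mult_right_mono) auto
      also have "\<dots> < d' * (norm v + norm w + 1)" using d' by (simp add: algebra_simps)
      also have "\<dots> = d" unfolding d'_def using pos by simp
      finally show ?thesis .
    qed
    then show ?thesis using d' d(2) by (intro exI[of _ d']) (auto simp: dist_real_def)
  qed
  have "\<bar>dd w (dd v f) p - dd v (dd w f) p\<bar> < e + e" if e: "e > 0" for e
  proof -
    obtain d1 where d1: "d1 > 0" "\<And>\<xi> \<eta>. \<bar>\<xi>\<bar> < d1 \<Longrightarrow> \<bar>\<eta>\<bar> < d1 \<Longrightarrow> \<bar>dd w (dd v f) (p + \<xi> *\<^sub>R v + \<eta> *\<^sub>R w) - dd w (dd v f) p\<bar> < e"
      using near[OF e, of w v] by blast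
    obtain d2 where d2: "d2 > 0" "\<And>\<xi> \<eta>. \<bar>\<xi>\<bar> < d2 \<Longrightarrow> \<bar>\<eta>\<bar> < d2 \<Longrightarrow> \<bar>dd v (dd w f) (p + \<xi> *\<^sub>R w + \<eta> *\<^sub>R v) - dd v (dd w f) p\<bar> < e"
      using near[OF e, of v w] by blast
    define h where "h = min d1 d2"
    have h: "h > 0" "h \<le> d1" "h \<le> d2" using d1 d2 by (auto simp: h_def)
    obtain \<xi> \<eta> where k1: "0 < \<xi>" "\<xi> < h" "0 < \<eta>" "\<eta> < h"
      "f (p + h *\<^sub>R v + h *\<^sub>R w) - f (p + h *\<^sub>R v) - f (p + h *\<^sub>R w) + f p = h * h * dd w (dd v f) (p + \<xi> *\<^sub>R v + \<eta> *\<^sub>R w)"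
      using key[OF h(1), of v w] by blast
    obtain \<xi>' \<eta>' where k2: "0 < \<xi>'" "\<xi>' < h" "0 < \<eta>'" "\<eta>' < h"
      "f (p + h *\<^sub>R w + h *\<^sub>R v) - f (p + h *\<^sub>R w) - f (p + h *\<^sub>R v) + f p = h * h * dd v (dd w f) (p + \<xi>' *\<^sub>R w + \<eta>' *\<^sub>R v)"
      using key[OF h(1), of w v] by blast
    have "f (p + h *\<^sub>R w + h *\<^sub>R v) = f (p + h *\<^sub>R v + h *\<^sub>R w)" by (simp add: algebra_simps)
    then have "h * h * dd w (dd v f) (p + \<xi> *\<^sub>R v + \<eta> *\<^sub>R w) = h * h * dd v (dd w f) (p + \<xi>' *\<^sub>R w + \<eta>' *\<^sub>R v)"
      using k1(5) k2(5) by linarith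
    then have "dd w (dd v f) (p + \<xi> *\<^sub>R v + \<eta> *\<^sub>R w) = dd v (dd w f) (p + \<xi>' *\<^sub>R w + \<eta>' *\<^sub>R v)"
      using h(1) by simp
    then show ?thesis using d1(2)[of \<xi> \<eta>] d2(2)[of \<xi>' \<eta>'] k1 k2 h by simp
  qed
  from this[of "\<bar>dd w (dd v f) p - dd v (dd w f) p\<bar> / 2"] show ?thesis by fastforce
qed

theorem dd_symmetric:
  fixes f :: "'a::euclidean_space \<Rightarrow> 'b::euclidean_space"
  assumes f: "Ck (Suc (Suc k)) f"
  shows "dd w (dd v f) p = dd v (dd w f) p"
proof (rule euclidean_eqI)
  fix b :: 'b assume "b \<in> Basis"
  have f': "Ck (Suc (Suc 0)) f" by (rule Ck_mono[OF f]) simp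
  note bl = bounded_linear_inner_left[of b]
  have e: "dd v (\<lambda>x. f x \<bullet> b) = (\<lambda>x. dd v f x \<bullet> b)" for v
    using dd_bounded_linear_comp[OF _ bl, of _ f v] f' by blast
  have e2: "dd w (\<lambda>x. dd v f x \<bullet> b) p = dd w (dd v f) p \<bullet> b" for v w
    using dd_bounded_linear_comp[OF Ck_dd[OF f'] bl] .
  have "Ck (Suc (Suc 0)) (\<lambda>x. f x \<bullet> b)" by (rule Ck_bounded_linear_comp[OF bl f'])
  from dd_symmetric_real[OF this, of w v p]
  show "dd w (dd v f) p \<bullet> b = dd v (dd w f) p \<bullet> b" unfolding e e2 .
qed

subsection \<open>Mollification\<close>

text \<open>Convolution with the kernel \<open>k\<close>, meant for \<open>g\<close> supported in
  the box. Over a box the Leibniz rule for parameter integrals applies directly.\<close>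

definition mollify :: "('a::euclidean_space \<Rightarrow> real) \<Rightarrow> 'a \<Rightarrow> 'a \<Rightarrow> ('a \<Rightarrow> real) \<Rightarrow> 'a \<Rightarrow> real" where
  "mollify k a b g x = integral (cbox a b) (\<lambda>t. k (x - t) * g t)"

lemma mollify_has_derivative:
  assumes g: "continuous_on UNIV g" and k: "Ck (Suc m) k"
  shows "(mollify k a b g has_derivative (\<lambda>v. mollify (dd v k) a b g x)) (at x)"
proof -
  have ck: "continuous_on UNIV k" by (rule Ck_continuous[OF k])
  have cd: "continuous_on UNIV (dd v k)" for v by (rule Ck_continuous[OF Ck_dd[OF k]])
  define fx where "fx x t = Blinfun (\<lambda>v. dd v k (x - t) * g t)" for x t
  have bl: "bounded_linear (\<lambda>v. dd v k y * c)" for y c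
    using has_derivative_bounded_linear[OF Ck_has_derivative[OF k]]
    by (rule bounded_linear_mult_const)
  have fx: "blinfun_apply (fx x t) = (\<lambda>v. dd v k (x - t) * g t)" for x t
    unfolding fx_def by (rule bounded_linear_Blinfun_apply[OF bl])
  have cfx: "continuous_on (UNIV \<times> cbox a b) (\<lambda>(x, t). fx x t)"
    unfolding split_beta
    by (rule continuous_on_blinfun_componentwise)
      (auto simp: fx intro!: continuous_on_compose2[OF cd] continuous_on_compose2[OF g] continuous_intros)
  have "((\<lambda>x. integral (cbox a b) (\<lambda>t. k (x - t) * g t)) has_derivative integral (cbox a b) (fx x)) (at x within UNIV)"
  proof (rule leibniz_rule)
    fix x t
    have "((\<lambda>x. k (x - t)) has_derivative (\<lambda>v. dd v k (x - t))) (at x)"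
      by (rule has_derivative_compose[OF _ Ck_has_derivative[OF k]]) (auto intro!: derivative_eq_intros)
    then show "((\<lambda>x. k (x - t) * g t) has_derivative blinfun_apply (fx x t)) (at x within UNIV)"
      unfolding fx by (intro has_derivative_mult_left) simp
  next
    show "(\<lambda>t. k (x - t) * g t) integrable_on cbox a b" for x
      by (intro integrable_continuous continuous_intros continuous_on_compose2[OF ck] continuous_on_compose2[OF g]) auto
  qed (use cfx in auto)
  moreover have "continuous_on (cbox a b) (fx x)"
    by (rule continuous_on_blinfun_componentwise)
      (auto simp: fx intro!: continuous_on_compose2[OF cd] continuous_on_compose2[OF g] continuous_intros)
  then have "fx x integrable_on cbox a b" by (rule integrable_continuous)
  then have "blinfun_apply (integral (cbox a b) (fx x)) = (\<lambda>v. mollify (dd v k) a b g x)"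
    using blinfun_apply_integral[of "fx x" "cbox a b"] unfolding mollify_def fx by auto
  ultimately show ?thesis unfolding mollify_def[of k, abs_def] by simp
qed

lemma Ck_mollify:
  assumes g: "continuous_on UNIV g"
  shows "Ck m k \<Longrightarrow> Ck m (mollify k a b g)"
proof (induct m arbitrary: k)
  case 0
  have "continuous_on UNIV (\<lambda>x. integral (cbox a b) (\<lambda>t. k (x - t) * g t))"
    by (rule integral_continuous_on_param)
      (use 0 in \<open>auto simp: split_beta intro!: continuous_on_compose2[of UNIV k] continuous_on_compose2[OF g] continuous_intros\<close>)
  then show ?case by (simp add: mollify_def[abs_def])
next
  case (Suc m)
  show ?case
    by (rule Ck_SucI[OF mollify_has_derivative[OF g Suc(2)]], rule Suc(1)[OF Ck_dd[OF Suc(2)]])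
qed

text \<open>The derivative first falls on the kernel and is moved to \<open>f\<close> by integrating
  the derivative of \<open>k (x - t) * f t\<close> in \<open>t\<close>. Hence derivatives of
  mollified functions converge as well.\<close>

lemma dd_mollify:
  assumes f: "Ck (Suc 0) f" and z: "\<And>x. x \<notin> cbox a b \<Longrightarrow> f x = 0" and k: "Ck (Suc 0) k"
  shows "dd v (mollify k a b f) x = mollify k a b (dd v f) x"
proof -
  have cf: "continuous_on UNIV f" "continuous_on UNIV (dd v f)"
    by (rule Ck_continuous[OF f], rule Ck_continuous[OF Ck_dd[OF f]])
  have ck: "continuous_on UNIV k" "continuous_on UNIV (dd v k)"
    by (rule Ck_continuous[OF k], rule Ck_continuous[OF Ck_dd[OF k]])
  have z': "dd v f t = 0" if "t \<notin> cbox a b" for t by (rule dd_zero_off[OF closed_cbox z that])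
  have blm: "bounded_linear (\<lambda>t::'a. - t)" by (rule bounded_linear_minus[OF bounded_linear_ident])
  have kx: "Ck (Suc 0) (\<lambda>t. k (x - t))" using Ck_compose_affine[OF blm k, of x] by simp
  have dk: "dd v (\<lambda>t. k (x - t)) t = - dd v k (x - t)" for t
  proof -
    have "dd v (\<lambda>t. k (x - t)) t = dd (- v) k (x - t)"
      using dd_compose_affine[OF blm k, of v x t] by simp
    also have "\<dots> = - dd v k (x - t)"
      using linear_neg[OF has_derivative_linear[OF Ck_has_derivative[OF k]]] .
    finally show ?thesis .
  qed
  have c1: "continuous_on UNIV (\<lambda>t. k (x - t) * dd v f t)" and c2: "continuous_on UNIV (\<lambda>t. dd v k (x - t) * f t)"
    by (intro continuous_intros continuous_on_compose2[OF ck(1)] continuous_on_compose2[OF ck(2)] cf; simp)+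
  have i1: "integrable lborel (\<lambda>t. k (x - t) * dd v f t)" and i2: "integrable lborel (\<lambda>t. dd v k (x - t) * f t)"
    by (rule Cc_integrable[OF c1 compact_cbox[of a b]], simp add: z', rule Cc_integrable[OF c2 compact_cbox[of a b]], simp add: z)
  have "0 = (\<integral>t. dd v (\<lambda>t. k (x - t) * f t) t \<partial>lborel)"
    by (rule integral_dd_zero[symmetric, OF Ck_mult[OF kx f] compact_cbox[of a b]]) (simp add: z)
  also have "\<dots> = (\<integral>t. k (x - t) * dd v f t - dd v k (x - t) * f t \<partial>lborel)"
    unfolding dd_mult[OF kx f] dk by simp
  also have "\<dots> = (\<integral>t. k (x - t) * dd v f t \<partial>lborel) - (\<integral>t. dd v k (x - t) * f t \<partial>lborel)"
    by (rule Bochner_Integration.integral_diff[OF i1 i2])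
  also have "(\<integral>t. k (x - t) * dd v f t \<partial>lborel) = mollify k a b (dd v f) x"
    unfolding mollify_def by (rule Cc_integral_cbox[OF c1, symmetric]) (simp add: z')
  also have "(\<integral>t. dd v k (x - t) * f t \<partial>lborel) = mollify (dd v k) a b f x"
    unfolding mollify_def by (rule Cc_integral_cbox[OF c2, symmetric]) (simp add: z)
  also have "mollify (dd v k) a b f x = dd v (mollify k a b f) x"
    using dd_eqI[OF mollify_has_derivative[OF cf(1) k]] by metis
  finally show ?thesis by simp
qed

lemma Ck_inner_self: "Ck k (\<lambda>y::'a::euclidean_space. y \<bullet> y)"
proof -
  have "(\<lambda>y::'a. y \<bullet> y) = (\<lambda>y. \<Sum>b\<in>Basis. (y \<bullet> b) * (y \<bullet> b))"
    by (rule ext) (rule euclidean_inner)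
  then show ?thesis
    by (simp only:) (intro Ck_sum Ck_mult Ck_bounded_linear bounded_linear_inner_left)
qed

text \<open>The fourth power makes this exactly regular enough: three derivatives are what the
  exchange formula asks of a mollified function.\<close>

definition bump :: "real \<Rightarrow> 'a::euclidean_space \<Rightarrow> real" where
  "bump h y = (max 0 (h\<^sup>2 - y \<bullet> y)) ^ 4"

definition kern :: "real \<Rightarrow> 'a::euclidean_space \<Rightarrow> real" where
  "kern h y = bump h y / (\<integral>y. bump h (y::'a) \<partial>lborel)"

context
  fixes h :: real
  assumes h: "0 < h"
begin

lemma Ck_bump: "Ck 3 (bump h :: 'a::euclidean_space \<Rightarrow> real)"
proof -
  have "Ck 3 (\<lambda>y::'a. (max 0 (h\<^sup>2 - y \<bullet> y)) ^ Suc 3)"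
    by (rule Ck_max_power) (intro Ck_diff Ck_const Ck_inner_self)
  then show ?thesis unfolding bump_def[abs_def] by simp
qed

lemma bump_zero: "h \<le> norm y \<Longrightarrow> bump h y = 0"
  unfolding bump_def using power_mono[of h "norm y" 2] h by (simp add: power2_norm_eq_inner)

lemma bump_integrable: "integrable lborel (bump h :: 'a::euclidean_space \<Rightarrow> real)"
  by (rule Cc_integrable[OF Ck_continuous[OF Ck_bump] compact_cball[of 0 h]]) (simp add: bump_zero)

lemma bump_integral_pos: "0 < (\<integral>y. bump h (y::'a::euclidean_space) \<partial>lborel)"
proof -
  \<comment> \<open>On the ball of radius \<open>h/2\<close> the base of the power is at least
    \<open>h^2 - h^2/4\<close>.\<close>
  let ?c = "(3/4 * h\<^sup>2) ^ 4"
  have le: "?c * indicator (ball (0::'a) (h/2)) y \<le> bump h y" for y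
  proof (cases "y \<in> ball 0 (h/2)")
    case True
    then have "norm y \<le> h/2" by simp
    then have "(norm y)\<^sup>2 \<le> (h/2)\<^sup>2" by (intro power_mono) auto
    then have "(norm y)\<^sup>2 \<le> h\<^sup>2 / 4" by (simp add: power_divide)
    then have "3/4 * h\<^sup>2 \<le> h\<^sup>2 - y \<bullet> y" unfolding power2_norm_eq_inner by linarith
    then have "3/4 * h\<^sup>2 \<le> max 0 (h\<^sup>2 - y \<bullet> y)" by (rule max.coboundedI2)
    then have "?c \<le> (max 0 (h\<^sup>2 - y \<bullet> y)) ^ 4" by (rule power_mono) simp
    then show ?thesis using True by (simp add: bump_def del: mem_ball_0)
  qed (simp add: bump_def)
  have "0 < ?c * measure lborel (ball (0::'a) (h/2))"
    using h content_ball_pos[of "h/2" "0::'a"] by simp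
  also have "\<dots> = (\<integral>y. ?c * indicator (ball (0::'a) (h/2)) y \<partial>lborel)" by simp
  also have "\<dots> \<le> (\<integral>y. bump h (y::'a) \<partial>lborel)"
    by (rule integral_mono[OF _ bump_integrable le]) (auto intro!: integrable_mult_right integrable_real_indicator simp: emeasure_bounded_finite[OF bounded_ball, unfolded infinity_ennreal_def])
  finally show ?thesis .
qed

lemma Ck_kern: "Ck 3 (kern h :: 'a::euclidean_space \<Rightarrow> real)"
proof -
  have "kern h = (\<lambda>y::'a. bump h y * (1 / (\<integral>y. bump h (y::'a) \<partial>lborel)))"
    by (simp add: kern_def fun_eq_iff)
  then show ?thesis by (simp only:) (intro Ck_mult Ck_bump Ck_const)
qed

lemma kern_nonneg: "0 \<le> kern h (y::'a::euclidean_space)"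
  unfolding kern_def by (rule divide_nonneg_pos[OF _ bump_integral_pos]) (simp add: bump_def)

lemma kern_zero: "h \<le> norm y \<Longrightarrow> kern h y = 0"
  by (simp add: kern_def bump_zero)

lemma kern_shift_integrable: "integrable lborel (\<lambda>t::'a::euclidean_space. kern h (x - t))"
proof (rule Cc_integrable[of _ "cball x h"])
  show "continuous_on UNIV (\<lambda>t::'a. kern h (x - t))"
    by (rule continuous_on_compose2[OF Ck_continuous[OF Ck_kern]]) (auto intro: continuous_intros)
qed (auto simp: dist_norm kern_zero)

lemma kern_shift_integral: "(\<integral>t. kern h (x - t::'a::euclidean_space) \<partial>lborel) = 1"
proof -
  have e: "kern h (x - t) = kern h (t + (- x))" for t
    by (simp add: kern_def bump_def inner_diff_left inner_diff_right inner_commute algebra_simps)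
  have m: "kern h \<in> borel_measurable borel"
    by (rule borel_measurable_continuous_onI[OF Ck_continuous[OF Ck_kern]])
  have "(\<integral>t. kern h (x - t) \<partial>lborel) = (\<integral>t. kern h (t::'a) \<partial>lborel)"
    unfolding e by (rule lborel_integral_translate[OF m])
  also have "\<dots> = 1" unfolding kern_def using bump_integral_pos[where 'a='a] by simp
  finally show ?thesis .
qed

lemma mollify_close:
  fixes g :: "'a::euclidean_space \<Rightarrow> real"
  assumes g: "continuous_on UNIV g" and z: "\<And>x. x \<notin> cbox a b \<Longrightarrow> g x = 0"
    and e: "\<And>t. dist t x < h \<Longrightarrow> \<bar>g t - g x\<bar> \<le> e"
  shows "\<bar>mollify (kern h) a b g x - g x\<bar> \<le> e"
proof -
  have ck: "continuous_on UNIV (\<lambda>t. kern h (x - t))"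
    by (rule continuous_on_compose2[OF Ck_continuous[OF Ck_kern]]) (auto intro: continuous_intros)
  have c: "continuous_on UNIV (\<lambda>t. kern h (x - t) * g t)"
    by (intro continuous_intros ck g)
  have i: "integrable lborel (\<lambda>t. kern h (x - t) * g t)"
    by (rule Cc_integrable[OF c compact_cbox[of a b]]) (simp add: z)
  have i2: "integrable lborel (\<lambda>t. kern h (x - t) * g x)" "integrable lborel (\<lambda>t. kern h (x - t) * e)"
    using kern_shift_integrable[of x] by simp_all
  have "mollify (kern h) a b g x = (\<integral>t. kern h (x - t) * g t \<partial>lborel)"
    unfolding mollify_def by (rule Cc_integral_cbox[OF c]) (simp add: z)
  moreover have "g x = (\<integral>t. kern h (x - t) * g x \<partial>lborel)" using kern_shift_integral[of x] by simp
  ultimately have "mollify (kern h) a b g x - g x = (\<integral>t. kern h (x - t) * g t - kern h (x - t) * g x \<partial>lborel)"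
    using Bochner_Integration.integral_diff[OF i i2(1)] by simp
  also have "\<bar>\<dots>\<bar> \<le> (\<integral>t. kern h (x - t) * e \<partial>lborel)"
  proof -
    have "\<bar>kern h (x - t) * g t - kern h (x - t) * g x\<bar> \<le> kern h (x - t) * e" for t
    proof (cases "dist t x < h")
      case True
      have "\<bar>kern h (x - t) * g t - kern h (x - t) * g x\<bar> = kern h (x - t) * \<bar>g t - g x\<bar>"
        using kern_nonneg[of "x - t"] by (simp add: abs_mult right_diff_distrib[symmetric])
      then show ?thesis using e[OF True] kern_nonneg[of "x - t"] by (simp add: mult_left_mono)
    next
      case False
      then show ?thesis using kern_zero[of "x - t"] by (simp add: dist_norm norm_minus_commute)
    qed
    then show ?thesis
      using Bochner_Integration.integral_norm_bound_integral[OF Bochner_Integration.integrable_diff[OF i i2(1)] i2(2)] by simp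
  qed
  also have "\<dots> = e" using kern_shift_integral[of x] by simp
  finally show ?thesis .
qed

lemma mollify_zero:
  assumes "\<And>t. dist t x < h \<Longrightarrow> g t = 0"
  shows "mollify (kern h) a b g x = 0"
proof -
  have "kern h (x - t) * g t = 0" for t
    using assms[of t] kern_zero[of "x - t"] by (cases "dist t x < h") (auto simp: dist_norm norm_minus_commute)
  then have "(\<lambda>t. kern h (x - t) * g t) = (\<lambda>t. 0)" by (rule ext)
  then show ?thesis unfolding mollify_def by (simp only: integral_0)
qed

end

lemma Cc_uniformly_continuous:
  fixes g :: "'a::euclidean_space \<Rightarrow> real"
  assumes g: "continuous_on UNIV g" and K: "compact K" and z: "\<And>x. x \<notin> K \<Longrightarrow> g x = 0" and e: "e > 0"
  obtains d where "d > 0" "\<And>x t. dist t x < d \<Longrightarrow> \<bar>g t - g x\<bar> < e"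
proof -
  obtain B where B: "B > 0" "\<And>x. x \<in> K \<Longrightarrow> norm x \<le> B"
    using compact_imp_bounded[OF K] bounded_pos by blast
  \<comment> \<open>The enlargement by 1 together with \<open>d \<le> 1\<close> keeps both points in
    the ball as soon as one of them lies in the support.\<close>
  have "uniformly_continuous_on (cball 0 (B + 1)) g"
    by (intro compact_uniformly_continuous continuous_on_subset[OF g]) auto
  then obtain d where d: "d > 0" "\<And>x t. x \<in> cball 0 (B + 1) \<Longrightarrow> t \<in> cball 0 (B + 1) \<Longrightarrow> dist t x < d \<Longrightarrow> dist (g t) (g x) < e"
    unfolding uniformly_continuous_on_def using e by meson
  show thesis
  proof (rule that[of "min d 1"])
    show "min d 1 > 0" using d by simp
    fix x t :: 'a assume xt: "dist t x < min d 1"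
    show "\<bar>g t - g x\<bar> < e"
    proof (cases "x \<in> K \<or> t \<in> K")
      case True
      have "\<bar>norm t - norm x\<bar> \<le> dist t x" using norm_triangle_ineq3 unfolding dist_norm by blast
      then have "norm x \<le> B + 1" "norm t \<le> B + 1" using True B(2)[of x] B(2)[of t] xt by auto
      then show ?thesis using d(2)[of x t] xt by (simp add: dist_real_def)
    qed (use z e in auto)
  qed
qed

definition moll :: "'a::euclidean_space \<Rightarrow> 'a \<Rightarrow> nat \<Rightarrow> ('a \<Rightarrow> real) \<Rightarrow> 'a \<Rightarrow> real" where
  "moll a b n f = mollify (kern (1 / real (Suc n))) a b f"

lemma Ck_moll: "continuous_on UNIV f \<Longrightarrow> Ck 3 (moll a b n f)"
  unfolding moll_def by (rule Ck_mollify) (auto intro: Ck_kern)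

lemma dd_moll:
  assumes "Ck (Suc 0) f" "\<And>x. x \<notin> cbox a b \<Longrightarrow> f x = 0"
  shows "dd v (moll a b n f) = moll a b n (dd v f)"
  unfolding moll_def by (rule ext, rule dd_mollify[OF assms]) (auto intro: Ck_mono[OF Ck_kern])

lemma moll_zero:
  assumes "\<And>t. dist t x < 1 / real (Suc n) \<Longrightarrow> f t = 0"
  shows "moll a b n f x = 0"
  unfolding moll_def by (rule mollify_zero) (use assms in auto)

lemma moll_uniform_limit:
  assumes g: "continuous_on UNIV g" and z: "\<And>x. x \<notin> cbox a b \<Longrightarrow> g x = 0"
  shows "uniform_limit UNIV (\<lambda>n. moll a b n g) g sequentially"
proof (rule uniform_limitI)
  fix e :: real assume e: "e > 0"
  obtain d where d: "d > 0" "\<And>x t. dist t x < d \<Longrightarrow> \<bar>g t - g x\<bar> < e / 2"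
    using Cc_uniformly_continuous[OF g compact_cbox z, where e="e / 2"] e by auto
  have "eventually (\<lambda>n. 1 / real (Suc n) < d) sequentially"
    using order_tendstoD(2)[OF LIMSEQ_inverse_real_of_nat d(1)] by (simp add: inverse_eq_divide)
  then show "\<forall>\<^sub>F n in sequentially. \<forall>x\<in>UNIV. dist (moll a b n g x) (g x) < e"
  proof (rule eventually_mono)
    fix n assume n: "1 / real (Suc n) < d"
    have "\<bar>moll a b n g x - g x\<bar> \<le> e / 2" for x
      unfolding moll_def
    proof (rule mollify_close[OF _ g z])
      fix t assume "dist t x < 1 / real (Suc n)"
      then have "dist t x < d" using n by (rule less_trans)
      then show "\<bar>g t - g x\<bar> \<le> e / 2" using d(2) less_imp_le by blast
    qed simp_all
    then have "dist (moll a b n g x) (g x) < e" for x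
      using e by (simp add: dist_real_def le_less_trans[of _ "e/2"])
    then show "\<forall>x\<in>UNIV. dist (moll a b n g x) (g x) < e" by blast
  qed
qed

subsection \<open>Left invariant fields and integration by parts\<close>

abbreviation ev :: "'n::finite \<Rightarrow> 4 \<Rightarrow> real^4^'n" where
  "ev l a \<equiv> axis l (axis a 1)"

lemma symp_linear_left: "symp (x + y) v = symp x v + symp y v" "symp (c *\<^sub>R x) v = c * symp x v"
  and symp_linear_right: "symp v (x + y) = symp v x + symp v y" "symp v (c *\<^sub>R x) = c * symp v x"
  by (simp_all add: symp_def sum.distrib[symmetric] sum_distrib_left algebra_simps)

lemma symp_skew: "symp x y = - symp y x"
  by (simp add: symp_def sum_negf[symmetric] algebra_simps)

lemma symp_0 [simp]: "symp 0 v = 0" "symp v 0 = 0"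
  by (simp_all add: symp_def)

lemma symp_self [simp]: "symp x x = 0"
  using symp_skew[of x x] by simp

lemma bounded_linear_symp: "bounded_linear (\<lambda>p::('n::finite) hpt. c * symp (fst p) v)"
  by (rule linear_conv_bounded_linear[THEN iffD1], rule linearI)
    (simp_all add: symp_linear_left algebra_simps)

lemma symp_ev:
  "symp (ev l a) (ev m b) = (if l = m then
     (if a = 1 \<and> b = 2 \<or> a = 3 \<and> b = 4 then 1 else if a = 2 \<and> b = 1 \<or> a = 4 \<and> b = 3 then -1 else 0) else 0)"
proof -
  have "symp (ev l a) (ev m b) = (\<Sum>k\<in>UNIV. if k = l then (if l = m then
     (if a = 1 \<and> b = 2 \<or> a = 3 \<and> b = 4 then 1 else if a = 2 \<and> b = 1 \<or> a = 4 \<and> b = 3 then -1 else 0) else 0) else 0)"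
    unfolding symp_def
    by (rule sum.cong[OF refl]) (use exhaust_4[of a] exhaust_4[of b] in \<open>auto simp: axis_def\<close>)
  then show ?thesis by simp
qed

text \<open>The left invariant field as a directional derivative with the direction frozen at
  \<open>p\<close>. It agrees with \<open>HX\<close> at points of differentiability
  (\<open>HX_eq_XX\<close>) and gives access to the calculus of \<open>dd\<close>.\<close>

definition XX :: "'n::finite \<Rightarrow> 4 \<Rightarrow> ('n hpt \<Rightarrow> 'b::real_normed_vector) \<Rightarrow> 'n hpt \<Rightarrow> 'b" where
  "XX l a f p = dd (ev l a, 2 * symp (fst p) (ev l a)) f p"

abbreviation TT :: "(('n::finite) hpt \<Rightarrow> 'b::real_normed_vector) \<Rightarrow> 'n hpt \<Rightarrow> 'b" where
  "TT \<equiv> dd (0, 1)"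

lemma dd_linear:
  assumes "Ck (Suc k) f"
  shows "dd (v + w) f p = dd v f p + dd w f p" "dd (c *\<^sub>R v) f p = c *\<^sub>R dd v f p"
  using has_derivative_linear[OF Ck_has_derivative[OF assms]] by (auto intro: linear_add linear_scale)

lemma XX_decomp:
  assumes "Ck (Suc k) f"
  shows "XX l a f = (\<lambda>p. dd (ev l a, 0) f p + (2 * symp (fst p) (ev l a)) *\<^sub>R TT f p)"
proof
  fix p :: "'a hpt"
  have "(ev l a, 2 * symp (fst p) (ev l a)) = (ev l a, 0) + (2 * symp (fst p) (ev l a)) *\<^sub>R (0, 1)"
    by simp
  then show "XX l a f p = dd (ev l a, 0) f p + (2 * symp (fst p) (ev l a)) *\<^sub>R TT f p"
    unfolding XX_def by (simp only: dd_linear[OF assms])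
qed

lemma Ck_symp: "Ck k (\<lambda>p::('n::finite) hpt. complex_of_real (2 * symp (fst p) v))"
  by (rule Ck_bounded_linear_comp[OF bounded_linear_of_real], rule Ck_bounded_linear[OF bounded_linear_symp])

lemma Ck_XX:
  fixes f :: "('n::finite) hpt \<Rightarrow> complex"
  assumes "Ck (Suc k) f"
  shows "Ck k (XX l a f)"
  unfolding XX_decomp[OF assms] scaleR_conv_of_real
  by (intro Ck_add Ck_mult Ck_symp Ck_dd assms)

lemma XX_mult:
  fixes f g :: "('n::finite) hpt \<Rightarrow> complex"
  assumes "Ck (Suc k) f" "Ck (Suc j) g"
  shows "XX l a (\<lambda>p. f p * g p) p = f p * XX l a g p + XX l a f p * g p"
  unfolding XX_def by (rule dd_mult[OF assms])

lemma XX_add: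
  assumes "Ck (Suc k) f" "Ck (Suc j) g"
  shows "XX l a (\<lambda>p. f p + g p) p = XX l a f p + XX l a g p"
  unfolding XX_def by (rule dd_add[OF assms])

lemma XX_cmult:
  fixes f :: "('n::finite) hpt \<Rightarrow> complex"
  assumes "Ck (Suc k) f"
  shows "XX l a (\<lambda>p. c * f p) p = c * XX l a f p"
  unfolding XX_def by (rule dd_bounded_linear_comp[OF assms bounded_linear_mult_right])

lemma XX_zero_off:
  assumes "closed K" "\<And>x. x \<notin> K \<Longrightarrow> f x = 0" "x \<notin> K"
  shows "XX l a f x = 0"
  unfolding XX_def by (rule dd_zero_off[OF assms])

text \<open>The fields are divergence free: the coefficient of the central derivative does not
  depend on the central variable and can be moved inside that derivative.\<close>

lemma integral_XX_zero:
  fixes f :: "('n::finite) hpt \<Rightarrow> complex"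
  assumes f: "Ck (Suc 0) f" and K: "compact K" and z: "\<And>x. x \<notin> K \<Longrightarrow> f x = 0"
  shows "(\<integral>p. XX l a f p \<partial>lborel) = 0"
proof -
  let ?s = "\<lambda>p::'n hpt. complex_of_real (2 * symp (fst p) (ev l a))"
  have sf: "Ck (Suc 0) (\<lambda>p. ?s p * f p)" by (rule Ck_mult[OF Ck_symp f])
  have z2: "?s x * f x = 0" if "x \<notin> K" for x using z[OF that] by simp
  have ds: "dd (0, 1) ?s p = 0" for p
  proof -
    have "bounded_linear ?s"
      using bounded_linear_compose[OF bounded_linear_of_real bounded_linear_symp[of 2 "ev l a"]] by simp
    from dd_eqI[OF bounded_linear_imp_has_derivative[OF this]] show ?thesis by simp
  qed
  have e: "XX l a f p = dd (ev l a, 0) f p + TT (\<lambda>p. ?s p * f p) p" for p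
    unfolding dd_mult[OF Ck_symp f] ds XX_decomp[OF f] by (simp add: scaleR_conv_of_real)
  note cl = compact_imp_closed[OF K]
  have "integrable lborel (dd (ev l a, 0) f)" "integrable lborel (TT (\<lambda>p. ?s p * f p))"
    by (rule Cc_integrable[OF Ck_continuous[OF Ck_dd[OF f]] K dd_zero_off[OF cl z]], assumption+,
        rule Cc_integrable[OF Ck_continuous[OF Ck_dd[OF sf]] K dd_zero_off[OF cl z2]], assumption+)
  then show ?thesis
    unfolding e using integral_dd_zero[OF f K z] integral_dd_zero[OF sf K z2] by simp
qed

lemma XX_XX:
  fixes f :: "('n::finite) hpt \<Rightarrow> complex"
  assumes f: "Ck (Suc (Suc k)) f"
  shows "XX l a (XX m b f) p = dd (ev l a, 0) (dd (ev m b, 0) f) p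
      + of_real (2 * symp (fst p) (ev l a)) * TT (dd (ev m b, 0) f) p
      + (of_real (2 * symp (fst p) (ev m b)) * (dd (ev l a, 0) (TT f) p + of_real (2 * symp (fst p) (ev l a)) * TT (TT f) p)
         + of_real (2 * symp (ev l a) (ev m b)) * TT f p)"
proof -
  have f1: "Ck (Suc k) f" by (rule Ck_Suc_D[OF f])
  have fd: "Ck (Suc k) (dd v f)" for v by (rule Ck_dd[OF f])
  let ?s = "\<lambda>m b. \<lambda>p::'n hpt. complex_of_real (2 * symp (fst p) (ev m b))"
  have ds: "dd w (?s m b) p = of_real (2 * symp (fst w) (ev m b))" for w m b p
  proof -
    have "bounded_linear (?s m b)"
      using bounded_linear_compose[OF bounded_linear_of_real bounded_linear_symp[of 2 "ev m b"]] by simp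
    from dd_eqI[OF bounded_linear_imp_has_derivative[OF this]] show ?thesis .
  qed
  have "XX m b f = (\<lambda>p. dd (ev m b, 0) f p + ?s m b p * TT f p)"
    unfolding XX_decomp[OF f1] by (simp add: scaleR_conv_of_real)
  then have "XX l a (XX m b f) p = XX l a (dd (ev m b, 0) f) p + XX l a (\<lambda>p. ?s m b p * TT f p) p"
    using XX_add[OF fd Ck_mult[OF Ck_symp fd]] by simp
  also have "XX l a (\<lambda>p. ?s m b p * TT f p) p = ?s m b p * XX l a (TT f) p + XX l a (?s m b) p * TT f p"
    by (rule XX_mult[OF Ck_symp fd])
  also have "XX l a (?s m b) p = of_real (2 * symp (ev l a) (ev m b))" unfolding XX_def ds by simp
  finally show ?thesis
    unfolding XX_decomp[OF fd] by (simp add: scaleR_conv_of_real)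
qed

text \<open>The pure second derivatives cancel. What remains is the derivative of one field's
  coefficient along the other, taken twice with opposite signs; \<open>symp\<close> being skew, the
  two add up to the factor 4.\<close>

lemma XX_commutator:
  fixes f :: "('n::finite) hpt \<Rightarrow> complex"
  assumes f: "Ck (Suc (Suc k)) f"
  shows "XX l a (XX m b f) p - XX m b (XX l a f) p = of_real (4 * symp (ev l a) (ev m b)) * TT f p"
proof -
  have s1: "dd (ev l a, 0) (dd (ev m b, 0) f) p = dd (ev m b, 0) (dd (ev l a, 0) f) p"
    "TT (dd (ev m b, 0) f) p = dd (ev m b, 0) (TT f) p" "TT (dd (ev l a, 0) f) p = dd (ev l a, 0) (TT f) p"
    by (rule dd_symmetric[OF f])+
  have "symp (ev m b) (ev l a) = - symp (ev l a) (ev m b)" by (rule symp_skew)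
  then show ?thesis unfolding XX_XX[OF f] s1 by (simp add: algebra_simps)
qed

definition ZZ :: "'n::finite \<Rightarrow> complex \<Rightarrow> 4 \<Rightarrow> complex \<Rightarrow> 4 \<Rightarrow> ('n hpt \<Rightarrow> complex) \<Rightarrow> 'n hpt \<Rightarrow> complex" where
  "ZZ l c a d b f p = c * XX l a f p + d * XX l b f p"

text \<open>The two columns of the complex \<open>2n \<times> 2\<close> matrix of the operators \<open>Qbar\<close>.\<close>

definition Z0 :: "'n::finite sidx \<Rightarrow> ('n hpt \<Rightarrow> complex) \<Rightarrow> 'n hpt \<Rightarrow> complex" where
  "Z0 x = (if snd x then ZZ (fst x) (-1) 3 \<i> 4 else ZZ (fst x) 1 1 \<i> 2)"

definition Z1 :: "'n::finite sidx \<Rightarrow> ('n hpt \<Rightarrow> complex) \<Rightarrow> 'n hpt \<Rightarrow> complex" where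
  "Z1 x = (if snd x then ZZ (fst x) 1 1 (-\<i>) 2 else ZZ (fst x) 1 3 \<i> 4)"

lemma Ck_ZZ: "Ck (Suc k) f \<Longrightarrow> Ck k (ZZ l c a d b f)"
  unfolding ZZ_def[abs_def] by (intro Ck_add Ck_mult Ck_const Ck_XX)

lemma ZZ_mult:
  assumes "Ck (Suc k) f" "Ck (Suc j) g"
  shows "ZZ l c a d b (\<lambda>p. f p * g p) p = f p * ZZ l c a d b g p + ZZ l c a d b f p * g p"
  unfolding ZZ_def XX_mult[OF assms] by (simp add: algebra_simps)

lemma integral_ZZ_zero:
  assumes f: "Ck (Suc 0) f" and K: "compact K" and z: "\<And>x. x \<notin> K \<Longrightarrow> f x = 0"
  shows "(\<integral>p. ZZ l c a d b f p \<partial>lborel) = 0"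
proof -
  have "integrable lborel (XX l a f)" for a
    by (rule Cc_integrable[OF Ck_continuous[OF Ck_XX[OF f]] K XX_zero_off[OF compact_imp_closed[OF K] z]])
  then show ?thesis unfolding ZZ_def using integral_XX_zero[OF f K z] by simp
qed

lemma ZZ_zero_off:
  assumes "closed K" "\<And>x. x \<notin> K \<Longrightarrow> f x = 0" "x \<notin> K"
  shows "ZZ l c a d b f x = 0"
  unfolding ZZ_def by (simp add: XX_zero_off[OF assms])

lemma ZZ_ZZ:
  assumes f: "Ck (Suc (Suc k)) f"
  shows "ZZ l c a d b (ZZ m c' a' d' b' f) p = c * c' * XX l a (XX m a' f) p + c * d' * XX l a (XX m b' f) p
      + d * c' * XX l b (XX m a' f) p + d * d' * XX l b (XX m b' f) p"
proof -
  have X: "Ck (Suc k) (XX l a f)" for l a by (rule Ck_XX[OF f])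
  have cX: "Ck (Suc k) (\<lambda>p. c * XX l a f p)" for c l a by (intro Ck_mult Ck_const X)
  show ?thesis
    unfolding ZZ_def[abs_def] XX_add[OF cX cX] XX_cmult[OF X] by (simp add: algebra_simps)
qed

lemma ZZ_commutator:
  assumes f: "Ck (Suc (Suc k)) f"
  shows "ZZ l c a d b (ZZ m c' a' d' b' f) p - ZZ m c' a' d' b' (ZZ l c a d b f) p
    = 4 * (c * c' * of_real (symp (ev l a) (ev m a')) + c * d' * of_real (symp (ev l a) (ev m b'))
      + d * c' * of_real (symp (ev l b) (ev m a')) + d * d' * of_real (symp (ev l b) (ev m b'))) * TT f p"
proof -
  have x: "XX l a (XX m b f) p = XX m b (XX l a f) p + of_real (4 * symp (ev l a) (ev m b)) * TT f p" for l a m b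
    using XX_commutator[OF f, of l a m b p] by (simp add: algebra_simps)
  show ?thesis unfolding ZZ_ZZ[OF f]
    by (subst (1) x, subst (1) x[of l a m b'], subst (1) x[of l b m a'], subst (1) x[of l b m b'])
      (simp add: algebra_simps)
qed

lemma Ck_Z: "Ck (Suc k) f \<Longrightarrow> Ck k (Z0 x f)" "Ck (Suc k) f \<Longrightarrow> Ck k (Z1 x f)"
  unfolding Z0_def Z1_def by (auto intro: Ck_ZZ)

lemma Z_mult:
  assumes "Ck (Suc k) f" "Ck (Suc j) g"
  shows "Z0 x (\<lambda>p. f p * g p) p = f p * Z0 x g p + Z0 x f p * g p"
    "Z1 x (\<lambda>p. f p * g p) p = f p * Z1 x g p + Z1 x f p * g p"
  unfolding Z0_def Z1_def using ZZ_mult[OF assms] by auto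

lemma integral_Z_zero:
  assumes "Ck (Suc 0) f" "compact K" "\<And>x. x \<notin> K \<Longrightarrow> f x = 0"
  shows "(\<integral>p. Z0 x f p \<partial>lborel) = 0" "(\<integral>p. Z1 x f p \<partial>lborel) = 0"
  unfolding Z0_def Z1_def using integral_ZZ_zero[OF assms] by auto

lemma Z_zero_off:
  assumes "closed K" "\<And>x. x \<notin> K \<Longrightarrow> f x = 0" "y \<notin> K"
  shows "Z0 x f y = 0" "Z1 x f y = 0"
  unfolding Z0_def Z1_def using ZZ_zero_off[OF assms] by auto

text \<open>Two different operators of one column either belong to different quaternionic
  coordinates or use the disjoint real coordinates 1, 2 and 3, 4; \<open>symp\<close> vanishes on
  all such pairs.\<close>

lemma Z_commute:
  assumes "Ck (Suc (Suc k)) f"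
  shows "Z0 x (Z0 y f) = Z0 y (Z0 x f)" "Z1 x (Z1 y f) = Z1 y (Z1 x f)"
proof -
  have "Z0 x (Z0 y f) p - Z0 y (Z0 x f) p = 0" "Z1 x (Z1 y f) p - Z1 y (Z1 x f) p = 0" for p
    unfolding Z0_def Z1_def
    by (cases "snd x"; cases "snd y"; simp only: if_True if_False ZZ_commutator[OF assms] symp_ev; simp)+
  then show "Z0 x (Z0 y f) = Z0 y (Z0 x f)" "Z1 x (Z1 y f) = Z1 y (Z1 x f)" by (auto simp: fun_eq_iff)
qed

text \<open>Nonzero commutators occur only when \<open>x\<close> and \<open>y\<close> are the two
  indices over the same \<open>l\<close>. There both sides equal \<open>-8 i\<close> times the
  central derivative, one coming from the coordinates 1, 2 and the other from 3, 4.\<close>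

lemma Z01_commutator_symmetric:
  assumes "Ck (Suc (Suc k)) f"
  shows "Z0 x (Z1 y f) p - Z1 y (Z0 x f) p = Z0 y (Z1 x f) p - Z1 x (Z0 y f) p"
  unfolding Z0_def Z1_def
  by (cases "snd x"; cases "snd y"; simp only: if_True if_False ZZ_commutator[OF assms] symp_ev; simp)

lemma Z_prod:
  assumes "finite I" "\<And>i. i \<in> I \<Longrightarrow> Ck (Suc k) (g i)"
  shows "Z0 x (\<lambda>p. \<Prod>i\<in>I. g i p) p = (\<Sum>j\<in>I. Z0 x (g j) p * (\<Prod>i\<in>I - {j}. g i p))"
    "Z1 x (\<lambda>p. \<Prod>i\<in>I. g i p) p = (\<Sum>j\<in>I. Z1 x (g j) p * (\<Prod>i\<in>I - {j}. g i p))"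
proof -
  have c: "Z0 x (\<lambda>p. 1) p = 0" "Z1 x (\<lambda>p. 1) p = 0"
  proof -
    have "dd v (\<lambda>p. 1::complex) p = 0" for v by (rule dd_eqI[where f'="\<lambda>v. 0"]) simp
    then show "Z0 x (\<lambda>p. 1) p = 0" "Z1 x (\<lambda>p. 1) p = 0" by (simp_all add: Z0_def Z1_def ZZ_def XX_def)
  qed
  have "Z0 x (\<lambda>p. \<Prod>i\<in>I. g i p) p = (\<Sum>j\<in>I. Z0 x (g j) p * (\<Prod>i\<in>I - {j}. g i p)) \<and>
    Z1 x (\<lambda>p. \<Prod>i\<in>I. g i p) p = (\<Sum>j\<in>I. Z1 x (g j) p * (\<Prod>i\<in>I - {j}. g i p))"
    using assms
  proof (induct I)
    case empty
    then show ?case using c by simp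
  next
    case (insert m I)
    have gp: "Ck (Suc k) (\<lambda>p. \<Prod>i\<in>I. g i p)" by (rule Ck_prod) (use insert in auto)
    have gm: "Ck (Suc k) (g m)" using insert by auto
    have r: "(\<Prod>i\<in>insert m I - {j}. g i p) = g m p * (\<Prod>i\<in>I - {j}. g i p)" if "j \<in> I" for j
    proof -
      have "insert m I - {j} = insert m (I - {j})" using that insert by auto
      then show ?thesis using insert by simp
    qed
    have m: "insert m I - {m} = I" using insert by auto
    have P: "(\<lambda>p. \<Prod>i\<in>insert m I. g i p) = (\<lambda>p. g m p * (\<Prod>i\<in>I. g i p))" using insert by simp
    have "(\<Sum>j\<in>insert m I. Z (g j) p * (\<Prod>i\<in>insert m I - {j}. g i p))
        = Z (g m) p * (\<Prod>i\<in>I. g i p) + g m p * (\<Sum>j\<in>I. Z (g j) p * (\<Prod>i\<in>I - {j}. g i p))" for Z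
      using insert.hyps by (simp add: m r sum_distrib_left algebra_simps cong: sum.cong)
    then show ?case using insert unfolding P Z_mult[OF gm gp] by (simp add: algebra_simps)
  qed
  then show "Z0 x (\<lambda>p. \<Prod>i\<in>I. g i p) p = (\<Sum>j\<in>I. Z0 x (g j) p * (\<Prod>i\<in>I - {j}. g i p))"
    "Z1 x (\<lambda>p. \<Prod>i\<in>I. g i p) p = (\<Sum>j\<in>I. Z1 x (g j) p * (\<Prod>i\<in>I - {j}. g i p))" by auto
qed

section \<open>Exchanging a test function with one of the n functions\<close>

definition MZ :: "('n::finite \<Rightarrow> 'n hpt \<Rightarrow> complex) \<Rightarrow> 'n hpt \<Rightarrow> complex" where
  "MZ U p = (\<Sum>\<pi> | \<pi> permutes (UNIV :: 'n sidx set).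
     of_int (sign \<pi>) * (\<Prod>i\<in>UNIV. Z0 (\<pi> (i, False)) (Z1 (\<pi> (i, True)) (U i)) p))"

text \<open>Integration by parts moves first \<open>Z0\<close> and then \<open>Z1\<close> from
  \<open>U i0\<close> to the test function. The fields also hit the second-order factors of the
  other slots, whence the third derivatives required there; these terms disappear in the alternating
  sum.\<close>

theorem integral_MZ_swap_smooth:
  fixes U :: "'n::finite \<Rightarrow> 'n hpt \<Rightarrow> complex"
  assumes phi: "Ck (Suc (Suc 0)) \<phi>" and K: "compact K" and z: "\<And>x. x \<notin> K \<Longrightarrow> \<phi> x = 0"
    and U0: "Ck (Suc (Suc 0)) (U i0)" and U: "\<And>i. i \<noteq> i0 \<Longrightarrow> Ck (Suc (Suc (Suc 0))) (U i)"
  shows "(\<integral>p. \<phi> p * MZ U p \<partial>lborel) = (\<integral>p. U i0 p * MZ (U(i0 := \<phi>)) p \<partial>lborel)"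
proof -
  let ?Perm = "{\<pi>. \<pi> permutes (UNIV :: 'n sidx set)}"
  let ?I = "UNIV - {i0}"
  define a where "a = U i0"
  define g where "g \<pi> i = Z0 (\<pi> (i, False)) (Z1 (\<pi> (i, True)) (U i))" for \<pi> :: "'n sidx \<Rightarrow> 'n sidx" and i
  define R where "R \<pi> p = (\<Prod>i\<in>?I. g \<pi> i p)" for \<pi> p
  define rest where "rest j \<pi> p = (\<Prod>i\<in>?I - {j}. g \<pi> i p)" for j \<pi> p
  define P Q where "P \<pi> = \<pi> (i0, False)" and "Q \<pi> = \<pi> (i0, True)" for \<pi> :: "'n sidx \<Rightarrow> 'n sidx"
  note cl = compact_imp_closed[OF K]
  have h2: "Ck (Suc (Suc 0)) (Z1 y (U j))" if "j \<in> ?I" for j y by (rule Ck_Z(2)[OF U]) (use that in auto)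
  have g1: "Ck (Suc 0) (g \<pi> j)" if "j \<in> ?I" for \<pi> j unfolding g_def by (rule Ck_Z(1)[OF h2[OF that]])
  have R1: "Ck (Suc 0) (R \<pi>)" for \<pi> unfolding R_def[abs_def] by (rule Ck_prod) (rule g1)
  have a1: "Ck (Suc 0) (Z1 y a)" "Ck (Suc 0) a" for y unfolding a_def by (rule Ck_Z(2)[OF U0], rule Ck_Suc_D[OF U0])
  have p1: "Ck (Suc 0) (Z0 y \<phi>)" "Ck (Suc 0) \<phi>" for y by (rule Ck_Z(1)[OF phi], rule Ck_Suc_D[OF phi])
  \<comment> \<open>\<open>E1\<close> and \<open>E2\<close> have support in \<open>K\<close>, so
    their \<open>Z0\<close> and \<open>Z1\<close> derivatives integrate to zero; they carry the
    first and the second integration by parts.\<close>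
  define E1 where "E1 \<pi> p = \<phi> p * (Z1 (Q \<pi>) a p * R \<pi> p)" for \<pi> p
  define E2 where "E2 \<pi> p = Z0 (P \<pi>) \<phi> p * (a p * R \<pi> p)" for \<pi> p
  have E1: "Ck (Suc 0) (E1 \<pi>)" for \<pi> unfolding E1_def[abs_def] by (intro Ck_mult p1 a1 R1)
  have E2: "Ck (Suc 0) (E2 \<pi>)" for \<pi> unfolding E2_def[abs_def] by (intro Ck_mult p1 a1 R1)
  have zE1: "E1 \<pi> x = 0" and zE2: "E2 \<pi> x = 0" if "x \<notin> K" for \<pi> x
    unfolding E1_def E2_def using z[OF that] Z_zero_off[OF cl z that] by auto
  have gsw: "g (\<pi> \<circ> Transposition.transpose x y) i = g \<pi> i" if "fst x \<noteq> i" "fst y \<noteq> i" for \<pi> x y i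
    unfolding g_def using that by (auto simp: Transposition.transpose_def)
  have rsw: "rest j (\<pi> \<circ> Transposition.transpose x y) p = rest j \<pi> p" if "fst x \<in> {i0, j}" "fst y \<in> {i0, j}" for \<pi> x y j p
    unfolding rest_def by (rule prod.cong[OF refl], subst gsw) (use that in auto)
  have Rsw: "R (\<pi> \<circ> Transposition.transpose x y) p = R \<pi> p" if "fst x = i0" "fst y = i0" for \<pi> x y p
    unfolding R_def by (rule prod.cong[OF refl], subst gsw) (use that in auto)
  have sep: "MZ V p = (\<Sum>\<pi>\<in>?Perm. of_int (sign \<pi>) * (Z0 (P \<pi>) (Z1 (Q \<pi>) (V i0)) p * R \<pi> p))"
    if "\<And>i. i \<noteq> i0 \<Longrightarrow> V i = U i" for V p
  proof -
    have "(\<Prod>i\<in>UNIV. Z0 (\<pi> (i, False)) (Z1 (\<pi> (i, True)) (V i)) p) = Z0 (P \<pi>) (Z1 (Q \<pi>) (V i0)) p * R \<pi> p" for \<pi>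
      unfolding P_def Q_def R_def g_def
      by (subst prod.remove[of UNIV i0]) (use that in \<open>auto intro!: prod.cong\<close>)
    then show ?thesis unfolding MZ_def by simp
  qed
  have ZR: "Z0 x (R \<pi>) p = (\<Sum>j\<in>?I. Z0 x (g \<pi> j) p * rest j \<pi> p)"
    "Z1 x (R \<pi>) p = (\<Sum>j\<in>?I. Z1 x (g \<pi> j) p * rest j \<pi> p)" for x \<pi> p
    unfolding R_def[abs_def] rest_def by (rule Z_prod[OF finite g1], assumption)+
  \<comment> \<open>If \<open>Z0\<close> hits slot \<open>j\<close>, two \<open>Z0\<close> act on
    the same function. They commute, so exchanging the arguments at \<open>(i0, False)\<close> and
    \<open>(j, False)\<close> changes only the sign.\<close>
  have V1: "(\<Sum>\<pi>\<in>?Perm. of_int (sign \<pi>) * (\<phi> p * (Z1 (Q \<pi>) a p * Z0 (P \<pi>) (R \<pi>) p))) = 0" for p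
  proof -
    have "(\<Sum>\<pi>\<in>?Perm. of_int (sign \<pi>) * (\<phi> p * (Z1 (Q \<pi>) a p * Z0 (P \<pi>) (R \<pi>) p)))
      = (\<Sum>\<pi>\<in>?Perm. \<Sum>j\<in>?I. of_int (sign \<pi>) * (\<phi> p * (Z1 (Q \<pi>) a p * (Z0 (P \<pi>) (g \<pi> j) p * rest j \<pi> p))))"
      unfolding ZR by (simp add: sum_distrib_left)
    also have "\<dots> = (\<Sum>j\<in>?I. \<Sum>\<pi>\<in>?Perm. of_int (sign \<pi>) * (\<phi> p * (Z1 (Q \<pi>) a p * (Z0 (P \<pi>) (g \<pi> j) p * rest j \<pi> p))))"
      by (rule sum.swap)
    also have "\<dots> = 0"
    proof (rule sum.neutral, rule ballI)
      fix j assume j: "j \<in> ?I"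
      let ?t = "Transposition.transpose (i0, False) (j, False)"
      have "Z0 (P (\<pi> \<circ> ?t)) (g (\<pi> \<circ> ?t) j) = Z0 (P \<pi>) (g \<pi> j)" "Q (\<pi> \<circ> ?t) = Q \<pi>" for \<pi>
        unfolding g_def P_def Q_def using j Z_commute(1)[OF h2[OF j]] by (auto simp: Transposition.transpose_def)
      then show "(\<Sum>\<pi>\<in>?Perm. of_int (sign \<pi>) * (\<phi> p * (Z1 (Q \<pi>) a p * (Z0 (P \<pi>) (g \<pi> j) p * rest j \<pi> p)))) = 0"
        by (intro sum_sign_symmetric_zero[of "(i0, False)" "(j, False)"]) (use j rsw in auto)
    qed
    finally show ?thesis .
  qed
  have V2: "(\<Sum>\<pi>\<in>?Perm. of_int (sign \<pi>) * (Z0 (P \<pi>) \<phi> p * (a p * Z1 (Q \<pi>) (R \<pi>) p))) = 0" for p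
  proof -
    have "(\<Sum>\<pi>\<in>?Perm. of_int (sign \<pi>) * (Z0 (P \<pi>) \<phi> p * (a p * Z1 (Q \<pi>) (R \<pi>) p)))
      = (\<Sum>\<pi>\<in>?Perm. \<Sum>j\<in>?I. of_int (sign \<pi>) * (Z0 (P \<pi>) \<phi> p * (a p * (Z1 (Q \<pi>) (g \<pi> j) p * rest j \<pi> p))))"
      unfolding ZR by (simp add: sum_distrib_left)
    also have "\<dots> = (\<Sum>j\<in>?I. \<Sum>\<pi>\<in>?Perm. of_int (sign \<pi>) * (Z0 (P \<pi>) \<phi> p * (a p * (Z1 (Q \<pi>) (g \<pi> j) p * rest j \<pi> p))))"
      by (rule sum.swap)
    also have "\<dots> = 0"
    proof (rule sum.neutral, rule ballI)
      fix j assume j: "j \<in> ?I"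
      define h where "h \<pi> = Z1 (\<pi> (j, True)) (U j)" for \<pi> :: "'n sidx \<Rightarrow> 'n sidx"
      define P' where "P' \<pi> = \<pi> (j, False)" for \<pi> :: "'n sidx \<Rightarrow> 'n sidx"
      have gj: "g \<pi> j = Z0 (P' \<pi>) (h \<pi>)" for \<pi> unfolding g_def P'_def h_def ..
      \<comment> \<open>If \<open>Z1\<close> hits slot \<open>j\<close>, the order is
        \<open>Z1 Z0 Z1\<close>. It is written as \<open>Z0 Z1 Z1\<close> minus a commutator: in
        \<open>?f1\<close> the two \<open>Z1\<close> commute, and in \<open>?f2\<close> the
        commutator is symmetric in the arguments at \<open>(j, False)\<close> and
        \<open>(i0, True)\<close>.\<close>
      let ?f1 = "\<lambda>\<pi>. Z0 (P \<pi>) \<phi> p * (a p * (Z0 (P' \<pi>) (Z1 (Q \<pi>) (h \<pi>)) p * rest j \<pi> p))"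
      let ?f2 = "\<lambda>\<pi>. Z0 (P \<pi>) \<phi> p * (a p * ((Z0 (P' \<pi>) (Z1 (Q \<pi>) (h \<pi>)) p - Z1 (Q \<pi>) (Z0 (P' \<pi>) (h \<pi>)) p) * rest j \<pi> p))"
      have s1: "(\<Sum>\<pi>\<in>?Perm. of_int (sign \<pi>) * ?f1 \<pi>) = 0"
      proof (rule sum_sign_symmetric_zero[of "(i0, True)" "(j, True)"])
        fix \<pi> :: "'n sidx \<Rightarrow> 'n sidx"
        let ?t = "Transposition.transpose (i0, True) (j, True)"
        have "Z1 (Q (\<pi> \<circ> ?t)) (h (\<pi> \<circ> ?t)) = Z1 (Q \<pi>) (h \<pi>)" "P (\<pi> \<circ> ?t) = P \<pi>" "P' (\<pi> \<circ> ?t) = P' \<pi>"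
          unfolding h_def P_def Q_def P'_def using j Z_commute(2)[OF U, of j] by (auto simp: Transposition.transpose_def)
        then show "?f1 (\<pi> \<circ> ?t) = ?f1 \<pi>" using rsw by simp
      qed (use j in auto)
      have s2: "(\<Sum>\<pi>\<in>?Perm. of_int (sign \<pi>) * ?f2 \<pi>) = 0"
      proof (rule sum_sign_symmetric_zero[of "(j, False)" "(i0, True)"])
        fix \<pi> :: "'n sidx \<Rightarrow> 'n sidx"
        let ?t = "Transposition.transpose (j, False) (i0, True)"
        have e: "h (\<pi> \<circ> ?t) = h \<pi>" "P (\<pi> \<circ> ?t) = P \<pi>" "P' (\<pi> \<circ> ?t) = Q \<pi>" "Q (\<pi> \<circ> ?t) = P' \<pi>"
          unfolding h_def P_def Q_def P'_def using j by (auto simp: Transposition.transpose_def)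
        have "Z0 (Q \<pi>) (Z1 (P' \<pi>) (h \<pi>)) p - Z1 (P' \<pi>) (Z0 (Q \<pi>) (h \<pi>)) p
          = Z0 (P' \<pi>) (Z1 (Q \<pi>) (h \<pi>)) p - Z1 (Q \<pi>) (Z0 (P' \<pi>) (h \<pi>)) p"
          unfolding h_def by (rule Z01_commutator_symmetric[OF h2[OF j]])
        then show "?f2 (\<pi> \<circ> ?t) = ?f2 \<pi>" using rsw by (simp add: e)
      qed (use j in auto)
      have "(\<Sum>\<pi>\<in>?Perm. of_int (sign \<pi>) * (Z0 (P \<pi>) \<phi> p * (a p * (Z1 (Q \<pi>) (g \<pi> j) p * rest j \<pi> p))))
        = (\<Sum>\<pi>\<in>?Perm. of_int (sign \<pi>) * ?f1 \<pi>) - (\<Sum>\<pi>\<in>?Perm. of_int (sign \<pi>) * ?f2 \<pi>)"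
        unfolding gj sum_subtractf[symmetric] by (rule sum.cong) (simp_all add: algebra_simps)
      then show "(\<Sum>\<pi>\<in>?Perm. of_int (sign \<pi>) * (Z0 (P \<pi>) \<phi> p * (a p * (Z1 (Q \<pi>) (g \<pi> j) p * rest j \<pi> p)))) = 0"
        unfolding s1 s2 by simp
    qed
    finally show ?thesis .
  qed
  \<comment> \<open>Both integrations by parts leave the order \<open>Z1 Z0\<close> on the test
    function, while \<open>MZ\<close> has \<open>Z0 Z1\<close>; the commutator is symmetric in the
    two arguments of slot \<open>i0\<close> and drops out.\<close>
  have V3: "(\<Sum>\<pi>\<in>?Perm. of_int (sign \<pi>) * (Z1 (Q \<pi>) (Z0 (P \<pi>) \<phi>) p * R \<pi> p)) = MZ (U(i0 := \<phi>)) p" for p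
  proof -
    let ?f = "\<lambda>\<pi>. (Z0 (P \<pi>) (Z1 (Q \<pi>) \<phi>) p - Z1 (Q \<pi>) (Z0 (P \<pi>) \<phi>) p) * R \<pi> p"
    have "(\<Sum>\<pi>\<in>?Perm. of_int (sign \<pi>) * ?f \<pi>) = 0"
    proof (rule sum_sign_symmetric_zero[of "(i0, False)" "(i0, True)"])
      fix \<pi> :: "'n sidx \<Rightarrow> 'n sidx"
      let ?t = "Transposition.transpose (i0, False) (i0, True)"
      have "P (\<pi> \<circ> ?t) = Q \<pi>" "Q (\<pi> \<circ> ?t) = P \<pi>" unfolding P_def Q_def by auto
      then show "?f (\<pi> \<circ> ?t) = ?f \<pi>"
        using Rsw Z01_commutator_symmetric[OF phi, of "Q \<pi>" "P \<pi>" p] by simp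
    qed simp
    then have "(\<Sum>\<pi>\<in>?Perm. of_int (sign \<pi>) * (Z1 (Q \<pi>) (Z0 (P \<pi>) \<phi>) p * R \<pi> p))
      = (\<Sum>\<pi>\<in>?Perm. of_int (sign \<pi>) * (Z0 (P \<pi>) (Z1 (Q \<pi>) \<phi>) p * R \<pi> p))"
      by (simp add: algebra_simps sum_subtractf)
    then show ?thesis by (subst sep) auto
  qed
  have main: "\<phi> p * MZ U p = (\<Sum>\<pi>\<in>?Perm. of_int (sign \<pi>) * (Z0 (P \<pi>) (E1 \<pi>) p - Z1 (Q \<pi>) (E2 \<pi>) p)) + a p * MZ (U(i0 := \<phi>)) p" for p
  proof -
    have e1: "Z0 (P \<pi>) (E1 \<pi>) p = \<phi> p * (Z1 (Q \<pi>) a p * Z0 (P \<pi>) (R \<pi>) p + Z0 (P \<pi>) (Z1 (Q \<pi>) a) p * R \<pi> p)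
        + Z0 (P \<pi>) \<phi> p * (Z1 (Q \<pi>) a p * R \<pi> p)" for \<pi>
      unfolding E1_def[abs_def] Z_mult(1)[OF p1(2) Ck_mult[OF a1(1) R1]] Z_mult(1)[OF a1(1) R1] ..
    have e2: "Z1 (Q \<pi>) (E2 \<pi>) p = Z0 (P \<pi>) \<phi> p * (a p * Z1 (Q \<pi>) (R \<pi>) p + Z1 (Q \<pi>) a p * R \<pi> p)
        + Z1 (Q \<pi>) (Z0 (P \<pi>) \<phi>) p * (a p * R \<pi> p)" for \<pi>
      unfolding E2_def[abs_def] Z_mult(2)[OF p1(1) Ck_mult[OF a1(2) R1]] Z_mult(2)[OF a1(2) R1] ..
    have "(\<Sum>\<pi>\<in>?Perm. of_int (sign \<pi>) * (Z0 (P \<pi>) (E1 \<pi>) p - Z1 (Q \<pi>) (E2 \<pi>) p))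
      = (\<Sum>\<pi>\<in>?Perm. of_int (sign \<pi>) * (\<phi> p * (Z1 (Q \<pi>) a p * Z0 (P \<pi>) (R \<pi>) p))
          + \<phi> p * (of_int (sign \<pi>) * (Z0 (P \<pi>) (Z1 (Q \<pi>) a) p * R \<pi> p))
          - of_int (sign \<pi>) * (Z0 (P \<pi>) \<phi> p * (a p * Z1 (Q \<pi>) (R \<pi>) p))
          - a p * (of_int (sign \<pi>) * (Z1 (Q \<pi>) (Z0 (P \<pi>) \<phi>) p * R \<pi> p)))"
      by (rule sum.cong[OF refl]) (simp add: e1 e2 algebra_simps)
    also have "\<dots> = \<phi> p * MZ U p - a p * MZ (U(i0 := \<phi>)) p"
      unfolding sum.distrib sum_subtractf V1 V2 sum_distrib_left[symmetric] V3
      by (simp add: sep[of U] a_def)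
    finally show ?thesis by simp
  qed
  have ZE: "integrable lborel (Z0 (P \<pi>) (E1 \<pi>))" "integrable lborel (Z1 (Q \<pi>) (E2 \<pi>))" for \<pi>
    by (rule Cc_integrable[OF Ck_continuous[OF Ck_Z(1)[OF E1]] K Z_zero_off(1)[OF cl zE1]], assumption+,
        rule Cc_integrable[OF Ck_continuous[OF Ck_Z(2)[OF E2]] K Z_zero_off(2)[OF cl zE2]], assumption+)
  have i2: "integrable lborel (\<lambda>p. a p * MZ (U(i0 := \<phi>)) p)"
  proof (rule Cc_integrable[OF _ K])
    have "Ck 0 (MZ (U(i0 := \<phi>)))"
      unfolding MZ_def[abs_def]
    proof (intro Ck_sum Ck_mult Ck_const Ck_prod Ck_Z)
      show "Ck (Suc (Suc 0)) ((U(i0 := \<phi>)) i)" for i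
        using phi Ck_Suc_D[OF U] by (cases "i = i0") auto
    qed
    then show "continuous_on UNIV (\<lambda>p. a p * MZ (U(i0 := \<phi>)) p)"
      using Ck_mult[of 0 a "MZ (U(i0 := \<phi>))"] Ck_continuous[OF a1(2)] by simp
    fix x assume x: "x \<notin> K"
    have "Z1 y \<phi> x = 0" if "x \<notin> K" for x y using Z_zero_off[OF cl z that] by simp
    then have "Z0 y' (Z1 y \<phi>) x = 0" for y y' using Z_zero_off(1)[OF cl _ x] by blast
    then have "MZ (U(i0 := \<phi>)) x = 0" by (subst sep) auto
    then show "a x * MZ (U(i0 := \<phi>)) x = 0" by simp
  qed
  have "(\<integral>p. (\<Sum>\<pi>\<in>?Perm. of_int (sign \<pi>) * (Z0 (P \<pi>) (E1 \<pi>) p - Z1 (Q \<pi>) (E2 \<pi>) p)) \<partial>lborel) = 0"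
    using ZE integral_Z_zero(1)[OF E1 K zE1] integral_Z_zero(2)[OF E2 K zE2] by simp
  moreover have "integrable lborel (\<lambda>p. \<Sum>\<pi>\<in>?Perm. of_int (sign \<pi>) * (Z0 (P \<pi>) (E1 \<pi>) p - Z1 (Q \<pi>) (E2 \<pi>) p))"
    using ZE by simp
  ultimately show ?thesis unfolding main using i2 by (simp add: a_def)
qed

subsection \<open>The quaternionic Hessian in terms of the complex fields\<close>

lemma Ck_differentiable: "Ck (Suc k) f \<Longrightarrow> f differentiable (at x)"
  by (simp only: Ck_Suc_iff)

definition cx :: "('a \<Rightarrow> real) \<Rightarrow> 'a \<Rightarrow> complex" where
  "cx u p = complex_of_real (u p)"

lemma Ck_cx: "Ck k u \<Longrightarrow> Ck k (cx u)"
  unfolding cx_def[abs_def] by (rule Ck_bounded_linear_comp[OF bounded_linear_of_real])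

lemma dd_cx: "Ck (Suc k) u \<Longrightarrow> dd v (cx u) = cx (dd v u)"
  unfolding cx_def[abs_def] by (rule ext, rule dd_bounded_linear_comp[OF _ bounded_linear_of_real])

lemma XX_cx: "Ck (Suc k) u \<Longrightarrow> XX l a (cx u) = cx (XX l a u)"
  unfolding XX_def[abs_def] by (simp add: dd_cx) (simp add: cx_def[abs_def])

lemma Ck_XX_real:
  fixes u :: "('n::finite) hpt \<Rightarrow> real"
  assumes "Ck (Suc k) u"
  shows "Ck k (XX l a u)"
  unfolding XX_decomp[OF assms] real_scaleR_def
  by (intro Ck_add Ck_mult Ck_bounded_linear[OF bounded_linear_symp] Ck_dd assms)

lemma hmul_ev: "hmul p (axis l (axis a s), 0) = p + s *\<^sub>R (ev l a, 2 * symp (fst p) (ev l a))"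
proof -
  have "axis l (axis a s) = s *\<^sub>R ev l a" by (simp add: vec_eq_iff axis_def)
  then show ?thesis by (simp add: hmul_def prod_eq_iff symp_linear_right)
qed

lemma hmul_t: "hmul p (0, s) = p + s *\<^sub>R (0, 1)"
  by (simp add: hmul_def prod_eq_iff)

lemma vector_derivative_line:
  assumes "f differentiable (at p)"
  shows "vector_derivative (\<lambda>s. f (p + s *\<^sub>R w)) (at 0) = dd w f p"
proof -
  have d: "(f has_derivative (\<lambda>v. dd v f p)) (at p)"
    using assms unfolding dd_def by (simp add: frechet_derivative_works[symmetric])
  have d': "(f has_derivative (\<lambda>v. dd v f p)) (at (p + 0 *\<^sub>R w))" using d by simp
  have "((\<lambda>s. f (p + s *\<^sub>R w)) has_derivative (\<lambda>h. dd (h *\<^sub>R w) f p)) (at 0)"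
    by (rule has_derivative_compose[where f="\<lambda>s. p + s *\<^sub>R w" and f'="\<lambda>h. h *\<^sub>R w" and g=f, OF _ d'])
      (auto intro!: derivative_eq_intros)
  moreover have "dd (h *\<^sub>R w) f p = h *\<^sub>R dd w f p" for h
    using has_derivative_linear[OF d] by (rule linear_scale)
  ultimately have "((\<lambda>s. f (p + s *\<^sub>R w)) has_vector_derivative dd w f p) (at 0)"
    unfolding has_vector_derivative_def by simp
  then show ?thesis by (rule vector_derivative_at)
qed

lemma HX_eq_XX: "f differentiable (at p) \<Longrightarrow> HX l a f p = XX l a f p"
  unfolding HX_def XX_def hmul_ev by (rule vector_derivative_line)

lemma Ht_eq_TT: "f differentiable (at p) \<Longrightarrow> Ht f p = TT f p"
  unfolding Ht_def hmul_t by (rule vector_derivative_line)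

text \<open>Locally equal functions have the same candidates for a derivative, so the chosen values
  agree even where no derivative exists.\<close>

lemma vector_derivative_line_cong:
  fixes p w :: "'a::real_normed_vector"
  assumes "open U" "p \<in> U" "\<And>x. x \<in> U \<Longrightarrow> f x = g x"
  shows "vector_derivative (\<lambda>s. f (p + s *\<^sub>R w)) (at 0) = vector_derivative (\<lambda>s. g (p + s *\<^sub>R w)) (at 0)"
proof -
  let ?V = "(\<lambda>s::real. p + s *\<^sub>R w) -` U"
  have V: "open ?V" "0 \<in> ?V"
    using assms by (auto intro!: open_vimage continuous_intros)
  have "((\<lambda>s. f (p + s *\<^sub>R w)) has_vector_derivative D) (at 0) \<longleftrightarrow> ((\<lambda>s. g (p + s *\<^sub>R w)) has_vector_derivative D) (at 0)" for D
    by (auto intro: has_vector_derivative_transform_within_open[OF _ V] simp: assms(3))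
  then show ?thesis unfolding vector_derivative_def by simp
qed

lemma HX_cong_open:
  assumes "open U" "p \<in> U" "\<And>x. x \<in> U \<Longrightarrow> f x = g x"
  shows "HX l a f p = HX l a g p"
  unfolding HX_def hmul_ev by (rule vector_derivative_line_cong[OF assms])

lemma Ht_cong_open:
  assumes "open U" "p \<in> U" "\<And>x. x \<in> U \<Longrightarrow> f x = g x"
  shows "Ht f p = Ht g p"
  unfolding Ht_def hmul_t by (rule vector_derivative_line_cong[OF assms])

text \<open>This locality is what allows a function given on an open set to be replaced by its
  product with a cut-off that is 1 near the point.\<close>

lemma qhess_cong_open:
  assumes "open U" "p \<in> U" "\<And>x. x \<in> U \<Longrightarrow> u x = v x"
  shows "qhess u p = qhess v p"
proof -
  have "Qop m u x = Qop m v x" if "x \<in> U" for m x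
  proof -
    have "HX m a u x = HX m a v x" for a by (rule HX_cong_open[OF assms(1) that]) (rule assms(3))
    then show ?thesis unfolding Qop_def by simp
  qed
  then have "HX l a (Qop m u) p = HX l a (Qop m v) p" for l a m
    by (rule HX_cong_open[OF assms(1,2)])
  moreover have "Ht u p = Ht v p" by (rule Ht_cong_open[OF assms(1,2)]) (rule assms(3))
  ultimately show ?thesis unfolding fun_eq_iff qhess_def Qbar_def by simp
qed

context
  fixes u :: "('n::finite) hpt \<Rightarrow> real"
  assumes u: "Ck (Suc (Suc 0)) u"
begin

lemma Qop_eq: "Qop m u = (\<lambda>p. XX m 1 u p *\<^sub>R qone - XX m 2 u p *\<^sub>R qi - XX m 3 u p *\<^sub>R qj - XX m 4 u p *\<^sub>R qk)"
proof -
  have "u differentiable (at p)" for p by (rule Ck_differentiable[OF u])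
  then show ?thesis unfolding fun_eq_iff Qop_def by (simp add: HX_eq_XX)
qed

lemma HX_Qop: "HX l a (Qop m u) p = XX l a (XX m 1 u) p *\<^sub>R qone - XX l a (XX m 2 u) p *\<^sub>R qi
    - XX l a (XX m 3 u) p *\<^sub>R qj - XX l a (XX m 4 u) p *\<^sub>R qk"
proof -
  have X: "(XX m b u has_derivative (\<lambda>v. dd v (XX m b u) p)) (at p)" for b
    by (rule Ck_has_derivative[OF Ck_XX_real[OF u]])
  have d: "(Qop m u has_derivative (\<lambda>v. dd v (XX m 1 u) p *\<^sub>R qone - dd v (XX m 2 u) p *\<^sub>R qi
      - dd v (XX m 3 u) p *\<^sub>R qj - dd v (XX m 4 u) p *\<^sub>R qk)) (at p)"
    unfolding Qop_eq by (intro has_derivative_diff has_derivative_scaleR_left X)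
  have "HX l a (Qop m u) p = XX l a (Qop m u) p"
    by (rule HX_eq_XX) (use d in \<open>auto simp: differentiable_def\<close>)
  also have "\<dots> = XX l a (XX m 1 u) p *\<^sub>R qone - XX l a (XX m 2 u) p *\<^sub>R qi
    - XX l a (XX m 3 u) p *\<^sub>R qj - XX l a (XX m 4 u) p *\<^sub>R qk"
    unfolding XX_def[of l a "Qop m u"] dd_eqI[OF d] by (simp add: XX_def[of l a "XX m b u" p for b])
  finally show ?thesis .
qed

lemma qhess_nth:
  shows "qhess u p l m $ 1 = XX l 1 (XX m 1 u) p + XX l 2 (XX m 2 u) p + XX l 3 (XX m 3 u) p + XX l 4 (XX m 4 u) p"
    "qhess u p l m $ 2 = XX l 2 (XX m 1 u) p - XX l 1 (XX m 2 u) p - XX l 3 (XX m 4 u) p + XX l 4 (XX m 3 u) p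
       + (if l = m then 8 * TT u p else 0)"
    "qhess u p l m $ 3 = XX l 3 (XX m 1 u) p - XX l 1 (XX m 3 u) p + XX l 2 (XX m 4 u) p - XX l 4 (XX m 2 u) p"
    "qhess u p l m $ 4 = XX l 4 (XX m 1 u) p - XX l 1 (XX m 4 u) p - XX l 2 (XX m 3 u) p + XX l 3 (XX m 2 u) p"
proof -
  have t: "Ht u p = TT u p" by (rule Ht_eq_TT[OF Ck_differentiable[OF u]])
  show "qhess u p l m $ 1 = XX l 1 (XX m 1 u) p + XX l 2 (XX m 2 u) p + XX l 3 (XX m 3 u) p + XX l 4 (XX m 4 u) p"
    "qhess u p l m $ 2 = XX l 2 (XX m 1 u) p - XX l 1 (XX m 2 u) p - XX l 3 (XX m 4 u) p + XX l 4 (XX m 3 u) p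
       + (if l = m then 8 * TT u p else 0)"
    "qhess u p l m $ 3 = XX l 3 (XX m 1 u) p - XX l 1 (XX m 3 u) p + XX l 2 (XX m 4 u) p - XX l 4 (XX m 2 u) p"
    "qhess u p l m $ 4 = XX l 4 (XX m 1 u) p - XX l 1 (XX m 4 u) p - XX l 2 (XX m 3 u) p + XX l 3 (XX m 2 u) p"
    unfolding qhess_def Qbar_def HX_Qop t by simp_all
qed

lemma XX_commutator_real: "XX m b (XX l a u) p = XX l a (XX m b u) p - 4 * symp (ev l a) (ev m b) * TT u p"
proof -
  have "XX l a (XX m b (cx u)) p - XX m b (XX l a (cx u)) p = of_real (4 * symp (ev l a) (ev m b)) * TT (cx u) p"
    by (rule XX_commutator[OF Ck_cx[OF u]])
  then have "complex_of_real (XX l a (XX m b u) p - XX m b (XX l a u) p) = of_real (4 * symp (ev l a) (ev m b) * TT u p)"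
    unfolding XX_cx[OF u] XX_cx[OF Ck_XX_real[OF u]] dd_cx[OF u] cx_def by simp
  then show ?thesis by (simp only: of_real_eq_iff)
qed

text \<open>This has the form required by \<open>mixD_skew\<close>, so the mixed determinant of
  Hessians becomes an alternating sum of products of second-order operators.\<close>

lemma pfE_qhess: "pfE (qhess u p) x y = Z0 x (Z1 y (cx u)) p - Z0 y (Z1 x (cx u)) p"
proof -
  obtain l s m t where xy: "x = (l, s)" "y = (m, t)" by (metis surj_pair)
  note ZZ = ZZ_ZZ[OF Ck_cx[OF u]]
  have c: "XX l a (XX m b (cx u)) p = of_real (XX l a (XX m b u) p)" for l a m b
    unfolding XX_cx[OF u] XX_cx[OF Ck_XX_real[OF u]] cx_def ..
  show ?thesis
    unfolding xy pfE_def pfB_def qcA_def qcB_def Z0_def Z1_def fst_conv snd_conv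
    by (cases s; cases t; simp only: if_True if_False ZZ c XX_commutator_real[of m _ l] symp_ev;
        simp add: complex_eq_iff qhess_nth)
qed

text \<open>On the diagonal the commutators of the coordinate pairs 1, 2 and 3, 4 contribute
  \<open>-8\<close> times the central derivative to the \<open>qi\<close> component; this is exactly
  what the extra term in \<open>qhess\<close> cancels. Off the diagonal the fields commute.\<close>

lemma qherm_qhess: "qherm UNIV (qhess u p)"
  unfolding qherm_def
proof (intro ballI)
  fix l m
  show "qhess u p m l = qconj (qhess u p l m)"
  proof (cases "l = m")
    case True
    have c: "XX m 2 (XX m 1 u) p = XX m 1 (XX m 2 u) p - 4 * TT u p" "XX m 4 (XX m 3 u) p = XX m 3 (XX m 4 u) p - 4 * TT u p"
      "XX m 3 (XX m 1 u) p = XX m 1 (XX m 3 u) p" "XX m 4 (XX m 2 u) p = XX m 2 (XX m 4 u) p"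
      "XX m 4 (XX m 1 u) p = XX m 1 (XX m 4 u) p" "XX m 3 (XX m 2 u) p = XX m 2 (XX m 3 u) p"
      using XX_commutator_real[of m 2 m 1 p] XX_commutator_real[of m 4 m 3 p] XX_commutator_real[of m 3 m 1 p]
        XX_commutator_real[of m 4 m 2 p] XX_commutator_real[of m 4 m 1 p] XX_commutator_real[of m 3 m 2 p]
      by (simp_all add: symp_ev)
    show ?thesis unfolding True quat_eq_iff qconj_nth qhess_nth c by simp
  next
    case False
    have c: "XX m b (XX l a u) p = XX l a (XX m b u) p" for a b
      using XX_commutator_real[of m b l a p] False by (simp add: symp_ev)
    show ?thesis unfolding quat_eq_iff qconj_nth qhess_nth c using False by simp
  qed
qed

end

lemma mixD_qhess:
  assumes "\<And>i. Ck (Suc (Suc 0)) (u i :: ('n::finite) hpt \<Rightarrow> real)"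
  shows "mixD (\<lambda>i. qhess (u i) p) = 2 ^ CARD('n) * MZ (\<lambda>i. cx (u i)) p"
  unfolding MZ_def by (rule mixD_skew[where W="\<lambda>i x y. Z0 x (Z1 y (cx (u i))) p"]) (rule pfE_qhess[OF assms])

section \<open>Uniform limits and the exchange formula for C^2 functions\<close>

text \<open>Continuity of the limit is carried along because it bounds the limit on compact sets,
  without which uniform limits cannot be multiplied.\<close>

definition ulim :: "'a::topological_space set \<Rightarrow> (nat \<Rightarrow> 'a \<Rightarrow> 'b::real_normed_vector) \<Rightarrow> ('a \<Rightarrow> 'b) \<Rightarrow> bool" where
  "ulim X f l \<longleftrightarrow> uniform_limit X f l sequentially \<and> continuous_on X l"

lemma ulim_const: "continuous_on X s \<Longrightarrow> ulim X (\<lambda>n. s) s"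
  unfolding ulim_def by (auto intro: uniform_limit_const)

lemma ulim_add: "ulim X f l \<Longrightarrow> ulim X g m \<Longrightarrow> ulim X (\<lambda>n x. f n x + g n x) (\<lambda>x. l x + m x)"
  unfolding ulim_def by (auto intro: uniform_limit_add continuous_on_add)

lemma ulim_mult:
  fixes f g :: "nat \<Rightarrow> 'a::topological_space \<Rightarrow> 'b::real_normed_algebra"
  assumes "compact X" "ulim X f l" "ulim X g m"
  shows "ulim X (\<lambda>n x. f n x * g n x) (\<lambda>x. l x * m x)"
proof -
  have "bounded (l ` X)" "bounded (m ` X)"
    using assms unfolding ulim_def by (auto intro: compact_imp_bounded compact_continuous_image)
  then show ?thesis using assms unfolding ulim_def by (auto intro: uniform_lim_mult continuous_on_mult)
qed

lemma ulim_sum: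
  "(\<And>i. i \<in> I \<Longrightarrow> ulim X (f i) (l i)) \<Longrightarrow> ulim X (\<lambda>n x. \<Sum>i\<in>I. f i n x) (\<lambda>x. \<Sum>i\<in>I. l i x)"
  by (induct I rule: infinite_finite_induct) (auto intro: ulim_add ulim_const)

lemma ulim_prod:
  fixes f :: "'i \<Rightarrow> nat \<Rightarrow> 'a::topological_space \<Rightarrow> 'b::{real_normed_algebra,comm_monoid_mult}"
  assumes "compact X"
  shows "(\<And>i. i \<in> I \<Longrightarrow> ulim X (f i) (l i)) \<Longrightarrow> ulim X (\<lambda>n x. \<Prod>i\<in>I. f i n x) (\<lambda>x. \<Prod>i\<in>I. l i x)"
  by (induct I rule: infinite_finite_induct) (auto intro: ulim_mult[OF assms] ulim_const)

lemma ulim_cx: "ulim X f l \<Longrightarrow> ulim X (\<lambda>n. cx (f n)) (cx l)"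
proof -
  assume "ulim X f l"
  moreover have "dist (cx a x) (cx b x) = dist (a x) (b x)" for a b :: "'a \<Rightarrow> real" and x
    unfolding cx_def dist_norm by (metis norm_of_real of_real_diff real_norm_def)
  moreover have "continuous_on X l \<Longrightarrow> continuous_on X (cx l)"
    unfolding cx_def[abs_def] by (rule continuous_on_of_real)
  ultimately show ?thesis unfolding ulim_def uniform_limit_iff by simp
qed

lemma ulim_integral:
  fixes F :: "nat \<Rightarrow> 'a::euclidean_space \<Rightarrow> 'b::euclidean_space"
  assumes u: "ulim (cbox a b) F f" and c: "\<And>n. continuous_on UNIV (F n)" "continuous_on UNIV f"
    and z: "\<And>n x. x \<notin> cbox a b \<Longrightarrow> F n x = 0" "\<And>x. x \<notin> cbox a b \<Longrightarrow> f x = 0"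
  shows "(\<lambda>n. \<integral>x. F n x \<partial>lborel) \<longlonglongrightarrow> (\<integral>x. f x \<partial>lborel)"
proof -
  have "uniform_limit (cbox a b) F f sequentially" using u by (simp add: ulim_def)
  then obtain I J where IJ: "\<And>n. (F n has_integral I n) (cbox a b)" "(f has_integral J) (cbox a b)" "I \<longlonglongrightarrow> J"
    by (rule uniform_limit_integral_cbox) (auto intro: continuous_on_subset[OF c(1)])
  have "I n = (\<integral>x. F n x \<partial>lborel)" for n
    using Cc_integral_cbox[OF c(1) z(1)] integral_unique[OF IJ(1)] by metis
  moreover have "J = (\<integral>x. f x \<partial>lborel)"
    using Cc_integral_cbox[OF c(2) z(2)] integral_unique[OF IJ(2)] by metis
  ultimately show ?thesis using IJ(3) by (metis (no_types, lifting) ext)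
qed

lemma ulim_moll:
  assumes g: "continuous_on UNIV g" and z: "\<And>x. x \<notin> cbox a b \<Longrightarrow> g x = 0"
  shows "ulim X (\<lambda>n. moll a b n g) g"
  unfolding ulim_def
  using uniform_limit_on_subset[OF moll_uniform_limit[OF g z]] continuous_on_subset[OF g] by blast

text \<open>Constant-coefficient derivatives commute with mollification and thus converge uniformly.
  The fields have variable coefficients, so second-order expressions are first expanded by
  \<open>XX_XX\<close> into such derivatives with fixed continuous coefficients.\<close>

lemma ulim_Z_moll:
  fixes u :: "('n::finite) hpt \<Rightarrow> real"
  assumes X: "compact X" and u: "Ck (Suc (Suc 0)) u" and z: "\<And>x. x \<notin> cbox a b \<Longrightarrow> u x = 0"
  shows "ulim X (\<lambda>n. Z0 x (Z1 y (cx (moll a b n u)))) (Z0 x (Z1 y (cx u)))"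
proof -
  have u1: "Ck (Suc 0) u" by (rule Ck_Suc_D[OF u])
  have ud: "Ck (Suc 0) (dd v u)" for v by (rule Ck_dd[OF u])
  have zd: "dd v u p = 0" if "p \<notin> cbox a b" for v p by (rule dd_zero_off[OF closed_cbox z that])
  have zdd: "dd w (dd v u) p = 0" if "p \<notin> cbox a b" for v w p by (rule dd_zero_off[OF closed_cbox zd that])
  have m3: "Ck 3 (moll a b n u)" for n by (rule Ck_moll[OF Ck_continuous[OF u]])
  have m: "Ck (Suc (Suc 0)) (moll a b n u)" "Ck (Suc 0) (moll a b n u)" for n
    by (rule Ck_mono[OF m3], simp)+
  have md: "dd v (moll a b n u) = moll a b n (dd v u)" "dd w (moll a b n (dd v u)) = moll a b n (dd w (dd v u))" for v w n
    using dd_moll[OF u1 z] dd_moll[OF ud zd] by auto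
  have mc: "Ck (Suc 0) (moll a b n (dd v u))" for n v
    using Ck_dd[OF m(1)] unfolding md .
  have L1: "ulim X (\<lambda>n. dd v (cx (moll a b n u))) (dd v (cx u))" for v
    unfolding dd_cx[OF m(2)] dd_cx[OF u1] md
    by (rule ulim_cx, rule ulim_moll[OF Ck_continuous[OF ud] zd])
  have L2: "ulim X (\<lambda>n. dd w (dd v (cx (moll a b n u)))) (dd w (dd v (cx u)))" for v w
    unfolding dd_cx[OF m(2)] dd_cx[OF u1] md dd_cx[OF mc] dd_cx[OF ud]
    by (rule ulim_cx, rule ulim_moll[OF Ck_continuous[OF Ck_dd[OF ud]] zdd])
  have s: "continuous_on X (\<lambda>p. complex_of_real (2 * symp (fst p) v))" for v
    using Ck_continuous[OF Ck_symp] continuous_on_subset by blast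
  have L3: "ulim X (\<lambda>n. XX l a' (XX m b' (cx (moll a b n u)))) (XX l a' (XX m b' (cx u)))" for l a' m b'
    unfolding XX_XX[OF Ck_cx[OF m(1)], abs_def] XX_XX[OF Ck_cx[OF u], abs_def]
    by (intro ulim_add ulim_mult[OF X] ulim_const[OF s] ulim_const[OF continuous_on_const] L1 L2)
  have L4: "ulim X (\<lambda>n. ZZ l c a' d b' (ZZ m c' a'' d' b'' (cx (moll a b n u)))) (ZZ l c a' d b' (ZZ m c' a'' d' b'' (cx u)))"
    for l c a' d b' m c' a'' d' b''
    unfolding ZZ_ZZ[OF Ck_cx[OF m(1)], abs_def] ZZ_ZZ[OF Ck_cx[OF u], abs_def]
    by (intro ulim_add ulim_mult[OF X] ulim_const[OF continuous_on_const] L3)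
  show ?thesis unfolding Z0_def Z1_def using L4 by auto
qed

lemma Ck_MZ:
  assumes "\<And>i. Ck (Suc (Suc 0)) (U i)"
  shows "continuous_on UNIV (MZ U)"
proof -
  have "Ck 0 (MZ U)"
    unfolding MZ_def[abs_def] by (intro Ck_sum Ck_mult Ck_const Ck_prod Ck_Z assms)
  then show ?thesis by simp
qed

definition mixR :: "('n::finite \<Rightarrow> 'n hpt \<Rightarrow> real) \<Rightarrow> 'n hpt \<Rightarrow> real" where
  "mixR u p = Re (mixD (\<lambda>i. qhess (u i) p))"

lemma mixR_eq:
  assumes "\<And>i. Ck (Suc (Suc 0)) (u i :: ('n::finite) hpt \<Rightarrow> real)"
  shows "mixR u p = 2 ^ CARD('n) * Re (MZ (\<lambda>i. cx (u i)) p)"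
proof -
  have "Re (complex_of_real c * z) = c * Re z" for c z by simp
  from this[of "2 ^ CARD('n)"] show ?thesis
    unfolding mixR_def mixD_qhess[OF assms] by simp
qed

text \<open>The functions in the slots other than \<open>i0\<close> are mollified to gain the third
  derivative; the smooth exchange is applied and the limit taken on both sides, which involve second
  derivatives only.\<close>

lemma integral_mixR_swap_Cc:
  fixes u :: "'n::finite \<Rightarrow> 'n hpt \<Rightarrow> real"
  assumes phi: "Ck (Suc (Suc 0)) \<phi>" "\<And>x. x \<notin> cbox a b \<Longrightarrow> \<phi> x = 0"
    and u: "\<And>i. Ck (Suc (Suc 0)) (u i)" "\<And>i x. x \<notin> cbox a b \<Longrightarrow> u i x = 0"
  shows "(\<integral>p. \<phi> p * mixR u p \<partial>lborel) = (\<integral>p. u i0 p * mixR (u(i0 := \<phi>)) p \<partial>lborel)"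
proof -
  let ?X = "cbox a b"
  define V where "V n i = (if i = i0 then u i0 else moll a b n (u i))" for n i
  have V3: "Ck (Suc (Suc (Suc 0))) (V n i)" if "i \<noteq> i0" for n i
    unfolding V_def using that Ck_moll[OF Ck_continuous[OF u(1)[of i]], of a b n] by (simp add: numeral_3_eq_3)
  have V2: "Ck (Suc (Suc 0)) (V n i)" for n i
    using V3[THEN Ck_Suc_D] u(1) by (cases "i = i0") (auto simp: V_def)
  have cphi: "Ck (Suc (Suc 0)) (cx \<phi>)" by (rule Ck_cx[OF phi(1)])
  have zphi: "cx \<phi> x = 0" if "x \<notin> ?X" for x using phi(2)[OF that] by (simp add: cx_def)
  let ?W = "\<lambda>n. (\<lambda>i. cx (V n i))"
  let ?U = "\<lambda>i. cx (u i)"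
  have swap: "(\<integral>p. cx \<phi> p * MZ (?W n) p \<partial>lborel) = (\<integral>p. cx (u i0) p * MZ ((?W n)(i0 := cx \<phi>)) p \<partial>lborel)" for n
  proof -
    have "(\<integral>p. cx \<phi> p * MZ (?W n) p \<partial>lborel) = (\<integral>p. ?W n i0 p * MZ ((?W n)(i0 := cx \<phi>)) p \<partial>lborel)"
      by (rule integral_MZ_swap_smooth[OF cphi compact_cbox[of a b] zphi Ck_cx[OF V2] Ck_cx[OF V3]])
    moreover have "V n i0 = u i0" by (simp add: V_def)
    ultimately show ?thesis by (simp only:)
  qed
  have LZ: "ulim ?X (\<lambda>n. Z0 x (Z1 y (?W n i))) (Z0 x (Z1 y (?U i)))" for x y i
  proof (cases "i = i0")
    case True
    have "Ck 0 (Z0 x (Z1 y (cx (u i0))))" by (intro Ck_Z Ck_cx u(1))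
    then show ?thesis using True by (auto simp: V_def intro!: ulim_const intro: continuous_on_subset)
  next
    case False
    then show ?thesis using ulim_Z_moll[OF compact_cbox u(1) u(2)] by (simp add: V_def)
  qed
  have LZ': "ulim ?X (\<lambda>n. Z0 x (Z1 y (((?W n)(i0 := cx \<phi>)) i))) (Z0 x (Z1 y ((?U(i0 := cx \<phi>)) i)))" for x y i
  proof (cases "i = i0")
    case True
    have "Ck 0 (Z0 x (Z1 y (cx \<phi>)))" by (intro Ck_Z cphi)
    then show ?thesis using True by (auto intro!: ulim_const intro: continuous_on_subset)
  next
    case False
    then show ?thesis using LZ by simp
  qed
  have cc: "continuous_on UNIV (cx \<phi>)" "continuous_on UNIV (cx (u i0))"
    by (rule Ck_continuous[OF cphi], rule Ck_continuous[OF Ck_cx[OF u(1)]])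
  have cM: "continuous_on UNIV (MZ (?W n))" "continuous_on UNIV (MZ ?U)"
    "continuous_on UNIV (MZ ((?W n)(i0 := cx \<phi>)))" "continuous_on UNIV (MZ (?U(i0 := cx \<phi>)))" for n
    by ((rule Ck_MZ, (simp add: Ck_cx V2 u(1) phi(1))), rule Ck_MZ, (simp add: Ck_cx V2 u(1) phi(1)),
      rule Ck_MZ, (simp add: Ck_cx V2 u(1) phi(1)), rule Ck_MZ, (simp add: Ck_cx V2 u(1) phi(1)))
  have l1: "(\<lambda>n. \<integral>p. cx \<phi> p * MZ (?W n) p \<partial>lborel) \<longlonglongrightarrow> (\<integral>p. cx \<phi> p * MZ ?U p \<partial>lborel)"
  proof (rule ulim_integral[of a b])
    show "ulim ?X (\<lambda>n p. cx \<phi> p * MZ (?W n) p) (\<lambda>p. cx \<phi> p * MZ ?U p)"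
      unfolding MZ_def[abs_def]
      by (intro ulim_mult[OF compact_cbox] ulim_sum ulim_prod[OF compact_cbox] LZ ulim_const[OF continuous_on_const] ulim_const[OF continuous_on_subset[OF cc(1)]]) simp
  qed (use zphi cc cM in \<open>auto intro: continuous_on_mult\<close>)
  have l2: "(\<lambda>n. \<integral>p. cx (u i0) p * MZ ((?W n)(i0 := cx \<phi>)) p \<partial>lborel) \<longlonglongrightarrow> (\<integral>p. cx (u i0) p * MZ (?U(i0 := cx \<phi>)) p \<partial>lborel)"
  proof (rule ulim_integral[of a b])
    show "ulim ?X (\<lambda>n p. cx (u i0) p * MZ ((?W n)(i0 := cx \<phi>)) p) (\<lambda>p. cx (u i0) p * MZ (?U(i0 := cx \<phi>)) p)"
      unfolding MZ_def[abs_def]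
      by (intro ulim_mult[OF compact_cbox] ulim_sum ulim_prod[OF compact_cbox] LZ' ulim_const[OF continuous_on_const] ulim_const[OF continuous_on_subset[OF cc(2)]]) simp
    show "cx (u i0) x * MZ ((?W n)(i0 := cx \<phi>)) x = 0" "cx (u i0) x * MZ (?U(i0 := cx \<phi>)) x = 0" if "x \<notin> ?X" for n x
      using u(2)[OF that, of i0] by (simp_all add: cx_def)
  qed (use cc cM in \<open>auto intro: continuous_on_mult\<close>)
  have main: "(\<integral>p. cx \<phi> p * MZ ?U p \<partial>lborel) = (\<integral>p. cx (u i0) p * MZ (?U(i0 := cx \<phi>)) p \<partial>lborel)"
    by (rule LIMSEQ_unique[OF l1]) (use l2 swap in simp)
  have i1: "integrable lborel (\<lambda>p. cx \<phi> p * MZ ?U p)" and i2: "integrable lborel (\<lambda>p. cx (u i0) p * MZ (?U(i0 := cx \<phi>)) p)"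
    by (rule Cc_integrable[OF continuous_on_mult[OF cc(1) cM(2)] compact_cbox[of a b]], simp add: zphi,
      rule Cc_integrable[OF continuous_on_mult[OF cc(2) cM(4)] compact_cbox[of a b]], simp add: u(2) cx_def)
  have up: "?U(i0 := cx \<phi>) = (\<lambda>i. cx ((u(i0 := \<phi>)) i))" by auto
  have u': "Ck (Suc (Suc 0)) ((u(i0 := \<phi>)) i)" for i using u(1) phi(1) by simp
  have e1: "\<phi> p * mixR u p = 2 ^ CARD('n) * Re (cx \<phi> p * MZ ?U p)" for p
    unfolding mixR_eq[OF u(1)] by (simp add: cx_def)
  have e2: "u i0 p * mixR (u(i0 := \<phi>)) p = 2 ^ CARD('n) * Re (cx (u i0) p * MZ (?U(i0 := cx \<phi>)) p)" for p
    unfolding mixR_eq[OF u'] up by (simp add: cx_def)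
  show ?thesis unfolding e1 e2 using integral_Re[OF i1] integral_Re[OF i2] main by simp
qed

lemma continuous_mixR:
  assumes "\<And>i. Ck (Suc (Suc 0)) (u i :: ('n::finite) hpt \<Rightarrow> real)"
  shows "continuous_on UNIV (mixR u)"
  unfolding mixR_eq[OF assms, abs_def]
  by (intro continuous_intros Ck_MZ Ck_cx assms)

subsection \<open>Local regularity and cut-off\<close>

text \<open>A local form of \<open>Ck\<close> that links the basis-wise condition
  \<open>C2_on\<close> to global regularity after multiplication by a cut-off
  (\<open>Ck_cutoff_mult\<close>).\<close>

fun Ck_on :: "nat \<Rightarrow> 'a::euclidean_space set \<Rightarrow> ('a \<Rightarrow> real) \<Rightarrow> bool" where
  "Ck_on 0 S f \<longleftrightarrow> continuous_on S f"
| "Ck_on (Suc k) S f \<longleftrightarrow> (\<forall>x\<in>S. f differentiable (at x)) \<and> (\<forall>v. Ck_on k S (dd v f))"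

lemma Ck_on_cong:
  assumes "open S"
  shows "(\<And>x. x \<in> S \<Longrightarrow> f x = g x) \<Longrightarrow> Ck_on k S f \<Longrightarrow> Ck_on k S g"
proof (induct k arbitrary: f g)
  case 0
  then show ?case using continuous_on_cong by fastforce
next
  case (Suc k)
  have "g differentiable (at x)" if "x \<in> S" for x
  proof -
    obtain D where "(f has_derivative D) (at x)" using Suc(3) \<open>x \<in> S\<close> unfolding Ck_on.simps differentiable_def by blast
    then have "(g has_derivative D) (at x)"
      by (rule has_derivative_transform_within_open[OF _ assms \<open>x \<in> S\<close> Suc(2)])
    then show ?thesis unfolding differentiable_def by blast
  qed
  moreover have "Ck_on k S (dd v g)" for v
  proof (rule Suc(1))
    show "dd v f x = dd v g x" if "x \<in> S" for x by (rule dd_cong_open[OF assms that Suc(2)])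
    show "Ck_on k S (dd v f)" using Suc(3) by simp
  qed
  ultimately show ?case by simp
qed

lemma Ck_on_Suc_D: "Ck_on (Suc k) S f \<Longrightarrow> Ck_on k S f"
proof (induct k arbitrary: f)
  case 0
  then show ?case
    by (auto intro!: continuous_at_imp_continuous_on differentiable_imp_continuous_within)
next
  case (Suc k)
  then show ?case by simp
qed

lemma Ck_on_add:
  assumes S: "open S"
  shows "Ck_on k S f \<Longrightarrow> Ck_on k S g \<Longrightarrow> Ck_on k S (\<lambda>x. f x + g x)"
proof (induct k arbitrary: f g)
  case 0
  then show ?case by (auto intro: continuous_on_add)
next
  case (Suc k)
  have "Ck_on k S (dd v (\<lambda>x. f x + g x))" for v
  proof (rule Ck_on_cong[OF S])
    show "Ck_on k S (\<lambda>x. dd v f x + dd v g x)" using Suc by simp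
    fix x assume "x \<in> S"
    then have "(f has_derivative (\<lambda>v. dd v f x)) (at x)" "(g has_derivative (\<lambda>v. dd v g x)) (at x)"
      using Suc(2,3) unfolding dd_def by (simp_all add: frechet_derivative_works[symmetric])
    from dd_eqI[OF has_derivative_add[OF this]]
    show "dd v f x + dd v g x = dd v (\<lambda>x. f x + g x) x" by simp
  qed
  then show ?case using Suc(2,3) by simp
qed

lemma Ck_on_cmult:
  assumes S: "open S"
  shows "Ck_on k S f \<Longrightarrow> Ck_on k S (\<lambda>x. c * f x)"
proof (induct k arbitrary: f)
  case 0
  then show ?case by (auto intro: continuous_intros)
next
  case (Suc k)
  have "Ck_on k S (dd v (\<lambda>x. c * f x))" for v
  proof (rule Ck_on_cong[OF S])
    show "Ck_on k S (\<lambda>x. c * dd v f x)" using Suc by simp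
    fix x assume "x \<in> S"
    then have "(f has_derivative (\<lambda>v. dd v f x)) (at x)"
      using Suc(2) unfolding dd_def by (simp_all add: frechet_derivative_works[symmetric])
    from dd_eqI[OF has_derivative_mult_right[OF this]]
    show "c * dd v f x = dd v (\<lambda>x. c * f x) x" by simp
  qed
  then show ?case using Suc(2) by simp
qed

lemma Ck_on_sum:
  assumes "open S"
  shows "(\<And>i. i \<in> I \<Longrightarrow> Ck_on k S (f i)) \<Longrightarrow> Ck_on k S (\<lambda>x. \<Sum>i\<in>I. f i x)"
proof (induct I rule: infinite_finite_induct)
  case empty
  have "Ck_on k S (\<lambda>x. 0)"
  proof (induct k)
    case (Suc k)
    have "dd v (\<lambda>x::'a. 0::real) = (\<lambda>x. 0)" for v by (rule ext, rule dd_eqI[where f'="\<lambda>v. 0"]) simp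
    then show ?case using Suc by simp
  qed simp
  then show ?case by simp
next
  case (infinite I)
  have "Ck_on k S (\<lambda>x. 0)"
  proof (induct k)
    case (Suc k)
    have "dd v (\<lambda>x::'a. 0::real) = (\<lambda>x. 0)" for v by (rule ext, rule dd_eqI[where f'="\<lambda>v. 0"]) simp
    then show ?case using Suc by simp
  qed simp
  then show ?case using infinite by simp
next
  case (insert i I)
  then show ?case using Ck_on_add[OF assms] by simp
qed

lemma linear_Basis_expand:
  fixes g :: "'a::euclidean_space \<Rightarrow> 'b::real_vector"
  assumes l: "linear g"
  shows "g v = (\<Sum>b\<in>Basis. (v \<bullet> b) *\<^sub>R g b)"
proof -
  have "g v = g (\<Sum>b\<in>Basis. (v \<bullet> b) *\<^sub>R b)" by (simp add: euclidean_representation)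
  also have "\<dots> = (\<Sum>b\<in>Basis. g ((v \<bullet> b) *\<^sub>R b))" by (rule linear_sum[OF l])
  finally show ?thesis by (simp add: linear_scale[OF l])
qed

lemma dd_Basis_expand:
  fixes f :: "'a::euclidean_space \<Rightarrow> real"
  assumes "f differentiable (at x)"
  shows "dd v f x = (\<Sum>b\<in>Basis. (v \<bullet> b) * dd b f x)"
  unfolding dd_def using linear_Basis_expand[OF linear_frechet_derivative[OF assms], of v] by simp

lemma C1_on_Ck_on:
  assumes S: "open S" and f: "C1_on S f"
  shows "Ck_on 1 S f"
proof -
  have d: "f differentiable (at x)" if "x \<in> S" for x using f that unfolding C1_on_def by blast
  have "continuous_on S (dd v f)" for v
  proof -
    have "dd v f x = (\<Sum>b\<in>Basis. (v \<bullet> b) * dd b f x)" if "x \<in> S" for x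
      by (rule dd_Basis_expand[OF d[OF that]])
    moreover have "continuous_on S (\<lambda>x. \<Sum>b\<in>Basis. (v \<bullet> b) * dd b f x)"
      using f unfolding C1_on_def dd_def by (intro continuous_intros) auto
    ultimately show ?thesis by (subst continuous_on_cong[OF refl]) auto
  qed
  then show ?thesis using d by simp
qed

lemma C2_on_Ck_on:
  assumes S: "open S" and f: "C2_on S f"
  shows "Ck_on (Suc (Suc 0)) S f"
proof -
  have f1: "C1_on S f" and f2: "\<And>b. b \<in> Basis \<Longrightarrow> C1_on S (dd b f)"
    using f unfolding C2_on_def dd_def[abs_def] by auto
  have d: "f differentiable (at x)" if "x \<in> S" for x using f1 that unfolding C1_on_def by blast
  have "Ck_on (Suc 0) S (dd v f)" for v
  proof (rule Ck_on_cong[OF S])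
    show "Ck_on (Suc 0) S (\<lambda>x. \<Sum>b\<in>Basis. (v \<bullet> b) * dd b f x)"
      by (intro Ck_on_sum[OF S] Ck_on_cmult[OF S]) (use C1_on_Ck_on[OF S f2] in simp)
    show "(\<Sum>b\<in>Basis. (v \<bullet> b) * dd b f x) = dd v f x" if "x \<in> S" for x
      by (rule dd_Basis_expand[OF d[OF that], symmetric])
  qed
  then show ?thesis using d by simp
qed

lemma Ck_cutoff_mult:
  assumes S: "open S" and K: "closed K" "K \<subseteq> S"
  shows "Ck k \<psi> \<Longrightarrow> (\<And>x. x \<notin> K \<Longrightarrow> \<psi> x = 0) \<Longrightarrow> Ck_on k S u \<Longrightarrow> Ck k (\<lambda>x. \<psi> x * u x)"
proof (induct k arbitrary: \<psi> u)
  case 0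
  have "isCont (\<lambda>x. \<psi> x * u x) x" for x
  proof (cases "x \<in> S")
    case True
    have "isCont \<psi> x" "isCont u x"
      using 0 True S by (auto simp: continuous_on_eq_continuous_at)
    then show ?thesis by (rule isCont_mult)
  next
    case False
    then have x: "x \<in> - K" using K by blast
    have "eventually (\<lambda>y. y \<in> - K) (nhds x)" using x K(1) by (intro eventually_nhds_in_open) auto
    then have "eventually (\<lambda>y. \<psi> y * u y = 0) (nhds x)"
      by (rule eventually_mono) (use 0 in auto)
    then show ?thesis using isCont_cong[of "\<lambda>y. \<psi> y * u y" "\<lambda>y. 0" x] by simp
  qed
  then show ?case by (simp add: continuous_at_imp_continuous_on)
next
  case (Suc k)
  have zd: "dd v \<psi> x = 0" if "x \<notin> K" for v x by (rule dd_zero_off[OF K(1) Suc(3) that])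
  show ?case
  proof (rule Ck_SucI[where f'="\<lambda>x v. \<psi> x * dd v u x + dd v \<psi> x * u x"])
    fix x
    show "((\<lambda>x. \<psi> x * u x) has_derivative (\<lambda>v. \<psi> x * dd v u x + dd v \<psi> x * u x)) (at x)"
    proof (cases "x \<in> S")
      case True
      then have "(u has_derivative (\<lambda>v. dd v u x)) (at x)"
        using Suc(4) unfolding dd_def by (simp_all add: frechet_derivative_works[symmetric])
      then show ?thesis using has_derivative_mult[OF Ck_has_derivative[OF Suc(2)]] by blast
    next
      case False
      then have x: "x \<notin> K" using K by blast
      have "((\<lambda>x. \<psi> x * u x) has_derivative (\<lambda>v. 0)) (at x)"
        by (rule has_derivative_transform_within_open[of "\<lambda>x. 0" _ _ _ "- K"]) (use K x Suc(3) in auto)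
      then show ?thesis using Suc(3)[OF x] zd[OF x] by simp
    qed
  next
    fix v
    have "Ck k (\<lambda>x. \<psi> x * dd v u x)"
      by (rule Suc(1)[OF Ck_Suc_D[OF Suc(2)] Suc(3)]) (use Suc(4) in auto)
    moreover have "Ck k (\<lambda>x. dd v \<psi> x * u x)"
      by (rule Suc(1)[OF Ck_dd[OF Suc(2)] zd Ck_on_Suc_D[OF Suc(4)]])
    ultimately show "Ck k (\<lambda>x. \<psi> x * dd v u x + dd v \<psi> x * u x)" by (rule Ck_add)
  qed
qed

lemma smooth_cutoff:
  fixes K \<Omega> :: "'a::euclidean_space set"
  assumes "open \<Omega>" "compact K" "K \<subseteq> \<Omega>"
  obtains \<psi> :: "'a \<Rightarrow> real" and N K' where "Ck 3 \<psi>" "open N" "K \<subseteq> N" "N \<subseteq> K'" "compact K'" "K' \<subseteq> \<Omega>"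
    "\<forall>x\<in>N. \<psi> x = 1" "\<forall>x. x \<notin> K' \<longrightarrow> \<psi> x = 0" "\<forall>x. 0 \<le> \<psi> x"
proof (cases "K = {}")
  \<comment> \<open>The empty set is separate because \<open>infdist\<close> to it is 0 by
    convention.\<close>
  case True
  show ?thesis by (rule that[of "\<lambda>x. 0" "{}" "{}"]) (use True in auto)
next
  case False
  obtain e where e: "e > 0" "(\<Union>x\<in>K. cball x e) \<subseteq> \<Omega>"
    using compact_subset_open_imp_cball_epsilon_subset[OF assms(2,1,3)] by blast
  define d where "d = e / 4"
  have d: "d > 0" using e by (simp add: d_def)
  define K' where "K' = {x. infdist x K \<le> e}"
  have K': "compact K'" unfolding K'_def by (rule compact_infdist_le[OF False assms(2) e(1)])
  have K'O: "K' \<subseteq> \<Omega>"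
  proof
    fix x assume "x \<in> K'"
    obtain y where y: "y \<in> K" "infdist x K = dist x y"
      using infdist_attains_inf[of K x] compact_imp_closed[OF assms(2)] False by blast
    then have "x \<in> cball y e" using \<open>x \<in> K'\<close> by (simp add: K'_def dist_commute)
    then show "x \<in> \<Omega>" using e y by blast
  qed
  \<comment> \<open>With \<open>d = e/4\<close> the profile is 1 up to distance \<open>2 d\<close>
    and 0 from \<open>3 d\<close> on. Mollifying at a scale below \<open>d\<close> keeps the value 1
    within distance \<open>d\<close> and the value 0 beyond \<open>4 d\<close>, the radius of
    \<open>K'\<close>.\<close>
  define g where "g x = max 0 (min 1 (3 - infdist x K / d))" for x
  have cg: "continuous_on UNIV g" unfolding g_def by (intro continuous_intros) (use d in auto)
  obtain a b where ab: "K' \<subseteq> cbox a b" by (rule compact_in_cbox[OF K'])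
  have g0: "g x = 0" if "3 * d \<le> infdist x K" for x
    using that d by (simp add: g_def field_simps)
  have g1: "g x = 1" if "infdist x K \<le> 2 * d" for x
    using that d by (simp add: g_def field_simps)
  have gab: "g x = 0" if "x \<notin> cbox a b" for x
    using that ab g0[of x] d unfolding K'_def d_def by (force simp: not_le)
  obtain n where n: "1 / real (Suc n) < d"
    using nat_approx_posE[OF d] by (metis inverse_eq_divide)
  define \<psi> where "\<psi> = moll a b n g"
  have tri: "\<bar>infdist t K - infdist x K\<bar> < d" if "dist t x < 1 / real (Suc n)" for t x
    using infdist_triangle_abs[of t K x] that n by linarith
  show ?thesis
  proof (rule that[of \<psi> "{x. infdist x K < d}" K'])
    show "Ck 3 \<psi>" unfolding \<psi>_def by (rule Ck_moll[OF cg])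
    show "open {x. infdist x K < d}" by (intro open_Collect_less continuous_intros)
    show "K \<subseteq> {x. infdist x K < d}" using d by (auto simp: infdist_zero)
    show "{x. infdist x K < d} \<subseteq> K'" using d e by (auto simp: K'_def d_def)
    show "\<forall>x\<in>{x. infdist x K < d}. \<psi> x = 1"
    proof
      fix x assume that: "x \<in> {x. infdist x K < d}"
      have "\<bar>mollify (kern (1 / real (Suc n))) a b g x - g x\<bar> \<le> 0"
      proof (rule mollify_close[OF _ cg gab])
        fix t assume "dist t x < 1 / real (Suc n)"
        then have "infdist t K \<le> 2 * d" using tri[of t x] that by auto
        then show "\<bar>g t - g x\<bar> \<le> 0" using g1[of t] g1[of x] that d by simp
      qed simp_all
      then show "\<psi> x = 1" using g1[of x] that d by (simp add: \<psi>_def moll_def)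
    qed
    show "\<forall>x. x \<notin> K' \<longrightarrow> \<psi> x = 0"
      unfolding \<psi>_def
    proof (intro allI impI, rule moll_zero)
      fix x t assume that: "x \<notin> K'"
      assume "dist t x < 1 / real (Suc n)"
      then have "\<bar>infdist t K - infdist x K\<bar> < d" by (rule tri)
      moreover have "4 * d < infdist x K" using that by (simp add: K'_def d_def)
      ultimately have "3 * d \<le> infdist t K" by linarith
      then show "g t = 0" by (rule g0)
    qed
    show "\<forall>x. 0 \<le> \<psi> x"
      unfolding \<psi>_def moll_def mollify_def
    proof (rule allI, rule integral_nonneg)
      fix x
      have "continuous_on UNIV (\<lambda>t. kern (1 / real (Suc n)) (x - t) * g t)"
        by (intro continuous_intros continuous_on_compose2[OF Ck_continuous[OF Ck_kern]] cg) auto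
      then show "(\<lambda>t. kern (1 / real (Suc n)) (x - t) * g t) integrable_on cbox a b"
        by (intro integrable_continuous) (auto intro: continuous_on_subset)
      show "0 \<le> kern (1 / real (Suc n)) (x - t) * g t" for t
        by (intro mult_nonneg_nonneg kern_nonneg) (auto simp: g_def)
    qed
  qed (use K' K'O in auto)
qed

lemma qhess_zero: "qhess (\<lambda>x. 0) p l m = 0"
proof -
  have h: "HX l a (\<lambda>x. 0) p = (0::'b::real_normed_vector)" for l a p unfolding HX_def by simp
  have "Qop m (\<lambda>x. 0) = (\<lambda>p. 0)" by (simp add: fun_eq_iff Qop_def h)
  then show ?thesis by (simp add: qhess_def Qbar_def h Ht_def qmult.zero_right)
qed

lemma mixR_zero_off:
  assumes "open U" "p \<in> U" "\<And>x. x \<in> U \<Longrightarrow> u i x = 0"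
  shows "mixR u p = 0"
proof -
  have "qhess (u i) p = qhess (\<lambda>x. 0) p" by (rule qhess_cong_open[OF assms(1,2)]) (rule assms(3))
  then have "qhess (u i) p l m = 0" for l m by (simp add: qhess_zero)
  then have "pfE (qhess (u i) p) x y = 0" for x y unfolding pfE_def by (simp add: pfB_linear)
  then have "(\<Prod>j\<in>UNIV. pfE (qhess (u j) p) (\<pi> (j, False)) (\<pi> (j, True))) = 0" for \<pi>
    by (intro prod_zero bexI[of _ i]) simp_all
  then show ?thesis unfolding mixR_def mixD_def by (simp only: mult_zero_right sum.neutral_const zero_complex.sel)
qed

lemma mixR_cong_open:
  assumes "open U" "p \<in> U" "\<And>i x. x \<in> U \<Longrightarrow> u i x = v i x"
  shows "mixR u p = mixR v p"
proof -
  have "qhess (u i) p = qhess (v i) p" for i by (rule qhess_cong_open[OF assms(1,2)]) (rule assms(3))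
  then show ?thesis unfolding mixR_def by simp
qed

text \<open>All functions are multiplied by a cut-off equal to 1 near the support of the test
  function. Both integrands live on that support: the left one through the factor, the right one
  because the Hessian of the test function vanishes off it.\<close>

theorem integral_mixR_swap:
  fixes u :: "'n::finite \<Rightarrow> 'n hpt \<Rightarrow> real"
  assumes \<Omega>: "open \<Omega>" and K: "compact K" "K \<subseteq> \<Omega>"
    and phi: "Ck (Suc (Suc 0)) \<phi>" "\<And>x. x \<notin> K \<Longrightarrow> \<phi> x = 0"
    and u: "\<And>i. C2_on \<Omega> (u i)"
  shows "(\<integral>p. \<phi> p * mixR u p \<partial>lborel) = (\<integral>p. u i0 p * mixR (u(i0 := \<phi>)) p \<partial>lborel)"
proof -
  obtain \<psi> :: "'n hpt \<Rightarrow> real" and N K' where psi: "Ck 3 \<psi>" "open N" "K \<subseteq> N" "N \<subseteq> K'" "compact K'" "K' \<subseteq> \<Omega>"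
    and psi1: "\<forall>x\<in>N. \<psi> x = 1" and psi0: "\<forall>x. x \<notin> K' \<longrightarrow> \<psi> x = 0"
    by (rule smooth_cutoff[OF \<Omega> K])
  obtain a b where ab: "K' \<subseteq> cbox a b" by (rule compact_in_cbox[OF psi(5)])
  define v where "v i x = \<psi> x * u i x" for i x
  have psi2: "Ck (Suc (Suc 0)) \<psi>" by (rule Ck_mono[OF psi(1)]) simp
  have v2: "Ck (Suc (Suc 0)) (v i)" for i
    unfolding v_def[abs_def]
    by (rule Ck_cutoff_mult[OF \<Omega> compact_imp_closed[OF psi(5)] psi(6) psi2 psi0[rule_format] C2_on_Ck_on[OF \<Omega> u]])
  have vz: "v i x = 0" if "x \<notin> cbox a b" for i x using psi0[rule_format, of x] ab that by (auto simp: v_def)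
  have pz: "\<phi> x = 0" if "x \<notin> cbox a b" for x using phi(2)[of x] ab psi(3,4) that by blast
  have vu: "v i x = u i x" if "x \<in> N" for i x using psi1 that by (simp add: v_def)
  have off: "mixR (w(i0 := \<phi>)) p = 0" if "p \<notin> K" for w p
    by (rule mixR_zero_off[of "- K" _ _ i0]) (use that phi(2) compact_imp_closed[OF K(1)] in auto)
  have e1: "\<phi> p * mixR u p = \<phi> p * mixR v p" for p
  proof (cases "p \<in> K")
    case True
    then have "mixR u p = mixR v p" using mixR_cong_open[OF psi(2), of p u v] vu psi(3) by auto
    then show ?thesis by simp
  qed (use phi in simp)
  have e2: "u i0 p * mixR (u(i0 := \<phi>)) p = v i0 p * mixR (v(i0 := \<phi>)) p" for p
  proof (cases "p \<in> K")
    case True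
    then have p: "p \<in> N" using psi(3) by blast
    have "mixR (u(i0 := \<phi>)) p = mixR (v(i0 := \<phi>)) p"
      by (rule mixR_cong_open[OF psi(2) p]) (use vu in auto)
    then show ?thesis using vu[OF p] by simp
  qed (use off in simp)
  show ?thesis unfolding e1 e2 by (rule integral_mixR_swap_Cc[OF phi(1) pz v2 vz])
qed

subsection \<open>Plurisubharmonic functions have positive semidefinite Hessian\<close>

lemma dd2_linear:
  fixes f :: "'a::euclidean_space \<Rightarrow> real"
  assumes f: "Ck (Suc (Suc 0)) f"
  shows "linear (\<lambda>v. dd v (dd w f) p)" "linear (\<lambda>v. dd w (dd v f) p)"
proof -
  show *: "linear (\<lambda>v. dd v (dd w f) p)"
    by (rule has_derivative_linear[OF Ck_has_derivative[OF Ck_dd[OF f]]])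
  then show "linear (\<lambda>v. dd w (dd v f) p)"
    unfolding dd_symmetric[OF f, of w] .
qed

lemma line_deriv:
  fixes g :: "'a::euclidean_space \<Rightarrow> real"
  assumes "Ck (Suc k) g"
  shows "((\<lambda>s. g (x + s *\<^sub>R v)) has_real_derivative dd v g (x + s *\<^sub>R v)) (at s)"
proof -
  have "((\<lambda>s. g (x + s *\<^sub>R v)) has_derivative (\<lambda>h. dd (h *\<^sub>R v) g (x + s *\<^sub>R v))) (at s)"
    by (rule has_derivative_compose[OF _ Ck_has_derivative[OF assms]]) (auto intro!: derivative_eq_intros)
  moreover have "dd (h *\<^sub>R v) g (x + s *\<^sub>R v) = h * dd v g (x + s *\<^sub>R v)" for h
    using linear_scale[OF has_derivative_linear[OF Ck_has_derivative[OF assms]]] by simp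
  moreover have "times (dd v g (x + s *\<^sub>R v)) = (\<lambda>h. h * dd v g (x + s *\<^sub>R v))" by (simp add: fun_eq_iff)
  ultimately show ?thesis unfolding has_field_derivative_def by simp
qed

text \<open>Lagrange's remainder along the segment from 0 to \<open>z\<close>; the second
  derivatives at the intermediate point differ from those at 0 by less than \<open>e\<close> in
  total, by continuity.\<close>

lemma taylor2_upper:
  fixes f :: "'a::euclidean_space \<Rightarrow> real"
  assumes f: "Ck (Suc (Suc 0)) f" and e: "e > 0"
  obtains r where "r > 0" "\<And>z. norm z < r \<Longrightarrow> f z \<le> f 0 + dd z f 0 + dd z (dd z f) 0 / 2 + e * (norm z)\<^sup>2"
proof -
  let ?B = "Basis :: 'a set"
  define G where "G y = (\<Sum>b\<in>?B. \<Sum>c\<in>?B. \<bar>dd b (dd c f) y - dd b (dd c f) 0\<bar>)" for y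
  have cd: "continuous_on UNIV (dd b (dd c f))" for b c by (rule Ck_continuous[OF Ck_dd[OF Ck_dd[OF f]]])
  have "continuous_on UNIV G" unfolding G_def by (intro continuous_intros cd)
  then have "isCont G 0" by (simp add: continuous_on_eq_continuous_at)
  moreover have G0: "G 0 = 0" by (simp add: G_def)
  ultimately obtain r where r: "r > 0" "\<And>y. norm y < r \<Longrightarrow> \<bar>G y\<bar> < e"
    using e unfolding continuous_at_eps_delta by (auto simp: dist_norm)
  have ex: "dd z (dd z f) y = (\<Sum>b\<in>?B. \<Sum>c\<in>?B. (z \<bullet> b) * (z \<bullet> c) * dd b (dd c f) y)" for z y
  proof -
    have "dd z (dd z f) y = (\<Sum>b\<in>?B. (z \<bullet> b) * dd b (dd z f) y)"
      using linear_Basis_expand[OF dd2_linear(1)[OF f, of z y], of z] by (simp only: real_scaleR_def)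
    also have "\<dots> = (\<Sum>b\<in>?B. (z \<bullet> b) * (\<Sum>c\<in>?B. (z \<bullet> c) * dd b (dd c f) y))"
      by (intro sum.cong refl arg_cong2[where f=times])
        (use linear_Basis_expand[OF dd2_linear(2)[OF f], of _ z y] in \<open>simp only: real_scaleR_def\<close>)
    finally show ?thesis by (simp add: sum_distrib_left mult.assoc)
  qed
  have diff: "dd z (dd z f) y - dd z (dd z f) 0 \<le> (norm z)\<^sup>2 * G y" for z y
  proof -
    have "dd z (dd z f) y - dd z (dd z f) 0 = (\<Sum>b\<in>?B. \<Sum>c\<in>?B. (z \<bullet> b) * (z \<bullet> c) * (dd b (dd c f) y - dd b (dd c f) 0))"
      unfolding ex by (simp add: sum_subtractf[symmetric] right_diff_distrib)
    also have "\<dots> \<le> (\<Sum>b\<in>?B. \<Sum>c\<in>?B. (norm z)\<^sup>2 * \<bar>dd b (dd c f) y - dd b (dd c f) 0\<bar>)"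
    proof (intro sum_mono)
      fix b c assume bc: "b \<in> ?B" "c \<in> ?B"
      have "\<bar>(z \<bullet> b) * (z \<bullet> c)\<bar> \<le> norm z * norm z"
        unfolding abs_mult using bc by (intro mult_mono Basis_le_norm) auto
      then have "\<bar>(z \<bullet> b) * (z \<bullet> c)\<bar> * \<bar>dd b (dd c f) y - dd b (dd c f) 0\<bar> \<le> (norm z)\<^sup>2 * \<bar>dd b (dd c f) y - dd b (dd c f) 0\<bar>"
        by (intro mult_right_mono) (auto simp: power2_eq_square)
      then show "(z \<bullet> b) * (z \<bullet> c) * (dd b (dd c f) y - dd b (dd c f) 0) \<le> (norm z)\<^sup>2 * \<bar>dd b (dd c f) y - dd b (dd c f) 0\<bar>"
        using abs_ge_self[of "((z \<bullet> b) * (z \<bullet> c)) * (dd b (dd c f) y - dd b (dd c f) 0)"]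
        unfolding abs_mult[of "(z \<bullet> b) * (z \<bullet> c)"] by linarith
    qed
    finally show ?thesis by (simp add: G_def sum_distrib_left)
  qed
  show ?thesis
  proof (rule that[OF r(1)])
    fix z :: 'a assume z: "norm z < r"
    define D where "D m s = (if m = 0 then f (0 + s *\<^sub>R z) else if m = 1 then dd z f (0 + s *\<^sub>R z)
      else dd z (dd z f) (0 + s *\<^sub>R z))" for m :: nat and s
    have D: "D 0 = (\<lambda>s. f (0 + s *\<^sub>R z))" "D 1 = (\<lambda>s. dd z f (0 + s *\<^sub>R z))" "D 2 = (\<lambda>s. dd z (dd z f) (0 + s *\<^sub>R z))"
      by (simp_all add: D_def fun_eq_iff)
    have "\<exists>t>0. t < 1 \<and> D 0 1 = (\<Sum>m<2. D m 0 / fact m * 1 ^ m) + D 2 t / fact 2 * 1 ^ 2"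
    proof (rule Maclaurin)
      have "(D 0 has_real_derivative D (Suc 0) t) (at t)" "(D 1 has_real_derivative D (Suc 1) t) (at t)" for t
        using line_deriv[OF f, of 0 z t] line_deriv[OF Ck_dd[OF f], of z 0 z t]
        unfolding One_nat_def[symmetric] Suc_1 D by simp_all
      then show "\<forall>m t. m < 2 \<and> 0 \<le> t \<and> t \<le> 1 \<longrightarrow> (D m has_real_derivative D (Suc m) t) (at t)"
      proof (intro allI impI)
        fix m :: nat and t :: real assume "m < 2 \<and> 0 \<le> t \<and> t \<le> 1"
        then have "m = 0 \<or> m = 1" by auto
        then show "(D m has_real_derivative D (Suc m) t) (at t)"
          using \<open>\<And>t. (D 0 has_real_derivative D (Suc 0) t) (at t)\<close> \<open>\<And>t. (D 1 has_real_derivative D (Suc 1) t) (at t)\<close> by metis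
      qed
    qed simp_all
    then obtain t where t01: "0 < t" "t < 1" and Dt: "D 0 1 = (\<Sum>m<2. D m 0 / fact m * 1 ^ m) + D 2 t / fact 2 * 1 ^ 2"
      by blast
    have "(\<Sum>m<2. D m 0 / fact m * 1 ^ m) = D 0 0 + D 1 0" by (simp add: numeral_2_eq_2)
    then have t: "0 < t" "t < 1" "f z = f 0 + dd z f 0 + dd z (dd z f) (t *\<^sub>R z) / 2"
      using t01 Dt unfolding D by simp_all
    have "norm (t *\<^sub>R z) \<le> norm z" using t by (simp add: mult_left_le_one_le)
    then have "\<bar>G (t *\<^sub>R z)\<bar> < e" using r z by auto
    then have "(norm z)\<^sup>2 * G (t *\<^sub>R z) \<le> (norm z)\<^sup>2 * e" by (intro mult_left_mono) auto
    then have "dd z (dd z f) (t *\<^sub>R z) \<le> dd z (dd z f) 0 + e * (norm z)\<^sup>2"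
      using diff[of z "t *\<^sub>R z"] by (simp add: mult.commute)
    moreover have "0 \<le> e * (norm z)\<^sup>2" using e by simp
    ultimately show "f z \<le> f 0 + dd z f 0 + dd z (dd z f) 0 / 2 + e * (norm z)\<^sup>2"
      using t(3) by linarith
  qed
qed

lemma Ck_C2_on: "Ck (Suc (Suc 0)) f \<Longrightarrow> C2_on S f" for f :: "'a::euclidean_space \<Rightarrow> real"
proof -
  assume f: "Ck (Suc (Suc 0)) f"
  have c: "C1_on S g" if "Ck (Suc 0) g" for g :: "'a \<Rightarrow> real"
    using Ck_differentiable[OF that] continuous_on_subset[OF Ck_continuous[OF Ck_dd[OF that]] subset_UNIV]
    unfolding C1_on_def dd_def[abs_def] by blast
  have "C1_on S (dd b f)" for b by (rule c[OF Ck_dd[OF f]])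
  then show ?thesis using c[OF Ck_Suc_D[OF f]] unfolding C2_on_def dd_def[abs_def] by blast
qed

text \<open>The comparison function is a quartic polynomial along every line, so its second
  derivatives can be read off as coefficients.\<close>

lemma dd2_poly4:
  fixes h :: "'a::euclidean_space \<Rightarrow> real"
  assumes h: "Ck (Suc (Suc 0)) h" and p: "\<And>s. h (z + s *\<^sub>R w) = c0 + c1 * s + c2 * s^2 + c3 * s^3 + c4 * s^4"
  shows "dd w (dd w h) z = 2 * c2"
proof -
  have "((\<lambda>s. h (z + s *\<^sub>R w)) has_real_derivative (c1 + 2 * c2 * s + 3 * c3 * s^2 + 4 * c4 * s^3)) (at s)" for s
    unfolding p by (auto intro!: derivative_eq_intros)
  from DERIV_unique[OF line_deriv[OF h] this]
  have p1: "dd w h (z + s *\<^sub>R w) = c1 + 2 * c2 * s + 3 * c3 * s^2 + 4 * c4 * s^3" for s .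
  have "((\<lambda>s. dd w h (z + s *\<^sub>R w)) has_real_derivative 2 * c2) (at 0)"
    unfolding p1 by (auto intro!: derivative_eq_intros)
  from DERIV_unique[OF line_deriv[OF Ck_dd[OF h]] this] show ?thesis by simp
qed

section \<open>The symplectic form and the SubLaplacian on quaternionic lines\<close>

lemma inner_quat: "x \<bullet> y = x$1 * y$1 + x$2 * y$2 + x$3 * y$3 + x$4 * y$4" for x y :: quat
  by (simp add: inner_vec_def sum_4)

lemma inner_qmult_adj: "qmult a x \<bullet> y = x \<bullet> qmult (qconj a) y"
  unfolding inner_quat by (simp add: algebra_simps)

definition lchar :: "real^4^('n::finite) \<Rightarrow> quat" where
  "lchar q = (\<Sum>l\<in>UNIV. qmult (qconj (q$l)) (qmult qi (q$l)))"

lemma Lambda_lchar: "Lambda q = norm (lchar q)"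
  by (simp add: Lambda_def lchar_def)

text \<open>\<open>symp v w\<close> is the sum over \<open>l\<close> of the real inner products of
  \<open>qi v_l\<close> with \<open>w_l\<close>. The adjoint of left multiplication by
  \<open>q_l\<close> is left multiplication by its conjugate, and this assembles
  \<open>lchar q\<close>.\<close>

lemma symp_qline: "symp (qline q x) (qline q y) = qmult (lchar q) x \<bullet> y"
proof -
  have s: "symp v w = (\<Sum>l\<in>UNIV. qmult qi (v$l) \<bullet> w$l)" for v w :: "real^4^'a"
    unfolding symp_def inner_quat by (rule sum.cong) (simp_all add: algebra_simps)
  have "symp (qline q x) (qline q y) = (\<Sum>l\<in>UNIV. qmult (qmult (qconj (q$l)) (qmult qi (q$l))) x \<bullet> y)"
    unfolding s qline_def by (rule sum.cong) (simp_all add: inner_qmult_adj qmult_assoc)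
  then show ?thesis by (simp add: lchar_def qmult.sum_left inner_sum_left)
qed

abbreviation qe :: "4 \<Rightarrow> quat" where "qe a \<equiv> axis a 1"

text \<open>The sum is the squared norm of \<open>lchar q\<close> times \<open>x\<close>, and the
  quaternion norm is multiplicative. It is therefore isotropic in \<open>x\<close> and can be
  compensated by a multiple of \<open>|x|^4\<close>.\<close>

lemma sum_symp_qline_sq: "(\<Sum>a\<in>UNIV. (symp (qline q x) (qline q (qe a)))\<^sup>2) = (Lambda q)\<^sup>2 * (x \<bullet> x)"
proof -
  have "symp (qline q x) (qline q (qe a)) = qmult (lchar q) x $ a" for a
    unfolding symp_qline by (simp add: inner_axis)
  then have "(\<Sum>a\<in>UNIV. (symp (qline q x) (qline q (qe a)))\<^sup>2) = (norm (qmult (lchar q) x))\<^sup>2"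
    by (simp add: quat_norm_sq sum_4 del: qmult_nth)
  then show ?thesis by (simp add: norm_qmult Lambda_lchar power_mult_distrib power2_norm_eq_inner[of x])
qed

lemma qline_linear: "qline q (x + y) = qline q x + qline q y" "qline q (c *\<^sub>R x) = c *\<^sub>R qline q x"
  by (simp_all add: qline_def vec_eq_iff qmult_add_right)

lemma lmul_line: "lmul q z (axis a s, 0) = z + s *\<^sub>R (qe a, 2 * symp (qline q (fst z)) (qline q (qe a)))"
proof -
  have "axis a s = s *\<^sub>R qe a" by (simp add: vec_eq_iff axis_def)
  then show ?thesis by (simp add: lmul_def prod_eq_iff qline_linear symp_linear_right)
qed

lemma subLap_eq:
  assumes h: "Ck (Suc (Suc 0)) h"
  shows "subLap q h z = (\<Sum>a\<in>UNIV. dd (qe a, 2 * symp (qline q (fst z)) (qline q (qe a)))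
     (dd (qe a, 2 * symp (qline q (fst z)) (qline q (qe a))) h) z)"
  unfolding subLap_def
proof (rule sum.cong[OF refl])
  fix a
  let ?w = "\<lambda>z::quat \<times> real. (qe a, 2 * symp (qline q (fst z)) (qline q (qe a)))"
  have 1: "LX q a h y = dd (?w y) h y" for y
    unfolding LX_def lmul_line by (rule vector_derivative_line[OF Ck_differentiable[OF h]])
  have 2: "?w (z + s *\<^sub>R ?w z) = ?w z" for s
    by (simp add: qline_linear symp_linear_left)
  have "LX q a (LX q a h) z = vector_derivative (\<lambda>s. dd (?w z) h (z + s *\<^sub>R ?w z)) (at 0)"
    unfolding LX_def[of q a "LX q a h"] lmul_line 1 2 ..
  also have "\<dots> = dd (?w z) (dd (?w z) h) z"
    by (rule vector_derivative_line[OF Ck_differentiable[OF Ck_dd[OF h]]])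
  finally show "LX q a (LX q a h) z = dd (?w z) (dd (?w z) h) z" .
qed

text \<open>The comparison function is the second-order Taylor polynomial with its trace removed,
  plus a large multiple of the harmonic polynomial \<open>t\<^sup>2 - (\<Lambda>\<^sup>2/3) |\<lambda>|\<^sup>4\<close>
  that controls the terms involving the centre.\<close>

lemma subharmonic_laplacian_nonneg:
  fixes w :: "quat \<times> real \<Rightarrow> real"
  assumes w: "Ck (Suc (Suc 0)) w" and U: "open U" "0 \<in> U"
    and sh: "\<And>V h. open V \<Longrightarrow> bounded V \<Longrightarrow> closure V \<subseteq> U \<Longrightarrow> C2_on V h \<Longrightarrow> continuous_on (closure V) h \<Longrightarrow>
        \<forall>z\<in>V. subLap q h z = 0 \<Longrightarrow> \<forall>z\<in>frontier V. w z \<le> h z \<Longrightarrow> \<forall>z\<in>V. w z \<le> h z"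
  shows "0 \<le> (\<Sum>a\<in>UNIV. dd (qe a, 0) (dd (qe a, 0) w) 0)"
proof (rule ccontr)
  define \<tau> where "\<tau> = (\<Sum>a\<in>UNIV. dd (qe a, 0) (dd (qe a, 0) w) 0)"
  assume "\<not> 0 \<le> (\<Sum>a\<in>UNIV. dd (qe a, 0) (dd (qe a, 0) w) 0)"
  then have tau: "\<tau> < 0" by (simp add: \<tau>_def)
  \<comment> \<open>Removing the trace leaves a gap of \<open>\<alpha> |x|^2\<close>, since
    \<open>\<tau> / 8 = - \<alpha>\<close>. It is spent in four equal quarters: on the cross term,
    the quartic term, the Taylor error and the final strict margin.\<close>
  define \<alpha> where "\<alpha> = - \<tau> / 8"
  have al: "\<alpha> > 0" using tau by (simp add: \<alpha>_def)
  define S where "S v u = dd v (dd u w) 0" for v u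
  have Ssym: "S v u = S u v" for v u unfolding S_def by (rule dd_symmetric[OF w])
  have Slin: "linear (\<lambda>v. S v u)" "linear (\<lambda>v. S u v)" for u
    unfolding S_def by (rule dd2_linear[OF w])+
  have w1: "linear (\<lambda>v. dd v w 0)" by (rule has_derivative_linear[OF Ck_has_derivative[OF w]])
  have "bounded_linear (\<lambda>v. S v (0, 1))" using Slin(1) linear_conv_bounded_linear by blast
  then obtain B where B: "\<And>v. \<bar>S v (0, 1)\<bar> \<le> norm v * B" "B \<ge> 0"
    using bounded_linear.nonneg_bounded by (metis real_norm_def)
  define C where "C = \<bar>S (0, 1) (0, 1)\<bar> / 2"
  \<comment> \<open>The summands of \<open>M\<close> pay for the \<open>t^2\<close> parts of, in
    this order, the cross term (by Young's inequality), the pure central second derivative, the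
    Taylor error and the margin \<open>\<beta> t^2\<close>.\<close>
  define M where "M = B\<^sup>2 / \<alpha> + C + \<alpha> / 4 + 1"
  have M: "M \<ge> 1" "M > 0" unfolding M_def C_def using al by (auto intro!: add_nonneg_nonneg add_nonneg_pos)
  \<comment> \<open>The SubLaplacian sends \<open>t^2\<close> to \<open>8 \<Lambda>^2 |x|^2\<close>
    and \<open>|x|^4\<close> to \<open>24 |x|^2\<close>.\<close>
  define \<kappa> where "\<kappa> = (Lambda q)\<^sup>2 / 3"
  have ka: "\<kappa> \<ge> 0" by (simp add: \<kappa>_def)
  obtain r1 where r1: "r1 > 0" "\<And>z. norm z < r1 \<Longrightarrow> w z \<le> w 0 + dd z w 0 + dd z (dd z w) 0 / 2 + \<alpha> / 4 * (norm z)\<^sup>2"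
    using taylor2_upper[OF w, of "\<alpha> / 4"] al by auto
  obtain r2 where r2: "r2 > 0" "cball 0 r2 \<subseteq> U" using open_contains_cball[THEN iffD1, OF U(1)] U(2) by blast
  \<comment> \<open>The three bounds give validity of the Taylor estimate, containment in
    \<open>U\<close>, and \<open>M \<kappa> |x|^4 \<le> \<alpha>/4 |x|^2\<close>.\<close>
  define r where "r = min (min (r1 / 2) r2) (sqrt (\<alpha> / (4 * (M * \<kappa> + 1))))"
  have Mk: "M * \<kappa> + 1 > 0" using M ka by (simp add: add_nonneg_pos)
  have r: "r > 0" "r < r1" "r \<le> r2" "r\<^sup>2 \<le> \<alpha> / (4 * (M * \<kappa> + 1))"
  proof -
    have s: "sqrt (\<alpha> / (4 * (M * \<kappa> + 1))) > 0" using al Mk by simp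
    then show r0: "r > 0" using r1 r2 by (simp add: r_def)
    show "r < r1" "r \<le> r2" using r1 by (auto simp: r_def min_def)
    have "r \<le> sqrt (\<alpha> / (4 * (M * \<kappa> + 1)))" by (simp add: r_def)
    then have "r\<^sup>2 \<le> (sqrt (\<alpha> / (4 * (M * \<kappa> + 1))))\<^sup>2" using r0 by (intro power_mono) auto
    also have "\<dots> = \<alpha> / (4 * (M * \<kappa> + 1))" using al Mk by simp
    finally show "r\<^sup>2 \<le> \<alpha> / (4 * (M * \<kappa> + 1))" .
  qed
  define \<beta> where "\<beta> = min (\<alpha> / 4) 1"
  have be: "\<beta> > 0" using al by (simp add: \<beta>_def)
  \<comment> \<open>The shift by \<open>\<beta> r^2\<close> puts \<open>h\<close> below
    \<open>w\<close> at the origin, while the margin \<open>\<beta> |z|^2\<close> makes up for it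
    exactly on the sphere of radius \<open>r\<close>.\<close>
  define h where "h z = w 0 - \<beta> * r\<^sup>2 + dd z w 0 + S (fst z, 0) (fst z, 0) / 2 - \<tau> / 8 * (fst z \<bullet> fst z)
      + M * ((snd z)\<^sup>2 - \<kappa> * (fst z \<bullet> fst z)\<^sup>2)" for z
  have est: "w z - h z \<le> \<beta> * r\<^sup>2 - \<beta> * (norm z)\<^sup>2" if z: "norm z \<le> r" for z
  proof -
    obtain x t where xt: "z = (x, t)" by force
    define n where "n = norm x"
    have nz: "(norm z)\<^sup>2 = n\<^sup>2 + t\<^sup>2" unfolding xt n_def norm_Pair by simp
    have xx: "x \<bullet> x = n\<^sup>2" by (simp add: n_def power2_norm_eq_inner)
    have zz: "(x, t) = (x, 0) + t *\<^sub>R (0, 1)" by simp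
    have "dd z (dd z w) 0 = S ((x, 0) + t *\<^sub>R (0, 1)) ((x, 0) + t *\<^sub>R (0, 1))" unfolding S_def xt zz ..
    also have "\<dots> = S (x, 0) (x, 0) + 2 * t * S (x, 0) (0, 1) + t\<^sup>2 * S (0, 1) (0, 1)"
      unfolding linear_add[OF Slin(1)] linear_add[OF Slin(2)] linear_scale[OF Slin(1)] linear_scale[OF Slin(2)] Ssym[of "(0, 1)" "(x, 0)"]
      by (simp add: algebra_simps power2_eq_square)
    finally have D2: "dd z (dd z w) 0 = S (x, 0) (x, 0) + 2 * t * S (x, 0) (0, 1) + t\<^sup>2 * S (0, 1) (0, 1)" .
    have "norm (x, 0::real) = n" by (simp add: n_def norm_Pair)
    then have nB: "\<bar>S (x, 0) (0, 1)\<bar> \<le> n * B" using B(1)[of "(x, 0)"] by simp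
    have "t * S (x, 0) (0, 1) \<le> \<bar>t\<bar> * \<bar>S (x, 0) (0, 1)\<bar>" by (metis abs_ge_self abs_mult)
    also have "\<dots> \<le> \<bar>t\<bar> * (n * B)" by (rule mult_left_mono[OF nB]) simp
    also have "\<dots> \<le> \<alpha> / 4 * n\<^sup>2 + B\<^sup>2 / \<alpha> * t\<^sup>2"
    proof -
      have "0 \<le> (\<alpha> * n / 2 - B * \<bar>t\<bar>)\<^sup>2 / \<alpha>" using al by simp
      also have "\<dots> = \<alpha> / 4 * n\<^sup>2 + B\<^sup>2 / \<alpha> * t\<^sup>2 - \<bar>t\<bar> * (n * B)"
        using al by (simp add: power2_eq_square field_simps)
      finally show ?thesis by simp
    qed
    finally have c1: "t * S (x, 0) (0, 1) \<le> \<alpha> / 4 * n\<^sup>2 + B\<^sup>2 / \<alpha> * t\<^sup>2" .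
    have c2: "t\<^sup>2 * S (0, 1) (0, 1) / 2 \<le> C * t\<^sup>2"
      unfolding C_def using mult_left_mono[OF abs_ge_self[of "S (0, 1) (0, 1)"], of "t\<^sup>2"] by (simp add: mult.commute)
    have "norm z < r1" using z r by simp
    from r1(2)[OF this] have up: "w z - h z \<le> \<beta> * r\<^sup>2 + t * S (x, 0) (0, 1) + t\<^sup>2 * S (0, 1) (0, 1) / 2
        + \<tau> / 8 * n\<^sup>2 - M * t\<^sup>2 + M * \<kappa> * (n\<^sup>2)\<^sup>2 + \<alpha> / 4 * (n\<^sup>2 + t\<^sup>2)"
      unfolding h_def D2 nz unfolding xt fst_conv snd_conv xx by (simp add: algebra_simps add_divide_distrib)
    have "n\<^sup>2 \<le> (norm z)\<^sup>2" unfolding nz by simp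
    also have "\<dots> \<le> r\<^sup>2" using z by (intro power_mono) auto
    finally have "n\<^sup>2 \<le> \<alpha> / (4 * (M * \<kappa> + 1))" using r(4) by (rule order_trans)
    then have "n\<^sup>2 * (4 * (M * \<kappa> + 1)) \<le> \<alpha>" using Mk by (simp add: pos_le_divide_eq)
    moreover have "n\<^sup>2 * (4 * (M * \<kappa> + 1)) = 4 * (n\<^sup>2 * (M * \<kappa>)) + 4 * n\<^sup>2" by (simp add: algebra_simps)
    ultimately have "n\<^sup>2 * (M * \<kappa>) \<le> \<alpha> / 4" using zero_le_power2[of n] by linarith
    then have "n\<^sup>2 * (n\<^sup>2 * (M * \<kappa>)) \<le> n\<^sup>2 * (\<alpha> / 4)" by (intro mult_left_mono) auto
    then have c3: "M * \<kappa> * (n\<^sup>2)\<^sup>2 \<le> \<alpha> / 4 * n\<^sup>2" by (simp add: power2_eq_square algebra_simps)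
    have Mt: "M * t\<^sup>2 = B\<^sup>2 / \<alpha> * t\<^sup>2 + C * t\<^sup>2 + \<alpha> / 4 * t\<^sup>2 + t\<^sup>2" unfolding M_def by (simp add: algebra_simps)
    have ta: "\<tau> / 8 * n\<^sup>2 = - (\<alpha> * n\<^sup>2)" by (simp add: \<alpha>_def)
    have "\<beta> * (n\<^sup>2 + t\<^sup>2) \<le> \<alpha> / 4 * n\<^sup>2 + 1 * t\<^sup>2"
      unfolding distrib_left by (intro add_mono mult_right_mono) (auto simp: \<beta>_def)
    then show ?thesis using up c1 c2 c3 Mt ta unfolding nz by (simp add: algebra_simps)
  qed
  have blx: "bounded_linear (\<lambda>z::quat \<times> real. (fst z, 0::real))"
    by (intro bounded_linear_Pair bounded_linear_fst bounded_linear_zero)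
  have Sb: "Ck (Suc (Suc 0)) (\<lambda>z::quat \<times> real. S (fst z, 0) (fst z, 0))"
  proof -
    have "S (fst z, 0) (fst z, 0) = (\<Sum>b\<in>Basis. \<Sum>c\<in>Basis. ((fst z, 0) \<bullet> b) * (((fst z, 0) \<bullet> c) * S b c))" for z :: "quat \<times> real"
    proof -
      have "S (fst z, 0) (fst z, 0) = (\<Sum>b\<in>Basis. ((fst z, 0) \<bullet> b) * S b (fst z, 0))"
        using linear_Basis_expand[OF Slin(1)[of "(fst z, 0)"], of "(fst z, 0)"] by (simp only: real_scaleR_def)
      also have "\<dots> = (\<Sum>b\<in>Basis. ((fst z, 0) \<bullet> b) * (\<Sum>c\<in>Basis. ((fst z, 0) \<bullet> c) * S b c))"
        by (intro sum.cong refl arg_cong2[where f=times])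
          (use linear_Basis_expand[OF Slin(2), of _ "(fst z, 0)"] in \<open>simp only: real_scaleR_def\<close>)
      finally show ?thesis by (simp add: sum_distrib_left)
    qed
    moreover have "Ck (Suc (Suc 0)) (\<lambda>z::quat \<times> real. \<Sum>b\<in>Basis. \<Sum>c\<in>Basis. ((fst z, 0) \<bullet> b) * (((fst z, 0) \<bullet> c) * S b c))"
      by (intro Ck_sum Ck_mult Ck_const Ck_bounded_linear bounded_linear_compose[OF bounded_linear_inner_left blx])
    ultimately show ?thesis by simp
  qed
  have xx2: "Ck (Suc (Suc 0)) (\<lambda>z::quat \<times> real. fst z \<bullet> fst z)"
    using Ck_compose_affine[OF bounded_linear_fst Ck_inner_self, of "Suc (Suc 0)" 0] by simp
  have h2: "Ck (Suc (Suc 0)) h"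
    unfolding h_def[abs_def] power2_eq_square divide_inverse
    by (intro Ck_add Ck_diff Ck_mult Ck_const Sb xx2 Ck_bounded_linear bounded_linear_snd
        linear_conv_bounded_linear[THEN iffD1, OF w1])
  have lap: "subLap q h z = 0" for z
  proof -
    obtain x t where xt: "z = (x, t)" by force
    define \<omega> where "\<omega> a = symp (qline q x) (qline q (qe a))" for a
    have "dd (qe a, 2 * \<omega> a) (dd (qe a, 2 * \<omega> a) h) z
      = 2 * (S (qe a, 0) (qe a, 0) / 2 - \<tau> / 8 + M * (4 * (\<omega> a)\<^sup>2 - \<kappa> * (4 * (x$a)\<^sup>2 + 2 * (x \<bullet> x))))" for a
    proof (rule dd2_poly4[OF h2])
      fix s
      have i: "(x + s *\<^sub>R qe a) \<bullet> (x + s *\<^sub>R qe a) = x \<bullet> x + 2 * s * x$a + s\<^sup>2"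
        by (simp add: inner_add_left inner_add_right inner_axis inner_axis' power2_eq_square) (simp add: axis_def algebra_simps)
      have zs: "z + s *\<^sub>R (qe a, 2 * \<omega> a) = (x + s *\<^sub>R qe a, t + s * (2 * \<omega> a))" by (simp add: xt)
      have p: "(x + s *\<^sub>R qe a, 0::real) = (x, 0) + s *\<^sub>R (qe a, 0)" by simp
      have Se: "S (x + s *\<^sub>R qe a, 0) (x + s *\<^sub>R qe a, 0) = S (x, 0) (x, 0) + 2 * s * S (x, 0) (qe a, 0) + s\<^sup>2 * S (qe a, 0) (qe a, 0)"
        unfolding p linear_add[OF Slin(1)] linear_add[OF Slin(2)] linear_scale[OF Slin(1)] linear_scale[OF Slin(2)] Ssym[of "(qe a, 0)" "(x, 0)"]
        by (simp add: algebra_simps power2_eq_square)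
      have De: "dd (z + s *\<^sub>R (qe a, 2 * \<omega> a)) w 0 = dd z w 0 + s * dd (qe a, 2 * \<omega> a) w 0"
        unfolding linear_add[OF w1] linear_scale[OF w1] by simp
      show "h (z + s *\<^sub>R (qe a, 2 * \<omega> a)) =
        (w 0 - \<beta> * r\<^sup>2 + dd z w 0 + S (x, 0) (x, 0) / 2 - \<tau> / 8 * (x \<bullet> x) + M * (t\<^sup>2 - \<kappa> * (x \<bullet> x)\<^sup>2))
        + (dd (qe a, 2 * \<omega> a) w 0 + S (x, 0) (qe a, 0) - \<tau> / 4 * x$a + M * (4 * t * \<omega> a - \<kappa> * (4 * (x \<bullet> x) * x$a))) * s
        + (S (qe a, 0) (qe a, 0) / 2 - \<tau> / 8 + M * (4 * (\<omega> a)\<^sup>2 - \<kappa> * (4 * (x$a)\<^sup>2 + 2 * (x \<bullet> x)))) * s\<^sup>2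
        + (- (M * \<kappa> * (4 * x$a))) * s ^ 3 + (- (M * \<kappa>)) * s ^ 4"
        unfolding h_def De unfolding zs fst_conv snd_conv i Se
        by (simp add: algebra_simps power2_eq_square power3_eq_cube power4_eq_xxxx)
    qed
    then have "subLap q h z = (\<Sum>a\<in>UNIV. 2 * (S (qe a, 0) (qe a, 0) / 2 - \<tau> / 8 + M * (4 * (\<omega> a)\<^sup>2 - \<kappa> * (4 * (x$a)\<^sup>2 + 2 * (x \<bullet> x)))))"
      unfolding subLap_eq[OF h2] by (simp add: xt \<omega>_def)
    also have "\<dots> = (\<Sum>a\<in>UNIV. S (qe a, 0) (qe a, 0)) - \<tau> + M * (8 * (\<Sum>a\<in>UNIV. (\<omega> a)\<^sup>2) - \<kappa> * (8 * (x \<bullet> x) + 16 * (x \<bullet> x)))"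
      by (simp add: sum_4 inner_quat power2_eq_square algebra_simps)
    also have "(\<Sum>a\<in>UNIV. S (qe a, 0) (qe a, 0)) = \<tau>" by (simp add: S_def \<tau>_def)
    also have "(\<Sum>a\<in>UNIV. (\<omega> a)\<^sup>2) = (Lambda q)\<^sup>2 * (x \<bullet> x)" unfolding \<omega>_def by (rule sum_symp_qline_sq)
    finally show ?thesis by (simp add: \<kappa>_def algebra_simps)
  qed
  have "\<forall>z\<in>ball 0 r. w z \<le> h z"
  proof (rule sh)
    show "closure (ball 0 r) \<subseteq> U" using r r2 by auto
    show "C2_on (ball 0 r) h" by (rule Ck_C2_on[OF h2])
    show "continuous_on (closure (ball 0 r)) h" by (rule continuous_on_subset[OF Ck_continuous[OF h2]]) simp
    show "\<forall>z\<in>ball 0 r. subLap q h z = 0" using lap by blast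
    show "\<forall>z\<in>frontier (ball 0 r). w z \<le> h z"
    proof
      fix z :: "quat \<times> real" assume "z \<in> frontier (ball 0 r)"
      then have "norm z = r" using r by (simp add: sphere_def)
      then show "w z \<le> h z" using est[of z] by simp
    qed
  qed auto
  moreover have "(0 :: quat \<times> real) \<in> ball 0 r" using r by simp
  ultimately have "w 0 \<le> h 0" by blast
  moreover have "h 0 = w 0 - \<beta> * r\<^sup>2"
    using linear_0[OF w1] linear_0[OF Slin(1), of 0] by (simp add: h_def zero_prod_def[symmetric])
  moreover have "\<beta> * r\<^sup>2 > 0" using be r by simp
  ultimately show False by linarith
qed

abbreviation Vf :: "'n::finite \<Rightarrow> 4 \<Rightarrow> 'n hpt \<Rightarrow> 'n hpt" where
  "Vf l a p \<equiv> (ev l a, 2 * symp (fst p) (ev l a))"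

lemma XX_XX_real:
  fixes u :: "('n::finite) hpt \<Rightarrow> real"
  assumes u: "Ck (Suc (Suc 0)) u"
  shows "XX l a (XX m b u) p = dd (Vf l a p) (dd (Vf m b p) u) p + 2 * symp (ev l a) (ev m b) * TT u p"
proof -
  let ?s = "\<lambda>p::'n hpt. 2 * symp (fst p) (ev m b)"
  have ud: "Ck (Suc 0) (dd v u)" for v by (rule Ck_dd[OF u])
  have s1: "Ck (Suc 0) ?s" by (rule Ck_bounded_linear[OF bounded_linear_symp])
  have ds: "dd w ?s p = 2 * symp (fst w) (ev m b)" for w
    by (rule dd_eqI[OF bounded_linear_imp_has_derivative[OF bounded_linear_symp]])
  have "XX m b u = (\<lambda>p. dd (ev m b, 0) u p + ?s p * TT u p)"
    unfolding XX_decomp[OF Ck_Suc_D[OF u]] by simp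
  then have "XX l a (XX m b u) p = dd (Vf l a p) (dd (ev m b, 0) u) p + (?s p * dd (Vf l a p) (TT u) p + dd (Vf l a p) ?s p * TT u p)"
    unfolding XX_def[of l a] by (simp add: dd_add[OF ud Ck_mult[OF s1 ud]] dd_mult[OF s1 ud])
  moreover have "dd (Vf l a p) (dd (Vf m b p) u) p = dd (Vf l a p) (dd (ev m b, 0) u) p + ?s p * dd (Vf l a p) (TT u) p"
  proof -
    have "Vf m b p = (ev m b, 0) + ?s p *\<^sub>R (0, 1)" by simp
    then show ?thesis
      using linear_add[OF dd2_linear(2)[OF u]] linear_scale[OF dd2_linear(2)[OF u]] by (metis real_scaleR_def)
  qed
  ultimately show ?thesis unfolding ds by simp
qed

text \<open>An identity of quaternion algebra for an arbitrary array \<open>Y\<close> of second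
  derivatives. The correction \<open>d\<close> in the second component is harmless: it occurs only
  for \<open>p = r\<close>, and the conjugate of \<open>p\<close> times \<open>qi p\<close> has zero
  real part.\<close>

lemma qmult_qconj_sum_axis:
  fixes A p r :: quat
  assumes "A $ 1 = Y 1 1 + Y 2 2 + Y 3 3 + Y 4 4"
    "A $ 2 = Y 2 1 - Y 1 2 - Y 3 4 + Y 4 3 + d"
    "A $ 3 = Y 3 1 - Y 1 3 + Y 2 4 - Y 4 2"
    "A $ 4 = Y 4 1 - Y 1 4 - Y 2 3 + Y 3 2"
    and d: "d = 0 \<or> p = r"
  shows "qmult (qconj p) (qmult A r) $ 1 = (\<Sum>a\<in>UNIV. \<Sum>b\<in>UNIV. \<Sum>c\<in>UNIV. qmult p (qe a) $ b * qmult r (qe a) $ c * Y b c)"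
proof -
  have x: "qe 1 = qone" "qe 2 = qi" "qe 3 = qj" "qe 4 = qk"
    by (simp_all add: qone_def qi_def qj_def qk_def)
  define A' where "A' = A - d *\<^sub>R qi"
  have "qmult (qconj p) (qmult A r) $ 1 = qmult (qconj p) (qmult A' r) $ 1 + d * (qmult (qconj p) (qmult qi r) $ 1)"
    by (simp add: A'_def algebra_simps)
  also have "d * (qmult (qconj p) (qmult qi r) $ 1) = 0" using d by (auto simp: algebra_simps)
  also have "qmult (qconj p) (qmult A' r) $ 1 = (\<Sum>a\<in>UNIV. \<Sum>b\<in>UNIV. \<Sum>c\<in>UNIV. qmult p (qe a) $ b * qmult r (qe a) $ c * Y b c)"
    unfolding sum_4 x by (simp add: A'_def assms(1-4)) (simp add: algebra_simps)
  finally show ?thesis by simp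
qed

lemma ev_expand: "v = (\<Sum>l\<in>UNIV. \<Sum>b\<in>UNIV. (v$l$b) *\<^sub>R ev l b)" for v :: "real^4^('n::finite)"
proof -
  have "(\<Sum>l\<in>UNIV. \<Sum>b\<in>UNIV. (v$l$b) *\<^sub>R ev l b) $ i $ j = v $ i $ j" for i j
  proof -
    have "(\<Sum>b\<in>UNIV. (v$l$b) *\<^sub>R ev l b) $ i $ j = (if l = i then v $ i $ j else 0)" for l
    proof -
      have "(\<Sum>b\<in>UNIV. (v$l$b) *\<^sub>R ev l b) $ i $ j = (\<Sum>b\<in>UNIV. if b = j then (if l = i then v $ i $ j else 0) else 0)"
        unfolding sum_component by (rule sum.cong) (auto simp: axis_def)
      then show ?thesis by simp
    qed
    then show ?thesis by simp
  qed
  then show ?thesis by (simp add: vec_eq_iff)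
qed

lemma linear_ev_expand:
  assumes l: "linear (G :: real^4^('n::finite) \<Rightarrow> real)"
  shows "G v = (\<Sum>l\<in>UNIV. \<Sum>b\<in>UNIV. v$l$b * G (ev l b))"
proof -
  have "G v = G (\<Sum>l\<in>UNIV. \<Sum>b\<in>UNIV. (v$l$b) *\<^sub>R ev l b)" using ev_expand[of v] by simp
  then show ?thesis by (simp add: linear_sum[OF l] linear_scale[OF l])
qed

text \<open>The right-hand side consists of second derivatives along directions frozen at
  \<open>p\<close>, which is what the SubLaplacian of the pullback to the line through
  \<open>p\<close> yields at the origin. The differences between frozen and true fields sum to a
  multiple of \<open>symp v v\<close>, which is 0.\<close>

lemma qform_qhess:
  fixes u :: "('n::finite) hpt \<Rightarrow> real" and q :: "real^4^'n"
  assumes u: "Ck (Suc (Suc 0)) u"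
  shows "qform UNIV (qhess u p) (\<lambda>l. q$l) $ 1 = (\<Sum>a\<in>UNIV.
     dd (qline q (qe a), 2 * symp (fst p) (qline q (qe a))) (dd (qline q (qe a), 2 * symp (fst p) (qline q (qe a))) u) p)"
proof -
  define W where "W v = (v, 2 * symp (fst p) v)" for v
  define X where "X l b m c = XX l b (XX m c u) p" for l b m c
  have Wl: "linear W" unfolding W_def by (rule linearI) (simp_all add: symp_linear_right algebra_simps)
  have T: "linear (\<lambda>v. dd (W v) (dd z u) p)" "linear (\<lambda>v. dd z (dd (W v) u) p)" for z
    using linear_compose[OF Wl dd2_linear(1)[OF u]] linear_compose[OF Wl dd2_linear(2)[OF u]] by (simp_all add: comp_def)
  have sl: "linear (\<lambda>v. symp v z)" "linear (\<lambda>v. symp z v)" for z :: "real^4^'n"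
    by (rule linearI; simp add: symp_linear_left symp_linear_right)+
  have quad: "dd (W v) (dd (W v) u) p = (\<Sum>l\<in>UNIV. \<Sum>b\<in>UNIV. v$l$b * (\<Sum>m\<in>UNIV. \<Sum>c\<in>UNIV. v$m$c * X l b m c))" for v
  proof -
    have e: "dd (W (ev l b)) (dd (W (ev m c)) u) p = X l b m c - 2 * TT u p * symp (ev l b) (ev m c)" for l b m c
      unfolding W_def X_def XX_XX_real[OF u] by simp
    have "dd (W v) (dd (W v) u) p = (\<Sum>l\<in>UNIV. \<Sum>b\<in>UNIV. v$l$b * dd (W (ev l b)) (dd (W v) u) p)"
      by (rule linear_ev_expand[OF T(1)])
    also have "\<dots> = (\<Sum>l\<in>UNIV. \<Sum>b\<in>UNIV. v$l$b * (\<Sum>m\<in>UNIV. \<Sum>c\<in>UNIV. v$m$c * dd (W (ev l b)) (dd (W (ev m c)) u) p))"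
      by (intro sum.cong refl arg_cong2[where f=times]) (rule linear_ev_expand[OF T(2)])
    also have "\<dots> = (\<Sum>l\<in>UNIV. \<Sum>b\<in>UNIV. v$l$b * (\<Sum>m\<in>UNIV. \<Sum>c\<in>UNIV. v$m$c * X l b m c))
       - 2 * TT u p * (\<Sum>l\<in>UNIV. \<Sum>b\<in>UNIV. v$l$b * (\<Sum>m\<in>UNIV. \<Sum>c\<in>UNIV. v$m$c * symp (ev l b) (ev m c)))"
      unfolding e by (simp add: sum_distrib_left sum_subtractf right_diff_distrib mult.assoc mult.left_commute)
    also have "(\<Sum>l\<in>UNIV. \<Sum>b\<in>UNIV. v$l$b * (\<Sum>m\<in>UNIV. \<Sum>c\<in>UNIV. v$m$c * symp (ev l b) (ev m c))) = symp v v"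
      unfolding linear_ev_expand[OF sl(2), of _ v, symmetric] linear_ev_expand[OF sl(1), of v, symmetric] ..
    finally show ?thesis by simp
  qed
  have "qform UNIV (qhess u p) (\<lambda>l. q$l) $ 1 = (\<Sum>l\<in>UNIV. \<Sum>m\<in>UNIV. qmult (qconj (q$l)) (qmult (qhess u p l m) (q$m)) $ 1)"
    by (simp add: qform_def del: qmult_nth)
  also have "\<dots> = (\<Sum>l\<in>UNIV. \<Sum>m\<in>UNIV. \<Sum>a\<in>UNIV. \<Sum>b\<in>UNIV. \<Sum>c\<in>UNIV. qmult (q$l) (qe a) $ b * qmult (q$m) (qe a) $ c * X l b m c)"
  proof (intro sum.cong refl)
    fix l m
    show "qmult (qconj (q$l)) (qmult (qhess u p l m) (q$m)) $ 1 = (\<Sum>a\<in>UNIV. \<Sum>b\<in>UNIV. \<Sum>c\<in>UNIV. qmult (q$l) (qe a) $ b * qmult (q$m) (qe a) $ c * X l b m c)"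
      by (rule qmult_qconj_sum_axis[where d="if l = m then 8 * TT u p else 0"])
        (auto simp: qhess_nth[OF u] X_def)
  qed
  also have "\<dots> = (\<Sum>a\<in>UNIV. \<Sum>l\<in>UNIV. \<Sum>b\<in>UNIV. \<Sum>m\<in>UNIV. \<Sum>c\<in>UNIV. qmult (q$l) (qe a) $ b * qmult (q$m) (qe a) $ c * X l b m c)"
  proof -
    have swap: "(\<Sum>l\<in>UNIV. \<Sum>m\<in>UNIV. \<Sum>a\<in>UNIV. \<Sum>b\<in>UNIV. \<Sum>c\<in>UNIV. F l m a b c) = (\<Sum>a\<in>UNIV. \<Sum>l\<in>UNIV. \<Sum>b\<in>UNIV. \<Sum>m\<in>UNIV. \<Sum>c\<in>UNIV. F l m a b c)"
      for F :: "'n \<Rightarrow> 'n \<Rightarrow> 4 \<Rightarrow> 4 \<Rightarrow> 4 \<Rightarrow> real"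
    proof -
      have "(\<Sum>l\<in>UNIV. \<Sum>m\<in>UNIV. \<Sum>a\<in>UNIV. \<Sum>b\<in>UNIV. \<Sum>c\<in>UNIV. F l m a b c) = (\<Sum>l\<in>UNIV. \<Sum>a\<in>UNIV. \<Sum>m\<in>UNIV. \<Sum>b\<in>UNIV. \<Sum>c\<in>UNIV. F l m a b c)"
        by (rule sum.cong[OF refl]) (rule sum.swap)
      also have "\<dots> = (\<Sum>a\<in>UNIV. \<Sum>l\<in>UNIV. \<Sum>m\<in>UNIV. \<Sum>b\<in>UNIV. \<Sum>c\<in>UNIV. F l m a b c)" by (rule sum.swap)
      also have "\<dots> = (\<Sum>a\<in>UNIV. \<Sum>l\<in>UNIV. \<Sum>b\<in>UNIV. \<Sum>m\<in>UNIV. \<Sum>c\<in>UNIV. F l m a b c)"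
        by (intro sum.cong refl) (rule sum.swap)
      finally show ?thesis .
    qed
    show ?thesis by (rule swap)
  qed
  also have "\<dots> = (\<Sum>a\<in>UNIV. dd (W (qline q (qe a))) (dd (W (qline q (qe a))) u) p)"
    unfolding quad by (simp add: qline_def sum_distrib_left mult.assoc del: qmult_nth)
  finally show ?thesis unfolding W_def .
qed

lemma lchar_second_difference:
  "lchar (q + s *\<^sub>R e) + lchar (q - s *\<^sub>R e) = 2 *\<^sub>R lchar q + (2 * s\<^sup>2) *\<^sub>R lchar e"
proof -
  have "qmult (qconj (x + s *\<^sub>R y)) (qmult qi (x + s *\<^sub>R y)) + qmult (qconj (x - s *\<^sub>R y)) (qmult qi (x - s *\<^sub>R y))
    = 2 *\<^sub>R qmult (qconj x) (qmult qi x) + (2 * s\<^sup>2) *\<^sub>R qmult (qconj y) (qmult qi y)" for x y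
    by (simp add: quat_eq_iff) (simp add: algebra_simps power2_eq_square)
  then show ?thesis
    unfolding lchar_def scaleR_sum_right sum.distrib[symmetric] by simp
qed

text \<open>\<open>lchar\<close> is quadratic, so if \<open>q\<close> and both
  \<open>q + s e\<close> and \<open>q - s e\<close> were degenerate, its second difference would
  force \<open>lchar e = 0\<close>. For \<open>e\<close> with a single entry \<open>qone\<close>,
  however, \<open>lchar e = qi\<close>.\<close>

lemma degenerate_set_approx:
  fixes q :: "real^4^('n::finite)"
  assumes q: "q \<in> degenerate_set"
  obtains e where "\<And>s. s \<noteq> 0 \<Longrightarrow> q + s *\<^sub>R e \<notin> degenerate_set \<or> q - s *\<^sub>R e \<notin> degenerate_set"
proof -
  define l0 where "l0 = (undefined :: 'n)"
  define e :: "real^4^'n" where "e = axis l0 qone"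
  have "lchar e = (\<Sum>l\<in>UNIV. if l = l0 then qi else 0)"
    unfolding lchar_def by (rule sum.cong) (auto simp: e_def axis_def quat_eq_iff)
  then have le: "lchar e = qi" by simp
  show ?thesis
  proof (rule that[of e])
    fix s :: real assume s: "s \<noteq> 0"
    show "q + s *\<^sub>R e \<notin> degenerate_set \<or> q - s *\<^sub>R e \<notin> degenerate_set"
    proof (rule ccontr)
      assume "\<not> ?thesis"
      then have "lchar (q + s *\<^sub>R e) = 0" "lchar (q - s *\<^sub>R e) = 0" "lchar q = 0"
        using q by (auto simp: degenerate_set_def Lambda_lchar)
      then have "(2 * s\<^sup>2) *\<^sub>R qi = 0" using lchar_second_difference[of q s e] le by simp
      then show False using s by (simp add: quat_eq_iff)
    qed
  qed
qed

text \<open>At nondegenerate \<open>q\<close> the quadratic form of the Hessian is the horizontal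
  Laplacian of the pullback to a line at the origin. Degenerate \<open>q\<close> are limits of
  nondegenerate ones and the form is continuous in \<open>q\<close>.\<close>

theorem psh_qpossemidef:
  fixes u :: "('n::finite) hpt \<Rightarrow> real"
  assumes \<Omega>: "open \<Omega>" and u: "C2_on \<Omega> u" and psh: "psh_on \<Omega> (\<lambda>x. ereal (u x))" and eta: "\<eta> \<in> \<Omega>"
  shows "qpossemidef (qhess u \<eta>)"
proof -
  obtain \<psi> :: "'n hpt \<Rightarrow> real" and N K' where psi: "Ck 3 \<psi>" "open N" "{\<eta>} \<subseteq> N" "N \<subseteq> K'" "compact K'" "K' \<subseteq> \<Omega>"
    and psi1: "\<forall>x\<in>N. \<psi> x = 1" and psi0: "\<forall>x. x \<notin> K' \<longrightarrow> \<psi> x = 0"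
    by (rule smooth_cutoff[OF \<Omega>, of "{\<eta>}"]) (use eta in auto)
  define v where "v x = \<psi> x * u x" for x
  have v2: "Ck (Suc (Suc 0)) v"
    unfolding v_def[abs_def]
    by (rule Ck_cutoff_mult[OF \<Omega> compact_imp_closed[OF psi(5)] psi(6) Ck_mono[OF psi(1)] psi0[rule_format] C2_on_Ck_on[OF \<Omega> u]]) simp
  have vu: "v x = u x" if "x \<in> N" for x using psi1 that by (simp add: v_def)
  have H: "qhess u \<eta> = qhess v \<eta>" by (rule qhess_cong_open[OF psi(2)]) (use psi(3) vu in auto)
  have nondeg: "0 \<le> qform UNIV (qhess v \<eta>) (\<lambda>l. q$l) $ 1" if q: "q \<notin> degenerate_set" for q
  proof -
    \<comment> \<open>\<open>iota\<close> is affine, with linear part \<open>L\<close>, so the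
      pullback of a C^2 function needs no more than the chain rule for affine maps.\<close>
    define L where "L z = (qline q (fst z), snd z + 2 * symp (fst \<eta>) (qline q (fst z)))" for z :: "quat \<times> real"
    have "linear L" unfolding L_def
      by (rule linearI) (simp_all add: qline_linear symp_linear_right algebra_simps)
    then have L: "bounded_linear L" by (rule linear_conv_bounded_linear[THEN iffD1])
    have io: "iota \<eta> q z = L z + \<eta>" for z by (simp add: iota_def hmul_def L_def prod_eq_iff)
    have io': "iota \<eta> q = (\<lambda>z. L z + \<eta>)" by (rule ext) (rule io)
    define U where "U = iota \<eta> q -` N"
    have U: "open U" "0 \<in> U"
      unfolding U_def io' using psi(2,3) linear_0[OF \<open>linear L\<close>]
      by (auto intro!: open_vimage continuous_intros linear_continuous_on[OF L])
    define w where "w z = v (L z + \<eta>)" for z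
    have w2: "Ck (Suc (Suc 0)) w" unfolding w_def[abs_def] by (rule Ck_compose_affine[OF L v2])
    have wu: "w z = u (iota \<eta> q z)" if "z \<in> U" for z
      using that vu unfolding U_def w_def io by auto
    have sub: "subharmonic_on q (iota \<eta> q -` \<Omega>) ((\<lambda>x. ereal (u x)) \<circ> iota \<eta> q)"
      using psh q unfolding psh_on_def by blast
    have UO: "U \<subseteq> iota \<eta> q -` \<Omega>" using psi(4,6) by (auto simp: U_def)
    have lap: "0 \<le> (\<Sum>a\<in>UNIV. dd (qe a, 0) (dd (qe a, 0) w) 0)"
    proof (rule subharmonic_laplacian_nonneg[OF w2 U])
      fix V h assume V: "open V" "bounded V" "closure V \<subseteq> U" "C2_on V h" "continuous_on (closure V) h"
        "\<forall>z\<in>V. subLap q h z = 0" "\<forall>z\<in>frontier V. w z \<le> h z"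
      have fr: "\<forall>z\<in>frontier V. ((\<lambda>x. ereal (u x)) \<circ> iota \<eta> q) z \<le> ereal (h z)"
        using V(3,7) wu by (auto simp: frontier_def subset_eq)
      have "closure V \<subseteq> iota \<eta> q -` \<Omega>" using V(3) UO by (rule subset_trans)
      then have "\<forall>z\<in>V. ((\<lambda>x. ereal (u x)) \<circ> iota \<eta> q) z \<le> ereal (h z)"
        using sub V(1,2,4,5,6) fr unfolding subharmonic_on_def by blast
      moreover have "z \<in> U" if "z \<in> V" for z using V(3) closure_subset[of V] that by blast
      ultimately show "\<forall>z\<in>V. w z \<le> h z" using wu by (auto simp: comp_def)
    qed
    have ddw: "dd (qe a, 0) (dd (qe a, 0) w) 0 = dd (L (qe a, 0)) (dd (L (qe a, 0)) v) \<eta>" for a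
    proof -
      have "dd (qe a, 0) w = (\<lambda>z. dd (L (qe a, 0)) v (L z + \<eta>))"
        unfolding w_def[abs_def] by (rule ext, rule dd_compose_affine[OF L v2])
      then show ?thesis using dd_compose_affine[OF L Ck_dd[OF v2], of "(qe a, 0)" _ \<eta> 0] linear_0[OF \<open>linear L\<close>] by simp
    qed
    show ?thesis using lap unfolding qform_qhess[OF v2] ddw by (simp add: L_def)
  qed
  have cont: "continuous_on UNIV (\<lambda>s::real. qform UNIV (qhess v \<eta>) (\<lambda>l. (q + s *\<^sub>R e)$l) $ 1)" for q e
  proof -
    have qc: "bounded_linear qconj"
      by (rule linear_conv_bounded_linear[THEN iffD1], rule linearI) (simp_all add: qconj_add qconj_scaleR)
    show ?thesis unfolding qform_def
      by (intro continuous_intros qmult.continuous_on bounded_linear.continuous_on[OF qc])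
  qed
  have all: "0 \<le> qform UNIV (qhess v \<eta>) (\<lambda>l. q$l) $ 1" for q
  proof (rule ccontr)
    assume neg: "\<not> ?thesis"
    then have "q \<in> degenerate_set" using nondeg by blast
    then obtain e where e: "\<And>s. s \<noteq> 0 \<Longrightarrow> q + s *\<^sub>R e \<notin> degenerate_set \<or> q - s *\<^sub>R e \<notin> degenerate_set"
      using degenerate_set_approx[of q] by blast
    define F where "F s = qform UNIV (qhess v \<eta>) (\<lambda>l. (q + s *\<^sub>R e)$l) $ 1" for s
    have F0: "F 0 < 0" using neg by (simp add: F_def)
    have "isCont F 0" using cont[of q e, folded F_def] unfolding continuous_on_eq_continuous_at[OF open_UNIV] by blast
    then obtain d where d: "d > 0" "\<And>s. \<bar>s\<bar> < d \<Longrightarrow> \<bar>F s - F 0\<bar> < - F 0"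
      using F0 unfolding continuous_at_eps_delta dist_real_def by (metis diff_0_right neg_0_less_iff_less)
    have "F (d/2) < 0" "F (- (d/2)) < 0" using d(2)[of "d/2"] d(2)[of "- (d/2)"] d(1) by auto
    moreover have "q + (d/2) *\<^sub>R e \<notin> degenerate_set \<or> q + (- (d/2)) *\<^sub>R e \<notin> degenerate_set"
      using e[of "d/2"] d(1) by simp
    ultimately show False using nondeg unfolding F_def by (metis not_less)
  qed
  have "0 \<le> qform UNIV (qhess v \<eta>) x $ 1" for x using all[of "\<chi> l. x l"] by simp
  then show ?thesis unfolding H qpossemidef_def using qherm_qhess[OF v2] by blast
qed

subsection \<open>Chern-Levine-Nirenberg estimate\<close>

definition sqx :: "('n::finite) hpt \<Rightarrow> real" where
  "sqx p = fst p \<bullet> fst p"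

lemma Ck_sqx: "Ck k (sqx :: ('n::finite) hpt \<Rightarrow> real)"
proof -
  have e: "(sqx :: 'n hpt \<Rightarrow> real) = (\<lambda>p. \<Sum>b\<in>Basis. (fst p \<bullet> b) * (fst p \<bullet> b))"
    by (rule ext) (simp add: sqx_def euclidean_inner[of "fst _" "fst _"])
  have b: "Ck k (\<lambda>p::'n hpt. fst p \<bullet> b)" for b
    by (rule Ck_bounded_linear) (intro bounded_linear_intros)
  show ?thesis unfolding e by (intro Ck_sum Ck_mult b)
qed

lemma XX_XX_sqx: "XX l a (XX m b sqx) p = (if l = m \<and> a = b then 2 else 0)"
  and TT_sqx: "TT sqx p = 0"
proof -
  have d: "dd v sqx p = 2 * (fst p \<bullet> fst v)" for v and p :: "'a hpt"
    unfolding sqx_def[abs_def] by (rule dd_eqI) (auto intro!: derivative_eq_intros simp: inner_commute)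
  have x: "XX m b sqx = (\<lambda>p. 2 * (fst p \<bullet> ev m b))" unfolding XX_def d by simp
  have "dd v (XX m b sqx) p = 2 * (fst v \<bullet> ev m b)" for v
    unfolding x by (rule dd_eqI) (auto intro!: derivative_eq_intros)
  then show "XX l a (XX m b sqx) p = (if l = m \<and> a = b then 2 else 0)"
    unfolding XX_def[of l a] by (simp add: inner_axis_axis)
  show "TT sqx p = 0" unfolding d by simp
qed

lemma qhess_sqx: "qhess sqx p l m = 8 *\<^sub>R qidm l m"
  unfolding quat_eq_iff qhess_nth[OF Ck_sqx] XX_XX_sqx TT_sqx by (simp add: qidm_def)

text \<open>Bounding each of the \<open>n^2\<close> terms of the form by
  \<open>\<epsilon> (|v_l|^2 + |v_m|^2) / 2\<close> and summing gives \<open>\<epsilon> n\<close>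
  times the sum of the \<open>|v_l|^2\<close>. The sign \<open>s\<close> covers both one-sided
  bounds.\<close>

lemma qpossemidef_dominated:
  assumes A: "qherm UNIV (A :: 'n::finite \<Rightarrow> 'n \<Rightarrow> quat)" and e: "\<And>l m. norm (A l m) \<le> \<epsilon>" and s: "\<bar>s\<bar> = 1"
  shows "qpossemidef (\<lambda>l m. (\<epsilon> * CARD('n)) *\<^sub>R qidm l m + s *\<^sub>R A l m)"
proof -
  have "0 \<le> qform UNIV (\<lambda>l m. (\<epsilon> * CARD('n)) *\<^sub>R qidm l m + s *\<^sub>R A l m) v $ 1" for v
  proof -
    have e0: "0 \<le> \<epsilon>" using e[of undefined undefined] norm_ge_zero order_trans by blast
    have t: "\<bar>qmult (qconj (v l)) (qmult (A l m) (v m)) $ 1\<bar> \<le> \<epsilon> * ((norm (v l))\<^sup>2 + (norm (v m))\<^sup>2) / 2" for l m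
    proof -
      have "\<bar>qmult (qconj (v l)) (qmult (A l m) (v m)) $ 1\<bar> \<le> norm (v l) * (norm (A l m) * norm (v m))"
        using component_le_norm_cart[of "qmult (qconj (v l)) (qmult (A l m) (v m))" 1] by (simp only: norm_qmult norm_qconj)
      also have "\<dots> = norm (A l m) * (norm (v l) * norm (v m))" by simp
      also have "\<dots> \<le> \<epsilon> * (norm (v l) * norm (v m))" by (rule mult_right_mono[OF e]) simp
      also have "\<dots> \<le> \<epsilon> * (((norm (v l))\<^sup>2 + (norm (v m))\<^sup>2) / 2)"
        by (rule mult_left_mono[OF _ e0]) (use sum_squares_bound[of "norm (v l)" "norm (v m)"] in simp)
      finally show ?thesis by simp
    qed
    have "\<bar>qform UNIV A v $ 1\<bar> \<le> (\<Sum>l\<in>UNIV. \<Sum>m\<in>UNIV. \<bar>qmult (qconj (v l)) (qmult (A l m) (v m)) $ 1\<bar>)"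
      unfolding qform_def sum_component by (intro order_trans[OF sum_abs] sum_mono sum_abs)
    also have "\<dots> \<le> (\<Sum>l\<in>UNIV. \<Sum>m\<in>UNIV. \<epsilon> * ((norm (v l))\<^sup>2 + (norm (v m))\<^sup>2) / 2)"
      by (intro sum_mono t)
    also have "\<dots> = \<epsilon> * CARD('n) * (\<Sum>l\<in>UNIV. (norm (v l))\<^sup>2)"
      by (simp add: sum.distrib sum_divide_distrib[symmetric] distrib_left sum_distrib_left[symmetric])
    finally show ?thesis unfolding qform_add qform_scaleR vector_add_component vector_scaleR_component qform_qidm
      using s by (auto simp: abs_if split: if_splits)
  qed
  then show ?thesis unfolding qpossemidef_def using qherm_add[OF qherm_scaleR[OF qherm_qidm] qherm_scaleR[OF A]] by blast
qed

lemma mixD_slot_linear: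
  fixes H :: "'n::finite \<Rightarrow> 'n \<Rightarrow> 'n \<Rightarrow> quat"
  shows "mixD (H(i := \<lambda>l m. c *\<^sub>R A l m + d *\<^sub>R B l m)) = of_real c * mixD (H(i := A)) + of_real d * mixD (H(i := B))"
proof -
  have "(\<Prod>j\<in>UNIV. pfE ((H(i := A)) j) (x j) (y j)) = pfE A (x i) (y i) * (\<Prod>j\<in>UNIV - {i}. pfE (H j) (x j) (y j))" for A x y
    by (subst prod.remove[of UNIV i]) auto
  then show ?thesis
    unfolding mixD_def by (simp add: pfE_def pfB_linear algebra_simps sum.distrib sum_distrib_left)
qed

text \<open>From here on plurisubharmonicity of a C^2 function is used only through its Hessian.
  This class contains \<open>sqx\<close> by direct computation.\<close>

definition qpsh :: "('n::finite) hpt set \<Rightarrow> ('n hpt \<Rightarrow> real) \<Rightarrow> bool" where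
  "qpsh \<Omega> u \<longleftrightarrow> C2_on \<Omega> u \<and> (\<forall>p\<in>\<Omega>. qpossemidef (qhess u p))"

lemma mixR_upd: "mixR (u(i := \<phi>)) p = Re (mixD ((\<lambda>j. qhess (u j) p)(i := qhess \<phi> p)))"
  unfolding mixR_def by (rule arg_cong[where f="\<lambda>H. Re (mixD H)"]) auto

text \<open>Both \<open>\<epsilon> n I\<close> plus and minus the Hessian of \<phi> are
  semidefinite, and the mixed determinant is linear in slot \<open>i\<close> and nonnegative. The
  factor 1/8 arises since the Hessian of \<open>sqx\<close> is \<open>8 I\<close>.\<close>

lemma mixR_dominated:
  fixes w :: "('n::{finite,linorder}) \<Rightarrow> 'n hpt \<Rightarrow> real"
  assumes w: "\<And>j. qpossemidef (qhess (w j) p)" and phi: "Ck (Suc (Suc 0)) \<phi>"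
    and e: "\<And>l m. norm (qhess \<phi> p l m) \<le> \<epsilon>"
  shows "\<bar>mixR (w(i := \<phi>)) p\<bar> \<le> \<epsilon> * CARD('n) / 8 * mixR (w(i := sqx)) p"
proof -
  let ?H = "\<lambda>j. qhess (w j) p"
  have H: "qhess sqx p = (\<lambda>l m. 8 *\<^sub>R qidm l m + 0 *\<^sub>R qidm l m)" by (simp add: fun_eq_iff qhess_sqx)
  have "0 \<le> \<epsilon> * CARD('n) * Re (mixD (?H(i := qidm))) + s * Re (mixD (?H(i := qhess \<phi> p)))" if s: "\<bar>s\<bar> = 1" for s
  proof -
    have "mixD (?H(i := (\<lambda>l m. (\<epsilon> * CARD('n)) *\<^sub>R qidm l m + s *\<^sub>R qhess \<phi> p l m))) \<in> \<real>\<^sub>\<ge>\<^sub>0"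
      by (rule mixD_nonneg) (use w qpossemidef_dominated[OF qherm_qhess[OF phi] e s] in auto)
    then show ?thesis unfolding mixD_slot_linear by (auto simp: complex_nonneg_Reals_iff)
  qed
  from this[of 1] this[of "-1"]
  have "\<bar>Re (mixD (?H(i := qhess \<phi> p)))\<bar> \<le> \<epsilon> * CARD('n) * Re (mixD (?H(i := qidm)))" by auto
  moreover have "Re (mixD (?H(i := qhess sqx p))) = 8 * Re (mixD (?H(i := qidm)))"
    unfolding H mixD_slot_linear by simp
  ultimately show ?thesis unfolding mixR_upd by simp
qed

lemma qpsh_sqx: "qpsh \<Omega> sqx"
proof -
  have "0 \<le> qform UNIV (\<lambda>l m. 8 *\<^sub>R qidm l m) v $ 1" for v :: "'a \<Rightarrow> quat"
    unfolding qform_scaleR vector_scaleR_component qform_qidm by (simp add: sum_nonneg)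
  moreover have "qhess sqx p = (\<lambda>l m. 8 *\<^sub>R qidm l m)" for p :: "'a hpt" by (simp add: fun_eq_iff qhess_sqx)
  ultimately show ?thesis
    unfolding qpsh_def qpossemidef_def by (auto intro: Ck_C2_on[OF Ck_sqx] qherm_scaleR[OF qherm_qidm])
qed

lemma mixR_nonneg:
  assumes "p \<in> \<Omega>" "\<And>i. qpsh \<Omega> (w i)"
  shows "0 \<le> mixR (w :: ('n::{finite,linorder}) \<Rightarrow> 'n hpt \<Rightarrow> real) p"
proof -
  have "mixD (\<lambda>i. qhess (w i) p) \<in> \<real>\<^sub>\<ge>\<^sub>0" by (rule mixD_nonneg) (use assms in \<open>auto simp: qpsh_def\<close>)
  then show ?thesis unfolding mixR_def by (simp add: complex_nonneg_Reals_iff)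
qed

lemma mixR_MA_density:
  assumes "p \<in> \<Omega>" "qpsh \<Omega> (u :: ('n::{finite,linorder}) hpt \<Rightarrow> real)"
  shows "mixR (\<lambda>i::'n. u) p = (2 ^ CARD('n) * fact CARD('n)) * MA_density u p"
proof -
  have "qpossemidef (qhess u p)" using assms by (auto simp: qpsh_def)
  from qpossemidef_mixD(1)[OF this] show ?thesis
    unfolding mixR_def MA_density_def by (simp only: Re_complex_of_real)
qed

lemma continuous_on_mixR:
  fixes w :: "('n::finite) \<Rightarrow> 'n hpt \<Rightarrow> real"
  assumes \<Omega>: "open \<Omega>" and w: "\<And>i. C2_on \<Omega> (w i)"
  shows "continuous_on \<Omega> (mixR w)"
proof -
  have "isCont (mixR w) p" if p: "p \<in> \<Omega>" for p
  proof -
    obtain \<psi> :: "'n hpt \<Rightarrow> real" and N K' where psi: "Ck 3 \<psi>" "open N" "{p} \<subseteq> N" "N \<subseteq> K'" "compact K'" "K' \<subseteq> \<Omega>"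
      and psi1: "\<forall>x\<in>N. \<psi> x = 1" and psi0: "\<forall>x. x \<notin> K' \<longrightarrow> \<psi> x = 0"
      by (rule smooth_cutoff[OF \<Omega>, of "{p}"]) (use p in auto)
    define w' where "w' i x = \<psi> x * w i x" for i x
    have w': "Ck (Suc (Suc 0)) (w' i)" for i
      unfolding w'_def[abs_def]
      by (rule Ck_cutoff_mult[OF \<Omega> compact_imp_closed[OF psi(5)] psi(6) Ck_mono[OF psi(1)] psi0[rule_format] C2_on_Ck_on[OF \<Omega> w]]) simp
    have e: "mixR w x = mixR w' x" if "x \<in> N" for x
      by (rule mixR_cong_open[OF psi(2) that]) (use psi1 in \<open>simp add: w'_def\<close>)
    have "eventually (\<lambda>x. x \<in> N) (nhds p)" by (rule eventually_nhds_in_open[OF psi(2)]) (use psi(3) in simp)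
    then have ev: "eventually (\<lambda>x. mixR w x = mixR w' x) (nhds p)" by (rule eventually_mono) (rule e)
    have "isCont (mixR w') p" using continuous_mixR[of w', OF w'] unfolding continuous_on_eq_continuous_at[OF open_UNIV] by blast
    then show ?thesis using isCont_cong[OF ev] by blast
  qed
  then show ?thesis by (simp add: continuous_at_imp_continuous_on)
qed

lemma qhess_bounded:
  fixes \<phi> :: "('n::finite) hpt \<Rightarrow> real"
  assumes phi: "Ck (Suc (Suc 0)) \<phi>" and K: "compact K"
  obtains \<epsilon> where "0 \<le> \<epsilon>" "\<And>p l m. p \<in> K \<Longrightarrow> norm (qhess \<phi> p l m) \<le> \<epsilon>"
proof -
  have XXc: "continuous_on UNIV (XX l a (XX m b \<phi>))" for l a m b
    by (rule Ck_continuous[OF Ck_XX_real[OF Ck_XX_real[OF phi]]])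
  have TTc: "continuous_on UNIV (TT \<phi>)" by (rule Ck_continuous[OF Ck_dd[OF phi]])
  have c: "continuous_on UNIV (\<lambda>p. qhess \<phi> p l m $ k)" for l m k
  proof -
    have "continuous_on UNIV (\<lambda>p. qhess \<phi> p l m $ k)" if "k = 1 \<or> k = 2 \<or> k = 3 \<or> k = 4"
      using that by (elim disjE; cases "l = m"; simp only: qhess_nth[OF phi] if_True if_False simp_thms)
        (intro continuous_intros XXc TTc)+
    then show ?thesis using exhaust_4[of k] by blast
  qed
  define S where "S p = (\<Sum>l\<in>UNIV. \<Sum>m\<in>UNIV. \<Sum>k\<in>UNIV. \<bar>qhess \<phi> p l m $ k\<bar>)" for p
  have "continuous_on K S" unfolding S_def[abs_def] by (intro continuous_intros continuous_on_subset[OF c subset_UNIV])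
  then have "bounded (S ` K)" using K compact_continuous_image compact_imp_bounded by blast
  then obtain B where B: "\<And>p. p \<in> K \<Longrightarrow> \<bar>S p\<bar> \<le> B" unfolding bounded_iff by auto
  have "norm (qhess \<phi> p l m) \<le> max 0 B" if "p \<in> K" for p l m
  proof -
    have "norm (qhess \<phi> p l m) \<le> (\<Sum>k\<in>UNIV. \<bar>qhess \<phi> p l m $ k\<bar>)" by (rule norm_le_l1_cart)
    also have "\<dots> \<le> (\<Sum>m\<in>UNIV. \<Sum>k\<in>UNIV. \<bar>qhess \<phi> p l m $ k\<bar>)"
      by (rule member_le_sum[of m UNIV "\<lambda>m. \<Sum>k\<in>UNIV. \<bar>qhess \<phi> p l m $ k\<bar>"]) (auto intro: sum_nonneg)
    also have "\<dots> \<le> S p" unfolding S_def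
      by (rule member_le_sum[of l UNIV "\<lambda>l. \<Sum>m\<in>UNIV. \<Sum>k\<in>UNIV. \<bar>qhess \<phi> p l m $ k\<bar>"]) (auto intro!: sum_nonneg)
    also have "\<dots> \<le> max 0 B" using B[OF that] by simp
    finally show ?thesis .
  qed
  then show ?thesis using that[of "max 0 B"] by simp
qed

lemma abs_integral_le:
  fixes f g :: "'a \<Rightarrow> real"
  assumes g: "integrable M g" and le: "\<And>x. \<bar>f x\<bar> \<le> g x"
  shows "\<bar>\<integral>x. f x \<partial>M\<bar> \<le> (\<integral>x. g x \<partial>M)"
proof -
  have "(\<integral>x. \<bar>f x\<bar> \<partial>M) \<le> (\<integral>x. g x \<partial>M)"
    by (rule integral_mono'[OF g]) (use le abs_ge_zero order_trans in blast)+
  then show ?thesis using integral_abs_bound[of M f] by linarith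
qed

lemma mixR_set_integrable:
  assumes "open \<Omega>" "compact K" "K \<subseteq> \<Omega>" "\<And>i. qpsh \<Omega> (w i)"
  shows "set_integrable lborel K (mixR (w :: 'n::finite \<Rightarrow> _))"
  unfolding set_integrable_def
  by (rule borel_integrable_compact[OF assms(2) continuous_on_subset[OF continuous_on_mixR[OF assms(1)] assms(3)]])
    (use assms(4) in \<open>simp add: qpsh_def\<close>)

text \<open>The basic estimate after an exchange: the test function sits in slot \<open>i\<close>,
  where its Hessian vanishes off \<open>K\<close> and is dominated on \<open>K\<close> by that of
  \<open>sqx\<close>, while the exchanged function \<open>g\<close> enters only through its sup
  norm.\<close>

lemma integral_mixR_test_bound:
  fixes w :: "('n::{finite,linorder}) \<Rightarrow> 'n hpt \<Rightarrow> real"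
  assumes \<Omega>: "open \<Omega>" and K: "compact K" "K \<subseteq> \<Omega>"
    and phi: "Ck (Suc (Suc 0)) \<phi>" "\<And>x. x \<notin> K \<Longrightarrow> \<phi> x = 0"
    and e: "\<And>p l m. p \<in> K \<Longrightarrow> norm (qhess \<phi> p l m) \<le> \<epsilon>"
    and w: "\<And>i. qpsh \<Omega> (w i)" and g: "\<And>x. x \<in> K \<Longrightarrow> \<bar>g x\<bar> \<le> \<delta>"
  shows "\<bar>\<integral>p. g p * mixR (w(i := \<phi>)) p \<partial>lborel\<bar> \<le> \<delta> * (\<epsilon> * CARD('n) / 8) * (\<integral>p\<in>K. mixR (w(i := sqx)) p \<partial>lborel)"
proof -
  let ?c = "\<delta> * (\<epsilon> * CARD('n) / 8)"
  have w': "qpsh \<Omega> ((w(i := sqx)) j)" for j by (simp add: w qpsh_sqx)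
  have "\<bar>g p * mixR (w(i := \<phi>)) p\<bar> \<le> ?c * (indicator K p *\<^sub>R mixR (w(i := sqx)) p)" for p
  proof (cases "p \<in> K")
    case True
    then have "\<bar>mixR (w(i := \<phi>)) p\<bar> \<le> \<epsilon> * CARD('n) / 8 * mixR (w(i := sqx)) p"
      using K w by (intro mixR_dominated phi e) (auto simp: qpsh_def)
    then have "\<bar>g p\<bar> * \<bar>mixR (w(i := \<phi>)) p\<bar> \<le> \<delta> * (\<epsilon> * CARD('n) / 8 * mixR (w(i := sqx)) p)"
      using g[OF True] by (intro mult_mono) auto
    then show ?thesis using True by (simp add: abs_mult)
  next
    case False
    have "mixR (w(i := \<phi>)) p = 0"
      by (rule mixR_zero_off[of "- K" p _ i]) (use False K(1) phi(2) in \<open>auto simp: compact_imp_closed\<close>)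
    then show ?thesis using False by simp
  qed
  then have "\<bar>\<integral>p. g p * mixR (w(i := \<phi>)) p \<partial>lborel\<bar> \<le> (\<integral>p. ?c * (indicator K p *\<^sub>R mixR (w(i := sqx)) p) \<partial>lborel)"
    by (intro abs_integral_le integrable_mult_right mixR_set_integrable[OF \<Omega> K w', unfolded set_integrable_def])
  then show ?thesis unfolding set_lebesgue_integral_def by simp
qed

definition loc_bdd :: "('n::finite) hpt set \<Rightarrow> ('n hpt \<Rightarrow> real) set \<Rightarrow> bool" where
  "loc_bdd \<Omega> W \<longleftrightarrow> (\<forall>K. compact K \<longrightarrow> K \<subseteq> \<Omega> \<longrightarrow> (\<exists>M\<ge>0. \<forall>w\<in>W. \<forall>x\<in>K. \<bar>w x\<bar> \<le> M))"

text \<open>Induction on the set of slots that may differ from \<open>sqx\<close>. A cut-off is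
  exchanged with the function in one such slot and the result is dominated with \<open>sqx\<close>
  in that slot, at the price of enlarging the compact set. As \<open>sqx\<close> is in
  \<open>W\<close>, the new tuple is again of the kind covered.\<close>

theorem mixR_CLN:
  assumes \<Omega>: "open \<Omega>" and W: "\<And>w. w \<in> W \<Longrightarrow> qpsh \<Omega> w" "loc_bdd \<Omega> W" "sqx \<in> W" and K: "compact K" "K \<subseteq> \<Omega>"
  obtains C where "0 \<le> C" "\<And>w :: ('n::{finite,linorder}) \<Rightarrow> 'n hpt \<Rightarrow> real. (\<And>i. w i \<in> W) \<Longrightarrow> (\<integral>p\<in>K. mixR w p \<partial>lborel) \<le> C"
proof -
  have "\<exists>C. \<forall>w :: 'n \<Rightarrow> 'n hpt \<Rightarrow> real. (\<forall>i. w i \<in> W) \<longrightarrow> (\<forall>i. i \<notin> T \<longrightarrow> w i = sqx) \<longrightarrow> (\<integral>p\<in>K. mixR w p \<partial>lborel) \<le> C"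
    if "finite T" "compact K" "K \<subseteq> \<Omega>" for T K
    using that
  proof (induct T arbitrary: K)
    case empty
    have "(\<integral>p\<in>K. mixR w p \<partial>lborel) \<le> (\<integral>p\<in>K. mixR (\<lambda>_. sqx) p \<partial>lborel)"
      if "\<forall>i. i \<notin> {} \<longrightarrow> w i = sqx" for w :: "'n \<Rightarrow> 'n hpt \<Rightarrow> real"
    proof -
      have "w = (\<lambda>_. sqx)" using that by (intro ext) simp
      then show ?thesis by simp
    qed
    then show ?case by blast
  next
    case (insert i T)
    obtain \<theta> :: "'n hpt \<Rightarrow> real" and N K' where chi: "Ck 3 \<theta>" "open N" "K \<subseteq> N" "N \<subseteq> K'" "compact K'" "K' \<subseteq> \<Omega>"
      and chi1: "\<forall>x\<in>N. \<theta> x = 1" and chi0: "\<forall>x. x \<notin> K' \<longrightarrow> \<theta> x = 0" and chipos: "\<forall>x. 0 \<le> \<theta> x"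
      by (rule smooth_cutoff[OF \<Omega> insert(4,5)])
    have chi2: "Ck (Suc (Suc 0)) \<theta>" by (rule Ck_mono[OF chi(1)]) simp
    obtain C where C: "\<And>w :: 'n \<Rightarrow> 'n hpt \<Rightarrow> real. (\<forall>i. w i \<in> W) \<Longrightarrow> (\<forall>i. i \<notin> T \<longrightarrow> w i = sqx) \<Longrightarrow> (\<integral>p\<in>K'. mixR w p \<partial>lborel) \<le> C"
      using insert(3)[OF chi(5,6)] by blast
    obtain \<epsilon> where eps: "0 \<le> \<epsilon>" "\<And>p l m. p \<in> K' \<Longrightarrow> norm (qhess \<theta> p l m) \<le> \<epsilon>"
      using qhess_bounded[OF chi2 chi(5)] by metis
    obtain M where M: "M \<ge> 0" "\<And>w x. w \<in> W \<Longrightarrow> x \<in> K' \<Longrightarrow> \<bar>w x\<bar> \<le> M"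
      using W(2) chi(5,6) unfolding loc_bdd_def by meson
    have "(\<integral>p\<in>K. mixR w p \<partial>lborel) \<le> M * (\<epsilon> * CARD('n) / 8) * C"
      if w: "\<forall>i. w i \<in> W" "\<forall>j. j \<notin> insert i T \<longrightarrow> w j = sqx" for w :: "'n \<Rightarrow> 'n hpt \<Rightarrow> real"
    proof -
      have wq: "qpsh \<Omega> (w j)" for j using w W(1) by blast
      have wc: "C2_on \<Omega> (w j)" for j using wq by (simp add: qpsh_def)
      have cont: "continuous_on \<Omega> (mixR w)" by (rule continuous_on_mixR[OF \<Omega> wc])
      have "integrable lborel (\<lambda>p. indicator K' p *\<^sub>R (\<theta> p * mixR w p))"
        by (rule borel_integrable_compact[OF chi(5)])
          (intro continuous_intros continuous_on_subset[OF cont chi(6)] continuous_on_subset[OF Ck_continuous[OF chi(1)] subset_UNIV])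
      moreover have "(\<lambda>p. indicator K' p *\<^sub>R (\<theta> p * mixR w p)) = (\<lambda>p. \<theta> p * mixR w p)"
        using chi0 by (intro ext) (metis indicator_simps mult_zero_left scaleR_one scaleR_zero_left)
      ultimately have int: "integrable lborel (\<lambda>p. \<theta> p * mixR w p)" by simp
      have "(\<integral>p\<in>K. mixR w p \<partial>lborel) \<le> (\<integral>p. \<theta> p * mixR w p \<partial>lborel)"
        unfolding set_lebesgue_integral_def
      proof (rule integral_mono[OF mixR_set_integrable[OF \<Omega> insert(4,5) wq, unfolded set_integrable_def] int])
        fix p
        show "indicator K p *\<^sub>R mixR w p \<le> \<theta> p * mixR w p"
        proof (cases "p \<in> K'")
          case True
          then have "p \<in> \<Omega>" using chi(6) by (rule set_rev_mp)
          then have w0: "0 \<le> mixR w p" by (rule mixR_nonneg[OF _ wq])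
          show ?thesis
          proof (cases "p \<in> K")
            case True
            then have "p \<in> N" using chi(3) by (rule set_rev_mp)
            then have "\<theta> p = 1" by (rule chi1[rule_format])
            then show ?thesis using True by simp
          next
            case False
            then show ?thesis using mult_nonneg_nonneg[OF chipos[rule_format, of p] w0] by simp
          qed
        next
          case False
          then have "\<theta> p = 0" "p \<notin> K" using chi0[rule_format, of p] subset_trans[OF chi(3,4)] by blast+
          then show ?thesis by simp
        qed
      qed
      \<comment> \<open>Only the size of \<open>w i\<close> on \<open>K'\<close> now matters; its
        derivatives have been traded for those of the fixed cut-off.\<close>
      also have "\<dots> = (\<integral>p. w i p * mixR (w(i := \<theta>)) p \<partial>lborel)"
        by (rule integral_mixR_swap[OF \<Omega> chi(5,6) chi2 chi0[rule_format] wc])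
      also have "\<dots> \<le> M * (\<epsilon> * CARD('n) / 8) * (\<integral>p\<in>K'. mixR (w(i := sqx)) p \<partial>lborel)"
        by (rule order_trans[OF abs_ge_self integral_mixR_test_bound[OF \<Omega> chi(5,6) chi2 chi0[rule_format] eps(2) wq M(2)]]) (use w in auto)
      also have "\<dots> \<le> M * (\<epsilon> * CARD('n) / 8) * C"
        by (intro mult_left_mono C) (use w W(3) M(1) eps(1) in auto)
      finally show ?thesis .
    qed
    then show ?case by blast
  qed
  from this[OF finite[of UNIV] K] obtain C where C: "\<And>w :: 'n \<Rightarrow> 'n hpt \<Rightarrow> real. (\<And>i. w i \<in> W) \<Longrightarrow> (\<integral>p\<in>K. mixR w p \<partial>lborel) \<le> C"
    by auto
  show ?thesis by (rule that[of "max 0 C"]) (use C in \<open>auto simp: le_max_iff_disj\<close>)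
qed

subsection \<open>Convergence of the densities\<close>

definition Cc :: "'a::euclidean_space set \<Rightarrow> ('a \<Rightarrow> real) set" where
  "Cc \<Omega> = {\<phi>. continuous_on UNIV \<phi> \<and> (\<exists>K. compact K \<and> K \<subseteq> \<Omega> \<and> (\<forall>x. x \<notin> K \<longrightarrow> \<phi> x = 0))}"

text \<open>The compact set \<open>K\<close> is chosen before the accuracy, so the mass bound on
  \<open>K\<close> is available when the accuracy has to be fixed.\<close>

lemma Cc_smooth_approx:
  fixes \<phi> :: "'a::euclidean_space \<Rightarrow> real"
  assumes \<Omega>: "open \<Omega>" and phi: "\<phi> \<in> Cc \<Omega>"
  obtains K where "compact K" "K \<subseteq> \<Omega>" "\<And>x. x \<notin> K \<Longrightarrow> \<phi> x = 0"
    "\<And>e. e > 0 \<Longrightarrow> \<exists>\<psi>. Ck 3 \<psi> \<and> (\<forall>x. x \<notin> K \<longrightarrow> \<psi> x = 0) \<and> (\<forall>x. \<bar>\<phi> x - \<psi> x\<bar> \<le> e)"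
proof -
  obtain K0 where c: "continuous_on UNIV \<phi>" and K0: "compact K0" "K0 \<subseteq> \<Omega>" "\<And>x. x \<notin> K0 \<Longrightarrow> \<phi> x = 0"
    using phi unfolding Cc_def by blast
  obtain N K where K: "open N" "K0 \<subseteq> N" "N \<subseteq> K" "compact K" "K \<subseteq> \<Omega>"
    using smooth_cutoff[OF \<Omega> K0(1,2)] by metis
  obtain d where d: "d > 0" "(\<Union>x\<in>K0. ball x d) \<subseteq> N"
    using compact_subset_open_imp_ball_epsilon_subset[OF K0(1) K(1,2)] by metis
  obtain a b where ab: "K0 \<subseteq> cbox a b" using compact_in_cbox[OF K0(1)] by metis
  have z: "\<phi> x = 0" if "x \<notin> cbox a b" for x using K0(3) ab that by blast
  have "\<exists>\<psi>. Ck 3 \<psi> \<and> (\<forall>x. x \<notin> K \<longrightarrow> \<psi> x = 0) \<and> (\<forall>x. \<bar>\<phi> x - \<psi> x\<bar> \<le> e)" if e: "e > 0" for e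
  proof -
    have "\<forall>\<^sub>F n in sequentially. \<forall>x\<in>UNIV. dist (moll a b n \<phi> x) (\<phi> x) < e"
      using moll_uniform_limit[OF c z] e unfolding uniform_limit_iff by blast
    moreover have "\<forall>\<^sub>F n in sequentially. 1 / real (Suc n) < d"
      using order_tendstoD(2)[OF LIMSEQ_inverse_real_of_nat d(1)] by (simp add: inverse_eq_divide)
    ultimately have "\<forall>\<^sub>F n in sequentially. (\<forall>x\<in>UNIV. dist (moll a b n \<phi> x) (\<phi> x) < e) \<and> 1 / real (Suc n) < d"
      by (rule eventually_conj)
    then obtain n where n: "\<And>x. dist (moll a b n \<phi> x) (\<phi> x) < e" "1 / real (Suc n) < d"
      unfolding eventually_sequentially by blast
    have "moll a b n \<phi> x = 0" if x: "x \<notin> K" for x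
    proof (rule moll_zero)
      fix t assume "dist t x < 1 / real (Suc n)"
      then have "x \<in> ball t d" using n(2) by simp
      then have "t \<notin> K0" using x d(2) K(3) by blast
      then show "\<phi> t = 0" by (rule K0(3))
    qed
    moreover have "\<bar>\<phi> x - moll a b n \<phi> x\<bar> \<le> e" for x
      using n(1)[of x] by (simp add: dist_real_def abs_minus_commute)
    ultimately show ?thesis using Ck_moll[OF c] by blast
  qed
  moreover have "\<phi> x = 0" if "x \<notin> K" for x using K0(3) K(2,3) that by blast
  ultimately show ?thesis using that[of K] K(4,5) by blast
qed

lemma integral_Cc_mult_bound:
  fixes f g :: "'a::euclidean_space \<Rightarrow> real"
  assumes K: "compact K" "K \<subseteq> \<Omega>" and f: "continuous_on \<Omega> f" "\<And>x. x \<in> \<Omega> \<Longrightarrow> 0 \<le> f x"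
    and g: "\<And>x. x \<notin> K \<Longrightarrow> g x = 0" "\<And>x. \<bar>g x\<bar> \<le> \<delta>"
  shows "\<bar>\<integral>x. g x * f x \<partial>lborel\<bar> \<le> \<delta> * (\<integral>x\<in>K. f x \<partial>lborel)"
proof -
  have "integrable lborel (\<lambda>x. indicator K x *\<^sub>R f x)"
    by (rule borel_integrable_compact[OF K(1) continuous_on_subset[OF f(1) K(2)]])
  moreover have "\<bar>g x * f x\<bar> \<le> \<delta> * (indicator K x *\<^sub>R f x)" for x
  proof (cases "x \<in> K")
    case True
    then have "0 \<le> f x" using f(2) K(2) by blast
    then show ?thesis using True g(2)[of x] by (simp add: abs_mult mult_right_mono)
  qed (simp add: g(1))
  ultimately have "\<bar>\<integral>x. g x * f x \<partial>lborel\<bar> \<le> (\<integral>x. \<delta> * (indicator K x *\<^sub>R f x) \<partial>lborel)"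
    by (intro abs_integral_le integrable_mult_right)
  then show ?thesis unfolding set_lebesgue_integral_def by simp
qed

lemma integrable_Cc_mult:
  fixes f g :: "'a::euclidean_space \<Rightarrow> real"
  assumes K: "compact K" "K \<subseteq> \<Omega>" and f: "continuous_on \<Omega> f"
    and g: "continuous_on UNIV g" "\<And>x. x \<notin> K \<Longrightarrow> g x = 0"
  shows "integrable lborel (\<lambda>x. g x * f x)"
proof -
  have "integrable lborel (\<lambda>x. indicator K x *\<^sub>R (g x * f x))"
    by (rule borel_integrable_compact[OF K(1)])
      (intro continuous_intros continuous_on_subset[OF f K(2)] continuous_on_subset[OF g(1) subset_UNIV])
  moreover have "(\<lambda>x. indicator K x *\<^sub>R (g x * f x)) = (\<lambda>x. g x * f x)"
    by (rule ext) (use g(2) in \<open>auto simp: indicator_def\<close>)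
  ultimately show ?thesis by simp
qed

text \<open>When a single slot changes from \<open>u\<close> to \<open>v\<close>, an exchange turns
  the difference of the integrals into one of \<open>v - u\<close> against a mixed density with the
  test function in that slot. This costs a multiple of the sup norm, and there are \<open>n\<close>
  such steps.\<close>

lemma mixR_test_lipschitz:
  assumes \<Omega>: "open \<Omega>" and W: "\<And>w. w \<in> W \<Longrightarrow> qpsh \<Omega> w" "loc_bdd \<Omega> W" "sqx \<in> W" and K: "compact K" "K \<subseteq> \<Omega>"
    and phi: "Ck (Suc (Suc 0)) \<phi>" "\<And>x. x \<notin> K \<Longrightarrow> \<phi> x = 0"
  obtains C where "0 \<le> C"
    "\<forall>u :: ('n::{finite,linorder}) hpt \<Rightarrow> real. \<forall>v \<delta>. u \<in> W \<longrightarrow> v \<in> W \<longrightarrow> 0 \<le> \<delta> \<longrightarrow> (\<forall>x\<in>K. \<bar>v x - u x\<bar> \<le> \<delta>) \<longrightarrow>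
      \<bar>(\<integral>p. \<phi> p * mixR (\<lambda>_. v) p \<partial>lborel) - (\<integral>p. \<phi> p * mixR (\<lambda>_. u) p \<partial>lborel)\<bar> \<le> C * \<delta>"
proof -
  obtain C0 where C0: "0 \<le> C0" "\<And>w :: 'n \<Rightarrow> 'n hpt \<Rightarrow> real. (\<And>i. w i \<in> W) \<Longrightarrow> (\<integral>p\<in>K. mixR w p \<partial>lborel) \<le> C0"
    using mixR_CLN[OF \<Omega> W K] by metis
  obtain \<epsilon> where eps: "0 \<le> \<epsilon>" "\<And>p l m. p \<in> K \<Longrightarrow> norm (qhess \<phi> p l m) \<le> \<epsilon>"
    using qhess_bounded[OF phi(1) K(1)] by metis
  define c where "c = \<epsilon> * CARD('n) / 8"
  have c0: "0 \<le> c" using eps(1) by (simp add: c_def)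
  have zero: "mixR (w(i := \<phi>)) p = 0" if "p \<notin> K" for w i and p :: "'n hpt"
    by (rule mixR_zero_off[of "- K" p _ i]) (use that K(1) phi(2) in \<open>auto simp: compact_imp_closed\<close>)
  have main: "\<bar>(\<integral>p. \<phi> p * mixR (\<lambda>_. v) p \<partial>lborel) - (\<integral>p. \<phi> p * mixR (\<lambda>_. u) p \<partial>lborel)\<bar> \<le> (CARD('n) * (c * C0)) * \<delta>"
    if uv: "u \<in> W" "v \<in> W" "0 \<le> \<delta>" and del: "\<And>x. x \<in> K \<Longrightarrow> \<bar>v x - u x\<bar> \<le> \<delta>" for u v \<delta>
  proof -
    define w where "w T i = (if i \<in> T then v else u)" for T and i :: 'n
    have wW: "w T i \<in> W" for T i using uv by (simp add: w_def)
    have wq: "qpsh \<Omega> (w T i)" for T i by (rule W(1)[OF wW])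
    have wc: "C2_on \<Omega> (w T i)" for T i using wq[of T i] by (simp add: qpsh_def)
    have cw: "continuous_on \<Omega> (w T i)" for T i
      using Ck_on_Suc_D[OF Ck_on_Suc_D[OF C2_on_Ck_on[OF \<Omega> wc[of T i]]]] by simp
    have "\<bar>(\<integral>p. \<phi> p * mixR (w T) p \<partial>lborel) - (\<integral>p. \<phi> p * mixR (w {}) p \<partial>lborel)\<bar> \<le> card T * (\<delta> * c * C0)" if "finite T" for T
      using that
    proof (induct T)
      case empty
      then show ?case by simp
    next
      case (insert i T)
      \<comment> \<open>The two tuples differ only in slot \<open>i\<close>; once the test function
        occupies it they coincide, so both integrals have the same density.\<close>
      have upd: "(w (insert i T))(i := \<phi>) = (w T)(i := \<phi>)" by (auto simp: w_def)
      have int: "integrable lborel (\<lambda>p. w S i p * mixR ((w T)(i := \<phi>)) p)" for S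
      proof -
        have "(\<lambda>p. w S i p * mixR ((w T)(i := \<phi>)) p) = (\<lambda>p. indicator K p *\<^sub>R (w S i p * mixR ((w T)(i := \<phi>)) p))"
          by (rule ext) (use zero in \<open>auto simp: indicator_def\<close>)
        moreover have "continuous_on \<Omega> (mixR ((w T)(i := \<phi>)))"
          by (rule continuous_on_mixR[OF \<Omega>]) (use wc Ck_C2_on[OF phi(1)] in auto)
        then have "integrable lborel (\<lambda>p. indicator K p *\<^sub>R (w S i p * mixR ((w T)(i := \<phi>)) p))"
          by (intro borel_integrable_compact[OF K(1)] continuous_intros continuous_on_subset[OF _ K(2)] cw)
        ultimately show ?thesis by simp
      qed
      have sw: "(\<integral>p. \<phi> p * mixR (w S) p \<partial>lborel) = (\<integral>p. w S i p * mixR ((w S)(i := \<phi>)) p \<partial>lborel)" for S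
        by (rule integral_mixR_swap[OF \<Omega> K phi wc])
      have "(\<integral>p. \<phi> p * mixR (w (insert i T)) p \<partial>lborel) - (\<integral>p. \<phi> p * mixR (w T) p \<partial>lborel)
        = (\<integral>p. (w (insert i T) i p - w T i p) * mixR ((w T)(i := \<phi>)) p \<partial>lborel)"
        unfolding sw[of T] sw[of "insert i T"] upd Bochner_Integration.integral_diff[OF int int, symmetric] left_diff_distrib ..
      also have "\<bar>\<dots>\<bar> \<le> \<delta> * c * (\<integral>p\<in>K. mixR ((w T)(i := sqx)) p \<partial>lborel)"
        unfolding c_def
      proof (rule integral_mixR_test_bound[OF \<Omega> K phi eps(2) wq])
        show "\<bar>w (insert i T) i x - w T i x\<bar> \<le> \<delta>" if "x \<in> K" for x
          using del[OF that] insert(2) by (simp add: w_def)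
      qed
      also have "\<dots> \<le> \<delta> * c * C0"
        by (rule mult_left_mono[OF C0(2)]) (use wW W(3) uv(3) c0 in auto)
      finally show ?case using insert by (simp add: distrib_right)
    qed
    from this[OF finite[of UNIV]] have "\<bar>(\<integral>p. \<phi> p * mixR (w UNIV) p \<partial>lborel) - (\<integral>p. \<phi> p * mixR (w {}) p \<partial>lborel)\<bar> \<le> CARD('n) * (\<delta> * c * C0)" .
    moreover have "w UNIV = (\<lambda>_. v)" "w {} = (\<lambda>_. u)" by (simp_all add: w_def fun_eq_iff)
    ultimately show ?thesis by (simp add: ac_simps)
  qed
  show ?thesis by (rule that[of "CARD('n) * (c * C0)"]) (use c0 C0(1) in simp, use main in blast)
qed

lemma loc_unif_conv_loc_bdd:
  fixes a :: "nat \<Rightarrow> ('n::finite) hpt \<Rightarrow> real"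
  assumes a: "loc_unif_conv \<Omega> a u" and c: "\<And>j. continuous_on \<Omega> (a j)"
  shows "loc_bdd \<Omega> (range a)"
  unfolding loc_bdd_def
proof (intro allI impI)
  fix K assume K: "compact K" "K \<subseteq> \<Omega>"
  have cK: "continuous_on K (a j)" for j by (rule continuous_on_subset[OF c K(2)])
  have bd: "\<exists>B\<ge>0. \<forall>x\<in>K. \<bar>f x\<bar> \<le> B" if "continuous_on K f" for f :: "'n hpt \<Rightarrow> real"
  proof -
    have "bounded (f ` K)" using K that compact_continuous_image compact_imp_bounded by blast
    then obtain B where "\<forall>x\<in>K. \<bar>f x\<bar> \<le> B" unfolding bounded_iff by auto
    then show ?thesis by (intro exI[of _ "max 0 B"]) (auto simp: le_max_iff_disj)
  qed
  have ul: "uniform_limit K a u sequentially" using a K unfolding loc_unif_conv_def by blast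
  have "continuous_on K u"
    by (rule uniform_limit_theorem[OF _ ul]) (use cK in auto)
  then obtain B where B: "B \<ge> 0" "\<forall>x\<in>K. \<bar>u x\<bar> \<le> B" using bd by blast
  have "\<forall>\<^sub>F n in sequentially. \<forall>x\<in>K. dist (a n x) (u x) < 1"
    using uniform_limitD[OF ul, of 1] by simp
  then obtain N where N: "\<And>n x. n \<ge> N \<Longrightarrow> x \<in> K \<Longrightarrow> dist (a n x) (u x) < 1"
    unfolding eventually_sequentially by blast
  have "\<forall>j. \<exists>b\<ge>0. \<forall>x\<in>K. \<bar>a j x\<bar> \<le> b" using bd[OF cK] by blast
  then obtain b where b: "\<And>j. b j \<ge> 0" "\<And>j x. x \<in> K \<Longrightarrow> \<bar>a j x\<bar> \<le> b j" by metis
  have b0: "0 \<le> (\<Sum>j<N. b j)" by (simp add: sum_nonneg b(1))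
  have "\<bar>a j x\<bar> \<le> B + 1 + (\<Sum>j<N. b j)" if x: "x \<in> K" for j x
  proof (cases "j < N")
    case True
    then have "b j \<le> (\<Sum>j<N. b j)" by (intro member_le_sum) (auto simp: b(1))
    then show ?thesis using b(2)[OF x, of j] B(1) by linarith
  next
    case False
    then have "\<bar>a j x - u x\<bar> < 1" using N[of j x] x by (simp add: dist_real_def)
    then show ?thesis using B(2)[rule_format, OF x] b0 by linarith
  qed
  then show "\<exists>M\<ge>0. \<forall>w\<in>range a. \<forall>x\<in>K. \<bar>w x\<bar> \<le> M"
    using B(1) b0 by (intro exI[of _ "B + 1 + (\<Sum>j<N. b j)"]) auto
qed

lemma loc_bdd_Un: "loc_bdd \<Omega> A \<Longrightarrow> loc_bdd \<Omega> B \<Longrightarrow> loc_bdd \<Omega> (A \<union> B)"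
  unfolding loc_bdd_def
proof (intro allI impI)
  fix K assume h: "\<forall>K. compact K \<longrightarrow> K \<subseteq> \<Omega> \<longrightarrow> (\<exists>M\<ge>0. \<forall>w\<in>A. \<forall>x\<in>K. \<bar>w x\<bar> \<le> M)"
    "\<forall>K. compact K \<longrightarrow> K \<subseteq> \<Omega> \<longrightarrow> (\<exists>M\<ge>0. \<forall>w\<in>B. \<forall>x\<in>K. \<bar>w x\<bar> \<le> M)" "compact K" "K \<subseteq> \<Omega>"
  obtain M1 where M1: "M1 \<ge> 0" "\<forall>w\<in>A. \<forall>x\<in>K. \<bar>w x\<bar> \<le> M1" using h(1)[rule_format, OF h(3,4)] by blast
  obtain M2 where M2: "M2 \<ge> 0" "\<forall>w\<in>B. \<forall>x\<in>K. \<bar>w x\<bar> \<le> M2" using h(2)[rule_format, OF h(3,4)] by blast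
  have "\<bar>w x\<bar> \<le> M1 + M2" if "w \<in> A \<union> B" "x \<in> K" for w x
    using that(1)
  proof
    assume "w \<in> A"
    from M1(2)[rule_format, OF this that(2)] M2(1) show ?thesis by linarith
  next
    assume "w \<in> B"
    from M2(2)[rule_format, OF this that(2)] M1(1) show ?thesis by linarith
  qed
  then show "\<exists>M\<ge>0. \<forall>w\<in>A \<union> B. \<forall>x\<in>K. \<bar>w x\<bar> \<le> M"
    using M1(1) M2(1) by (intro exI[of _ "M1 + M2"] conjI ballI) linarith+
qed

lemma loc_bdd_sqx: "loc_bdd \<Omega> {sqx :: ('n::finite) hpt \<Rightarrow> real}"
proof -
  have "loc_bdd \<Omega> (range (\<lambda>_::nat. sqx :: 'n hpt \<Rightarrow> real))"
    by (rule loc_unif_conv_loc_bdd[of _ _ sqx])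
      (auto simp: loc_unif_conv_def intro: uniform_limit_const continuous_on_subset[OF Ck_continuous[OF Ck_sqx]])
  then show ?thesis by simp
qed

lemma C2_on_continuous:
  assumes "open \<Omega>" "C2_on \<Omega> u" shows "continuous_on \<Omega> u"
  using Ck_on_Suc_D[OF Ck_on_Suc_D[OF C2_on_Ck_on[OF assms]]] by simp

text \<open>Two sequences with the same limit are compared at once. Equal sequences give convergence
  of the integrals, different ones the independence of the limit from the sequence.\<close>

theorem mixR_cauchy:
  fixes a b :: "nat \<Rightarrow> ('n::{finite,linorder}) hpt \<Rightarrow> real"
  assumes \<Omega>: "open \<Omega>" and phi: "\<phi> \<in> Cc \<Omega>"
    and a: "\<And>j. qpsh \<Omega> (a j)" "loc_unif_conv \<Omega> a u" and b: "\<And>j. qpsh \<Omega> (b j)" "loc_unif_conv \<Omega> b u" and e: "0 < e"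
  shows "\<exists>N. \<forall>j\<ge>N. \<forall>k\<ge>N. \<bar>(\<integral>p. \<phi> p * mixR (\<lambda>_::'n. a j) p \<partial>lborel) - (\<integral>p. \<phi> p * mixR (\<lambda>_::'n. b k) p \<partial>lborel)\<bar> < e"
proof -
  define W where "W = (range a \<union> range b) \<union> {sqx}"
  have Wq: "qpsh \<Omega> w" if "w \<in> W" for w using that a(1) b(1) qpsh_sqx unfolding W_def by blast
  have Wb: "loc_bdd \<Omega> W" unfolding W_def
    by (intro loc_bdd_Un loc_bdd_sqx loc_unif_conv_loc_bdd[OF a(2)] loc_unif_conv_loc_bdd[OF b(2)] C2_on_continuous[OF \<Omega>])
      (use a(1) b(1) in \<open>auto simp: qpsh_def\<close>)
  have Ws: "sqx \<in> W" "\<And>j. a j \<in> W" "\<And>j. b j \<in> W" by (auto simp: W_def)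
  have phic: "continuous_on UNIV \<phi>" using phi by (simp add: Cc_def)
  obtain K where K: "compact K" "K \<subseteq> \<Omega>" "\<And>x. x \<notin> K \<Longrightarrow> \<phi> x = 0"
    and appr: "\<And>e. e > 0 \<Longrightarrow> \<exists>\<psi>. Ck 3 \<psi> \<and> (\<forall>x. x \<notin> K \<longrightarrow> \<psi> x = 0) \<and> (\<forall>x. \<bar>\<phi> x - \<psi> x\<bar> \<le> e)"
    using Cc_smooth_approx[OF \<Omega> phi] by metis
  obtain C0 where C0: "0 \<le> C0" "\<And>w :: 'n \<Rightarrow> 'n hpt \<Rightarrow> real. (\<And>i. w i \<in> W) \<Longrightarrow> (\<integral>p\<in>K. mixR w p \<partial>lborel) \<le> C0"
    using mixR_CLN[OF \<Omega> Wq Wb Ws(1) K(1,2)] by metis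
  \<comment> \<open>Three errors of at most \<open>e/4\<close> are planned: replacing the test
    function by a C^3 one for each of the two functions, and passing from one function to the other.
    Adding 1 to the constants avoids division by zero.\<close>
  define \<eta> where "\<eta> = e / (4 * (C0 + 1))"
  have eta: "\<eta> > 0" "\<eta> * C0 \<le> e / 4" using e C0(1) by (auto simp: \<eta>_def field_simps)
  obtain \<psi> where psi: "Ck 3 \<psi>" "\<And>x. x \<notin> K \<Longrightarrow> \<psi> x = 0" "\<And>x. \<bar>\<phi> x - \<psi> x\<bar> \<le> \<eta>" using appr[OF eta(1)] by metis
  have psi2: "Ck (Suc (Suc 0)) \<psi>" by (rule Ck_mono[OF psi(1)]) simp
  have test: "\<bar>(\<integral>p. \<phi> p * mixR (\<lambda>_::'n. w) p \<partial>lborel) - (\<integral>p. \<psi> p * mixR (\<lambda>_::'n. w) p \<partial>lborel)\<bar> \<le> e / 4" if w: "w \<in> W" for w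
  proof -
    have wc: "continuous_on \<Omega> (mixR (\<lambda>_::'n. w))" using Wq[OF w] by (intro continuous_on_mixR[OF \<Omega>]) (simp add: qpsh_def)
    have "(\<integral>p. \<phi> p * mixR (\<lambda>_::'n. w) p \<partial>lborel) - (\<integral>p. \<psi> p * mixR (\<lambda>_::'n. w) p \<partial>lborel) = (\<integral>p. (\<phi> p - \<psi> p) * mixR (\<lambda>_::'n. w) p \<partial>lborel)"
      unfolding left_diff_distrib
      by (rule Bochner_Integration.integral_diff[symmetric]; rule integrable_Cc_mult[OF K(1,2) wc])
        (use phic K(3) Ck_continuous[OF psi(1)] psi(2) in auto)
    also have "\<bar>\<dots>\<bar> \<le> \<eta> * (\<integral>p\<in>K. mixR (\<lambda>_::'n. w) p \<partial>lborel)"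
      by (rule integral_Cc_mult_bound[OF K(1,2) wc mixR_nonneg]) (use Wq[OF w] K(3) psi(2,3) in auto)
    also have "\<dots> \<le> \<eta> * C0" by (rule mult_left_mono[OF C0(2)]) (use w eta in auto)
    finally show ?thesis using eta(2) by linarith
  qed
  obtain C where C: "0 \<le> C" "\<forall>u v \<delta>. u \<in> W \<longrightarrow> v \<in> W \<longrightarrow> 0 \<le> \<delta> \<longrightarrow> (\<forall>x\<in>K. \<bar>v x - u x\<bar> \<le> \<delta>) \<longrightarrow>
      \<bar>(\<integral>p. \<psi> p * mixR (\<lambda>_::'n. v) p \<partial>lborel) - (\<integral>p. \<psi> p * mixR (\<lambda>_::'n. u) p \<partial>lborel)\<bar> \<le> C * \<delta>"
    by (rule mixR_test_lipschitz[OF \<Omega> Wq Wb Ws(1) K(1,2) psi2 psi(2)])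
  define \<delta> where "\<delta> = e / (4 * (C + 1))"
  have del: "\<delta> > 0" "C * \<delta> \<le> e / 4" using e C(1) by (auto simp: \<delta>_def field_simps)
  have "\<forall>\<^sub>F n in sequentially. \<forall>x\<in>K. dist (f n x) (u x) < \<delta> / 2" if "loc_unif_conv \<Omega> f u" for f
    by (rule uniform_limitD) (use that K(1,2) del(1) in \<open>auto simp: loc_unif_conv_def\<close>)
  from eventually_conj[OF this[OF a(2)] this[OF b(2)]]
  obtain N where N: "\<And>n x. n \<ge> N \<Longrightarrow> x \<in> K \<Longrightarrow> dist (a n x) (u x) < \<delta> / 2" "\<And>n x. n \<ge> N \<Longrightarrow> x \<in> K \<Longrightarrow> dist (b n x) (u x) < \<delta> / 2"
    unfolding eventually_sequentially by blast
  have "\<bar>(\<integral>p. \<phi> p * mixR (\<lambda>_::'n. a j) p \<partial>lborel) - (\<integral>p. \<phi> p * mixR (\<lambda>_::'n. b k) p \<partial>lborel)\<bar> < e" if "j \<ge> N" "k \<ge> N" for j k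
  proof -
    have "\<bar>a j x - b k x\<bar> \<le> \<delta>" if x: "x \<in> K" for x
      using N(1)[OF \<open>j \<ge> N\<close> x] N(2)[OF \<open>k \<ge> N\<close> x] unfolding dist_real_def by linarith
    then have "\<forall>x\<in>K. \<bar>a j x - b k x\<bar> \<le> \<delta>" by (rule ballI)
    from C(2)[rule_format, OF Ws(3,2) less_imp_le[OF del(1)] this[rule_format]] test[OF Ws(2)[of j]] test[OF Ws(3)[of k]] del(2) e
    show ?thesis by linarith
  qed
  then show ?thesis by blast
qed

subsection \<open>Riesz representation on an open set\<close>

lemma CcI: "continuous_on UNIV f \<Longrightarrow> compact K \<Longrightarrow> K \<subseteq> \<Omega> \<Longrightarrow> (\<And>x. x \<notin> K \<Longrightarrow> f x = 0) \<Longrightarrow> f \<in> Cc \<Omega>"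
  unfolding Cc_def by blast

lemma Cc_mult: "f \<in> Cc \<Omega> \<Longrightarrow> continuous_on UNIV h \<Longrightarrow> (\<lambda>x. f x * h x) \<in> Cc \<Omega>"
proof -
  assume f: "f \<in> Cc \<Omega>" and h: "continuous_on UNIV h"
  obtain K where K: "continuous_on UNIV f" "compact K" "K \<subseteq> \<Omega>" "\<forall>x. x \<notin> K \<longrightarrow> f x = 0"
    using f unfolding Cc_def by blast
  show ?thesis by (rule CcI[OF continuous_on_mult[OF K(1) h] K(2,3)]) (use K(4) in simp)
qed

lemma Cc_cmult: "f \<in> Cc \<Omega> \<Longrightarrow> (\<lambda>x. c * f x) \<in> Cc \<Omega>"
  using Cc_mult[of f \<Omega> "\<lambda>_. c"] by (simp add: mult.commute)

lemma Cc_add: "f \<in> Cc \<Omega> \<Longrightarrow> g \<in> Cc \<Omega> \<Longrightarrow> (\<lambda>x. f x + g x) \<in> Cc \<Omega>"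
proof -
  assume "f \<in> Cc \<Omega>" "g \<in> Cc \<Omega>"
  then obtain K1 K2 where K: "continuous_on UNIV f" "compact K1" "K1 \<subseteq> \<Omega>" "\<forall>x. x \<notin> K1 \<longrightarrow> f x = 0"
    "continuous_on UNIV g" "compact K2" "K2 \<subseteq> \<Omega>" "\<forall>x. x \<notin> K2 \<longrightarrow> g x = 0"
    unfolding Cc_def by blast
  show ?thesis
    by (rule CcI[of _ "K1 \<union> K2"]) (use K in \<open>auto intro: continuous_intros compact_Un\<close>)
qed

lemma Cc_0: "(\<lambda>x. 0) \<in> Cc \<Omega>"
  by (rule CcI[of _ "{}"]) auto

lemma Cc_sum: "(\<And>i. i \<in> I \<Longrightarrow> f i \<in> Cc \<Omega>) \<Longrightarrow> (\<lambda>x. \<Sum>i\<in>I. f i x) \<in> Cc \<Omega>"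
  by (induct I rule: infinite_finite_induct) (auto simp: Cc_0 intro: Cc_add)

text \<open>The distance to the complement serves; the whole space is treated apart because the
  distance to an empty complement is 0 by convention.\<close>

lemma open_positivity_set:
  fixes U :: "'a::euclidean_space set"
  assumes "open U"
  shows "\<exists>g :: 'a \<Rightarrow> real. continuous_on UNIV g \<and> (\<forall>x. 0 \<le> g x) \<and> (\<forall>x. 0 < g x \<longleftrightarrow> x \<in> U)"
proof (cases "U = UNIV")
  case True
  show ?thesis by (rule exI[of _ "\<lambda>_. 1"]) (use True in auto)
next
  case False
  have "0 < infdist x (- U) \<longleftrightarrow> x \<in> U" for x
  proof -
    have "closed (- U)" "- U \<noteq> {}" using assms False by auto
    from in_closed_iff_infdist_zero[OF this, of x] infdist_nonneg[of x "- U"] show ?thesis by auto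
  qed
  then show ?thesis by (intro exI[of _ "\<lambda>x. infdist x (- U)"]) (auto intro: continuous_intros infdist_nonneg)
qed

context
  fixes \<Omega> :: "'a::euclidean_space set" and L :: "('a \<Rightarrow> real) \<Rightarrow> real"
begin

text \<open>The functions subordinate to \<open>U\<close> in the usual proof of the Riesz theorem,
  with supports also kept inside \<open>\<Omega>\<close>, where \<open>L\<close> is
  controlled.\<close>

definition subord :: "'a set \<Rightarrow> ('a \<Rightarrow> real) set" where
  "subord U = {f. continuous_on UNIV f \<and> (\<forall>x. 0 \<le> f x \<and> f x \<le> 1) \<and>
     (\<exists>S. compact S \<and> S \<subseteq> U \<inter> \<Omega> \<and> (\<forall>x. x \<notin> S \<longrightarrow> f x = 0))}"

definition rho :: "'a set \<Rightarrow> ennreal" where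
  "rho U = (SUP f\<in>subord U. ennreal (L f))"

text \<open>The open sets have to cover only \<open>E \<inter> \<Omega>\<close>, so the complement
  of \<open>\<Omega>\<close> gets measure 0 and the measure lives on all of the ambient
  space.\<close>

definition outer :: "'a set \<Rightarrow> ennreal" where
  "outer E = (INF U\<in>{U. open U \<and> E \<inter> \<Omega> \<subseteq> U}. rho U)"

lemma subordI:
  "continuous_on UNIV f \<Longrightarrow> (\<And>x. 0 \<le> f x) \<Longrightarrow> (\<And>x. f x \<le> 1) \<Longrightarrow> compact S \<Longrightarrow> S \<subseteq> U \<Longrightarrow> S \<subseteq> \<Omega> \<Longrightarrow> (\<And>x. x \<notin> S \<Longrightarrow> f x = 0) \<Longrightarrow> f \<in> subord U"
  unfolding subord_def by blast

lemma subordE: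
  assumes "f \<in> subord U"
  obtains S where "continuous_on UNIV f" "\<forall>x. 0 \<le> f x \<and> f x \<le> 1" "compact S" "S \<subseteq> U" "S \<subseteq> \<Omega>" "\<forall>x. x \<notin> S \<longrightarrow> f x = 0"
  using assms unfolding subord_def by blast

lemma subord_Cc: "f \<in> subord U \<Longrightarrow> f \<in> Cc \<Omega>"
  unfolding subord_def Cc_def by blast

lemma zero_subord: "(\<lambda>x. 0) \<in> subord U"
  by (rule subordI[of _ "{}"]) auto

lemma rho_upper: "f \<in> subord U \<Longrightarrow> ennreal (L f) \<le> rho U"
  unfolding rho_def by (rule SUP_upper)

lemma rho_mono: "U \<inter> \<Omega> \<subseteq> V \<Longrightarrow> rho U \<le> rho V"
  unfolding rho_def subord_def by (rule SUP_subset_mono) blast+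

lemma outer_le: "open U \<Longrightarrow> E \<inter> \<Omega> \<subseteq> U \<Longrightarrow> outer E \<le> rho U"
  unfolding outer_def by (rule INF_lower) simp

lemma outer_open: "open U \<Longrightarrow> outer U = rho U"
  by (rule antisym[OF outer_le]) (auto simp: outer_def intro!: INF_greatest rho_mono)

lemma outer_mono: "E \<subseteq> F \<Longrightarrow> outer E \<le> outer F"
  unfolding outer_def by (rule INF_superset_mono) auto

context
  assumes \<Omega>: "open \<Omega>"
    and L_add: "\<And>f g. f \<in> Cc \<Omega> \<Longrightarrow> g \<in> Cc \<Omega> \<Longrightarrow> L (\<lambda>x. f x + g x) = L f + L g"
    and L_cmult: "\<And>f c. f \<in> Cc \<Omega> \<Longrightarrow> L (\<lambda>x. c * f x) = c * L f"
    and L_pos: "\<And>f. f \<in> Cc \<Omega> \<Longrightarrow> (\<And>x. 0 \<le> f x) \<Longrightarrow> 0 \<le> L f"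
begin

lemma L_0: "L (\<lambda>x. 0) = 0"
  using L_cmult[OF Cc_0, of 0] by simp

lemma L_mono:
  assumes "f \<in> Cc \<Omega>" "g \<in> Cc \<Omega>" "\<And>x. f x \<le> g x"
  shows "L f \<le> L g"
proof -
  have d: "(\<lambda>x. g x + (-1) * f x) \<in> Cc \<Omega>" by (rule Cc_add[OF assms(2) Cc_cmult[OF assms(1)]])
  have "0 \<le> L (\<lambda>x. g x + (-1) * f x)" by (rule L_pos[OF d]) (simp add: assms(3))
  also have "\<dots> = L g + (-1) * L f" unfolding L_add[OF assms(2) Cc_cmult[OF assms(1)]] L_cmult[OF assms(1)] ..
  finally show ?thesis by simp
qed

lemma L_sum: "finite I \<Longrightarrow> (\<And>i. i \<in> I \<Longrightarrow> f i \<in> Cc \<Omega>) \<Longrightarrow> L (\<lambda>x. \<Sum>i\<in>I. f i x) = (\<Sum>i\<in>I. L (f i))"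
  by (induct I rule: finite_induct) (auto simp: L_0 L_add Cc_sum)

lemma subord_L_nonneg: "f \<in> subord U \<Longrightarrow> 0 \<le> L f"
  using L_pos[OF subord_Cc] unfolding subord_def by blast

lemma rho_empty: "rho {} = 0"
proof -
  have "f = (\<lambda>x. 0)" if "f \<in> subord {}" for f using that unfolding subord_def by auto
  then have "subord {} = {\<lambda>x. 0}" using zero_subord by blast
  then show ?thesis unfolding rho_def by (simp add: L_0)
qed

text \<open>In place of a partition of unity, cut-offs whose sum is at least 1 on the support of
  \<open>f\<close> are enough: \<open>f\<close> is then at most the sum of the pieces
  \<open>f * h i\<close>, and \<open>L\<close> is monotone.\<close>

lemma rho_UN:
  assumes U: "\<And>i::nat. open (U i)"
  shows "rho (\<Union>i. U i) \<le> (\<Sum>i. rho (U i))"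
  unfolding rho_def[of "\<Union>i. U i"]
proof (rule SUP_least)
  fix f assume f: "f \<in> subord (\<Union>i. U i)"
  obtain K where K: "continuous_on UNIV f" "\<forall>x. 0 \<le> f x \<and> f x \<le> 1" "compact K" "K \<subseteq> (\<Union>i. U i)" "K \<subseteq> \<Omega>" "\<forall>x. x \<notin> K \<longrightarrow> f x = 0"
    using subordE[OF f] by blast
  have "\<forall>i. \<exists>g :: 'a \<Rightarrow> real. continuous_on UNIV g \<and> (\<forall>x. 0 \<le> g x) \<and> (\<forall>x. 0 < g x \<longleftrightarrow> x \<in> U i)"
    by (intro allI open_positivity_set U)
  from choice[OF this] obtain g :: "nat \<Rightarrow> 'a \<Rightarrow> real" where g: "\<And>i. continuous_on UNIV (g i)" "\<And>i x. 0 \<le> g i x" "\<And>i x. 0 < g i x \<longleftrightarrow> x \<in> U i"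
    by blast
  \<comment> \<open>A single parameter \<open>m\<close> bounds both the number of sets and the
    scaling of the functions \<open>g i\<close>, so these open sets increase with \<open>m\<close>
    and compactness delivers one \<open>m\<close>.\<close>
  define O' where "O' m = (\<Union>i<m. {x. 2 < real m * g i x})" for m
  have Oiff: "x \<in> O' m \<longleftrightarrow> (\<exists>i<m. 2 < real m * g i x)" for m x unfolding O'_def by (simp add: Bex_def)
  have "open (O' m)" for m unfolding O'_def
    by (intro open_UN ballI open_Collect_less continuous_intros g(1))
  moreover have "K \<subseteq> (\<Union>m\<in>UNIV. O' m)"
  proof
    fix x assume "x \<in> K"
    then obtain i where "x \<in> U i" using K(4) by blast
    then have "0 < g i x" using g(3) by blast
    then obtain n :: nat where "2 / g i x < real n" using reals_Archimedean2 by blast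
    then have n: "2 < real n * g i x" using \<open>0 < g i x\<close> by (simp add: field_simps)
    have "real n * g i x \<le> real (n + Suc i) * g i x" using g(2)[of i x] by (intro mult_right_mono) simp_all
    then have "2 < real (n + Suc i) * g i x" using n by linarith
    then have "x \<in> O' (n + Suc i)" unfolding Oiff by (intro exI[of _ i]) simp
    then show "x \<in> (\<Union>m\<in>UNIV. O' m)" by (rule UN_I[OF UNIV_I])
  qed
  ultimately obtain C where C: "finite C" "K \<subseteq> (\<Union>m\<in>C. O' m)"
    by (rule compactE_image[OF K(3)])
  define m where "m = Max (insert 0 C)"
  have m: "c \<le> m" if "c \<in> C" for c unfolding m_def using C(1) that by simp
  have Omono: "O' c \<subseteq> O' m" if "c \<le> m" for c
  proof
    fix x assume "x \<in> O' c"
    then obtain i where i: "i < c" "2 < real c * g i x" unfolding Oiff by blast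
    have "real c * g i x \<le> real m * g i x" using that g(2)[of i x] by (intro mult_right_mono) simp_all
    then have "2 < real m * g i x" "i < m" using i that by linarith+
    then show "x \<in> O' m" unfolding Oiff by blast
  qed
  have KO: "K \<subseteq> O' m" using C(2) Omono m by blast
  \<comment> \<open>Equal to 1 where \<open>m g_i \<ge> 2\<close> and to 0 where
    \<open>m g_i \<le> 1\<close>. The gap between the thresholds gives \<open>f * h i\<close> a
    compact support inside \<open>U i\<close>.\<close>
  define h where "h i x = min 1 (max 0 (real m * g i x - 1))" for i x
  have hc: "continuous_on UNIV (h i)" for i unfolding h_def[abs_def] by (intro continuous_intros g(1))
  have h01: "0 \<le> h i x" "h i x \<le> 1" for i x by (auto simp: h_def)
  define F where "F i x = f x * h i x" for i x
  have Fs: "F i \<in> subord (U i)" for i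
  proof (rule subordI[of _ "K \<inter> {x. 1 \<le> real m * g i x}"])
    show "continuous_on UNIV (F i)" unfolding F_def[abs_def] by (intro continuous_intros K(1) hc)
    show "0 \<le> F i x" "F i x \<le> 1" for x using K(2) h01[of i x] unfolding F_def by (auto intro: mult_le_one)
    show "compact (K \<inter> {x. 1 \<le> real m * g i x})"
      by (intro compact_Int_closed K(3) closed_Collect_le continuous_intros g(1))
    show "K \<inter> {x. 1 \<le> real m * g i x} \<subseteq> \<Omega>" using K(5) by blast
    show "K \<inter> {x. 1 \<le> real m * g i x} \<subseteq> U i"
    proof
      fix x assume "x \<in> K \<inter> {x. 1 \<le> real m * g i x}"
      then have "g i x \<noteq> 0" by auto
      then show "x \<in> U i" using g(2)[of i x] g(3)[of i x] by linarith
    qed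
    show "F i x = 0" if "x \<notin> K \<inter> {x. 1 \<le> real m * g i x}" for x
      using that K(6)[rule_format, of x] by (auto simp: F_def h_def)
  qed
  have "f x \<le> (\<Sum>i<m. F i x)" for x
  proof (cases "x \<in> K")
    case True
    then obtain i where i: "i < m" "2 < real m * g i x" using subsetD[OF KO] unfolding Oiff by blast
    then have "f x = F i x" by (simp add: F_def h_def)
    also have "\<dots> \<le> (\<Sum>i<m. F i x)" using i(1) K(2) h01 by (intro member_le_sum) (simp_all add: F_def)
    finally show ?thesis .
  next
    case False
    then have "f x = 0" by (rule K(6)[rule_format])
    then show ?thesis by (simp add: F_def)
  qed
  then have "L f \<le> L (\<lambda>x. \<Sum>i<m. F i x)"
    by (intro L_mono subord_Cc[OF f] Cc_sum subord_Cc[OF Fs])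
  also have "\<dots> = (\<Sum>i<m. L (F i))" by (rule L_sum) (auto intro: subord_Cc[OF Fs])
  finally have "ennreal (L f) \<le> ennreal (\<Sum>i<m. L (F i))" by (rule ennreal_leI)
  also have "\<dots> = (\<Sum>i<m. ennreal (L (F i)))" by (rule sum_ennreal[symmetric]) (rule subord_L_nonneg[OF Fs])
  also have "\<dots> \<le> (\<Sum>i<m. rho (U i))" by (intro sum_mono rho_upper Fs)
  also have "\<dots> \<le> (\<Sum>i. rho (U i))" by (rule sum_le_suminf) auto
  finally show "ennreal (L f) \<le> (\<Sum>i. rho (U i))" .
qed

lemma outer_measure_space_outer: "outer_measure_space UNIV outer"
proof -
  have "outer (\<Union>i. A i) \<le> (\<Sum>i. outer (A i))" for A :: "nat \<Rightarrow> 'a set"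
  proof (rule ennreal_le_epsilon)
    fix e :: real assume e: "0 < e" and fin: "(\<Sum>i. outer (A i)) < top"
    have "\<exists>U. (open U \<and> A i \<inter> \<Omega> \<subseteq> U) \<and> rho U \<le> outer (A i) + e * (1/2)^Suc i" for i
    proof -
      have "outer (A i) < outer (A i) + e * (1/2)^Suc i"
        using e fin by (auto simp: less_top dest!: ennreal_suminf_lessD)
      then show ?thesis unfolding outer_def[of "A i"] INF_less_iff by (auto intro: less_imp_le)
    qed
    then obtain U where U: "\<And>i. open (U i)" "\<And>i. A i \<inter> \<Omega> \<subseteq> U i" "\<And>i. rho (U i) \<le> outer (A i) + e * (1/2)^Suc i"
      by metis
    have "outer (\<Union>i. A i) \<le> rho (\<Union>i. U i)" by (rule outer_le) (use U(1,2) in blast)+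
    also have "\<dots> \<le> (\<Sum>i. rho (U i))" by (rule rho_UN[OF U(1)])
    also have "\<dots> \<le> (\<Sum>i. outer (A i) + e * (1/2)^Suc i)" by (intro suminf_le U(3)) auto
    also have "\<dots> = (\<Sum>i. outer (A i)) + (\<Sum>i. ennreal e * ennreal ((1/2)^Suc i))"
      using e by (subst suminf_add[symmetric]) (auto simp del: ennreal_suminf_cmult simp add: ennreal_mult[symmetric])
    also have "\<dots> = (\<Sum>i. outer (A i)) + e"
      unfolding ennreal_suminf_cmult by (subst suminf_ennreal_eq[OF zero_le_power power_half_series]) auto
    finally show "outer (\<Union>i. A i) \<le> (\<Sum>i. outer (A i)) + e" .
  qed
  moreover have "outer {} = 0" using outer_open[OF open_empty] rho_empty by simp
  ultimately show ?thesis
    unfolding outer_measure_space_def positive_def increasing_def countably_subadditive_def using outer_mono by auto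
qed

text \<open>A function subordinate to \<open>U \<inter> V\<close> with support \<open>S\<close> and
  one subordinate to \<open>U - S\<close> have disjoint supports, so their sum is subordinate to
  \<open>U\<close>. Taking the supremum first over the second function and then over the first gives
  the inequality.\<close>

lemma open_caratheodory:
  assumes V: "open V"
  shows "outer (x \<inter> V) + outer (x - V) \<le> outer x"
  unfolding outer_def[of x]
proof (rule INF_greatest)
  fix U assume "U \<in> {U. open U \<and> x \<inter> \<Omega> \<subseteq> U}"
  then have U: "open U" "x \<inter> \<Omega> \<subseteq> U" by auto
  have ne: "subord W \<noteq> {}" for W using zero_subord by blast
  have "outer (x \<inter> V) \<le> rho (U \<inter> V)" by (rule outer_le) (use U V in auto)
  then have "outer (x \<inter> V) + outer (x - V) \<le> rho (U \<inter> V) + outer (x - V)" by (rule add_right_mono)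
  also have "\<dots> = (SUP f\<in>subord (U \<inter> V). ennreal (L f) + outer (x - V))"
    unfolding rho_def by (rule ennreal_SUP_add_left[OF ne, symmetric])
  also have "\<dots> \<le> rho U"
  proof (rule SUP_least)
    fix f assume f: "f \<in> subord (U \<inter> V)"
    obtain S where S: "continuous_on UNIV f" "\<forall>x. 0 \<le> f x \<and> f x \<le> 1" "compact S" "S \<subseteq> U \<inter> V" "S \<subseteq> \<Omega>" "\<forall>x. x \<notin> S \<longrightarrow> f x = 0"
      using subordE[OF f] by blast
    have "outer (x - V) \<le> rho (U - S)"
      by (rule outer_le) (use U S(4) compact_imp_closed[OF S(3)] in auto)
    then have "ennreal (L f) + outer (x - V) \<le> ennreal (L f) + rho (U - S)" by (rule add_left_mono)
    also have "\<dots> = (SUP g\<in>subord (U - S). ennreal (L g) + ennreal (L f))"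
      unfolding rho_def add.commute[of "ennreal (L f)"] by (rule ennreal_SUP_add_left[OF ne, symmetric])
    also have "\<dots> \<le> rho U"
    proof (rule SUP_least)
      fix g assume g: "g \<in> subord (U - S)"
      obtain T where T: "continuous_on UNIV g" "\<forall>x. 0 \<le> g x \<and> g x \<le> 1" "compact T" "T \<subseteq> U - S" "T \<subseteq> \<Omega>" "\<forall>x. x \<notin> T \<longrightarrow> g x = 0"
        using subordE[OF g] by blast
      have "(\<lambda>x. f x + g x) \<in> subord U"
      proof (rule subordI[of _ "S \<union> T"])
        show "continuous_on UNIV (\<lambda>x. f x + g x)" by (intro continuous_intros S(1) T(1))
        show "0 \<le> f x + g x" for x using S(2)[rule_format, of x] T(2)[rule_format, of x] by simp
        show "f x + g x \<le> 1" for x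
        proof (cases "x \<in> S")
          case True
          then have "g x = 0" using T(4,6) by blast
          then show ?thesis using S(2)[rule_format, of x] by simp
        next
          case False
          then have "f x = 0" using S(6) by blast
          then show ?thesis using T(2)[rule_format, of x] by simp
        qed
        show "compact (S \<union> T)" by (rule compact_Un[OF S(3) T(3)])
        show "S \<union> T \<subseteq> U" "S \<union> T \<subseteq> \<Omega>" using S(4,5) T(4,5) by blast+
        show "f x + g x = 0" if "x \<notin> S \<union> T" for x using S(6) T(6) that by simp
      qed
      from rho_upper[OF this] show "ennreal (L g) + ennreal (L f) \<le> rho U"
        unfolding L_add[OF subord_Cc[OF f] subord_Cc[OF g]]
        by (simp add: subord_L_nonneg[OF f] subord_L_nonneg[OF g] add.commute)
    qed
    finally show "ennreal (L f) + outer (x - V) \<le> rho U" .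
  qed
  finally show "outer (x \<inter> V) + outer (x - V) \<le> rho U" .
qed

definition riesz :: "'a measure" where
  "riesz = measure_of UNIV (sets borel) outer"

lemma sets_riesz: "sets riesz = sets borel"
  unfolding riesz_def using sets.sigma_sets_eq[of borel] by (simp add: sets_measure_of)

text \<open>Open sets are Caratheodory measurable, and the Caratheodory sets form a sigma-algebra on
  which \<open>outer\<close> is a measure; hence it is a measure on the Borel sets.\<close>

lemma emeasure_riesz: "A \<in> sets borel \<Longrightarrow> emeasure riesz A = outer A"
proof -
  assume A: "A \<in> sets borel"
  interpret P: sigma_algebra "UNIV :: 'a set" UNIV
    using sigma_algebra_Pow[of "UNIV :: 'a set"] by simp
  let ?S = "lambda_system UNIV UNIV outer"
  have ms: "measure_space UNIV ?S outer" by (rule P.caratheodory_lemma[OF outer_measure_space_outer])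
  have pos: "positive UNIV outer" and cs: "countably_subadditive UNIV outer"
    using outer_measure_space_outer unfolding outer_measure_space_def by auto
  have "V \<in> ?S" if "open V" for V
  proof -
    have "outer (x \<inter> V) + outer (x - V) = outer x" for x
    proof (rule antisym[OF open_caratheodory[OF that]])
      have "subadditive UNIV outer" by (rule P.countably_subadditive_subadditive[OF pos cs])
      from subadditiveD[OF this, of "x \<inter> V" "x - V"] show "outer x \<le> outer (x \<inter> V) + outer (x - V)"
        by (simp add: Int_Diff_disjoint Int_Diff_Un)
    qed
    then show ?thesis unfolding P.lambda_system_eq by simp
  qed
  then have "sigma_sets UNIV {V. open V} \<subseteq> ?S"
    using ms unfolding measure_space_def by (intro sigma_algebra.sigma_sets_subset) auto
  then have sub: "sets borel \<subseteq> ?S" unfolding borel_def by (simp add: sets_measure_of)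
  show ?thesis unfolding riesz_def
  proof (rule emeasure_measure_of_sigma[OF _ _ _ A])
    show "sigma_algebra (UNIV :: 'a set) (sets borel)"
      using sets.sigma_algebra_axioms[of "borel :: 'a measure"] by simp
    show "positive (sets borel) outer" using pos by (simp add: positive_def)
    show "countably_additive (sets borel) outer"
      using ms sub unfolding measure_space_def countably_additive_def by blast
  qed
qed

text \<open>A function subordinate to a set inside \<open>N\<close> stays below the cut-off. This
  bounds \<open>rho\<close> near a compact set by a finite number, which gives local finiteness and
  the starting constant for the slicing.\<close>

lemma compact_cutoff:
  assumes K: "compact K" "K \<subseteq> \<Omega>"
  obtains \<theta> N where "\<theta> \<in> Cc \<Omega>" "open N" "K \<subseteq> N" "\<forall>x. 0 \<le> \<theta> x" "\<forall>x\<in>N. \<theta> x = 1" "\<forall>U. U \<inter> \<Omega> \<subseteq> N \<longrightarrow> rho U \<le> ennreal (L \<theta>)"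
proof -
  obtain \<theta> :: "'a \<Rightarrow> real" and N K' where th: "Ck 3 \<theta>" "open N" "K \<subseteq> N" "N \<subseteq> K'" "compact K'" "K' \<subseteq> \<Omega>"
    and th1: "\<forall>x\<in>N. \<theta> x = 1" and th0: "\<forall>x. x \<notin> K' \<longrightarrow> \<theta> x = 0" and thpos: "\<forall>x. 0 \<le> \<theta> x"
    by (rule smooth_cutoff[OF \<Omega> K])
  have thC: "\<theta> \<in> Cc \<Omega>" by (rule CcI[OF Ck_continuous[OF th(1)] th(5,6) th0[rule_format]])
  have "rho U \<le> ennreal (L \<theta>)" if U: "U \<inter> \<Omega> \<subseteq> N" for U
    unfolding rho_def
  proof (rule SUP_least)
    fix f assume f: "f \<in> subord U"
    have "f x \<le> \<theta> x" for x
    proof (cases "x \<in> N")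
      case True
      then show ?thesis using f th1 unfolding subord_def by auto
    next
      case False
      then have "f x = 0" using f U unfolding subord_def by blast
      then show ?thesis using thpos by simp
    qed
    then show "ennreal (L f) \<le> ennreal (L \<theta>)" by (intro ennreal_leI L_mono subord_Cc[OF f] thC)
  qed
  then show ?thesis using that[OF thC th(2,3) thpos th1] by blast
qed

lemma radon_riesz: "radon_on \<Omega> riesz"
proof -
  have "outer (UNIV - \<Omega>) \<le> rho {}" by (rule outer_le) auto
  then have "emeasure riesz (UNIV - \<Omega>) = 0" using \<Omega> rho_empty by (subst emeasure_riesz) (auto simp: borel_closed)
  moreover have "emeasure riesz K < \<infinity>" if K: "compact K" "K \<subseteq> \<Omega>" for K
  proof -
    obtain \<theta> N where th: "open N" "K \<subseteq> N" "\<forall>U. U \<inter> \<Omega> \<subseteq> N \<longrightarrow> rho U \<le> ennreal (L \<theta>)"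
      using compact_cutoff[OF K] by metis
    have "outer K \<le> rho N" by (rule outer_le) (use th(1,2) in auto)
    also have "\<dots> \<le> ennreal (L \<theta>)" using th(3) by blast
    also have "\<dots> < \<infinity>" by simp
    finally show ?thesis using K(1) by (subst emeasure_riesz) (auto simp: compact_imp_closed borel_closed)
  qed
  ultimately show ?thesis unfolding radon_on_def using sets_riesz by blast
qed

lemma emeasure_riesz_open: "open U \<Longrightarrow> emeasure riesz U = rho U"
  by (simp add: emeasure_riesz outer_open borel_open)

lemma riesz_Cc_integrable:
  assumes f: "f \<in> Cc \<Omega>"
  shows "integrable riesz f"
proof -
  obtain K where K: "continuous_on UNIV f" "compact K" "K \<subseteq> \<Omega>" "\<forall>x. x \<notin> K \<longrightarrow> f x = 0"
    using f unfolding Cc_def by blast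
  have "bounded (f ` K)" using K(1,2) by (intro compact_imp_bounded compact_continuous_image) (rule continuous_on_subset, auto)
  then obtain B where B: "\<And>x. x \<in> K \<Longrightarrow> \<bar>f x\<bar> \<le> B" unfolding bounded_iff by auto
  have Ks: "K \<in> sets riesz" unfolding sets_riesz by (intro borel_closed compact_imp_closed K(2))
  have Kf: "emeasure riesz K < \<infinity>" using radon_riesz K(2,3) unfolding radon_on_def by blast
  show ?thesis
  proof (rule Bochner_Integration.integrable_bound)
    show "integrable riesz (\<lambda>x. B * indicator K x)" by (intro integrable_mult_right integrable_real_indicator Ks Kf)
    have "f \<in> borel_measurable borel" by (rule borel_measurable_continuous_onI[OF K(1)])
    then show "f \<in> borel_measurable riesz" using measurable_cong_sets[OF sets_riesz refl] by blast
    have "norm (f x) \<le> norm (B * indicator K x)" for x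
      using B[of x] K(4)[rule_format, of x] by (cases "x \<in> K") auto
    then show "AE x in riesz. norm (f x) \<le> norm (B * indicator K x)" by simp
  qed
qed

lemma slice_sum:
  fixes t d :: real
  assumes "0 \<le> t" "0 \<le> d"
  shows "(\<Sum>k<n. min (max (t - real k * d) 0) d) = min t (real n * d)"
proof (induct n)
  case (Suc n)
  then show ?case using assms by (auto simp: algebra_simps min_def max_def)
qed (use assms in simp)

text \<open>Slicing \<open>f = \<Sum>k<N. f\<^sub>k\<close> at the levels \<open>k / N\<close>: both \<open>N L f\<^sub>k\<close> and
  \<open>N \<integral> f\<^sub>k\<close> lie between the measures of neighbouring superlevel sets, so the
  two functionals differ by a telescoping sum divided by \<open>N\<close>.\<close>

lemma riesz_slices:
  assumes f: "f \<in> Cc \<Omega>" and f01: "\<And>x. 0 \<le> f x" "\<And>x. f x \<le> 1"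
  obtains M where "\<And>N::nat. 0 < N \<Longrightarrow> \<bar>L f - (\<integral>x. f x \<partial>riesz)\<bar> \<le> 2 * M / real N"
proof -
  obtain K where K: "continuous_on UNIV f" "compact K" "K \<subseteq> \<Omega>" "\<forall>x. x \<notin> K \<longrightarrow> f x = 0"
    using f unfolding Cc_def by blast
  obtain \<theta> Nb where th: "\<theta> \<in> Cc \<Omega>" "open Nb" "K \<subseteq> Nb" "\<forall>x. 0 \<le> \<theta> x" "\<forall>x\<in>Nb. \<theta> x = 1"
      "\<forall>U. U \<inter> \<Omega> \<subseteq> Nb \<longrightarrow> rho U \<le> ennreal (L \<theta>)"
    using compact_cutoff[OF K(2,3)] by metis
  define M where "M = L \<theta>"
  have M0: "0 \<le> M" unfolding M_def using th(1,4) by (intro L_pos) auto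
  have "\<bar>L f - (\<integral>x. f x \<partial>riesz)\<bar> \<le> 2 * M / real N" if N: "0 < N" for N :: nat
  proof -
    define d where "d = 1 / real N"
    have d: "0 < d" "real N * d = 1" using N by (auto simp: d_def)
    define P where "P k = {x. real k * d < f x}" for k
    define m where "m k = measure riesz (P k)" for k
    define F where "F k x = min (max (f x - real k * d) 0) d" for k x
    have Po: "open (P k)" for k unfolding P_def by (intro open_Collect_less continuous_intros K(1))
    have PK: "P k \<subseteq> K" for k
    proof
      fix x assume "x \<in> P k"
      moreover have "0 \<le> real k * d" using d(1) by simp
      ultimately have "f x \<noteq> 0" unfolding P_def by auto
      then show "x \<in> K" using K(4) by blast
    qed
    have Pm: "emeasure riesz (P k) \<le> ennreal M" for k
      unfolding emeasure_riesz_open[OF Po] M_def using th(6) PK[of k] th(3) by blast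
    then have Pf: "emeasure riesz (P k) < \<infinity>" for k using le_less_trans[OF Pm] by simp
    have em: "emeasure riesz (P k) = ennreal (m k)" for k
      unfolding m_def using Pf[of k] by (intro emeasure_eq_ennreal_measure) auto
    have mM: "m k \<le> M" for k using Pm[of k] M0 unfolding em by simp
    have m0: "0 \<le> m k" for k by (simp add: m_def)
    have Fc: "continuous_on UNIV (F k)" for k unfolding F_def[abs_def] by (intro continuous_intros K(1))
    have FK: "F k x = 0" if "x \<notin> K" for k x using K(4)[rule_format, OF that] d(1) by (simp add: F_def)
    have FC: "F k \<in> Cc \<Omega>" for k by (rule CcI[OF Fc K(2,3) FK])
    have F0: "0 \<le> F k x" "F k x \<le> d" for k x using d(1) by (auto simp: F_def)
    have fsum: "(\<lambda>x. \<Sum>k<N. F k x) = f"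
      unfolding F_def using slice_sum[of "f _" d N] f01 d by (intro ext) (simp add: min_def)
    \<comment> \<open>An index shift: \<open>e (Suc j)\<close> is the measure of level
      \<open>j\<close>, and \<open>e 0 = M\<close> stands in for the level below 0, which has no
      superlevel set of its own.\<close>
    define e where "e k = (case k of 0 \<Rightarrow> M | Suc j \<Rightarrow> m j)" for k
    have upL: "real N * L (F k) \<le> e k" for k
    proof (cases k)
      case 0
      have "L (\<lambda>x. real N * F k x) \<le> L \<theta>"
      proof (rule L_mono[OF Cc_cmult[OF FC] th(1)])
        show "real N * F k x \<le> \<theta> x" for x
        proof (cases "x \<in> K")
          case True
          then have "\<theta> x = 1" using th(3,5) by blast
          moreover have "real N * F k x \<le> real N * d" by (rule mult_left_mono[OF F0(2)]) simp
          ultimately show ?thesis using d(2) by simp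
        qed (simp add: FK th(4))
      qed
      then show ?thesis unfolding L_cmult[OF FC] using 0 by (simp add: e_def M_def)
    next
      case (Suc j)
      have "(\<lambda>x. real N * F k x) \<in> subord (P j)"
      proof (rule subordI[of _ "K \<inter> {x. real k * d \<le> f x}"])
        show "continuous_on UNIV (\<lambda>x. real N * F k x)" by (intro continuous_intros Fc)
        show "0 \<le> real N * F k x" for x using F0 by simp
        show "real N * F k x \<le> 1" for x unfolding d(2)[symmetric] by (rule mult_left_mono[OF F0(2)]) simp
        show "compact (K \<inter> {x. real k * d \<le> f x})"
          by (intro compact_Int_closed K(2) closed_Collect_le continuous_intros K(1))
        show "K \<inter> {x. real k * d \<le> f x} \<subseteq> P j"
          using d(1) by (auto simp: P_def Suc algebra_simps)
        show "K \<inter> {x. real k * d \<le> f x} \<subseteq> \<Omega>" using K(3) by blast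
        show "real N * F k x = 0" if "x \<notin> K \<inter> {x. real k * d \<le> f x}" for x
          using that FK[of x k] d(1) by (cases "x \<in> K") (auto simp: F_def)
      qed
      from rho_upper[OF this] have "ennreal (L (\<lambda>x. real N * F k x)) \<le> ennreal (m j)"
        unfolding em[symmetric] emeasure_riesz_open[OF Po] .
      then show ?thesis using m0[of j] unfolding L_cmult[OF FC] Suc e_def by (simp add: ennreal_le_iff)
    qed
    have loL: "m (Suc k) \<le> real N * L (F k)" for k
    proof -
      have "rho (P (Suc k)) \<le> ennreal (real N * L (F k))"
        unfolding rho_def
      proof (rule SUP_least)
        fix g assume g: "g \<in> subord (P (Suc k))"
        have "g x \<le> real N * F k x" for x
        proof (cases "x \<in> P (Suc k)")
          case True
          then have "F k x = d" using d(1) by (simp add: F_def P_def algebra_simps)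
          then show ?thesis using g d(2) unfolding subord_def by auto
        next
          case False
          then have "g x = 0" using g unfolding subord_def by blast
          then show ?thesis using F0 by simp
        qed
        then show "ennreal (L g) \<le> ennreal (real N * L (F k))"
          unfolding L_cmult[OF FC, symmetric] by (intro ennreal_leI L_mono subord_Cc[OF g] Cc_cmult FC)
      qed
      then have "ennreal (m (Suc k)) \<le> ennreal (real N * L (F k))" unfolding em[symmetric] emeasure_riesz_open[OF Po] .
      moreover have "0 \<le> real N * L (F k)" using L_pos[OF FC F0(1)] by simp
      ultimately show ?thesis by (simp add: ennreal_le_iff)
    qed
    have ind: "integrable riesz (\<lambda>x. d * indicator (P k) x)" "(\<integral>x. d * indicator (P k) x \<partial>riesz) = d * m k" for k
    proof -
      have "P k \<in> sets riesz" unfolding sets_riesz by (rule borel_open[OF Po])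
      then show "integrable riesz (\<lambda>x. d * indicator (P k) x)" "(\<integral>x. d * indicator (P k) x \<partial>riesz) = d * m k"
        using Pf[of k] unfolding m_def by (auto intro!: integrable_mult_right integrable_real_indicator)
    qed
    have FI: "integrable riesz (F k)" for k by (rule riesz_Cc_integrable[OF FC])
    have upI: "(\<integral>x. F k x \<partial>riesz) \<le> d * m k" for k
      unfolding ind(2)[symmetric]
      by (rule integral_mono[OF FI ind(1)]) (use F0 in \<open>auto simp: indicator_def P_def F_def\<close>)
    have loI: "d * m (Suc k) \<le> (\<integral>x. F k x \<partial>riesz)" for k
      unfolding ind(2)[symmetric]
      by (rule integral_mono[OF ind(1) FI]) (use d(1) in \<open>auto simp: indicator_def P_def F_def algebra_simps\<close>)
    have me: "m k \<le> e k" for k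
    proof (cases k)
      case (Suc j)
      have "P k \<subseteq> P j" unfolding P_def Suc using d(1) by (auto simp: algebra_simps)
      then have "emeasure riesz (P k) \<le> emeasure riesz (P j)"
        by (rule emeasure_mono) (simp add: sets_riesz borel_open[OF Po])
      then show ?thesis using m0[of j] unfolding em Suc e_def by (simp add: ennreal_le_iff)
    qed (simp add: e_def mM)
    have e2: "m (Suc k) = e (Suc (Suc k))" for k by (simp add: e_def)
    have diff: "\<bar>L (F k) - (\<integral>x. F k x \<partial>riesz)\<bar> \<le> d * (e k - e (Suc (Suc k)))" for k
    proof -
      have "L (F k) = d * (real N * L (F k))" using d(2) by (simp add: mult.assoc[symmetric] mult.commute)
      moreover have "d * (real N * L (F k)) \<le> d * e k" "d * m (Suc k) \<le> d * (real N * L (F k))" "d * m k \<le> d * e k"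
        using d(1) upL loL me by (auto intro: mult_left_mono)
      ultimately show ?thesis using upI[of k] loI[of k] unfolding e2 right_diff_distrib by linarith
    qed
    \<comment> \<open>The bounds for one slice are two indices apart, so two terms survive at each
      end of the telescoping sum; this is where the factor 2 of \<open>2 * M\<close> comes
      from.\<close>
    have tele: "(\<Sum>k<n. e k - e (Suc (Suc k))) = e 0 + e (Suc 0) - e n - e (Suc n)" for n
      by (induct n) auto
    have e0: "0 \<le> e k" for k unfolding e_def using M0 m0 by (cases k) auto
    have "L f - (\<integral>x. f x \<partial>riesz) = (\<Sum>k<N. L (F k) - (\<integral>x. F k x \<partial>riesz))"
    proof -
      have "L f = (\<Sum>k<N. L (F k))" using L_sum[of "{..<N}" F] FC unfolding fsum by simp
      moreover have "(\<integral>x. f x \<partial>riesz) = (\<Sum>k<N. \<integral>x. F k x \<partial>riesz)"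
        using Bochner_Integration.integral_sum[of "{..<N}" riesz F] FI unfolding fsum by simp
      ultimately show ?thesis by (simp add: sum_subtractf)
    qed
    also have "\<bar>\<dots>\<bar> \<le> (\<Sum>k<N. d * (e k - e (Suc (Suc k))))"
      by (rule order_trans[OF sum_abs]) (intro sum_mono diff)
    also have "\<dots> = d * (e 0 + e (Suc 0) - e N - e (Suc N))"
      unfolding sum_distrib_left[symmetric] tele ..
    also have "\<dots> \<le> d * (2 * M)"
    proof (rule mult_left_mono)
      have "e 0 = M" "e (Suc 0) \<le> M" using mM[of 0] by (simp_all add: e_def)
      then show "e 0 + e (Suc 0) - e N - e (Suc N) \<le> 2 * M" using e0[of N] e0[of "Suc N"] by linarith
    qed (use d(1) in simp)
    finally show ?thesis by (simp add: d_def)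
  qed
  then show ?thesis by (rule that)
qed

lemma integral_riesz:
  assumes f: "f \<in> Cc \<Omega>"
  shows "(\<integral>x. f x \<partial>riesz) = L f"
proof -
  \<comment> \<open>The slicing applies to values in \<open>[0, 1]\<close>; division by a bound and
    the splitting into positive and negative parts then cover all of
    \<open>Cc \<Omega>\<close>.\<close>
  have unit: "(\<integral>x. g x \<partial>riesz) = L g" if g: "g \<in> Cc \<Omega>" "\<And>x. 0 \<le> g x" "\<And>x. g x \<le> 1" for g
  proof -
    obtain M where M: "\<And>N::nat. 0 < N \<Longrightarrow> \<bar>L g - (\<integral>x. g x \<partial>riesz)\<bar> \<le> 2 * M / real N"
      using riesz_slices[OF g] by blast
    have "(\<lambda>N. 2 * M / real N) \<longlonglongrightarrow> 0" by (rule lim_const_over_n)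
    then have "\<bar>L g - (\<integral>x. g x \<partial>riesz)\<bar> \<le> 0"
      by (rule LIMSEQ_le_const) (use M in \<open>auto intro!: exI[of _ 1]\<close>)
    then show ?thesis by simp
  qed
  have pos: "(\<integral>x. g x \<partial>riesz) = L g" if g: "g \<in> Cc \<Omega>" "\<And>x. 0 \<le> g x" for g
  proof -
    obtain K where K: "continuous_on UNIV g" "compact K" "K \<subseteq> \<Omega>" "\<forall>x. x \<notin> K \<longrightarrow> g x = 0"
      using g(1) unfolding Cc_def by blast
    have "bounded (g ` K)" using K(1,2) by (intro compact_imp_bounded compact_continuous_image) (rule continuous_on_subset, auto)
    then obtain B0 where B0: "\<And>x. x \<in> K \<Longrightarrow> \<bar>g x\<bar> \<le> B0" unfolding bounded_iff by auto
    define B where "B = max 1 B0"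
    have B: "0 < B" "g x \<le> B" for x
      using B0[of x] K(4)[rule_format, of x] by (cases "x \<in> K"; auto simp: B_def)+
    have "(\<integral>x. (1 / B) * g x \<partial>riesz) = L (\<lambda>x. (1 / B) * g x)"
      by (rule unit[OF Cc_cmult[OF g(1)]]) (use g(2) B in \<open>auto simp: field_simps\<close>)
    then show ?thesis unfolding L_cmult[OF g(1)] using B(1) by simp
  qed
  have fc: "continuous_on UNIV f" using f by (simp add: Cc_def)
  obtain K where K: "compact K" "K \<subseteq> \<Omega>" "\<forall>x. x \<notin> K \<longrightarrow> f x = 0" using f unfolding Cc_def by blast
  define p where "p x = max (f x) 0" for x
  define q where "q x = max (- f x) 0" for x
  have p: "p \<in> Cc \<Omega>" "\<And>x. 0 \<le> p x"
    by (rule CcI[OF _ K(1,2)]) (use K(3) in \<open>auto simp: p_def[abs_def] intro!: continuous_intros fc\<close>)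
  have q: "q \<in> Cc \<Omega>" "\<And>x. 0 \<le> q x"
    by (rule CcI[OF _ K(1,2)]) (use K(3) in \<open>auto simp: q_def[abs_def] intro!: continuous_intros fc\<close>)
  have fpq: "f = (\<lambda>x. p x + (-1) * q x)" by (auto simp: p_def q_def fun_eq_iff max_def)
  have "(\<integral>x. f x \<partial>riesz) = (\<integral>x. p x \<partial>riesz) + (-1) * (\<integral>x. q x \<partial>riesz)"
    unfolding fpq using riesz_Cc_integrable[OF p(1)] riesz_Cc_integrable[OF q(1)] by simp
  also have "\<dots> = L p + (-1) * L q" unfolding pos[OF p] pos[OF q] ..
  also have "\<dots> = L (\<lambda>x. p x + (-1) * q x)" unfolding L_add[OF p(1) Cc_cmult[OF q(1)]] L_cmult[OF q(1)] ..
  finally show ?thesis using fpq by simp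
qed

end
end

theorem riesz_representation:
  fixes L :: "('a::euclidean_space \<Rightarrow> real) \<Rightarrow> real"
  assumes "open \<Omega>"
    and "\<And>f g. f \<in> Cc \<Omega> \<Longrightarrow> g \<in> Cc \<Omega> \<Longrightarrow> L (\<lambda>x. f x + g x) = L f + L g"
    and "\<And>f c. f \<in> Cc \<Omega> \<Longrightarrow> L (\<lambda>x. c * f x) = c * L f"
    and "\<And>f. f \<in> Cc \<Omega> \<Longrightarrow> (\<And>x. 0 \<le> f x) \<Longrightarrow> 0 \<le> L f"
  shows "\<exists>\<mu>. radon_on \<Omega> \<mu> \<and> (\<forall>f\<in>Cc \<Omega>. (\<integral>x. f x \<partial>\<mu>) = L f)"
proof (intro exI conjI ballI)
  show "radon_on \<Omega> (riesz \<Omega> L)" by (rule radon_riesz[OF assms])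
  show "(\<integral>x. f x \<partial>riesz \<Omega> L) = L f" if "f \<in> Cc \<Omega>" for f by (rule integral_riesz[OF assms that])
qed

subsection \<open>Locally uniform limits of plurisubharmonic functions\<close>

lemma C2_on_add_const: "C2_on V h \<Longrightarrow> C2_on V (\<lambda>x. h x + e)"
proof -
  have "((\<lambda>x. h x + e) has_derivative D) (at x) \<longleftrightarrow> (h has_derivative D) (at x)" for x D
    using has_derivative_add[of "\<lambda>x. h x + e" D _ "\<lambda>_. - e" "\<lambda>_. 0"] has_derivative_add[of h D _ "\<lambda>_. e" "\<lambda>_. 0"] by auto
  then show "C2_on V h \<Longrightarrow> C2_on V (\<lambda>x. h x + e)"
    unfolding C2_on_def C1_on_def frechet_derivative_def differentiable_def by simp
qed

text \<open>Adding a constant does not change which values are derivatives, so this holds without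
  any regularity of \<open>h\<close>.\<close>

lemma subLap_add_const: "subLap q (\<lambda>x. h x + e) z = subLap q h z"
proof -
  have "((\<lambda>s. f s + e) has_vector_derivative D) (at x) \<longleftrightarrow> (f has_vector_derivative D) (at x)" for f :: "real \<Rightarrow> real" and x D
    using has_vector_derivative_add[of "\<lambda>s. f s + e" D _ "\<lambda>_. - e" 0] has_vector_derivative_add[of f D _ "\<lambda>_. e" 0] by auto
  then have "LX q a (\<lambda>x. h x + e) = LX q a h" for a
    unfolding LX_def vector_derivative_def by (intro ext) simp
  then show ?thesis unfolding subLap_def by simp
qed

lemma continuous_on_iota: "continuous_on UNIV (iota (\<eta> :: ('n::finite) hpt) q)"
proof -
  have "linear (\<lambda>z. (qline q (fst z), snd z + 2 * symp (fst \<eta>) (qline q (fst z))))"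
    by (rule linearI) (simp_all add: qline_linear symp_linear_right algebra_simps)
  then have "bounded_linear (\<lambda>z. (qline q (fst z), snd z + 2 * symp (fst \<eta>) (qline q (fst z))))"
    by (rule linear_conv_bounded_linear[THEN iffD1])
  from continuous_on_add[OF linear_continuous_on[OF this] continuous_on_const[of _ \<eta>]]
  show ?thesis by (rule continuous_on_eq) (simp add: iota_def hmul_def prod_eq_iff)
qed

lemma loc_unif_conv_continuous:
  fixes f :: "nat \<Rightarrow> 'a::euclidean_space \<Rightarrow> real"
  assumes \<Omega>: "open \<Omega>" and f: "\<And>j. continuous_on \<Omega> (f j)" and lim: "loc_unif_conv \<Omega> f u"
  shows "continuous_on \<Omega> u"
proof (intro continuous_at_imp_continuous_on ballI)
  fix x assume "x \<in> \<Omega>"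
  then obtain r where r: "r > 0" "cball x r \<subseteq> \<Omega>" using open_contains_cball[of \<Omega>] \<Omega> by meson
  have ul: "uniform_limit (cball x r) f u sequentially" using lim compact_cball r(2) unfolding loc_unif_conv_def by blast
  have "continuous_on (cball x r) (f n)" for n by (rule continuous_on_subset[OF f r(2)])
  then have "\<forall>\<^sub>F n in sequentially. continuous_on (cball x r) (f n)" by simp
  then have "continuous_on (cball x r) u" by (rule uniform_limit_theorem[OF _ ul sequentially_bot])
  then have "continuous_on (ball x r) u" by (rule continuous_on_subset[OF _ ball_subset_cball])
  then show "isCont u x" using r(1) centre_in_ball[of x r] unfolding continuous_on_eq_continuous_at[OF open_ball] by blast
qed

lemma continuous_usc_on: "continuous_on S u \<Longrightarrow> usc_on S (\<lambda>x. ereal (u x))"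
  unfolding usc_on_def
proof (intro ballI allI impI)
  fix x c assume "continuous_on S u" "x \<in> S" "ereal (u x) < c"
  then have "((\<lambda>y. ereal (u y)) \<longlongrightarrow> ereal (u x)) (at x within S)" by (auto simp: continuous_on_def)
  then show "\<forall>\<^sub>F y in at x within S. ereal (u y) < c" using \<open>ereal (u x) < c\<close> by (rule order_tendstoD)
qed

lemma continuous_loc_integrable:
  fixes u :: "'a::euclidean_space \<Rightarrow> real"
  assumes u: "continuous_on \<Omega> u"
  shows "loc_integrable \<Omega> (\<lambda>x. ereal (u x))"
  unfolding loc_integrable_def
proof (intro allI impI, elim conjE, rule conjI)
  fix K assume K: "compact K" "K \<subseteq> \<Omega>"
  have c: "continuous_on K u" by (rule continuous_on_subset[OF u K(2)])
  have "u \<in> borel_measurable (restrict_space lborel K)"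
    using borel_measurable_continuous_on_restrict[OF c]
    by (simp cong: measurable_cong_sets add: sets_restrict_space_cong[OF sets_lborel])
  then show "(\<lambda>x. ereal (u x)) \<in> borel_measurable (restrict_space lborel K)" by simp
  have "bounded (u ` K)" using K(1) c by (intro compact_imp_bounded compact_continuous_image)
  then obtain B where B: "\<And>x. x \<in> K \<Longrightarrow> \<bar>u x\<bar> \<le> B" unfolding bounded_iff by auto
  have Ks: "K \<in> sets lborel" using K(1) by (simp add: compact_imp_closed)
  have "(\<integral>\<^sup>+x\<in>K. e2ennreal \<bar>ereal (u x)\<bar> \<partial>lborel) \<le> (\<integral>\<^sup>+x. ennreal B * indicator K x \<partial>lborel)"
  proof (rule nn_integral_mono)
    fix x
    have "e2ennreal \<bar>ereal (u x)\<bar> \<le> ennreal B" if "x \<in> K"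
      using B[OF that] by (simp add: ennreal.rep_eq e2ennreal_ereal ennreal_leI)
    then show "e2ennreal \<bar>ereal (u x)\<bar> * indicator K x \<le> ennreal B * indicator K x"
      by (auto simp: indicator_def)
  qed
  also have "\<dots> = ennreal B * emeasure lborel K" by (rule nn_integral_cmult_indicator[OF Ks])
  also have "\<dots> < \<infinity>" using emeasure_compact_finite[OF K(1)] by (simp add: ennreal_mult_less_top)
  finally show "(\<integral>\<^sup>+x\<in>K. e2ennreal \<bar>ereal (u x)\<bar> \<partial>lborel) < \<infinity>" .
qed

text \<open>Comparison functions may be raised by constants without losing harmonicity. On the
  compact image of the closure of \<open>V\<close> the approximants are uniformly close to
  \<open>u\<close>, so the comparison principle passes to the limit.\<close>

lemma psh_on_limit:
  fixes uj :: "nat \<Rightarrow> ('n::finite) hpt \<Rightarrow> real"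
  assumes \<Omega>: "open \<Omega>" and c: "\<And>j. continuous_on \<Omega> (uj j)" and psh: "\<And>j. psh_on \<Omega> (\<lambda>x. ereal (uj j x))"
    and lim: "loc_unif_conv \<Omega> uj u"
  shows "psh_on \<Omega> (\<lambda>x. ereal (u x))"
proof -
  have uc: "continuous_on \<Omega> u" by (rule loc_unif_conv_continuous[OF \<Omega> c lim])
  have "subharmonic_on q (iota \<eta> q -` \<Omega>) ((\<lambda>x. ereal (u x)) \<circ> iota \<eta> q)" if q: "q \<notin> degenerate_set" for \<eta> q
    unfolding subharmonic_on_def
  proof (intro conjI allI impI ballI; (elim conjE)?)
    have "continuous_on (iota \<eta> q -` \<Omega>) (\<lambda>z. u (iota \<eta> q z))"
      by (rule continuous_on_compose2[OF uc continuous_on_subset[OF continuous_on_iota subset_UNIV]]) auto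
    from continuous_usc_on[OF this] show "usc_on (iota \<eta> q -` \<Omega>) ((\<lambda>x. ereal (u x)) \<circ> iota \<eta> q)"
      by (simp add: comp_def)
  next
    fix V h z0
    assume V: "open V" "bounded V" "closure V \<subseteq> iota \<eta> q -` \<Omega>" "C2_on V h" "continuous_on (closure V) h"
      "\<forall>z\<in>V. subLap q h z = 0" "\<forall>z\<in>frontier V. ((\<lambda>x. ereal (u x)) \<circ> iota \<eta> q) z \<le> ereal (h z)" "z0 \<in> V"
    let ?K = "iota \<eta> q ` closure V"
    have K: "compact ?K" "?K \<subseteq> \<Omega>"
      using V(2,3) by (auto intro!: compact_continuous_image continuous_on_subset[OF continuous_on_iota subset_UNIV])
    have ul: "uniform_limit ?K uj u sequentially" using lim K unfolding loc_unif_conv_def by blast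
    have "u (iota \<eta> q z0) \<le> h z0 + e" if e: "0 < e" for e :: real
    proof -
      have "\<forall>\<^sub>F n in sequentially. \<forall>x\<in>?K. dist (uj n x) (u x) < e / 2"
        by (rule uniform_limitD[OF ul]) (use e in simp)
      then obtain n where "\<forall>x\<in>?K. dist (uj n x) (u x) < e / 2" unfolding eventually_sequentially by blast
      then have n: "\<bar>uj n (iota \<eta> q z) - u (iota \<eta> q z)\<bar> < e / 2" if "z \<in> closure V" for z
        using that by (auto simp: dist_real_def)
      \<comment> \<open>Raising \<open>h\<close> by \<open>e/2\<close> makes it a valid majorant of
        \<open>uj n\<close> on the frontier; returning from \<open>uj n\<close> to \<open>u\<close>
        inside \<open>V\<close> costs another \<open>e/2\<close>.\<close>
      have "\<forall>z\<in>V. ((\<lambda>x. ereal (uj n x)) \<circ> iota \<eta> q) z \<le> ereal (h z + e / 2)"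
      proof -
        have s: "subharmonic_on q (iota \<eta> q -` \<Omega>) ((\<lambda>x. ereal (uj n x)) \<circ> iota \<eta> q)"
          using psh[of n] q unfolding psh_on_def by blast
        have "((\<lambda>x. ereal (uj n x)) \<circ> iota \<eta> q) z \<le> ereal (h z + e / 2)" if z: "z \<in> frontier V" for z
        proof -
          have "z \<in> closure V" using z by (simp add: frontier_def)
          moreover have "u (iota \<eta> q z) \<le> h z" using V(7)[rule_format, OF z] by simp
          ultimately have "uj n (iota \<eta> q z) \<le> h z + e / 2" using n[of z] by linarith
          then show ?thesis by simp
        qed
        moreover have "\<forall>z\<in>V. subLap q (\<lambda>z. h z + e / 2) z = 0" using V(6) by (simp add: subLap_add_const)
        moreover have "continuous_on (closure V) (\<lambda>z. h z + e / 2)" by (intro continuous_intros V(5))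
        ultimately show ?thesis
          using s[unfolded subharmonic_on_def, THEN conjunct2, rule_format, of V "\<lambda>z. h z + e / 2"] V(1,2,3) C2_on_add_const[OF V(4), of "e / 2"] by blast
      qed
      then have "uj n (iota \<eta> q z0) \<le> h z0 + e / 2" using V(8) by simp
      moreover have "z0 \<in> closure V" using V(8) closure_subset by blast
      ultimately show ?thesis using n[of z0] by linarith
    qed
    then have "u (iota \<eta> q z0) \<le> h z0" by (rule field_le_epsilon)
    then show "((\<lambda>x. ereal (u x)) \<circ> iota \<eta> q) z0 \<le> ereal (h z0)" by simp
  qed
  then show ?thesis unfolding psh_on_def
    using continuous_usc_on[OF uc] continuous_loc_integrable[OF uc] by blast
qed

section \<open>Mass bounds and the weak limit of the Monge-Ampere densities\<close>

lemma MA_density_eq_mixR: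
  assumes "p \<in> \<Omega>" "qpsh \<Omega> (u :: ('n::{finite,linorder}) hpt \<Rightarrow> real)"
  shows "MA_density u p = mixR (\<lambda>_::'n. u) p / (2 ^ CARD('n) * fact CARD('n))" "0 \<le> MA_density u p"
proof -
  show 1: "MA_density u p = mixR (\<lambda>_::'n. u) p / (2 ^ CARD('n) * fact CARD('n))"
    unfolding mixR_MA_density[OF assms] by simp
  have "0 \<le> mixR (\<lambda>_::'n. u) p" by (rule mixR_nonneg[OF assms])
  then show "0 \<le> MA_density u p" unfolding 1 by simp
qed

lemma integral_Cc_MA_density:
  assumes phi: "\<phi> \<in> Cc \<Omega>" and u: "qpsh \<Omega> (u :: ('n::{finite,linorder}) hpt \<Rightarrow> real)"
  shows "(\<integral>p. \<phi> p * MA_density u p \<partial>lborel) = (\<integral>p. \<phi> p * mixR (\<lambda>_::'n. u) p \<partial>lborel) / (2 ^ CARD('n) * fact CARD('n))"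
proof -
  have e: "\<phi> p * MA_density u p = \<phi> p * mixR (\<lambda>_::'n. u) p / (2 ^ CARD('n) * fact CARD('n))" for p
  proof (cases "p \<in> \<Omega>")
    case True
    then show ?thesis using MA_density_eq_mixR(1)[OF _ u] by simp
  next
    case False
    then have "\<phi> p = 0" using phi unfolding Cc_def by blast
    then show ?thesis by simp
  qed
  show ?thesis unfolding e by simp
qed

lemma integrable_Cc_MA_density:
  assumes \<Omega>: "open \<Omega>" and phi: "\<phi> \<in> Cc \<Omega>" and u: "qpsh \<Omega> (u :: ('n::{finite,linorder}) hpt \<Rightarrow> real)"
  shows "integrable lborel (\<lambda>p. \<phi> p * MA_density u p)"
proof -
  obtain K where K: "continuous_on UNIV \<phi>" "compact K" "K \<subseteq> \<Omega>" "\<forall>x. x \<notin> K \<longrightarrow> \<phi> x = 0"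
    using phi unfolding Cc_def by blast
  have "continuous_on \<Omega> (mixR (\<lambda>_::'n. u))" using u by (intro continuous_on_mixR[OF \<Omega>]) (simp add: qpsh_def)
  then have "continuous_on \<Omega> (\<lambda>p. mixR (\<lambda>_::'n. u) p / (2 ^ CARD('n) * fact CARD('n)))" by (intro continuous_intros) auto
  then have "continuous_on \<Omega> (MA_density u)" by (rule continuous_on_eq) (simp add: MA_density_eq_mixR(1)[OF _ u])
  then show ?thesis by (rule integrable_Cc_mult[OF K(2,3) _ K(1) K(4)[rule_format]])
qed

lemma MA_density_mass_bounded:
  fixes uj :: "nat \<Rightarrow> ('n::{finite,linorder}) hpt \<Rightarrow> real"
  assumes \<Omega>: "open \<Omega>" and q: "\<And>j. qpsh \<Omega> (uj j)" and lim: "loc_unif_conv \<Omega> uj u" and K: "compact K" "K \<subseteq> \<Omega>"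
  shows "\<exists>C. \<forall>j. set_integrable lborel K (MA_density (uj j)) \<and> (\<integral>x\<in>K. \<bar>MA_density (uj j) x\<bar> \<partial>lborel) \<le> C"
proof -
  let ?c = "2 ^ CARD('n) * fact CARD('n) :: real"
  define W where "W = range uj \<union> {sqx}"
  have Wq: "qpsh \<Omega> w" if "w \<in> W" for w using that q qpsh_sqx unfolding W_def by blast
  have Wb: "loc_bdd \<Omega> W" unfolding W_def
    by (intro loc_bdd_Un loc_bdd_sqx loc_unif_conv_loc_bdd[OF lim] C2_on_continuous[OF \<Omega>]) (use q in \<open>simp add: qpsh_def\<close>)
  have Ws: "sqx \<in> W" "\<And>j. uj j \<in> W" by (auto simp: W_def)
  obtain C where C: "\<And>w :: 'n \<Rightarrow> 'n hpt \<Rightarrow> real. (\<And>i. w i \<in> W) \<Longrightarrow> (\<integral>p\<in>K. mixR w p \<partial>lborel) \<le> C"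
    using mixR_CLN[OF \<Omega> Wq Wb Ws(1) K] by metis
  have "set_integrable lborel K (MA_density (uj j)) \<and> (\<integral>x\<in>K. \<bar>MA_density (uj j) x\<bar> \<partial>lborel) \<le> C / ?c" for j
  proof -
    have e: "indicator K x *\<^sub>R MA_density (uj j) x = (indicator K x *\<^sub>R mixR (\<lambda>_::'n. uj j) x) / ?c" for x
      using K(2) MA_density_eq_mixR(1)[OF _ q, of x j] by (cases "x \<in> K") auto
    have a: "indicator K x *\<^sub>R \<bar>MA_density (uj j) x\<bar> = (indicator K x *\<^sub>R mixR (\<lambda>_::'n. uj j) x) / ?c" for x
      unfolding e[symmetric] using K(2) MA_density_eq_mixR(2)[OF _ q, of x j] by (cases "x \<in> K") auto
    have i: "integrable lborel (\<lambda>x. indicator K x *\<^sub>R mixR (\<lambda>_::'n. uj j) x)"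
      using mixR_set_integrable[OF \<Omega> K q] unfolding set_integrable_def .
    have "(\<integral>x. indicator K x *\<^sub>R mixR (\<lambda>_::'n. uj j) x \<partial>lborel) \<le> C"
      using C[of "\<lambda>_. uj j"] Ws(2) unfolding set_lebesgue_integral_def by simp
    then show ?thesis
      unfolding set_integrable_def set_lebesgue_integral_def e a using i by (simp add: divide_right_mono)
  qed
  then show ?thesis by blast
qed

lemma qpsh_psh:
  assumes "open \<Omega>" "C2_on \<Omega> u" "psh_on \<Omega> (\<lambda>x. ereal (u x))"
  shows "qpsh \<Omega> u"
  unfolding qpsh_def by (intro conjI ballI assms(2) psh_qpossemidef[OF assms])

text \<open>The quantifier order expresses independence: the measure is built from the one sequence
  \<open>uj\<close>, and every other admissible sequence with the same limit \<open>u\<close> then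
  converges to it.\<close>

lemma MA_density_weak_limit:
  fixes uj :: "nat \<Rightarrow> ('n::{finite,linorder}) hpt \<Rightarrow> real"
  assumes \<Omega>: "open \<Omega>" and q: "\<And>j. qpsh \<Omega> (uj j)" and lim: "loc_unif_conv \<Omega> uj u"
  shows "\<exists>\<mu>. radon_on \<Omega> \<mu> \<and> (\<forall>vj. (\<forall>j. qpsh \<Omega> (vj j)) \<longrightarrow> loc_unif_conv \<Omega> vj u \<longrightarrow> weak_conv_on \<Omega> (\<lambda>j. MA_density (vj j)) \<mu>)"
proof -
  define I where "I w \<phi> = (\<integral>p. \<phi> p * MA_density w p \<partial>lborel)" for w :: "'n hpt \<Rightarrow> real" and \<phi>
  define L where "L \<phi> = lim (\<lambda>j. I (uj j) \<phi>)" for \<phi>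
  \<comment> \<open>With \<open>vj = uj\<close> this is the Cauchy property that makes
    \<open>L\<close> a genuine limit; with arbitrary \<open>vj\<close> it transfers that limit to
    the other sequence.\<close>
  have close: "\<exists>N. \<forall>j\<ge>N. \<forall>k\<ge>N. \<bar>I (uj j) \<phi> - I (vj k) \<phi>\<bar> < e"
    if phi: "\<phi> \<in> Cc \<Omega>" and v: "\<And>j. qpsh \<Omega> (vj j)" "loc_unif_conv \<Omega> vj u" and e: "0 < e" for \<phi> vj e
  proof -
    let ?c = "2 ^ CARD('n) * fact CARD('n) :: real"
    have c: "0 < ?c" by simp
    then have "0 < e * ?c" using e by (rule mult_pos_pos[rotated])
    from mixR_cauchy[OF \<Omega> phi q lim v this] obtain N where N: "\<And>j k. j \<ge> N \<Longrightarrow> k \<ge> N \<Longrightarrow>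
      \<bar>(\<integral>p. \<phi> p * mixR (\<lambda>_::'n. uj j) p \<partial>lborel) - (\<integral>p. \<phi> p * mixR (\<lambda>_::'n. vj k) p \<partial>lborel)\<bar> < e * ?c" by blast
    have "\<bar>I (uj j) \<phi> - I (vj k) \<phi>\<bar> < e" if "j \<ge> N" "k \<ge> N" for j k
    proof -
      have "\<bar>I (uj j) \<phi> - I (vj k) \<phi>\<bar> = \<bar>(\<integral>p. \<phi> p * mixR (\<lambda>_::'n. uj j) p \<partial>lborel) - (\<integral>p. \<phi> p * mixR (\<lambda>_::'n. vj k) p \<partial>lborel)\<bar> / ?c"
        unfolding I_def integral_Cc_MA_density[OF phi q] integral_Cc_MA_density[OF phi v(1)]
        by (simp add: diff_divide_distrib[symmetric] abs_divide)
      also have "\<dots> < e" using N[OF that] c by (simp only: pos_divide_less_eq)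
      finally show ?thesis .
    qed
    then show ?thesis by blast
  qed
  have conv: "(\<lambda>j. I (uj j) \<phi>) \<longlonglongrightarrow> L \<phi>" if phi: "\<phi> \<in> Cc \<Omega>" for \<phi>
  proof -
    have "Cauchy (\<lambda>j. I (uj j) \<phi>)"
      unfolding Cauchy_def dist_real_def using close[OF phi q lim] by blast
    then show ?thesis unfolding L_def by (simp add: Cauchy_convergent_iff convergent_LIMSEQ_iff)
  qed
  have convv: "(\<lambda>j. I (vj j) \<phi>) \<longlonglongrightarrow> L \<phi>"
    if phi: "\<phi> \<in> Cc \<Omega>" and v: "\<And>j. qpsh \<Omega> (vj j)" "loc_unif_conv \<Omega> vj u" for \<phi> vj
  proof -
    have "(\<lambda>j. I (uj j) \<phi> - I (vj j) \<phi>) \<longlonglongrightarrow> 0"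
      unfolding LIMSEQ_iff using close[OF phi v] by (simp add: real_norm_def) blast
    from tendsto_diff[OF conv[OF phi] this] show ?thesis by simp
  qed
  have ex: "\<exists>\<mu>. radon_on \<Omega> \<mu> \<and> (\<forall>f\<in>Cc \<Omega>. (\<integral>x. f x \<partial>\<mu>) = L f)"
  proof (rule riesz_representation[OF \<Omega>])
    fix f g assume fg: "f \<in> Cc \<Omega>" "g \<in> Cc \<Omega>"
    have "I (uj j) (\<lambda>x. f x + g x) = I (uj j) f + I (uj j) g" for j
      unfolding I_def distrib_right
      by (rule Bochner_Integration.integral_add[OF integrable_Cc_MA_density[OF \<Omega> fg(1) q] integrable_Cc_MA_density[OF \<Omega> fg(2) q]])
    then have "(\<lambda>j. I (uj j) (\<lambda>x. f x + g x)) \<longlonglongrightarrow> L f + L g"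
      using tendsto_add[OF conv[OF fg(1)] conv[OF fg(2)]] by simp
    then show "L (\<lambda>x. f x + g x) = L f + L g" using conv[OF Cc_add[OF fg]] LIMSEQ_unique by blast
  next
    fix f :: "'n hpt \<Rightarrow> real" and c :: real assume f: "f \<in> Cc \<Omega>"
    have "I (uj j) (\<lambda>x. c * f x) = c * I (uj j) f" for j unfolding I_def by (simp add: mult.assoc)
    then have "(\<lambda>j. I (uj j) (\<lambda>x. c * f x)) \<longlonglongrightarrow> c * L f"
      using tendsto_mult_left[OF conv[OF f], of c] by simp
    then show "L (\<lambda>x. c * f x) = c * L f" using conv[OF Cc_cmult[OF f]] LIMSEQ_unique by blast
  next
    fix f :: "'n hpt \<Rightarrow> real" assume f: "f \<in> Cc \<Omega>" and f0: "\<And>x. 0 \<le> f x"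
    have "0 \<le> I (uj j) f" for j
      unfolding I_def
    proof (rule Bochner_Integration.integral_nonneg)
      show "0 \<le> f x * MA_density (uj j) x" for x
      proof (cases "x \<in> \<Omega>")
        case True
        then show ?thesis using MA_density_eq_mixR(2)[OF True q] f0[of x] by simp
      next
        case False
        then have "f x = 0" using f unfolding Cc_def by blast
        then show ?thesis by simp
      qed
    qed
    then show "0 \<le> L f" using LIMSEQ_le_const[OF conv[OF f]] by blast
  qed
  then obtain \<mu> where mu: "radon_on \<Omega> \<mu>" "\<forall>f\<in>Cc \<Omega>. (\<integral>x. f x \<partial>\<mu>) = L f" by blast
  have "weak_conv_on \<Omega> (\<lambda>j. MA_density (vj j)) \<mu>" if v: "\<forall>j. qpsh \<Omega> (vj j)" "loc_unif_conv \<Omega> vj u" for vj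
    unfolding weak_conv_on_def
  proof (intro allI impI)
    fix \<phi> :: "'n hpt \<Rightarrow> real"
    assume "continuous_on UNIV \<phi> \<and> (\<exists>K. compact K \<and> K \<subseteq> \<Omega> \<and> (\<forall>x. x \<notin> K \<longrightarrow> \<phi> x = 0))"
    then have phi: "\<phi> \<in> Cc \<Omega>" unfolding Cc_def by blast
    show "(\<lambda>j. \<integral>x. \<phi> x * MA_density (vj j) x \<partial>lborel) \<longlonglongrightarrow> (\<integral>x. \<phi> x \<partial>\<mu>)"
      using convv[OF phi v(1)[rule_format] v(2)] mu(2)[rule_format, OF phi] unfolding I_def by simp
  qed
  then show ?thesis using mu(1) by blast
qed

theorem theorem1p1:
  fixes \<Omega> :: "('n::{finite,linorder}) hpt set"
    and uj :: "nat \<Rightarrow> 'n hpt \<Rightarrow> real" and u :: "'n hpt \<Rightarrow> real"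
  assumes "open \<Omega>" and "connected \<Omega>"
    and "\<And>j. C2_on \<Omega> (uj j)" and "\<And>j. psh_on \<Omega> (\<lambda>x. ereal (uj j x))"
    and "loc_unif_conv \<Omega> uj u"
  shows "continuous_on \<Omega> u \<and> psh_on \<Omega> (\<lambda>x. ereal (u x))
    \<and> (\<forall>K. compact K \<and> K \<subseteq> \<Omega> \<longrightarrow>
          (\<exists>C. \<forall>j. set_integrable lborel K (MA_density (uj j)) \<and>
                 (\<integral>x\<in>K. \<bar>MA_density (uj j) x\<bar> \<partial>lborel) \<le> C))
    \<and> (\<exists>\<mu>. radon_on \<Omega> \<mu> \<and>
          (\<forall>vj :: nat \<Rightarrow> 'n hpt \<Rightarrow> real.
             (\<forall>j. C2_on \<Omega> (vj j) \<and> psh_on \<Omega> (\<lambda>x. ereal (vj j x))) \<and> loc_unif_conv \<Omega> vj u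
             \<longrightarrow> weak_conv_on \<Omega> (\<lambda>j. MA_density (vj j)) \<mu>))"
proof -
  note \<Omega> = assms(1) and lim = assms(5)
  have c: "continuous_on \<Omega> (uj j)" for j by (rule C2_on_continuous[OF \<Omega> assms(3)])
  have q: "qpsh \<Omega> (uj j)" for j by (rule qpsh_psh[OF \<Omega> assms(3,4)])
  obtain \<mu> where mu: "radon_on \<Omega> \<mu>"
    "\<forall>vj. (\<forall>j. qpsh \<Omega> (vj j)) \<longrightarrow> loc_unif_conv \<Omega> vj u \<longrightarrow> weak_conv_on \<Omega> (\<lambda>j. MA_density (vj j)) \<mu>"
    using MA_density_weak_limit[OF \<Omega> q lim] by blast
  have "weak_conv_on \<Omega> (\<lambda>j. MA_density (vj j)) \<mu>"
    if "\<forall>j. C2_on \<Omega> (vj j) \<and> psh_on \<Omega> (\<lambda>x. ereal (vj j x))" "loc_unif_conv \<Omega> vj u" for vj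
  proof -
    have "\<forall>j. qpsh \<Omega> (vj j)" using that(1) qpsh_psh[OF \<Omega>] by blast
    then show ?thesis using mu(2) that(2) by blast
  qed
  then show ?thesis
    using loc_unif_conv_continuous[OF \<Omega> c lim] psh_on_limit[OF \<Omega> c assms(4) lim]
      MA_density_mass_bounded[OF \<Omega> q lim] mu(1) by blast
qed

end
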